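(* Let $n$ be a positive integer. The torsion-free lamplighter group $\Gamma_n = \mathbb{Z}^n \wr \mathbb{Z}$ is profinitely rigid in the absolute sense.
   Context: The torsion-free lamplighter group of rank $n$ is the restricted wreath product $\Gamma_n = \mathbb{Z}^n \wr \mathbb{Z} \cong M \rtimes \langle t \rangle$, where $\langle t\rangle$ is infinite cyclic, $M$ is the free module of rank $n$ over the group ring $\mathbb{Z}[\langle t\rangle]$ (regarded as an abelian group), and $t$ acts on $M$ by module multiplication. For a finitely generated residually finite group $\Gamma$, let $\mathcal{C}(\Gamma)$ denote the set of isomorphism classes of finite quotients (finite epimorphic images) of $\Gamma$. The group $\Gamma$ is called profinitely rigid in the absolute sense if every finitely generated residually finite group $\Delta$ with $\mathcal{C}(\Delta) = \mathcal{C}(\Gamma)$ is isomorphic to $\Gamma$. (Equivalently: every finitely generated residually finite group $\Delta$ whose profinite completion $\widehat{\Delta}$ is isomorphic to $\widehat{\Gamma}$ is isomorphic to $\Gamma$.) *)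

theory Defs
  imports "HOL-Algebra.Algebra"
begin

definition semidirect_product ::
  "('a, 'm) monoid_scheme \<Rightarrow> ('b, 'k) monoid_scheme \<Rightarrow> ('b \<Rightarrow> 'a \<Rightarrow> 'a) \<Rightarrow> ('a \<times> 'b) monoid"
  where "semidirect_product N H \<phi> =
    \<lparr>carrier = carrier N \<times> carrier H,
     monoid.mult = (\<lambda>(a, h) (b, k). (a \<otimes>\<^bsub>N\<^esub> \<phi> h b, h \<otimes>\<^bsub>H\<^esub> k)),
     one = (\<one>\<^bsub>N\<^esub>, \<one>\<^bsub>H\<^esub>)\<rparr>"

text \<open>
  The base group \<open>sum_group (carrier B) (\<lambda>_. A)\<close> consists of the finitely supported functions
  from \<open>B\<close> to \<open>A\<close>; the top group \<open>B\<close> acts on it by left translation.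
\<close>

definition wreath_shift ::
  "('b, 'k) monoid_scheme \<Rightarrow> 'b \<Rightarrow> ('b \<Rightarrow> 'a) \<Rightarrow> 'b \<Rightarrow> 'a"
  where "wreath_shift B b f = (\<lambda>x\<in>carrier B. f (inv\<^bsub>B\<^esub> b \<otimes>\<^bsub>B\<^esub> x))"

definition restricted_wreath_product ::
  "('a, 'm) monoid_scheme \<Rightarrow> ('b, 'k) monoid_scheme \<Rightarrow> (('b \<Rightarrow> 'a) \<times> 'b) monoid"
  where "restricted_wreath_product A B =
    semidirect_product (sum_group (carrier B) (\<lambda>_. A)) B (wreath_shift B)"

text \<open>
  For \<open>A = \<int>\<^sup>n\<close> and \<open>B = \<int> = \<langle>t\<rangle>\<close>, a base element \<open>f\<close> is the vector whose \<open>i\<close>-th entry is \<open>\<Sum>x. f x i * t\<^sup>x\<close>,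
  \<open>i < n\<close>, in the free module of rank \<open>n\<close> over the group ring of \<open>\<langle>t\<rangle>\<close>, and the shift by
  \<open>1\<close> is multiplication by \<open>t\<close>.
\<close>

definition lamplighter_group :: "nat \<Rightarrow> ((int \<Rightarrow> nat \<Rightarrow> int) \<times> int) monoid"
  where "lamplighter_group n =
    restricted_wreath_product (product_group {..<n} (\<lambda>_. integer_group)) integer_group"

lemma group_semidirect_product:
  assumes N: "group N" and H: "group H"
    and hom: "\<And>h. h \<in> carrier H \<Longrightarrow> \<phi> h \<in> hom N N"
    and one: "\<And>a. a \<in> carrier N \<Longrightarrow> \<phi> \<one>\<^bsub>H\<^esub> a = a"
    and act: "\<And>h k a. \<lbrakk>h \<in> carrier H; k \<in> carrier H; a \<in> carrier N\<rbrakk>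
                \<Longrightarrow> \<phi> (h \<otimes>\<^bsub>H\<^esub> k) a = \<phi> h (\<phi> k a)"
  shows "group (semidirect_product N H \<phi>)"
proof -
  interpret N: group N by (rule N)
  interpret H: group H by (rule H)
  have cl: "\<phi> h a \<in> carrier N" if "h \<in> carrier H" "a \<in> carrier N" for h a
    using hom that by (auto simp: hom_def)
  have mlt: "\<phi> h (a \<otimes>\<^bsub>N\<^esub> b) = \<phi> h a \<otimes>\<^bsub>N\<^esub> \<phi> h b"
    if "h \<in> carrier H" "a \<in> carrier N" "b \<in> carrier N" for h a b
    using hom that by (auto simp: hom_def)
  show ?thesis
  proof (rule groupI)
    fix x assume x: "x \<in> carrier (semidirect_product N H \<phi>)"
    obtain a h where xe: "x = (a, h)" by fastforce
    have ah: "a \<in> carrier N" "h \<in> carrier H"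
      using x xe by (auto simp: semidirect_product_def)
    define y where "y = (\<phi> (inv\<^bsub>H\<^esub> h) (inv\<^bsub>N\<^esub> a), inv\<^bsub>H\<^esub> h)"
    have "\<phi> (inv\<^bsub>H\<^esub> h) (inv\<^bsub>N\<^esub> a) \<otimes>\<^bsub>N\<^esub> \<phi> (inv\<^bsub>H\<^esub> h) a = \<phi> (inv\<^bsub>H\<^esub> h) \<one>\<^bsub>N\<^esub>"
      using ah by (simp flip: mlt)
    also have "\<dots> = \<one>\<^bsub>N\<^esub>"
      using hom_one[OF hom N N] ah by auto
    finally show "\<exists>y\<in>carrier (semidirect_product N H \<phi>).
        y \<otimes>\<^bsub>semidirect_product N H \<phi>\<^esub> x = \<one>\<^bsub>semidirect_product N H \<phi>\<^esub>"
      using ah by (intro bexI[of _ y]) (auto simp: semidirect_product_def y_def xe cl)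
  qed (auto simp: semidirect_product_def cl mlt act one N.m_assoc H.m_assoc)
qed

lemma group_restricted_wreath_product:
  fixes A :: "('a, 'm) monoid_scheme" and B :: "('b, 'k) monoid_scheme"
  assumes A: "group A" and B: "group B"
  shows "group (restricted_wreath_product A B)"
proof -
  interpret A: group A by (rule A)
  interpret B: group B by (rule B)
  let ?N = "sum_group (carrier B) (\<lambda>_. A)"
  have cl: "wreath_shift B h f \<in> carrier ?N"
    if h: "h \<in> carrier B" and f: "f \<in> carrier ?N" for h f
  proof -
    have fin: "finite {x \<in> carrier B. f x \<noteq> \<one>\<^bsub>A\<^esub>}"
      using f by (auto simp: carrier_sum_group)
    have fc: "f x \<in> carrier A" if "x \<in> carrier B" for x
      using f that by (auto simp: carrier_sum_group)
    have "{x \<in> carrier B. f (inv\<^bsub>B\<^esub> h \<otimes>\<^bsub>B\<^esub> x) \<noteq> \<one>\<^bsub>A\<^esub>}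
        \<subseteq> (\<lambda>x. h \<otimes>\<^bsub>B\<^esub> x) ` {x \<in> carrier B. f x \<noteq> \<one>\<^bsub>A\<^esub>}"
    proof
      fix x assume "x \<in> {x \<in> carrier B. f (inv\<^bsub>B\<^esub> h \<otimes>\<^bsub>B\<^esub> x) \<noteq> \<one>\<^bsub>A\<^esub>}"
      moreover from this have "x = h \<otimes>\<^bsub>B\<^esub> (inv\<^bsub>B\<^esub> h \<otimes>\<^bsub>B\<^esub> x)"
        using h by (simp flip: B.m_assoc)
      ultimately show "x \<in> (\<lambda>x. h \<otimes>\<^bsub>B\<^esub> x) ` {x \<in> carrier B. f x \<noteq> \<one>\<^bsub>A\<^esub>}"
        using h by (intro image_eqI[of _ _ "inv\<^bsub>B\<^esub> h \<otimes>\<^bsub>B\<^esub> x"]) auto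
    qed
    then have "finite {x \<in> carrier B. f (inv\<^bsub>B\<^esub> h \<otimes>\<^bsub>B\<^esub> x) \<noteq> \<one>\<^bsub>A\<^esub>}"
      using fin finite_surj by blast
    moreover have "{x \<in> carrier B. wreath_shift B h f x \<noteq> \<one>\<^bsub>A\<^esub>}
        = {x \<in> carrier B. f (inv\<^bsub>B\<^esub> h \<otimes>\<^bsub>B\<^esub> x) \<noteq> \<one>\<^bsub>A\<^esub>}"
      by (auto simp: wreath_shift_def)
    moreover have "wreath_shift B h f \<in> (\<Pi>\<^sub>E x\<in>carrier B. carrier A)"
      using h fc by (auto simp: wreath_shift_def)
    ultimately show ?thesis
      by (simp add: carrier_sum_group)
  qed
  have hom: "wreath_shift B h \<in> hom ?N ?N" if h: "h \<in> carrier B" for h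
    using h cl by (auto simp: hom_def wreath_shift_def fun_eq_iff)
  have one: "wreath_shift B \<one>\<^bsub>B\<^esub> f = f" if "f \<in> carrier ?N" for f
    using that by (auto simp: wreath_shift_def carrier_sum_group fun_eq_iff PiE_iff extensional_def)
  have act: "wreath_shift B (h \<otimes>\<^bsub>B\<^esub> k) f = wreath_shift B h (wreath_shift B k f)"
    if "h \<in> carrier B" "k \<in> carrier B" for h k and f :: "'b \<Rightarrow> 'a"
    using that by (auto simp: wreath_shift_def fun_eq_iff B.inv_mult_group B.m_assoc)
  show ?thesis
    unfolding restricted_wreath_product_def
    by (intro group_semidirect_product sum_group A B hom one act) auto
qed

lemma group_lamplighter_group: "group (lamplighter_group n)"
  unfolding lamplighter_group_def
  by (intro group_restricted_wreath_product product_group group_integer_group)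

definition finitely_generated_group :: "('a, 'm) monoid_scheme \<Rightarrow> bool"
  where "finitely_generated_group G \<longleftrightarrow>
    group G \<and> (\<exists>S. finite S \<and> S \<subseteq> carrier G \<and> generate G S = carrier G)"

definition residually_finite_group :: "('a, 'm) monoid_scheme \<Rightarrow> bool"
  where "residually_finite_group G \<longleftrightarrow>
    group G \<and> (\<forall>g\<in>carrier G. g \<noteq> \<one>\<^bsub>G\<^esub> \<longrightarrow>
      (\<exists>N. N \<lhd> G \<and> finite (carrier (G Mod N)) \<and> g \<notin> N))"

text \<open>
  Isomorphism classes must be comparable across groups with different element types, so a class
  is represented by its members whose elements are natural numbers. Since every countable group
  has an isomorphic copy of this kind, nothing is lost for the finite groups considered here;
  see \<open>iso_class_eq_iff\<close>.
\<close>

definition iso_class :: "('a, 'm) monoid_scheme \<Rightarrow> nat monoid set"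
  where "iso_class G = {Q. group Q \<and> Q \<cong> G}"

definition finite_quotient_classes :: "('a, 'm) monoid_scheme \<Rightarrow> nat monoid set set"
  where "finite_quotient_classes G =
    {iso_class (G Mod N) | N. N \<lhd> G \<and> finite (carrier (G Mod N))}"

text \<open>
  A definition cannot quantify over types, so the element type of the competing groups is
  passed as a type argument. The unrestricted notion is obtained by leaving that type variable
  free in a theorem.
\<close>

definition profinitely_rigid :: "'b itself \<Rightarrow> ('a, 'm) monoid_scheme \<Rightarrow> bool"
  where "profinitely_rigid _ G \<longleftrightarrow>
    finitely_generated_group G \<and> residually_finite_group G \<and>
    (\<forall>D :: 'b monoid.
       finitely_generated_group D \<and> residually_finite_group D \<and>
       finite_quotient_classes D = finite_quotient_classes G \<longrightarrow> D \<cong> G)"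

lemma iso_class_nonempty:
  assumes G: "group G" and "countable (carrier G)"
  shows "iso_class G \<noteq> {}"
proof -
  interpret group G by (rule G)
  obtain f :: "'a \<Rightarrow> nat" where f: "inj_on f (carrier G)"
    using assms(2) by (auto simp: countable_def)
  define g where "g = the_inv_into (carrier G) f"
  have gf: "g (f x) = x" if "x \<in> carrier G" for x
    unfolding g_def by (rule the_inv_into_f_f[OF f that])
  define Q :: "nat monoid" where
    "Q = \<lparr>carrier = f ` carrier G, monoid.mult = (\<lambda>x y. f (g x \<otimes>\<^bsub>G\<^esub> g y)), one = f \<one>\<^bsub>G\<^esub>\<rparr>"
  have "f \<in> iso G Q"
    using f by (auto simp: iso_def hom_def bij_betw_def Q_def gf)
  moreover have "group Q"
  proof (rule groupI)
    fix x assume "x \<in> carrier Q"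
    then obtain a where a: "a \<in> carrier G" "x = f a" by (auto simp: Q_def)
    then show "\<exists>y\<in>carrier Q. y \<otimes>\<^bsub>Q\<^esub> x = \<one>\<^bsub>Q\<^esub>"
      by (intro bexI[of _ "f (inv\<^bsub>G\<^esub> a)"]) (auto simp: Q_def gf)
  qed (auto simp: Q_def gf m_assoc)
  ultimately have "Q \<in> iso_class G"
    using iso_sym is_isoI by (fastforce simp: iso_class_def)
  then show ?thesis by blast
qed

lemma iso_class_eq_iff:
  assumes "group G" "group H" "finite (carrier G)"
  shows "iso_class G = iso_class H \<longleftrightarrow> G \<cong> H"
proof
  assume eq: "iso_class G = iso_class H"
  have "iso_class G \<noteq> {}"
    by (rule iso_class_nonempty[OF assms(1) countable_finite[OF assms(3)]])
  then obtain Q where "Q \<in> iso_class G" by blast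
  with eq have Q: "group Q" "Q \<cong> G" "Q \<cong> H"
    by (auto simp: iso_class_def)
  have "G \<cong> Q"
    by (rule group.iso_sym[OF Q(1,2)])
  then show "G \<cong> H"
    using Q(3) by (rule iso_trans)
next
  assume GH: "G \<cong> H"
  have HG: "H \<cong> G"
    by (rule group.iso_sym[OF assms(1) GH])
  have "Q \<cong> G \<longleftrightarrow> Q \<cong> H" for Q :: "nat monoid"
    using iso_trans[OF _ GH] iso_trans[OF _ HG] by blast
  then show "iso_class G = iso_class H"
    by (simp add: iso_class_def)
qed

end

theory Submission
  imports Defs "HOL-Computational_Algebra.Computational_Algebra" "HOL-Library.Diagonal_Subsequence"
    "HOL-Library.Function_Algebras" "HOL-Number_Theory.Cong"
begin

text \<open>
  Let \<open>D\<close> have the finite quotients of \<open>\<Gamma> = \<int>\<^sup>n \<wr> \<int>\<close>. A compactness argument gives coherent epimorphisms of \<open>D\<close>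
  onto the quotients \<open>((\<int>/s)[X]/(X\<^sup>s - 1))\<^sup>n \<rtimes> \<int>/s\<close> of \<open>\<Gamma>\<close>, cofinal among the finite quotients of \<open>D\<close>.
  Let \<open>A\<close> consist of the elements that all of them send into the base; it is abelian and \<open>D/A\<close> embeds
  into the profinite integers. Commutators have a common annihilator only of augmentation divisible by
  3 under every sign character, so by Nakayama's lemma every sign character of \<open>D\<close> factors through a
  finite cyclic quotient; hence \<open>D/A\<close> is generated by a single element modulo squares and, being
  torsion-free, is infinite cyclic, generated by some \<open>t\<close>. Now \<open>A\<close> is a finitely generated module over
  \<open>\<int>[t, 1/t]\<close> whose quotients by \<open>(s, t\<^sup>s - 1)\<close> are free of rank \<open>n\<close>. Such a module is free of rank \<open>n\<close>:
  it is projective, and projective modules over \<open>\<int>[t, 1/t]\<close> are free, for which Seshadri's argument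
  suffices. So \<open>D = A \<rtimes> \<langle>t\<rangle>\<close> is isomorphic to \<open>\<Gamma>\<close>.
\<close>

section \<open>Modules over integer polynomials with free finite quotients\<close>

text \<open>The obstacle is \<open>D/A\<close>. A finitely generated dense subgroup of the profinite
  integers can have rank above one, and the residues alone do not exclude this. It is excluded
  through the commutators: they form a module with a finite nonzero quotient on which
  \<open>D\<close> acts through a given sign character, and the splitting of the extension by that
  quotient makes it visible in a finite quotient of \<open>D\<close>, where elements of trivial
  residue act trivially. The prime 3 is the smallest one modulo which 1 and -1 differ. Signs suffice
  because generation by one element modulo squares leaves, by Nakayama's lemma at 2, only an odd
  exponent between \<open>D/A\<close> and a cyclic subgroup. Freeness is reached without
  projectivity being stated: the finite quotients show that the module is torsion-free over
  \<open>Z[X]\<close> and that each reduction modulo a prime \<open>p\<close> is torsion-free over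
  \<open>F_p[X]\<close>, which is what Seshadri's argument consumes. In this part Laurent
  polynomials are replaced by \<open>Z[X]\<close>, with statements that hold up to a power of
  \<open>X\<close>.\<close>

lemma strip_leading_multiples:
  fixes f :: "int poly"
  assumes "\<not> [:p:] dvd f"
  obtains g h where "f = g + [:p:] * h" "\<not> p dvd lead_coeff g" "degree g \<le> degree f"
proof -
  define g where "g = map_poly (\<lambda>c. if p dvd c then 0 else c) f"
  have cg: "coeff g i = (if p dvd coeff f i then 0 else coeff f i)" for i
    by (simp add: g_def coeff_map_poly)
  have "[:p:] dvd f - g"
    by (auto simp: const_poly_dvd_iff cg)
  then obtain h where h: "f - g = [:p:] * h" by (auto simp: dvd_def)
  have "g \<noteq> 0"
    using assms h by (metis diff_zero dvd_triv_left)
  then have "coeff g (degree g) \<noteq> 0" by simp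
  then have "\<not> p dvd lead_coeff g"
    by (metis cg)
  moreover have "degree g \<le> degree f"
    by (rule degree_le) (auto simp: cg coeff_eq_0)
  ultimately show ?thesis using that[of g h] h by (simp add: algebra_simps)
qed

text \<open>Once the coefficients divisible by \<open>p\<close> are dropped, the leading coefficient
  of \<open>f\<close> is a unit modulo \<open>p\<close>. So division with remainder works in
  \<open>F_p[X]\<close>, and there are only finitely many remainders of degree below
  \<open>d\<close>.\<close>

lemma finite_residues:
  fixes f :: "int poly"
  assumes p: "Factorial_Ring.prime (p::int)" and f: "\<not> [:p:] dvd f"
  obtains Y where "finite Y" "\<And>g. \<exists>y\<in>Y. \<exists>a b. g = y + [:p:] * a + f * b"
proof -
  obtain f1 h where f1: "f = f1 + [:p:] * h" "\<not> p dvd lead_coeff f1"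
    using strip_leading_multiples[OF f] by metis
  define d where "d = degree f1"
  have "coprime (lead_coeff f1) p"
    using p f1(2) by (simp add: coprime_commute prime_imp_coprime)
  then obtain c e where ce: "c * lead_coeff f1 = 1 + p * e"
  proof -
    assume a: "\<And>c e. c * lead_coeff f1 = 1 + p * e \<Longrightarrow> thesis"
    obtain u v where "u * lead_coeff f1 + v * p = 1"
      using bezout_int[of "lead_coeff f1" p] \<open>coprime (lead_coeff f1) p\<close> by auto
    then have "u * lead_coeff f1 = 1 + p * (- v)" by (simp add: algebra_simps)
    then show ?thesis by (rule a)
  qed
  define Y where "Y = Poly ` {xs :: int list. set xs \<subseteq> {0..<p} \<and> length xs = d}"
  have finY: "finite Y"
    unfolding Y_def by (intro finite_imageI finite_lists_length_eq) auto
  have Yd: "\<exists>y\<in>Y. \<exists>a b. g = y + [:p:] * a + f * b" if g: "\<forall>i\<ge>d. coeff g i = 0" for g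
  proof -
    define y where "y = map_poly (\<lambda>c. c mod p) g"
    have cy: "coeff y i = coeff g i mod p" for i
      by (simp add: y_def coeff_map_poly)
    have "[:p:] dvd g - y"
      by (auto simp: const_poly_dvd_iff cy)
    then obtain a where a: "g - y = [:p:] * a" by (auto simp: dvd_def)
    have "y = Poly (map (coeff y) [0..<d])"
      using g by (auto simp: poly_eq_iff nth_default_def cy)
    moreover have "set (map (coeff y) [0..<d]) \<subseteq> {0..<p}"
      using p by (auto simp: cy prime_gt_0_int)
    ultimately have "y \<in> Y"
      unfolding Y_def by (metis (mono_tags, lifting) diff_zero image_eqI length_map length_upt mem_Collect_eq)
    moreover have "g = y + [:p:] * a + f * 0" using a by (simp add: algebra_simps)
    ultimately show ?thesis by blast
  qed
  have "\<exists>y\<in>Y. \<exists>a b. g = y + [:p:] * a + f * b" for g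
  proof (induction "degree g" arbitrary: g rule: less_induct)
    case less
    show ?case
    proof (cases "degree g < d \<or> g = 0")
      case True
      then show ?thesis using Yd[of g] by (metis coeff_0 coeff_eq_0 order_less_le_trans)
    next
      case False
      define m where "m = monom (lead_coeff g * c) (degree g - d)"
      \<comment> \<open>The inverse \<open>c\<close> of the leading coefficient is exact only modulo
        \<open>p\<close>; \<open>m1\<close> repays the error \<open>p * e\<close>, so that the top
        coefficient of \<open>g1\<close> is exactly 0.\<close>
      define m1 where "m1 = monom (lead_coeff g * e) (degree g)"
      define g1 where "g1 = g - m * f1 + [:p:] * m1"
      have cmf: "coeff (m * f1) i = (if i < degree g - d then 0 else lead_coeff g * c * coeff f1 (i - (degree g - d)))" for i
        by (simp add: m_def coeff_monom_mult)
      have cm1: "coeff ([:p:] * m1) i = (if i = degree g then p * (lead_coeff g * e) else 0)" for i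
        by (simp add: m1_def)
      have top: "coeff g1 (degree g) = 0"
      proof -
        have "coeff (m * f1) (degree g) = lead_coeff g * (c * lead_coeff f1)"
          using False by (simp add: cmf d_def)
        then show ?thesis unfolding g1_def by (simp only: coeff_add coeff_diff cm1) (simp add: ce algebra_simps)
      qed
      have hi: "coeff g1 i = 0" if "i > degree g" for i
      proof -
        have "coeff f1 (i - (degree g - d)) = 0"
          using that False by (intro coeff_eq_0) (auto simp: d_def)
        then show ?thesis using that unfolding g1_def by (simp only: coeff_add coeff_diff cm1 cmf) (simp add: coeff_eq_0)
      qed
      have eq: "g = g1 + [:p:] * (- m1 - m * h) + f * m"
        by (simp add: g1_def f1(1) algebra_simps del: mult_pCons_left mult_pCons_right)
      have "\<exists>y\<in>Y. \<exists>a b. g1 = y + [:p:] * a + f * b"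
      proof (cases "degree g = 0")
        case True
        then have "g1 = 0" using top hi by (intro poly_eqI) (metis coeff_0 neq0_conv)
        then show ?thesis using Yd[of 0] by auto
      next
        case False
        have "degree g1 < degree g"
        proof -
          have "degree g1 \<le> degree g - 1"
          proof (rule degree_le, intro allI impI)
            fix i assume "degree g - 1 < i"
            then have "i = degree g \<or> i > degree g" by linarith
            then show "coeff g1 i = 0" using top hi by blast
          qed
          then show ?thesis using False by simp
        qed
        then show ?thesis using less by blast
      qed
      then obtain y a b where "y \<in> Y" "g1 = y + [:p:] * a + f * b" by blast
      with eq have "g = y + [:p:] * (a - m1 - m * h) + f * (b + m)"
        by (simp add: algebra_simps del: mult_pCons_left mult_pCons_right)
      then show ?thesis using \<open>y \<in> Y\<close> by blast
    qed
  qed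
  then show ?thesis using that finY by blast
qed

text \<open>Pigeonhole on the residues. With \<open>z = X\<close> it makes torsion modules periodic;
  with \<open>z = X^s - 1\<close> it bounds how much of a power of \<open>z\<close> multiplication
  by \<open>f\<close> can hide.\<close>

lemma powers_repeat_mod:
  fixes f z :: "int poly"
  assumes p: "Factorial_Ring.prime (p::int)" and f: "\<not> [:p:] dvd f"
  obtains k l a b where "k < l" "z ^ k - z ^ l = [:p:] * a + f * b"
proof -
  obtain Y where Y: "finite Y" "\<And>g. \<exists>y\<in>Y. \<exists>a b. g = y + [:p:] * a + f * b"
    using finite_residues[OF p f] by blast
  obtain r where r: "\<And>k. r k \<in> Y" "\<And>k. \<exists>a b. z ^ k = r k + [:p:] * a + f * b"
    using Y(2)[of "z ^ _"] by metis
  have "\<not> inj r"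
    using Y(1) r(1) by (metis finite_subset finite_imageD image_subset_iff infinite_UNIV_nat)
  then obtain k l where "k < l" "r k = r l"
    by (metis inj_def linorder_less_linear)
  moreover obtain a b a' b' where "z ^ k = r k + [:p:] * a + f * b" "z ^ l = r l + [:p:] * a' + f * b'"
    using r(2) by metis
  ultimately have "z ^ k - z ^ l = [:p:] * (a - a') + f * (b - b')"
    using \<open>r k = r l\<close> by (simp add: algebra_simps del: mult_pCons_left mult_pCons_right)
  then show ?thesis using that \<open>k < l\<close> by blast
qed

text \<open>Modulo \<open>p\<close>, the difference \<open>z^k - z^l\<close> is a multiple of
  \<open>f\<close>. If \<open>f * y\<close> is divisible by \<open>z^N\<close> with
  \<open>N > k\<close>, then \<open>z^k * y\<close> is divisible by \<open>z^(k+1)\<close>, and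
  \<open>z^k\<close> cancels in the domain \<open>F_p[X]\<close>. So \<open>f\<close> can be
  cancelled at the price of passing from \<open>z^N\<close> to \<open>z\<close>, with a bound
  \<open>k\<close> that does not depend on \<open>y\<close>.\<close>

lemma cancel_mod_high_power:
  fixes f z :: "int poly"
  assumes p: "Factorial_Ring.prime (p::int)" and f: "\<not> [:p:] dvd f" and z: "\<not> [:p:] dvd z"
  obtains k where "\<And>N y u w. \<lbrakk>k < N; f * y = [:p:] * u + z ^ N * w\<rbrakk> \<Longrightarrow> \<exists>a b. y = [:p:] * a + z * b"
proof -
  obtain k l a b where kl: "k < l" "z ^ k - z ^ l = [:p:] * a + f * b"
    using powers_repeat_mod[OF p f] by blast
  have pp: "prime_elem [:p:]" using p by (simp only: prime_elem_const_poly_iff prime_imp_prime_elem)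
  show ?thesis
  proof (rule that)
    fix N y u w assume N: "k < N" "f * y = [:p:] * u + z ^ N * w"
    obtain l' where l': "l = k + Suc l'" using kl(1) less_iff_Suc_add by auto
    obtain N' where N': "N = k + Suc N'" using N(1) less_iff_Suc_add by auto
    have "z ^ k * y = z ^ l * y + ([:p:] * a + f * b) * y"
      using kl(2) by (simp add: algebra_simps)
    also have "\<dots> = z ^ l * y + [:p:] * a * y + b * (f * y)" by (simp add: algebra_simps)
    also have "\<dots> = z ^ l * y + [:p:] * a * y + b * ([:p:] * u + z ^ N * w)" by (simp only: N(2))
    finally have "z ^ k * (y - z * (z ^ l' * y + b * z ^ N' * w)) = [:p:] * (a * y + b * u)"
      by (simp add: l' N' algebra_simps power_add)
    then have "[:p:] dvd z ^ k * (y - z * (z ^ l' * y + b * z ^ N' * w))"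
      by (metis dvd_triv_left)
    then have "[:p:] dvd y - z * (z ^ l' * y + b * z ^ N' * w)"
      using pp z by (metis prime_elem_dvd_mult_iff prime_elem_dvd_power)
    then obtain c where "y - z * (z ^ l' * y + b * z ^ N' * w) = [:p:] * c" by (auto simp: dvd_def)
    then have "y = [:p:] * c + z * (z ^ l' * y + b * z ^ N' * w)" by (simp only: diff_eq_eq)
    then show "\<exists>a b. y = [:p:] * a + z * b" by blast
  qed
qed

text \<open>The geometric series expanded to second order at \<open>a = 1\<close>. Modulo
  \<open>p\<close> it shows that the \<open>p\<close>-th power at least squares
  \<open>a - 1\<close>.\<close>

lemma power_minus_one_mod_square:
  fixes a :: "'a :: comm_ring_1"
  obtains c where "a ^ p - 1 = of_nat p * (a - 1) + (a - 1)\<^sup>2 * c"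
proof -
  have 1: "a ^ i - 1 = (a - 1) * (\<Sum>j<i. a ^ j)" for i by (rule power_diff_1_eq)
  have "(\<Sum>j<p. a ^ j) = of_nat p + (\<Sum>j<p. a ^ j - 1)" by (simp add: sum_subtractf)
  also have "\<dots> = of_nat p + (a - 1) * (\<Sum>j<p. \<Sum>i<j. a ^ i)"
    by (simp add: 1 sum_distrib_left)
  finally have "a ^ p - 1 = (a - 1) * (of_nat p + (a - 1) * (\<Sum>j<p. \<Sum>i<j. a ^ i))"
    using 1[of p] by simp
  then have "a ^ p - 1 = of_nat p * (a - 1) + (a - 1)\<^sup>2 * (\<Sum>j<p. \<Sum>i<j. a ^ i)"
    by (simp add: power2_eq_square algebra_simps)
  then show ?thesis by (rule that)
qed

text \<open>For prime \<open>p\<close> the Frobenius map would give the exponent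
  \<open>p ^ h\<close>. The exponent \<open>2 ^ h\<close>, one squaring per factor \<open>p\<close>,
  also grows beyond any bound and comes directly from the preceding expansion.\<close>

lemma cyclotomic_deep_mod_p:
  fixes s :: nat and p :: nat
  shows "\<exists>u w. monom 1 (s * p ^ h) - (1::int poly) = [:int p:] * u + (monom 1 s - 1) ^ (2 ^ h) * w"
proof (induction h)
  case 0
  have "monom 1 (s * p ^ 0) - (1::int poly) = [:int p:] * 0 + (monom 1 s - 1) ^ (2 ^ 0) * 1" by simp
  then show ?case by blast
next
  case (Suc h)
  then obtain u w where uw: "monom 1 (s * p ^ h) - (1::int poly) = [:int p:] * u + (monom 1 s - 1) ^ (2 ^ h) * w" by blast
  define a :: "int poly" where "a = monom 1 (s * p ^ h)"
  define Z :: "int poly" where "Z = (monom 1 s - 1) ^ (2 ^ h)"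
  define P :: "int poly" where "P = [:int p:]"
  have Z2: "(monom 1 s - 1 :: int poly) ^ (2 ^ Suc h) = Z * Z"
    by (simp add: Z_def power_add[symmetric] mult_2)
  obtain c where c: "a ^ p - 1 = of_nat p * (a - 1) + (a - 1)\<^sup>2 * c"
    by (rule power_minus_one_mod_square)
  have "a ^ p = monom 1 (s * p ^ Suc h)"
    by (simp add: a_def monom_power algebra_simps)
  moreover have "(of_nat p :: int poly) = P" by (simp add: of_nat_poly P_def)
  ultimately have "monom 1 (s * p ^ Suc h) - 1 = P * (a - 1) + (a - 1)\<^sup>2 * c" using c by simp
  also have "\<dots> = P * (a - 1) + (P * u + Z * w)\<^sup>2 * c" using uw by (simp add: a_def Z_def P_def)
  also have "\<dots> = P * (a - 1 + (P * u * u + 2 * u * Z * w) * c) + (Z * Z) * (w * w * c)"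
    by (simp add: power2_eq_square algebra_simps)
  finally show ?case unfolding Z2 P_def by blast
qed

section \<open>The ideals generated by an integer and X^r - 1\<close>

lemma not_const_dvd_cyclotomic:
  fixes p :: int assumes "\<not> p dvd 1" "s > 0"
  shows "\<not> [:p:] dvd monom 1 s - (1::int poly)"
proof
  assume "[:p:] dvd monom 1 s - (1::int poly)"
  then have "p dvd coeff (monom 1 s - (1::int poly)) s" by (simp only: const_poly_dvd_iff)
  then show False using assms by (simp add: coeff_monom)
qed

lemma cyclotomic_dvd: "s dvd s' \<Longrightarrow> (monom 1 s - (1::int poly)) dvd monom 1 s' - 1"
proof -
  assume "s dvd s'"
  then obtain k where "s' = s * k" by auto
  then have "monom 1 s' = (monom 1 s :: int poly) ^ k" by (simp add: monom_power algebra_simps)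
  then show ?thesis by (metis power_diff_1_eq dvd_triv_left)
qed

definition ideal2 :: "int \<Rightarrow> nat \<Rightarrow> int poly set"
  where "ideal2 q r = {f. \<exists>a b. f = [:q:] * a + (monom 1 r - 1) * b}"

lemma ideal2I: "f = [:q:] * a + (monom 1 r - 1) * b \<Longrightarrow> f \<in> ideal2 q r"
  unfolding ideal2_def by blast

lemma ideal2E:
  assumes "f \<in> ideal2 q r" obtains a b where "f = [:q:] * a + (monom 1 r - 1) * b"
  using assms unfolding ideal2_def by blast

lemma ideal2_0 [simp]: "0 \<in> ideal2 q r"
  by (rule ideal2I[of _ _ 0 _ 0]) simp

lemma ideal2_add: "f \<in> ideal2 q r \<Longrightarrow> g \<in> ideal2 q r \<Longrightarrow> f + g \<in> ideal2 q r"
proof (elim ideal2E)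
  fix a b a' b' assume "f = [:q:] * a + (monom 1 r - 1) * b" "g = [:q:] * a' + (monom 1 r - 1) * b'"
  then have "f + g = [:q:] * (a + a') + (monom 1 r - 1) * (b + b')" by (simp only: distrib_left add_ac)
  then show ?thesis by (rule ideal2I)
qed

lemma ideal2_mult: "f \<in> ideal2 q r \<Longrightarrow> h * f \<in> ideal2 q r"
proof (elim ideal2E)
  fix a b assume "f = [:q:] * a + (monom 1 r - 1) * b"
  then have "h * f = [:q:] * (h * a) + (monom 1 r - 1) * (h * b)" by (simp only: distrib_left mult.left_commute)
  then show ?thesis by (rule ideal2I)
qed

lemma ideal2_uminus: "f \<in> ideal2 q r \<Longrightarrow> - f \<in> ideal2 q r"
  using ideal2_mult[of f q r "-1"] by simp

lemma ideal2_diff: "f \<in> ideal2 q r \<Longrightarrow> g \<in> ideal2 q r \<Longrightarrow> f - g \<in> ideal2 q r"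
  using ideal2_add[of f q r "-g"] ideal2_uminus by simp

lemma ideal2_trans: "f - g \<in> ideal2 q r \<Longrightarrow> g - h \<in> ideal2 q r \<Longrightarrow> f - h \<in> ideal2 q r"
  using ideal2_add[of "f - g" q r "g - h"] by simp

lemma ideal2_sym: "f - g \<in> ideal2 q r \<Longrightarrow> g - f \<in> ideal2 q r"
  using ideal2_uminus[of "f - g" q r] by simp

lemma ideal2_cong: "f - g \<in> ideal2 q r \<Longrightarrow> f \<in> ideal2 q r \<longleftrightarrow> g \<in> ideal2 q r"
  using ideal2_add[of "f - g" q r g] ideal2_add[of "g - f" q r f] ideal2_sym[of f g q r] by auto

lemma ideal2_const: "[:q:] * a \<in> ideal2 q r"
  by (rule ideal2I[of _ _ a _ 0]) simp

lemma ideal2_cyc: "(monom 1 r - 1) * b \<in> ideal2 q r"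
  by (rule ideal2I[of _ _ 0 _ b]) simp

lemma ideal2_mono:
  assumes "q dvd q'" "r dvd r'" "f \<in> ideal2 q' r'" shows "f \<in> ideal2 q r"
proof -
  obtain a b where f: "f = [:q':] * a + (monom 1 r' - 1) * b" using assms(3) by (rule ideal2E)
  obtain c where "q' = q * c" using assms(1) by auto
  then have 1: "[:q':] = [:q:] * [:c:]" by simp
  obtain e where 2: "monom 1 r' - (1::int poly) = (monom 1 r - 1) * e" using cyclotomic_dvd[OF assms(2)] by (auto simp: dvd_def)
  have "f = [:q:] * ([:c:] * a) + (monom 1 r - 1) * (e * b)" by (simp only: f 1 2 mult.assoc)
  then show ?thesis by (rule ideal2I)
qed

text \<open>A module over \<open>Z[X, 1/X]\<close> is encoded by a \<open>Z[X]\<close>-module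
  \<open>V\<close> and a submodule \<open>L\<close> modulo which \<open>X\<close> can be cancelled.
  The localization of \<open>V / L\<close> at \<open>X\<close> is meant, and elements are compared
  after multiplication by a power of \<open>X\<close>.\<close>

locale lattice_data = Modules.module scale
  for scale :: "int poly \<Rightarrow> 'v::ab_group_add \<Rightarrow> 'v" (infixr "*s" 75) +
  fixes L :: "'v set"
  assumes L: "subspace L"
    and L_sat: "monom 1 k *s v \<in> L \<Longrightarrow> v \<in> L"
begin

text \<open>The submodule \<open>L + (q, X^r - 1) V\<close>; the quotient by it is the reduction of
  \<open>V / L\<close> at level \<open>(q, r)\<close>.\<close>

definition LJ :: "int \<Rightarrow> nat \<Rightarrow> 'v set"
  where "LJ q r = {v. \<exists>a b. v - [:q:] *s a - (monom 1 r - 1) *s b \<in> L}"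

text \<open>The \<open>X\<close>-saturation of \<open>L + p V\<close>, that is, the preimage in
  \<open>V\<close> of \<open>p\<close> times the localized quotient. Modulo \<open>LJ\<close> the
  variable is invertible anyway, whereas here the saturation has to be built in.\<close>

definition Lp :: "int \<Rightarrow> 'v set"
  where "Lp p = {v. \<exists>k w. monom 1 k *s v - [:p:] *s w \<in> L}"

lemma L_add: "u \<in> L \<Longrightarrow> v \<in> L \<Longrightarrow> u + v \<in> L" using L by (rule subspace_add)
lemma L_diff: "u \<in> L \<Longrightarrow> v \<in> L \<Longrightarrow> u - v \<in> L" using L by (rule subspace_diff)
lemma L_scale: "u \<in> L \<Longrightarrow> f *s u \<in> L" using L by (rule subspace_scale)
lemma L_0: "0 \<in> L" using L by (rule subspace_0)

lemma L_cong: "u - v \<in> L \<Longrightarrow> u \<in> L \<longleftrightarrow> v \<in> L"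
  using L_add[of "u - v" v] L_diff[of u "u - v"] by auto

lemma subspace_LJ: "subspace (LJ q r)"
proof (rule subspaceI)
  show "0 \<in> LJ q r" unfolding LJ_def by (auto intro!: exI[of _ 0] simp: L_0)
next
  fix u v assume "u \<in> LJ q r" "v \<in> LJ q r"
  then obtain a b a' b' where "u - [:q:] *s a - (monom 1 r - 1) *s b \<in> L" "v - [:q:] *s a' - (monom 1 r - 1) *s b' \<in> L"
    unfolding LJ_def by blast
  then have "(u + v) - [:q:] *s (a + a') - (monom 1 r - 1) *s (b + b') \<in> L"
    using L_add by (fastforce simp: scale_right_distrib algebra_simps)
  then show "u + v \<in> LJ q r" unfolding LJ_def by blast
next
  fix c u assume "u \<in> LJ q r"
  then obtain a b where "u - [:q:] *s a - (monom 1 r - 1) *s b \<in> L" unfolding LJ_def by blast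
  then have "c *s (u - [:q:] *s a - (monom 1 r - 1) *s b) \<in> L" by (rule L_scale)
  then have "c *s u - [:q:] *s (c *s a) - (monom 1 r - 1) *s (c *s b) \<in> L"
    by (simp only: scale_right_diff_distrib scale_scale mult.commute)
  then show "c *s u \<in> LJ q r" unfolding LJ_def by blast
qed

lemma L_sub_LJ: "v \<in> L \<Longrightarrow> v \<in> LJ q r"
  unfolding LJ_def by (auto intro!: exI[of _ 0])

lemma LJ_const: "[:q:] *s a \<in> LJ q r"
  unfolding LJ_def by (rule CollectI, rule exI[of _ a], rule exI[of _ 0]) (simp add: L_0)

lemma LJ_cyc: "(monom 1 r - 1) *s b \<in> LJ q r"
  unfolding LJ_def by (rule CollectI, rule exI[of _ 0], rule exI[of _ b]) (simp add: L_0)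

lemma LJ_cong: "u - v \<in> LJ q r \<Longrightarrow> u \<in> LJ q r \<longleftrightarrow> v \<in> LJ q r"
  using subspace_add[OF subspace_LJ, of "u - v" q r v] subspace_diff[OF subspace_LJ, of u q r "u - v"] by auto

lemma ideal2_scale_LJ: "f \<in> ideal2 q r \<Longrightarrow> f *s v \<in> LJ q r"
proof (elim ideal2E)
  fix a b assume "f = [:q:] * a + (monom 1 r - 1) * b"
  then have "f *s v = [:q:] *s (a *s v) + (monom 1 r - 1) *s (b *s v)" by (simp only: scale_left_distrib scale_scale)
  then show ?thesis using subspace_add[OF subspace_LJ LJ_const LJ_cyc] by (simp only:)
qed

lemma LJ_mono:
  assumes "q dvd q'" "r dvd r'" "v \<in> LJ q' r'" shows "v \<in> LJ q r"
proof -
  obtain a b where 1: "v - [:q':] *s a - (monom 1 r' - 1) *s b \<in> L" using assms(3) unfolding LJ_def by blast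
  have "[:q':] *s a \<in> LJ q r" "(monom 1 r' - 1) *s b \<in> LJ q r"
    using ideal2_mono[OF assms(1,2)] ideal2_const[of q' 1 r'] ideal2_cyc[of r' 1 q'] by (auto intro!: ideal2_scale_LJ)
  then have "[:q':] *s a + (monom 1 r' - 1) *s b \<in> LJ q r" by (rule subspace_add[OF subspace_LJ])
  then show ?thesis using L_sub_LJ[OF 1] LJ_cong[of v "[:q':] *s a + (monom 1 r' - 1) *s b"] by (simp add: diff_diff_eq)
qed

text \<open>\<open>X\<close> is invertible modulo \<open>X^r - 1\<close>: after completing the
  exponent to \<open>r * k\<close> the power of \<open>X\<close> acts as 1.\<close>

lemma LJ_sat:
  assumes r: "r > 0" and v: "monom 1 k *s v \<in> LJ q r" shows "v \<in> LJ q r"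
proof -
  have "monom 1 (r * k - k) *s (monom 1 k *s v) \<in> LJ q r"
    using v by (rule subspace_scale[OF subspace_LJ])
  moreover have "r * k - k + k = r * k" using r by simp
  ultimately have 1: "monom 1 (r * k) *s v \<in> LJ q r" by (simp add: mult_monom)
  obtain e where e: "monom 1 (r * k) - (1::int poly) = (monom 1 r - 1) * e"
    using cyclotomic_dvd[of r "r * k"] by (auto simp: dvd_def)
  have "(monom 1 (r * k) - 1) *s v \<in> LJ q r"
    unfolding e by (rule ideal2_scale_LJ[OF ideal2_cyc])
  then show ?thesis using 1 LJ_cong by (simp add: scale_left_diff_distrib)
qed

lemma subspace_Lp: "subspace (Lp p)"
proof (rule subspaceI)
  show "0 \<in> Lp p" unfolding Lp_def by (auto intro!: exI[of _ 0] simp: L_0)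
next
  fix u v assume "u \<in> Lp p" "v \<in> Lp p"
  then obtain k w k' w' where 1: "monom 1 k *s u - [:p:] *s w \<in> L" "monom 1 k' *s v - [:p:] *s w' \<in> L"
    unfolding Lp_def by blast
  have "monom 1 k' *s (monom 1 k *s u - [:p:] *s w) + monom 1 k *s (monom 1 k' *s v - [:p:] *s w') \<in> L"
    by (intro L_add L_scale 1)
  moreover have "monom 1 k' *s (monom 1 k *s u - [:p:] *s w) + monom 1 k *s (monom 1 k' *s v - [:p:] *s w')
    = monom 1 (k + k') *s (u + v) - [:p:] *s (monom 1 k' *s w + monom 1 k *s w')"
    by (simp add: scale_right_diff_distrib scale_right_distrib mult_monom add.commute smult_monom monom_0[symmetric] algebra_simps)
  ultimately show "u + v \<in> Lp p" unfolding Lp_def by auto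
next
  fix c u assume "u \<in> Lp p"
  then obtain k w where "monom 1 k *s u - [:p:] *s w \<in> L" unfolding Lp_def by blast
  then have "c *s (monom 1 k *s u - [:p:] *s w) \<in> L" by (rule L_scale)
  then have "monom 1 k *s (c *s u) - [:p:] *s (c *s w) \<in> L"
    by (simp only: scale_right_diff_distrib scale_scale mult.commute)
  then show "c *s u \<in> Lp p" unfolding Lp_def by blast
qed

lemma L_sub_Lp: "v \<in> L \<Longrightarrow> v \<in> Lp p"
  unfolding Lp_def by (auto intro!: exI[of _ 0] simp flip: one_pCons simp: monom_0)

lemma Lp_const: "[:p:] *s w \<in> Lp p"
  unfolding Lp_def by (auto intro!: exI[of _ 0] exI[of _ w] simp: L_0 monom_0)

lemma Lp_dvd: "[:p:] dvd f \<Longrightarrow> f *s w \<in> Lp p"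
  using Lp_const by (auto simp: dvd_def simp del: mult_pCons_left mult_pCons_right simp flip: scale_scale)

lemma Lp_sat:
  assumes "monom 1 j *s v \<in> Lp p" shows "v \<in> Lp p"
proof -
  obtain k w where "monom 1 k *s (monom 1 j *s v) - [:p:] *s w \<in> L" using assms unfolding Lp_def by blast
  then have "monom 1 (k + j) *s v - [:p:] *s w \<in> L" by (simp add: mult_monom)
  then show ?thesis unfolding Lp_def by blast
qed

lemma Lp_cong: "u - v \<in> Lp p \<Longrightarrow> u \<in> Lp p \<longleftrightarrow> v \<in> Lp p"
  using subspace_add[OF subspace_Lp, of "u - v" p v] subspace_diff[OF subspace_Lp, of u p "u - v"] by auto

end

text \<open>For each \<open>s\<close> the map \<open>\<psi>\<close> induces an isomorphism of
  \<open>V / LJ s s\<close> with \<open>n\<close> copies of \<open>Z[X] / (s, X^s - 1)\<close>. Its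
  values are representatives, so additivity, linearity and surjectivity are stated modulo the ideal.
  By \<open>cap\<close> these quotients separate the elements of \<open>V / L\<close>; the maps of
  different levels need not be related to each other.\<close>

locale profree_data = lattice_data scale L
  for scale :: "int poly \<Rightarrow> 'v::ab_group_add \<Rightarrow> 'v" (infixr "*s" 75) and L +
  fixes n :: nat and S :: "'v set"
  assumes finS: "finite S"
    and gens: "\<exists>k f. monom 1 k *s v - (\<Sum>x\<in>S. f x *s x) \<in> L"
    and cap: "(\<And>s. s > 0 \<Longrightarrow> v \<in> LJ (int s) s) \<Longrightarrow> v \<in> L"
    and quot: "s > 0 \<Longrightarrow> \<exists>\<psi>. (\<forall>u v. \<forall>i<n. \<psi> (u + v) i - (\<psi> u i + \<psi> v i) \<in> ideal2 (int s) s)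
      \<and> (\<forall>f v. \<forall>i<n. \<psi> (f *s v) i - f * \<psi> v i \<in> ideal2 (int s) s)
      \<and> (\<forall>y. \<exists>v. \<forall>i<n. \<psi> v i - y i \<in> ideal2 (int s) s)
      \<and> (\<forall>v. v \<in> LJ (int s) s \<longleftrightarrow> (\<forall>i<n. \<psi> v i \<in> ideal2 (int s) s))"
begin

text \<open>An isomorphism with a free module over \<open>Z[X] / (s, X^s - 1)\<close> stays one
  after reduction modulo a larger ideal, so one \<open>\<psi>\<close> serves for all
  \<open>(q, X^r - 1)\<close> with \<open>q\<close> and \<open>r\<close> dividing \<open>s\<close>.
  Reading coarse levels off a fine one takes the place of compatibility between levels.\<close>

lemma quotE:
  assumes s: "s > 0"
  obtains \<psi> where "\<And>q r u v i. \<lbrakk>q dvd int s; r dvd s; i < n\<rbrakk> \<Longrightarrow> \<psi> (u + v) i - (\<psi> u i + \<psi> v i) \<in> ideal2 q r"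
    "\<And>q r f v i. \<lbrakk>q dvd int s; r dvd s; i < n\<rbrakk> \<Longrightarrow> \<psi> (f *s v) i - f * \<psi> v i \<in> ideal2 q r"
    "\<And>y. \<exists>v. \<forall>i<n. \<psi> v i - y i \<in> ideal2 (int s) s"
    "\<And>q r v. \<lbrakk>q dvd int s; r dvd s\<rbrakk> \<Longrightarrow> v \<in> LJ q r \<longleftrightarrow> (\<forall>i<n. \<psi> v i \<in> ideal2 q r)"
proof -
  obtain \<psi> where p1: "\<And>u v i. i < n \<Longrightarrow> \<psi> (u + v) i - (\<psi> u i + \<psi> v i) \<in> ideal2 (int s) s"
    and p2: "\<And>f v i. i < n \<Longrightarrow> \<psi> (f *s v) i - f * \<psi> v i \<in> ideal2 (int s) s"
    and p3: "\<And>y. \<exists>v. \<forall>i<n. \<psi> v i - y i \<in> ideal2 (int s) s"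
    and p4: "\<And>v. v \<in> LJ (int s) s \<longleftrightarrow> (\<forall>i<n. \<psi> v i \<in> ideal2 (int s) s)"
    using quot[OF s] by metis
  have q1: "\<psi> (u + v) i - (\<psi> u i + \<psi> v i) \<in> ideal2 q r" if "q dvd int s" "r dvd s" "i < n" for q r u v i
    using ideal2_mono[OF that(1,2) p1[OF that(3)]] .
  have q2: "\<psi> (f *s v) i - f * \<psi> v i \<in> ideal2 q r" if "q dvd int s" "r dvd s" "i < n" for q r f v i
    using ideal2_mono[OF that(1,2) p2[OF that(3)]] .
  have q4: "v \<in> LJ q r \<longleftrightarrow> (\<forall>i<n. \<psi> v i \<in> ideal2 q r)" if qr: "q dvd int s" "r dvd s" for q r v
  proof -
    have lin: "\<psi> (u + [:q:] *s a + (monom 1 r - 1) *s b) i - (\<psi> u i + [:q:] * \<psi> a i + (monom 1 r - 1) * \<psi> b i) \<in> ideal2 (int s) s"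
      if "i < n" for u a b i
    proof -
      have "(\<psi> (u + [:q:] *s a + (monom 1 r - 1) *s b) i - (\<psi> (u + [:q:] *s a) i + \<psi> ((monom 1 r - 1) *s b) i))
         + (\<psi> (u + [:q:] *s a) i - (\<psi> u i + \<psi> ([:q:] *s a) i)) + (\<psi> ([:q:] *s a) i - [:q:] * \<psi> a i)
         + (\<psi> ((monom 1 r - 1) *s b) i - (monom 1 r - 1) * \<psi> b i) \<in> ideal2 (int s) s"
        by (intro ideal2_add p1 p2 that)
      then show ?thesis by (rule back_subst[of "\<lambda>x. x \<in> _"]) (simp only: algebra_simps)
    qed
    show ?thesis
    proof
      assume "v \<in> LJ q r"
      then obtain a b where ab: "v - [:q:] *s a - (monom 1 r - 1) *s b \<in> L" unfolding LJ_def by blast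
      define u where "u = v - [:q:] *s a - (monom 1 r - 1) *s b"
      have v: "v = u + [:q:] *s a + (monom 1 r - 1) *s b" by (simp add: u_def)
      have "\<forall>i<n. \<psi> u i \<in> ideal2 (int s) s" using L_sub_LJ[OF ab] p4 unfolding u_def by blast
      then have 1: "\<psi> u i + [:q:] * \<psi> a i + (monom 1 r - 1) * \<psi> b i \<in> ideal2 q r" if "i < n" for i
        using ideal2_mono[OF qr] that by (intro ideal2_add ideal2_const ideal2_cyc) auto
      show "\<forall>i<n. \<psi> v i \<in> ideal2 q r"
        using 1 ideal2_cong[OF ideal2_mono[OF qr lin[of _ u a b]]] unfolding v by blast
    next
      assume "\<forall>i<n. \<psi> v i \<in> ideal2 q r"
      then obtain y z where yz: "\<And>i. i < n \<Longrightarrow> \<psi> v i = [:q:] * y i + (monom 1 r - 1) * z i"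
        unfolding ideal2_def by simp metis
      \<comment> \<open>Preimages of the negated coefficients correct \<open>v\<close> by an element
        of \<open>(q, X^r - 1) V\<close> to an element \<open>u\<close> that vanishes at level
        \<open>s\<close>.\<close>
      obtain a b where a: "\<And>i. i < n \<Longrightarrow> \<psi> a i - (- y i) \<in> ideal2 (int s) s" and b: "\<And>i. i < n \<Longrightarrow> \<psi> b i - (- z i) \<in> ideal2 (int s) s"
        using p3[of "\<lambda>i. - y i"] p3[of "\<lambda>i. - z i"] by metis
      define u where "u = v + [:q:] *s a + (monom 1 r - 1) *s b"
      have "\<psi> u i \<in> ideal2 (int s) s" if i: "i < n" for i
      proof -
        have "\<psi> v i + [:q:] * \<psi> a i + (monom 1 r - 1) * \<psi> b i = [:q:] * (\<psi> a i - (- y i)) + (monom 1 r - 1) * (\<psi> b i - (- z i))"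
          using yz[OF i] by (simp only:) (simp only: algebra_simps)
        also have "\<dots> \<in> ideal2 (int s) s" by (intro ideal2_add ideal2_mult a b i)
        finally show ?thesis using ideal2_cong[OF lin[OF i, of v a b]] by (simp only: u_def)
      qed
      then have "u \<in> LJ (int s) s" using p4 by blast
      then have "u \<in> LJ q r" by (rule LJ_mono[OF qr])
      moreover have "u - v \<in> LJ q r"
        using subspace_add[OF subspace_LJ LJ_const LJ_cyc] by (simp add: u_def)
      ultimately show "v \<in> LJ q r" using LJ_cong by blast
    qed
  qed
  show ?thesis using that[of \<psi>] q1 q2 p3 q4 by blast
qed

section \<open>Torsion-freeness over the integers, modulo a prime, and over Z[X]\<close>

lemma prime_torsion_free:
  assumes p: "Factorial_Ring.prime (p::int)" and v: "[:p:] *s v \<in> L" shows "v \<in> L"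
proof (rule cap)
  fix s0 :: nat assume s0: "s0 > 0"
  \<comment> \<open>This level has a factor \<open>p\<close> to spend. As \<open>X^s - 1\<close> is
    not divisible by the prime element \<open>p\<close>, a relation
    \<open>p * \<psi> v = p * s0 * a + (X^s - 1) * b\<close> makes \<open>p\<close> divide
    \<open>b\<close>, and cancelling \<open>p\<close> lands at level \<open>s0\<close>.\<close>
  define s where "s = nat p * s0"
  have s: "s > 0" "int s0 dvd int s" "s0 dvd s" "int s = p * int s0"
    using s0 prime_gt_0_int[OF p] by (auto simp: s_def)
  obtain \<psi> where
    2: "\<And>q r f v i. \<lbrakk>q dvd int s; r dvd s; i < n\<rbrakk> \<Longrightarrow> \<psi> (f *s v) i - f * \<psi> v i \<in> ideal2 q r" and
    4: "\<And>q r v. \<lbrakk>q dvd int s; r dvd s\<rbrakk> \<Longrightarrow> v \<in> LJ q r \<longleftrightarrow> (\<forall>i<n. \<psi> v i \<in> ideal2 q r)"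
    using quotE[OF s(1)] by metis
  have "\<psi> v i \<in> ideal2 (int s0) s0" if i: "i < n" for i
  proof -
    have "\<psi> ([:p:] *s v) i \<in> ideal2 (int s) s" using 4[of "int s" s "[:p:] *s v"] L_sub_LJ[OF v, of "int s" s] i by simp
    then have "[:p:] * \<psi> v i \<in> ideal2 (int s) s"
      using ideal2_cong[OF 2[of "int s" s i "[:p:]" v]] i by simp
    then obtain a b where "[:p:] * \<psi> v i = [:int s:] * a + (monom 1 s - 1) * b" by (rule ideal2E)
    moreover have "[:int s:] = [:p:] * [:int s0:]" by (simp add: s(4))
    ultimately have 5: "(monom 1 s - 1) * b = [:p:] * (\<psi> v i - [:int s0:] * a)"
      by (simp only: algebra_simps)
    then have "[:p:] dvd (monom 1 s - 1) * b" by (metis dvd_triv_left)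
    moreover have "\<not> [:p:] dvd monom 1 s - 1"
      by (rule not_const_dvd_cyclotomic) (use p s in \<open>auto simp: not_prime_unit\<close>)
    moreover have "prime_elem [:p:]" using p by (simp only: prime_elem_const_poly_iff prime_imp_prime_elem)
    ultimately have "[:p:] dvd b" by (simp only: prime_elem_dvd_mult_iff simp_thms)
    then obtain b' where "b = [:p:] * b'" by (auto simp: dvd_def)
    with 5 have "[:p:] * ((monom 1 s - 1) * b') = [:p:] * (\<psi> v i - [:int s0:] * a)"
      by (simp only: mult.left_commute)
    moreover have "[:p:] \<noteq> 0" using p by auto
    ultimately have "(monom 1 s - 1) * b' = \<psi> v i - [:int s0:] * a" by (simp only: mult_cancel_left simp_thms)
    then have "\<psi> v i = [:int s0:] * a + (monom 1 s - 1) * b'" by (simp only: algebra_simps)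
    then show ?thesis using ideal2_mono[OF dvd_refl s(3)] ideal2I by blast
  qed
  then show "v \<in> LJ (int s0) s0" using 4[OF s(2,3)] by blast
qed

lemma int_torsion_free:
  assumes "d \<noteq> 0" "[:d:] *s v \<in> L" shows "v \<in> L"
  using assms
proof (induction "nat \<bar>d\<bar>" arbitrary: d v rule: less_induct)
  case less
  show ?case
  proof (cases "is_unit d")
    case True
    then have "d = 1 \<or> d = -1" by auto
    then show ?thesis using less.prems L_scale[of "[:d:] *s v" "[:d:]"] by (auto simp flip: one_pCons)
  next
    case False
    then obtain p e where p: "Factorial_Ring.prime p" and d: "d = p * e"
      using prime_divisor_exists[of d] less.prems by (metis dvd_def)
    have "[:p:] *s ([:e:] *s v) \<in> L" using less.prems d by (simp add: mult.commute)
    then have "[:e:] *s v \<in> L" by (rule prime_torsion_free[OF p])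
    moreover have "nat \<bar>e\<bar> < nat \<bar>d\<bar>"
    proof -
      have "p \<ge> 2" using p by (simp add: prime_ge_2_int)
      then have "\<bar>d\<bar> = p * \<bar>e\<bar>" by (simp add: d abs_mult)
      moreover have "\<bar>e\<bar> > 0" using less.prems d by auto
      moreover have "2 * \<bar>e\<bar> \<le> p * \<bar>e\<bar>" using \<open>p \<ge> 2\<close> by (intro mult_right_mono) auto
      ultimately show ?thesis by linarith
    qed
    ultimately show ?thesis using less.hyps[of e v] less.prems d by auto
  qed
qed

end

context profree_data
begin

text \<open>Residual finiteness of a finitely generated module over \<open>F_p[X, 1/X]\<close>. A
  submodule \<open>W\<close> maximal among those avoiding \<open>x\<close> has a torsion quotient;
  by finite generation one polynomial \<open>F\<close> kills this quotient, and as
  \<open>F_p[X]/(F)\<close> is finite, so does some \<open>X^r - 1\<close>.\<close>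

lemma separate_mod_prime:
  assumes p: "Factorial_Ring.prime p" and x: "x \<notin> Lp (int p)"
  obtains s where "s > 0" "p dvd s" "x \<notin> LJ (int p) s"
proof -
  have pi: "Factorial_Ring.prime (int p)" using p by simp
  then have p1: "\<not> int p dvd 1" using prime_ge_2_int[OF pi] by (auto dest: zdvd_imp_le)
  have pe: "prime_elem [:int p:]" using pi by (simp only: prime_elem_const_poly_iff prime_imp_prime_elem)
  have n1: "\<not> [:int p:] dvd 1"
  proof
    assume "[:int p:] dvd 1"
    then have "int p dvd coeff 1 0" by (simp only: const_poly_dvd_iff)
    then show False using p1 by simp
  qed
  define \<W> where "\<W> = {W. subspace W \<and> (\<forall>k v. monom 1 k *s v \<in> W \<longrightarrow> v \<in> W) \<and> Lp (int p) \<subseteq> W \<and> x \<notin> W}"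
  have "Lp (int p) \<in> \<W>" using x subspace_Lp Lp_sat by (auto simp: \<W>_def)
  have "\<exists>W\<in>\<W>. \<forall>Y\<in>\<W>. W \<subseteq> Y \<longrightarrow> Y = W"
  proof (rule subset_Zorn_nonempty)
    show "\<W> \<noteq> {}" using \<open>Lp (int p) \<in> \<W>\<close> by blast
  next
    fix C assume C: "C \<noteq> {}" "subset.chain \<W> C"
    then have CW: "Y \<in> \<W>" if "Y \<in> C" for Y using that by (auto simp: subset_chain_def)
    have "subspace (\<Union>C)"
    proof (rule subspaceI)
      obtain Y where "Y \<in> C" using C(1) by blast
      moreover then have "subspace Y" using CW by (auto simp: \<W>_def)
      ultimately show "0 \<in> \<Union>C" using subspace_0 by blast
    next
      fix u v assume "u \<in> \<Union>C" "v \<in> \<Union>C"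
      then obtain Y Z where "u \<in> Y" "Y \<in> C" "v \<in> Z" "Z \<in> C" by blast
      moreover then have "Y \<subseteq> Z \<or> Z \<subseteq> Y" using C(2) by (auto simp: subset_chain_def)
      moreover have "subspace Y" "subspace Z" using CW \<open>Y \<in> C\<close> \<open>Z \<in> C\<close> by (auto simp: \<W>_def)
      ultimately show "u + v \<in> \<Union>C" by (metis UnionI subsetD subspace_add)
    next
      fix c u assume "u \<in> \<Union>C"
      then obtain Y where "u \<in> Y" "Y \<in> C" by blast
      moreover have "subspace Y" using CW \<open>Y \<in> C\<close> by (auto simp: \<W>_def)
      ultimately show "c *s u \<in> \<Union>C" by (metis UnionI subspace_scale)
    qed
    moreover have "v \<in> \<Union>C" if "monom 1 k *s v \<in> \<Union>C" for k v
      using that CW unfolding \<W>_def by blast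
    moreover have "Lp (int p) \<subseteq> \<Union>C" using C(1) CW unfolding \<W>_def by blast
    moreover have "x \<notin> \<Union>C" using CW unfolding \<W>_def by blast
    ultimately show "\<Union>C \<in> \<W>" unfolding \<W>_def by blast
  qed
  then obtain W where W: "W \<in> \<W>" and max: "\<And>Y. Y \<in> \<W> \<Longrightarrow> W \<subseteq> Y \<Longrightarrow> Y = W" by blast
  have sub: "subspace W" and sat: "\<And>k v. monom 1 k *s v \<in> W \<Longrightarrow> v \<in> W" and LW: "Lp (int p) \<subseteq> W" and xW: "x \<notin> W"
    using W by (auto simp: \<W>_def)
  \<comment> \<open>By maximality every saturated submodule strictly above \<open>W\<close> contains
    \<open>x\<close>; for the one generated by \<open>W\<close> and \<open>y\<close> this says that
    \<open>x\<close> is a multiple of \<open>y\<close> up to a power of \<open>X\<close>.\<close>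
  have reach: "\<exists>k h. monom 1 k *s x - h *s y \<in> W" if y: "y \<notin> W" for y
  proof (rule ccontr)
    assume no: "\<not> ?thesis"
    define Y where "Y = {v. \<exists>k h. monom 1 k *s v - h *s y \<in> W}"
    have YI: "v \<in> Y" if "monom 1 k *s v - h *s y \<in> W" for v k h
      using that unfolding Y_def by blast
    have "subspace Y"
    proof (rule subspaceI)
      show "0 \<in> Y" by (rule YI[of 0 _ 0]) (simp add: subspace_0[OF sub])
    next
      fix u v assume "u \<in> Y" "v \<in> Y"
      then obtain k h k' h' where 1: "monom 1 k *s u - h *s y \<in> W" "monom 1 k' *s v - h' *s y \<in> W"
        unfolding Y_def by blast
      have "monom 1 k' *s (monom 1 k *s u - h *s y) + monom 1 k *s (monom 1 k' *s v - h' *s y) \<in> W"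
        by (intro subspace_add[OF sub] subspace_scale[OF sub] 1)
      moreover have "monom 1 k' *s (monom 1 k *s u - h *s y) + monom 1 k *s (monom 1 k' *s v - h' *s y)
        = monom 1 (k + k') *s (u + v) - (monom 1 k' * h + monom 1 k * h') *s y"
        by (simp add: scale_right_diff_distrib scale_right_distrib scale_left_distrib mult_monom add.commute)
      ultimately show "u + v \<in> Y" using YI by metis
    next
      fix c u assume "u \<in> Y"
      then obtain k h where "monom 1 k *s u - h *s y \<in> W" unfolding Y_def by blast
      then have "c *s (monom 1 k *s u - h *s y) \<in> W" by (rule subspace_scale[OF sub])
      then have "monom 1 k *s (c *s u) - (c * h) *s y \<in> W"
        by (simp only: scale_right_diff_distrib scale_scale mult.commute)
      then show "c *s u \<in> Y" by (rule YI)
    qed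
    moreover have "v \<in> Y" if vk: "monom 1 j *s v \<in> Y" for j v
    proof -
      obtain k h where "monom 1 k *s (monom 1 j *s v) - h *s y \<in> W" using vk unfolding Y_def by blast
      then have "monom 1 (k + j) *s v - h *s y \<in> W" by (simp add: mult_monom)
      then show ?thesis by (rule YI)
    qed
    moreover have WY: "W \<subseteq> Y" using YI[of 0 _ 0] by (auto simp: monom_0 simp flip: one_pCons)
    moreover have "x \<notin> Y" using no by (auto simp: Y_def)
    ultimately have "Y \<in> \<W>" using LW by (auto simp: \<W>_def)
    then have "Y = W" using WY by (rule max)
    moreover have "y \<in> Y" by (rule YI[of 0 _ 1]) (simp add: monom_0 subspace_0[OF sub] flip: one_pCons)
    ultimately show False using y by blast
  qed
  have torsion: "\<exists>f. \<not> [:int p:] dvd f \<and> f *s y \<in> W" for y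
  proof (rule ccontr)
    assume no: "\<not> ?thesis"
    have "y \<notin> W" using no n1 scale_one by metis
    then obtain k h where kh: "monom 1 k *s x - h *s y \<in> W" using reach by blast
    have nh: "\<not> [:int p:] dvd h"
    proof
      assume "[:int p:] dvd h"
      then have "h *s y \<in> W" using Lp_dvd LW by blast
      then have "monom 1 k *s x \<in> W" using kh subspace_add[OF sub] by fastforce
      then show False using sat xW by blast
    qed
    \<comment> \<open>\<open>X - 1\<close> is a non-unit of \<open>F_p[X, 1/X]\<close>. Without
      torsion at \<open>y\<close>, both \<open>h y\<close> and some multiple of
      \<open>(X - 1) h y\<close> would equal \<open>x\<close> up to powers of \<open>X\<close>, so
      \<open>X - 1\<close> would be a unit; evaluating \<open>c\<close> at 1 refutes this.\<close>
    define y1 where "y1 = ((monom 1 1 - 1) * h) *s y"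
    have "\<not> [:int p:] dvd (monom 1 1 - 1) * h"
      using nh not_const_dvd_cyclotomic[OF p1, of 1] pe by (simp only: prime_elem_dvd_mult_iff) simp
    then have "y1 \<notin> W" using no by (auto simp: y1_def)
    then obtain l g where lg: "monom 1 l *s x - g *s y1 \<in> W" using reach by blast
    define c where "c = monom 1 l - monom 1 k * g * (monom 1 1 - 1)"
    have "monom 1 k *s (monom 1 l *s x - g *s y1) - monom 1 l *s (monom 1 k *s x - h *s y) \<in> W"
      by (intro subspace_diff[OF sub] subspace_scale[OF sub] kh lg)
    also have "monom 1 k *s (monom 1 l *s x - g *s y1) - monom 1 l *s (monom 1 k *s x - h *s y) = (c * h) *s y"
      by (simp add: c_def y1_def scale_right_diff_distrib scale_left_diff_distrib algebra_simps)
    finally have "[:int p:] dvd c * h" using no by blast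
    then have "[:int p:] dvd c" using nh pe by (simp only: prime_elem_dvd_mult_iff) simp
    then obtain e where "c = [:int p:] * e" by (auto simp: dvd_def)
    then have "poly c 1 = int p * poly e 1" by simp
    moreover have "poly c 1 = 1" by (simp add: c_def poly_monom)
    ultimately show False using p1 by (metis dvd_triv_left)
  qed
  obtain f where f: "\<And>y. \<not> [:int p:] dvd f y" "\<And>y. f y *s y \<in> W" using torsion by metis
  define F where "F = prod f S"
  have nF: "\<not> [:int p:] dvd F"
    unfolding F_def using finS
  proof (induction S rule: finite_induct)
    case (insert y T)
    then show ?case using f(1)[of y] pe by (simp only: prod.insert prime_elem_dvd_mult_iff simp_thms)
  qed (simp only: prod.empty n1 not_False_eq_True)
  have FW: "F *s v \<in> W" for v
  proof -
    obtain k g where kg: "monom 1 k *s v - (\<Sum>y\<in>S. g y *s y) \<in> L" using gens by blast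
    have "F *s (\<Sum>y\<in>S. g y *s y) \<in> W"
    proof -
      have "F *s (g y *s y) \<in> W" if "y \<in> S" for y
      proof -
        have "F = prod f (S - {y}) * f y" using that finS by (simp add: F_def prod.remove mult.commute)
        then have "F *s (g y *s y) = (prod f (S - {y}) * g y) *s (f y *s y)" by (simp add: mult_ac)
        then show ?thesis using subspace_scale[OF sub f(2)] by simp
      qed
      then show ?thesis by (simp only: scale_sum_right) (rule subspace_sum[OF sub])
    qed
    moreover have "F *s (monom 1 k *s v - (\<Sum>y\<in>S. g y *s y)) \<in> W"
      using kg L_sub_Lp LW by (intro subspace_scale[OF sub]) blast
    ultimately have "F *s (monom 1 k *s v) \<in> W"
      using subspace_add[OF sub] by (fastforce simp: scale_right_diff_distrib)
    then have "monom 1 k *s (F *s v) \<in> W" by (simp add: mult.commute)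
    then show ?thesis by (rule sat)
  qed
  obtain k l a b where kl: "k < l" "monom 1 1 ^ k - monom 1 1 ^ l = [:int p:] * a + F * b"
    using powers_repeat_mod[OF pi nF] by blast
  define r where "r = l - k"
  have pW: "(([:int p:] * a) *s v) \<in> W" for v a using Lp_dvd[OF dvd_triv_left] LW by (rule subsetD[rotated])
  have rW: "(monom 1 r - 1) *s v \<in> W" for v
  proof -
    have "monom 1 1 ^ l = monom 1 1 ^ k * (monom 1 r :: int poly)"
      using kl(1) by (simp add: r_def monom_power mult_monom)
    then have "monom 1 k * (monom 1 r - 1) = [:int p:] * (- a) + F * (- b)"
      using kl(2) by (simp add: monom_power algebra_simps del: mult_pCons_left mult_pCons_right)
    then have "monom 1 k *s ((monom 1 r - 1) *s v) = ([:int p:] * (- a)) *s v + F *s ((- b) *s v)"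
      by (simp only: scale_scale scale_left_distrib)
    then show ?thesis using subspace_add[OF sub pW FW] sat by metis
  qed
  \<comment> \<open>The factor \<open>p\<close> makes \<open>p\<close> divide the level, as reading
    off the modulus \<open>p\<close> at level \<open>s\<close> requires.\<close>
  define s where "s = p * r"
  have "LJ (int p) s \<subseteq> W"
  proof
    fix v assume "v \<in> LJ (int p) s"
    then obtain a b where ab: "v - [:int p:] *s a - (monom 1 s - 1) *s b \<in> L" unfolding LJ_def by blast
    obtain e where e: "monom 1 s - (1::int poly) = (monom 1 r - 1) * e"
      using cyclotomic_dvd[of r s] by (auto simp: dvd_def s_def)
    have "(monom 1 s - 1) *s b \<in> W" using rW[of "e *s b"] by (simp add: e)
    moreover have "[:int p:] *s a \<in> W" using Lp_const LW by blast
    moreover have "v - [:int p:] *s a - (monom 1 s - 1) *s b \<in> W" using ab L_sub_Lp LW by blast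
    ultimately have "v - [:int p:] *s a - (monom 1 s - 1) *s b + (monom 1 s - 1) *s b + [:int p:] *s a \<in> W"
      by (intro subspace_add[OF sub])
    then show "v \<in> W" by simp
  qed
  moreover have "s > 0" using kl(1) p by (simp add: s_def r_def prime_gt_0_nat)
  ultimately show ?thesis using that[of s] xW by (auto simp: s_def)
qed

text \<open>Modulo \<open>p\<close>, multiplication by \<open>f\<close> hides at most a bounded
  power of \<open>z = X^s0 - 1\<close>. At level \<open>s0 * p^k\<close> the polynomial
  \<open>X^s - 1\<close> is divisible by a higher power of \<open>z\<close> modulo \<open>p\<close>,
  so vanishing of \<open>f v\<close> at that level forces vanishing of \<open>v\<close> at level
  \<open>s0\<close>.\<close>

lemma torsion_free_mod_prime:
  assumes p: "Factorial_Ring.prime p" and f: "\<not> [:int p:] dvd f" and v: "f *s v \<in> Lp (int p)"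
  shows "v \<in> Lp (int p)"
proof (rule ccontr)
  have pi: "Factorial_Ring.prime (int p)" using p by simp
  then have p1: "\<not> int p dvd 1" using prime_ge_2_int[OF pi] by (auto dest: zdvd_imp_le)
  assume "v \<notin> Lp (int p)"
  then obtain s0 where s0: "s0 > 0" "p dvd s0" "v \<notin> LJ (int p) s0" using separate_mod_prime[OF p] by blast
  obtain j w where jw: "monom 1 j *s (f *s v) - [:int p:] *s w \<in> L" using v unfolding Lp_def by blast
  define v1 where "v1 = monom 1 j *s v"
  have fv1: "f *s v1 \<in> LJ (int p) r" for r
  proof -
    have "f *s v1 - [:int p:] *s w \<in> LJ (int p) r" using L_sub_LJ[OF jw] by (simp add: v1_def mult.commute)
    then show ?thesis using LJ_cong[of "f *s v1" "[:int p:] *s w"] LJ_const by simp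
  qed
  define z where "z = monom 1 s0 - (1 :: int poly)"
  have nz: "\<not> [:int p:] dvd z" unfolding z_def by (rule not_const_dvd_cyclotomic[OF p1 s0(1)])
  obtain k where k: "\<And>N y u w. \<lbrakk>k < N; f * y = [:int p:] * u + z ^ N * w\<rbrakk> \<Longrightarrow> \<exists>a b. y = [:int p:] * a + z * b"
    by (rule cancel_mod_high_power[OF pi f nz]) (rule that, assumption)
  have kk: "k < 2 ^ k" by (rule less_exp)
  define s where "s = s0 * p ^ k"
  have s: "s > 0" "int p dvd int s" "s0 dvd s" using s0 p by (auto simp: s_def prime_gt_0_nat)
  obtain u0 w0 where uw: "monom 1 s - (1::int poly) = [:int p:] * u0 + z ^ (2 ^ k) * w0"
    using cyclotomic_deep_mod_p[of s0 p k] unfolding z_def s_def by blast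
  obtain \<psi> where
    2: "\<And>q r f v i. \<lbrakk>q dvd int s; r dvd s; i < n\<rbrakk> \<Longrightarrow> \<psi> (f *s v) i - f * \<psi> v i \<in> ideal2 q r" and
    4: "\<And>q r v. \<lbrakk>q dvd int s; r dvd s\<rbrakk> \<Longrightarrow> v \<in> LJ q r \<longleftrightarrow> (\<forall>i<n. \<psi> v i \<in> ideal2 q r)"
    using quotE[OF s(1)] by metis
  have "\<psi> v1 i \<in> ideal2 (int p) s0" if i: "i < n" for i
  proof -
    have "f * \<psi> v1 i \<in> ideal2 (int p) s"
      using 4[OF s(2) dvd_refl] fv1 ideal2_cong[OF 2[OF s(2) dvd_refl i]] i by blast
    then obtain a b where "f * \<psi> v1 i = [:int p:] * a + (monom 1 s - 1) * b" by (rule ideal2E)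
    then have "f * \<psi> v1 i = [:int p:] * (a + u0 * b) + z ^ (2 ^ k) * (w0 * b)"
      by (simp only: uw algebra_simps)
    then obtain a b where "\<psi> v1 i = [:int p:] * a + z * b" using k[OF kk] by blast
    then show ?thesis unfolding z_def by (rule ideal2I)
  qed
  then have "v1 \<in> LJ (int p) s0" using 4[OF s(2,3)] by blast
  then show False using LJ_sat[OF s0(1)] s0(3) by (auto simp: v1_def)
qed

text \<open>Reductions modulo primes have no torsion for \<open>P\<close>, so \<open>P v = 0\<close>
  makes \<open>v\<close> divisible by any prime, and the quotient of \<open>v\<close> by this prime
  is again killed by \<open>P\<close>. Iterating, \<open>v\<close> is divisible by every integer and
  therefore vanishes at every level.\<close>

lemma primitive_torsion_free:
  assumes P: "\<And>p. Factorial_Ring.prime p \<Longrightarrow> \<not> [:int p:] dvd P" and v: "P *s v \<in> L"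
  shows "v \<in> L"
proof -
  have div: "\<exists>k w. monom 1 k *s v - [:int m:] *s w \<in> L \<and> P *s w \<in> L" if "m > 0" for m :: nat
    using that
  proof (induction m rule: less_induct)
    case (less m)
    show ?case
    proof (cases "m = 1")
      case True
      have "monom 1 0 *s v - [:int m:] *s v = 0" by (simp add: True monom_0)
      then show ?thesis using v L_0 by metis
    next
      case False
      then obtain p m' where p: "Factorial_Ring.prime p" and m: "m = p * m'"
        by (metis prime_factor_nat dvd_def)
      have "m' > 0" "m' < m" using m less.prems p prime_ge_2_nat[OF p] by (auto intro!: Nat.gr0I)
      then obtain k w where kw: "monom 1 k *s v - [:int m':] *s w \<in> L" "P *s w \<in> L" using less.IH by blast
      have "w \<in> Lp (int p)" using torsion_free_mod_prime[OF p P[OF p]] L_sub_Lp[OF kw(2)] by blast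
      then obtain k' w' where kw': "monom 1 k' *s w - [:int p:] *s w' \<in> L" unfolding Lp_def by blast
      have "monom 1 k' *s (monom 1 k *s v - [:int m':] *s w) + [:int m':] *s (monom 1 k' *s w - [:int p:] *s w') \<in> L"
        by (intro L_add L_scale kw kw')
      moreover have "monom 1 k' *s (monom 1 k *s v - [:int m':] *s w) + [:int m':] *s (monom 1 k' *s w - [:int p:] *s w')
         = monom 1 (k + k') *s v - [:int m:] *s w'"
        by (simp add: scale_right_diff_distrib mult_monom add.commute m mult.commute)
      moreover have "P *s w' \<in> L"
      proof (rule prime_torsion_free)
        show "Factorial_Ring.prime (int p)" using p by simp
        have "monom 1 k' *s (P *s w) - P *s (monom 1 k' *s w - [:int p:] *s w') \<in> L"
          by (intro L_diff L_scale kw' kw)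
        then show "[:int p:] *s (P *s w') \<in> L" by (simp add: scale_right_diff_distrib mult.commute)
      qed
      ultimately show ?thesis by auto
    qed
  qed
  show ?thesis
  proof (rule cap)
    fix s :: nat assume s: "s > 0"
    obtain k w where "monom 1 k *s v - [:int s:] *s w \<in> L" using div[OF s] by blast
    then have "monom 1 k *s v \<in> LJ (int s) s" using LJ_cong[of "monom 1 k *s v" "[:int s:] *s w"] L_sub_LJ LJ_const by simp
    then show "v \<in> LJ (int s) s" by (rule LJ_sat[OF s])
  qed
qed

lemma torsion_free:
  assumes P: "P \<noteq> 0" and v: "P *s v \<in> L" shows "v \<in> L"
proof -
  have c: "content P \<noteq> 0" "[:content P:] * primitive_part P = P" using P by auto
  have "[:content P:] *s (primitive_part P *s v) \<in> L" using v c(2) by (simp only: scale_scale)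
  then have "primitive_part P *s v \<in> L" by (rule int_torsion_free[OF c(1)])
  moreover have "\<not> [:int p:] dvd primitive_part P" if "Factorial_Ring.prime p" for p
  proof
    assume "[:int p:] dvd primitive_part P"
    then have "int p dvd content (primitive_part P)" by (simp only: const_poly_dvd_iff_dvd_content)
    then show False using P that by simp
  qed
  ultimately show ?thesis by (rule primitive_torsion_free[rotated])
qed

end

section \<open>Bases up to an integer denominator, and their rank\<close>

lemma degree_less_if_top_0:
  assumes "degree h \<le> degree f" "coeff h (degree f) = 0" "h \<noteq> 0"
  shows "degree h < degree f"
  using assms by (metis le_neq_implies_less leading_coeff_0_iff)

lemma ideal2_1_iff: "f \<in> ideal2 q 1 \<longleftrightarrow> q dvd poly f 1"
proof
  assume "f \<in> ideal2 q 1"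
  then obtain a b where "f = [:q:] * a + (monom 1 1 - 1) * b" by (rule ideal2E)
  then show "q dvd poly f 1" by (simp add: poly_monom)
next
  assume "q dvd poly f 1"
  then obtain c where c: "poly f 1 = q * c" by auto
  have "poly (f - [:poly f 1:]) 1 = 0" by simp
  then obtain b where b: "f - [:poly f 1:] = [:-1, 1:] * b" by (simp only: poly_eq_0_iff_dvd dvd_def) blast
  have m: "monom 1 1 - (1::int poly) = [:-1, 1:]" by (simp add: monom_altdef one_pCons)
  have "f = [:poly f 1:] + [:-1, 1:] * b" using b by (simp only: diff_eq_eq add.commute)
  also have "[:poly f 1:] = [:q:] * [:c:]" by (simp add: c)
  finally show "f \<in> ideal2 q 1" unfolding m[symmetric] by (rule ideal2I)
qed

context lattice_data
begin

definition combo :: "nat set \<Rightarrow> (nat \<Rightarrow> int poly) \<Rightarrow> (nat \<Rightarrow> 'v) \<Rightarrow> 'v"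
  where "combo I f x = (\<Sum>i\<in>I. f i *s x i)"

definition indep :: "nat set \<Rightarrow> (nat \<Rightarrow> 'v) \<Rightarrow> bool"
  where "indep I x \<longleftrightarrow> (\<forall>f. combo I f x \<in> L \<longrightarrow> (\<forall>i\<in>I. f i = 0))"

text \<open>\<open>d\<close> is a common denominator: the family spans after \<open>X\<close> and
  \<open>d\<close> are inverted. Seshadri's argument starts from such a family and removes the
  primes of \<open>d\<close> one at a time.\<close>

definition gen :: "nat set \<Rightarrow> (nat \<Rightarrow> 'v) \<Rightarrow> int \<Rightarrow> bool"
  where "gen I x d \<longleftrightarrow> (\<forall>v. \<exists>k f. (monom 1 k * [:d:]) *s v - combo I f x \<in> L)"

lemma combo_add: "combo I (\<lambda>i. f i + g i) x = combo I f x + combo I g x"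
  by (simp add: combo_def scale_left_distrib sum.distrib)

lemma combo_diff: "combo I (\<lambda>i. f i - g i) x = combo I f x - combo I g x"
  by (simp add: combo_def scale_left_diff_distrib sum_subtractf)

lemma combo_scale: "combo I (\<lambda>i. c * f i) x = c *s combo I f x"
  by (simp add: combo_def scale_sum_right)

lemma combo_cong: "(\<And>i. i \<in> I \<Longrightarrow> f i = g i) \<Longrightarrow> (\<And>i. i \<in> I \<Longrightarrow> x i = y i) \<Longrightarrow> combo I f x = combo I g y"
  by (simp add: combo_def)

lemma combo_remove: "finite I \<Longrightarrow> i \<in> I \<Longrightarrow> combo I f x = f i *s x i + combo (I - {i}) f x"
  by (simp add: combo_def sum.remove)

lemma combo_single:
  assumes "finite I" "i \<in> I" "\<And>j. j \<in> I \<Longrightarrow> j \<noteq> i \<Longrightarrow> f j = 0" shows "combo I f x = f i *s x i"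
  using assms by (simp add: combo_remove[of I i]) (simp add: combo_def)

lemma combo_elem:
  assumes I: "finite I" "i \<in> I" "j \<in> I" "i \<noteq> j"
  shows "combo I g (x(j := c *s x j + q *s x i)) = combo I (g(j := g j * c, i := g i + g j * q)) x"
proof -
  have split: "combo I f y = f j *s y j + (f i *s y i + combo (I - {j} - {i}) f y)" for f y
    using I by (simp add: combo_remove[of I j] combo_remove[of "I - {j}" i])
  have rest: "combo (I - {j} - {i}) g (x(j := c *s x j + q *s x i)) = combo (I - {j} - {i}) (g(j := g j * c, i := g i + g j * q)) x"
    by (rule combo_cong) auto
  show ?thesis unfolding split rest using I(4) by (simp add: scale_right_distrib scale_left_distrib)
qed

text \<open>The elementary step of Euclid's algorithm on coefficient vectors: changing the generator
  \<open>x j\<close> changes the coefficient at \<open>i\<close> to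
  \<open>c * g i - q * g j\<close>. The factor \<open>c\<close> makes room for pseudo-division over
  \<open>Z[X]\<close>.\<close>

lemma combo_elem_scaled:
  assumes I: "finite I" "i \<in> I" "j \<in> I" "i \<noteq> j"
  shows "combo I ((\<lambda>l. c * g l)(i := c * g i - q * g j, j := g j)) (x(j := c *s x j + q *s x i)) = c *s combo I g x"
proof -
  have "combo I ((\<lambda>l. c * g l)(i := c * g i - q * g j, j := g j)) (x(j := c *s x j + q *s x i)) = combo I (\<lambda>l. c * g l) x"
    unfolding combo_elem[OF I] by (rule combo_cong) (use I(4) in \<open>auto simp: mult.commute\<close>)
  then show ?thesis by (simp only: combo_scale)
qed

lemma gen_elem:
  assumes I: "finite I" "i \<in> I" "j \<in> I" "i \<noteq> j" and g: "gen I x d"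
  shows "gen I (x(j := [:c:] *s x j + q *s x i)) (d * c)"
  unfolding gen_def
proof
  fix v
  obtain k f where "(monom 1 k * [:d:]) *s v - combo I f x \<in> L" using g unfolding gen_def by blast
  then have "[:c:] *s ((monom 1 k * [:d:]) *s v - combo I f x) \<in> L" by (rule L_scale)
  moreover have "[:c:] *s ((monom 1 k * [:d:]) *s v - combo I f x) = (monom 1 k * [:d * c:]) *s v - [:c:] *s combo I f x"
    by (simp add: scale_right_diff_distrib mult_ac)
  ultimately show "\<exists>k f. (monom 1 k * [:d * c:]) *s v - combo I f (x(j := [:c:] *s x j + q *s x i)) \<in> L"
    unfolding combo_elem_scaled[OF I, of "[:c:]" f q x, symmetric] by metis
qed

lemma indep_elem:
  assumes I: "finite I" "i \<in> I" "j \<in> I" "i \<noteq> j" and g: "indep I x"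
  shows "indep I (x(j := x j + q *s x i))"
  unfolding indep_def
proof (intro allI impI ballI)
  fix f l assume f: "combo I f (x(j := x j + q *s x i)) \<in> L" and l: "l \<in> I"
  have "combo I (f(j := f j * 1, i := f i + f j * q)) x \<in> L"
    using f combo_elem[OF I, of f x 1 q] by simp
  then have 0: "\<forall>l\<in>I. (f(j := f j * 1, i := f i + f j * q)) l = 0" using g unfolding indep_def by blast
  have "f j = 0" using bspec[OF 0 I(3)] I(4) by (simp split: if_splits)
  moreover have "f i + f j * q = 0" using bspec[OF 0 I(2)] by simp
  ultimately show "f l = 0" using bspec[OF 0 l] by (auto split: if_splits)
qed

end

text \<open>Termination measure of Euclid's algorithm on a coefficient vector; with
  \<open>Suc\<close> the step from a nonzero constant to 0 also counts as progress.\<close>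

definition psize :: "nat set \<Rightarrow> (nat \<Rightarrow> int poly) \<Rightarrow> nat"
  where "psize I f = (\<Sum>i\<in>I. if f i = 0 then 0 else Suc (degree (f i)))"

lemma psize_less:
  assumes "finite I" "i \<in> I" "\<And>l. l \<in> I \<Longrightarrow> l \<noteq> i \<Longrightarrow> (f l = 0 \<longleftrightarrow> g l = 0) \<and> degree (f l) = degree (g l)"
    "g i \<noteq> 0" "f i = 0 \<or> degree (f i) < degree (g i)"
  shows "psize I f < psize I g"
proof -
  have "(\<Sum>i\<in>I - {i}. if f i = 0 then 0 else Suc (degree (f i))) = (\<Sum>i\<in>I - {i}. if g i = 0 then 0 else Suc (degree (g i)))"
    by (rule sum.cong) (use assms(3) in auto)
  moreover have "(if f i = 0 then 0 else Suc (degree (f i))) < (if g i = 0 then 0 else Suc (degree (g i)))"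
    using assms(4,5) by auto
  ultimately show ?thesis
    unfolding psize_def using assms(1,2) by (simp only: sum.remove)
qed

context profree_data
begin

text \<open>A generating family of least size is independent. Pseudo-division shortens a relation
  until a single term \<open>f i x i\<close> is left; by torsion-freeness \<open>x i\<close> lies in
  \<open>L\<close> and could be dropped. The factors that enter the denominator are leading
  coefficients, hence integers.\<close>

lemma rational_basis: "\<exists>I x d. finite I \<and> d \<noteq> 0 \<and> gen I x d \<and> indep I x"
proof -
  define P where "P m \<longleftrightarrow> (\<exists>I x d. finite I \<and> card I = m \<and> d \<noteq> 0 \<and> gen I x d)" for m
  obtain h where h: "bij_betw h {0..<card S} S" using ex_bij_betw_nat_finite[OF finS] by blast
  have "gen {0..<card S} h 1"
    unfolding gen_def
  proof
    fix v
    obtain k f where kf: "monom 1 k *s v - (\<Sum>x\<in>S. f x *s x) \<in> L" using gens by blast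
    have "(\<Sum>x\<in>S. f x *s x) = combo {0..<card S} (\<lambda>i. f (h i)) h"
      unfolding combo_def by (rule sum.reindex_bij_betw[OF h, symmetric])
    then have "(monom 1 k * [:1:]) *s v - combo {0..<card S} (\<lambda>i. f (h i)) h \<in> L" using kf by simp
    then show "\<exists>k f. (monom 1 k * [:1:]) *s v - combo {0..<card S} f h \<in> L" by blast
  qed
  then have "P (card S)" unfolding P_def by (intro exI[of _ "{0..<card S}"] exI[of _ h] exI[of _ 1]) auto
  then have PL: "P (LEAST m. P m)" by (rule LeastI)
  then obtain I x d where I: "finite I" "card I = (LEAST m. P m)" "d \<noteq> 0" "gen I x d" unfolding P_def by blast
  have "\<forall>i\<in>I. f i = 0" if "gen I x d" "d \<noteq> 0" "combo I f x \<in> L" for x d f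
    using that
  proof (induction "psize I f" arbitrary: x d f rule: less_induct)
    case less
    show ?case
    proof (cases "\<exists>i\<in>I. \<exists>j\<in>I. i \<noteq> j \<and> f i \<noteq> 0 \<and> f j \<noteq> 0")
      case True
      then obtain i j where ij: "i \<in> I" "j \<in> I" "i \<noteq> j" "f i \<noteq> 0" "f j \<noteq> 0" "degree (f j) \<le> degree (f i)"
        by (metis nle_le)
      define c where "c = lead_coeff (f j)"
      define q where "q = monom (lead_coeff (f i)) (degree (f i) - degree (f j))"
      define x' where "x' = x(j := [:c:] *s x j + q *s x i)"
      define f' where "f' = (\<lambda>l. [:c:] * f l)(i := [:c:] * f i - q * f j, j := f j)"
      have c0: "c \<noteq> 0" using ij by (simp add: c_def)
      have "combo I f' x' = [:c:] *s combo I f x"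
        unfolding x'_def f'_def by (rule combo_elem_scaled[OF I(1) ij(1-3)])
      then have "combo I f' x' \<in> L" using less.prems L_scale by simp
      moreover have "gen I x' (d * c)" unfolding x'_def by (rule gen_elem[OF I(1) ij(1-3) less.prems(1)])
      moreover have "psize I f' < psize I f"
      proof (rule psize_less[OF I(1) ij(1)])
        show "(f' l = 0 \<longleftrightarrow> f l = 0) \<and> degree (f' l) = degree (f l)" if "l \<in> I" "l \<noteq> i" for l
          using that c0 by (auto simp: f'_def)
        have fi: "f' i = [:c:] * f i - q * f j" using ij by (simp add: f'_def)
        have dq: "degree (q * f j) = degree (f i)"
          using ij by (simp add: q_def degree_mult_eq degree_monom_eq)
        have top: "coeff (f' i) (degree (f i)) = 0"
          using ij by (simp add: fi q_def coeff_monom_mult c_def)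
        have "degree (f' i) \<le> degree (f i)"
          unfolding fi by (rule degree_diff_le) (use dq in auto)
        then show "f' i = 0 \<or> degree (f' i) < degree (f i)" using degree_less_if_top_0 top by blast
      qed (use ij in auto)
      ultimately have "\<forall>i\<in>I. f' i = 0" using less.hyps[of f' x' "d * c"] less.prems c0 by simp
      then have "f' j = 0" using ij by blast
      then show ?thesis using ij by (simp add: f'_def)
    next
      case False
      show ?thesis
      proof (rule ccontr)
        assume "\<not> ?thesis"
        then obtain i where i: "i \<in> I" "f i \<noteq> 0" by blast
        have "combo I f x = f i *s x i" by (rule combo_single[OF I(1) i(1)]) (use False i in blast)
        then have xi: "x i \<in> L" using less.prems torsion_free[OF i(2)] by simp
        have "gen (I - {i}) x d"
          unfolding gen_def
        proof
          fix v
          obtain k g where "(monom 1 k * [:d:]) *s v - combo I g x \<in> L" using less.prems unfolding gen_def by blast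
          then have "(monom 1 k * [:d:]) *s v - combo I g x + g i *s x i \<in> L" by (rule L_add[OF _ L_scale[OF xi]])
          then have "(monom 1 k * [:d:]) *s v - combo (I - {i}) g x \<in> L"
            by (simp add: combo_remove[OF I(1) i(1)])
          then show "\<exists>k f. (monom 1 k * [:d:]) *s v - combo (I - {i}) f x \<in> L" by blast
        qed
        then have "P (card (I - {i}))" unfolding P_def using I(1) less.prems by (intro exI[of _ "I - {i}"]) auto
        then have "(LEAST m. P m) \<le> card (I - {i})" by (rule Least_le)
        then show False using I i by (metis card_Diff1_less linorder_not_less)
      qed
    qed
  qed
  then have "indep I x" using I unfolding indep_def by blast
  then show ?thesis using I by blast
qed

text \<open>Both ranks are counted modulo \<open>q\<close> and \<open>X - 1\<close>, for a prime
  \<open>q\<close> above the absolute value of \<open>d\<close>, so that the denominator is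
  invertible: \<open>V / LJ q 1\<close> has \<open>q ^ n\<close> elements by \<open>\<psi>\<close>
  and \<open>q ^ card I\<close> elements by the basis.\<close>

lemma rank_eq:
  assumes I: "finite I" "d \<noteq> 0" "gen I x d" "indep I x"
  shows "card I = n"
proof -
  obtain q where q: "Factorial_Ring.prime q" "q > nat \<bar>d\<bar>" using bigger_prime by blast
  define Q where "Q = int q"
  have q0: "q > 0" using q by (simp add: prime_gt_0_nat)
  have Q0: "Q > 0" using q0 by (simp add: Q_def)
  have cop: "coprime d Q"
  proof -
    have "\<not> Q dvd d" using q I(2) zdvd_imp_le[of Q "\<bar>d\<bar>"] by (auto simp: Q_def)
    moreover have "Factorial_Ring.prime Q" using q by (simp add: Q_def)
    ultimately show ?thesis using prime_imp_coprime coprime_commute by blast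
  qed
  obtain d' where d': "[d * d' = 1] (mod Q)" using cong_solve_coprime_int[OF cop] by blast
  obtain \<psi> where
    a1: "\<And>q' r u v i. \<lbrakk>q' dvd int q; r dvd q; i < n\<rbrakk> \<Longrightarrow> \<psi> (u + v) i - (\<psi> u i + \<psi> v i) \<in> ideal2 q' r" and
    a2: "\<And>q' r f v i. \<lbrakk>q' dvd int q; r dvd q; i < n\<rbrakk> \<Longrightarrow> \<psi> (f *s v) i - f * \<psi> v i \<in> ideal2 q' r" and
    a3: "\<And>y. \<exists>v. \<forall>i<n. \<psi> v i - y i \<in> ideal2 (int q) q" and
    a4: "\<And>q' r v. \<lbrakk>q' dvd int q; r dvd q\<rbrakk> \<Longrightarrow> v \<in> LJ q' r \<longleftrightarrow> (\<forall>i<n. \<psi> v i \<in> ideal2 q' r)"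
    by (rule quotE[OF q0]) (rule that; assumption)
  have QQ: "Q dvd int q" by (simp add: Q_def)
  note 1 = a1[OF QQ one_dvd] and 2 = a2[OF QQ one_dvd] and 3 = a3[folded Q_def] and 4 = a4[OF QQ one_dvd]
  define t where "t v i = poly (\<psi> v i) 1" for v i
  have t1: "[t (u + v) i = t u i + t v i] (mod Q)" if "i < n" for u v i
    using iffD1[OF ideal2_1_iff 1[OF that, of u v]] by (simp only: poly_diff poly_add t_def cong_iff_dvd_diff)
  have t2: "[t (f *s v) i = poly f 1 * t v i] (mod Q)" if "i < n" for f v i
    using iffD1[OF ideal2_1_iff 2[OF that, of f v]] by (simp only: poly_diff poly_mult t_def cong_iff_dvd_diff)
  have t4: "v \<in> LJ Q 1 \<longleftrightarrow> (\<forall>i<n. [t v i = 0] (mod Q))" for v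
    by (simp only: 4 ideal2_1_iff t_def cong_0_iff)
  have t5: "[t u i = t v i] (mod Q)" if "u - v \<in> LJ Q 1" "i < n" for u v i
  proof -
    have "[t (u - v) i + t v i = 0 + t v i] (mod Q)" using t4[of "u - v"] that by (intro cong_add) auto
    then show ?thesis using cong_trans[OF t1[OF that(2), of "u - v" v]] by simp
  qed
  have t6: "u - v \<in> LJ Q 1" if "\<And>i. i < n \<Longrightarrow> [t u i = t v i] (mod Q)" for u v
    unfolding t4
  proof (intro allI impI)
    fix i assume i: "i < n"
    have "[t (u - v) i + t v i = t v i] (mod Q)"
      using t1[OF i, of "u - v" v] that[OF i] by (metis cong_sym cong_trans diff_add_cancel)
    then show "[t (u - v) i = 0] (mod Q)" by (simp add: cong_iff_dvd_diff)
  qed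
  define E where "E = (\<lambda>e. combo I (\<lambda>i. [:e i:]) x)"
  define \<Theta> where "\<Theta> e = (\<lambda>i\<in>{..<n}. t (E e) i mod Q)" for e
  have "bij_betw \<Theta> (PiE I (\<lambda>_. {0..<Q})) (PiE {..<n} (\<lambda>_. {0..<Q}))"
    unfolding bij_betw_def
  proof
    show "inj_on \<Theta> (PiE I (\<lambda>_. {0..<Q}))"
    proof (rule inj_onI)
      fix e e' assume ee: "e \<in> PiE I (\<lambda>_. {0..<Q})" "e' \<in> PiE I (\<lambda>_. {0..<Q})" "\<Theta> e = \<Theta> e'"
      have "[t (E e) i = t (E e') i] (mod Q)" if "i < n" for i
        using fun_cong[OF ee(3), of i] that by (simp add: \<Theta>_def cong_def)
      then have "E e - E e' \<in> LJ Q 1" by (rule t6)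
      then obtain a b where ab: "E e - E e' - [:Q:] *s a - (monom 1 1 - 1) *s b \<in> L" unfolding LJ_def by blast
      obtain k f where kf: "(monom 1 k * [:d:]) *s a - combo I f x \<in> L" using I(3) unfolding gen_def by blast
      obtain l g where lg: "(monom 1 l * [:d:]) *s b - combo I g x \<in> L" using I(3) unfolding gen_def by blast
      \<comment> \<open>Multiplying the congruence by \<open>d\<close> and a power of
        \<open>X\<close> and expanding \<open>a\<close> and \<open>b\<close> in the basis gives an
        exact relation with coefficients \<open>F i\<close>. Independence makes them 0, and at
        \<open>X = 1\<close> the term with \<open>X - 1\<close> disappears.\<close>
      define F where "F i = (monom 1 k * monom 1 l * [:d:]) * [:e i - e' i:]
          - ([:Q:] * monom 1 l * f i + (monom 1 1 - 1) * monom 1 k * g i)" for i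
      have EE: "E e - E e' = combo I (\<lambda>i. [:e i - e' i:]) x"
        unfolding E_def combo_diff[symmetric] by simp
      have "(monom 1 k * monom 1 l * [:d:]) *s (E e - E e' - [:Q:] *s a - (monom 1 1 - 1) *s b)
        + ([:Q:] * monom 1 l) *s ((monom 1 k * [:d:]) *s a - combo I f x)
        + ((monom 1 1 - 1) * monom 1 k) *s ((monom 1 l * [:d:]) *s b - combo I g x) \<in> L"
        by (intro L_add L_scale ab kf lg)
      also have "(monom 1 k * monom 1 l * [:d:]) *s (E e - E e' - [:Q:] *s a - (monom 1 1 - 1) *s b)
        + ([:Q:] * monom 1 l) *s ((monom 1 k * [:d:]) *s a - combo I f x)
        + ((monom 1 1 - 1) * monom 1 k) *s ((monom 1 l * [:d:]) *s b - combo I g x)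
        = (monom 1 k * monom 1 l * [:d:]) *s (E e - E e') - ([:Q:] * monom 1 l) *s combo I f x - ((monom 1 1 - 1) * monom 1 k) *s combo I g x"
        by (simp add: scale_right_diff_distrib mult_ac del: mult_pCons_left mult_pCons_right)
      also have "\<dots> = combo I F x"
        unfolding F_def combo_diff combo_add combo_scale EE by simp
      finally have F0: "F i = 0" if "i \<in> I" for i using I(4) that unfolding indep_def by blast
      show "e = e'"
      proof (rule PiE_ext[OF ee(1,2)])
        fix i assume i: "i \<in> I"
        have "poly (F i) 1 = 0" by (simp only: F0[OF i] poly_0)
        then have "d * (e i - e' i) = Q * poly (f i) 1" by (simp add: F_def poly_monom mult.commute)
        then have "Q dvd d * (e i - e' i)" by simp
        then have "Q dvd e i - e' i" using cop by (simp add: coprime_commute coprime_dvd_mult_right_iff)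
        moreover have "e i \<in> {0..<Q}" "e' i \<in> {0..<Q}" using ee i by auto
        ultimately show "e i = e' i"
          by (metis atLeastLessThan_iff mod_eq_dvd_iff mod_pos_pos_trivial)
      qed
    qed
    show "\<Theta> ` (PiE I (\<lambda>_. {0..<Q})) = PiE {..<n} (\<lambda>_. {0..<Q})"
    proof (intro equalityI subsetI)
      fix y assume "y \<in> \<Theta> ` (PiE I (\<lambda>_. {0..<Q}))"
      then show "y \<in> PiE {..<n} (\<lambda>_. {0..<Q})" using Q0 by (auto simp: \<Theta>_def)
    next
      fix y assume y: "y \<in> PiE {..<n} (\<lambda>_. {0..<Q})"
      \<comment> \<open>The coordinates of \<open>v\<close> carry the inverse \<open>d'\<close> of
        \<open>d\<close> modulo \<open>q\<close>, which undoes the denominator introduced by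
        \<open>gen\<close>.\<close>
      obtain v where v: "\<And>i. i < n \<Longrightarrow> \<psi> v i - [:d' * y i:] \<in> ideal2 Q q" using 3[of "\<lambda>i. [:d' * y i:]"] by blast
      obtain k f where kf: "(monom 1 k * [:d:]) *s v - combo I f x \<in> L" using I(3) unfolding gen_def by blast
      define e where "e = (\<lambda>i\<in>I. poly (f i) 1 mod Q)"
      have e: "e \<in> PiE I (\<lambda>_. {0..<Q})" using Q0 by (auto simp: e_def)
      have "combo I (\<lambda>i. f i - [:e i:]) x \<in> LJ Q 1"
        unfolding combo_def
        by (intro subspace_sum[OF subspace_LJ] ideal2_scale_LJ)
           (auto simp: ideal2_1_iff[unfolded One_nat_def] e_def)
      then have 5: "combo I f x - E e \<in> LJ Q 1" by (simp only: combo_diff E_def)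
      have "(monom 1 k * [:d:] - [:d:]) *s v \<in> LJ Q 1"
        by (intro ideal2_scale_LJ) (simp add: ideal2_1_iff[unfolded One_nat_def] poly_monom)
      then have 6: "(monom 1 k * [:d:]) *s v - [:d:] *s v \<in> LJ Q 1" by (simp only: scale_left_diff_distrib)
      have "[t (E e) i = y i] (mod Q)" if i: "i < n" for i
      proof -
        have "[t (E e) i = t (combo I f x) i] (mod Q)" using t5[OF 5 i] by (rule cong_sym)
        also have "[t (combo I f x) i = t ((monom 1 k * [:d:]) *s v) i] (mod Q)"
          using t5[OF L_sub_LJ[OF kf] i] by (rule cong_sym)
        also have "[t ((monom 1 k * [:d:]) *s v) i = t ([:d:] *s v) i] (mod Q)" by (rule t5[OF 6 i])
        also have "[t ([:d:] *s v) i = d * t v i] (mod Q)" using t2[OF i, of "[:d:]" v] by simp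
        also have "[d * t v i = d * (d' * y i)] (mod Q)"
        proof (rule cong_scalar_left)
          have "\<psi> v i - [:d' * y i:] \<in> ideal2 Q 1" using ideal2_mono[OF dvd_refl one_dvd v[OF i]] .
          then show "[t v i = d' * y i] (mod Q)" by (simp only: ideal2_1_iff t_def cong_iff_dvd_diff poly_diff) simp
        qed
        also have "[d * (d' * y i) = y i] (mod Q)"
          using cong_scalar_right[OF d', of "y i"] by (simp add: mult.assoc)
        finally show ?thesis .
      qed
      then have "t (E e) i mod Q = y i" if "i < n" for i
        using y that by (auto simp: cong_def PiE_iff)
      then have "\<Theta> e = y" using y by (auto simp: \<Theta>_def fun_eq_iff PiE_iff extensional_def)
      then show "y \<in> \<Theta> ` (PiE I (\<lambda>_. {0..<Q}))" using e by blast
    qed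
  qed
  then have "card (PiE I (\<lambda>_. {0..<Q})) = card (PiE {..<n} (\<lambda>_. {0..<Q}))" by (rule bij_betw_same_card)
  then have "q ^ card I = q ^ n" using I(1) by (simp add: card_PiE Q_def)
  moreover have "q > 1" using q prime_gt_1_nat by blast
  ultimately show ?thesis by simp
qed

end

section \<open>Seshadri's argument: removing the denominator\<close>

context profree_data
begin

text \<open>\<open>H\<close> stands for a largest set of members that a change of basis can make
  divisible by \<open>p\<close>; then the other members are independent modulo \<open>p\<close>.
  Euclid's algorithm in \<open>F_p[X]\<close> reduces a relation modulo \<open>p\<close> to a single
  term, and torsion-freeness modulo \<open>p\<close> would turn that term into one more divisible
  member.\<close>

lemma seshadri_pure:
  assumes p: "Factorial_Ring.prime p" and I: "finite I"
    and max: "\<And>y j. \<lbrakk>gen I y d; indep I y; \<forall>i\<in>H. y i \<in> Lp (int p); j \<in> I - H\<rbrakk> \<Longrightarrow> y j \<notin> Lp (int p)"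
    and x: "gen I x d" "indep I x" "\<forall>i\<in>H. x i \<in> Lp (int p)" "combo (I - H) f x \<in> Lp (int p)"
  shows "\<forall>i\<in>I - H. [:int p:] dvd f i"
  using x
proof (induction "psize (I - H) f" arbitrary: x f rule: less_induct)
  case less
  define K where "K = I - H"
  have K: "finite K" using I by (simp add: K_def)
  have fK: "combo K f x \<in> Lp (int p)" using less.prems by (simp add: K_def)
  have IH: "\<forall>i\<in>K. [:int p:] dvd g i" if "psize K g < psize K f" "gen I y d" "indep I y" "\<forall>i\<in>H. y i \<in> Lp (int p)" "combo K g y \<in> Lp (int p)" for g y
    using less.hyps[of g y] that unfolding K_def by blast
  have pp: "Factorial_Ring.prime (int p)" using p by simp
  have sub: "u \<in> Lp (int p) \<Longrightarrow> v \<in> Lp (int p) \<Longrightarrow> u - v \<in> Lp (int p)" for u v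
    by (rule subspace_diff[OF subspace_Lp])
  have upd: "combo K (f(i := f i - h)) y = combo K f y - h *s y i" if "i \<in> K" for i h y
  proof -
    have "combo (K - {i}) (f(i := f i - h)) y = combo (K - {i}) f y" by (rule combo_cong) auto
    then show ?thesis using that by (simp add: combo_remove[OF K] scale_left_diff_distrib)
  qed
  have "\<forall>i\<in>K. [:int p:] dvd f i"
  proof (rule ccontr)
    assume "\<not> ?thesis"
    then obtain i0 where i0: "i0 \<in> K" "\<not> [:int p:] dvd f i0" by blast
    show False
    proof (cases "\<exists>i\<in>K. f i \<noteq> 0 \<and> int p dvd lead_coeff (f i)")
      case True
      then obtain i where i: "i \<in> K" "f i \<noteq> 0" "int p dvd lead_coeff (f i)" by blast
      \<comment> \<open>A leading term divisible by \<open>p\<close> can be discarded. Once no such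
        term is left, the leading coefficients are units modulo \<open>p\<close>.\<close>
      define h where "h = monom (lead_coeff (f i)) (degree (f i))"
      have ph: "[:int p:] dvd h" using i(3) by (auto simp: h_def const_poly_dvd_iff)
      have "psize K (f(i := f i - h)) < psize K f"
      proof (rule psize_less[OF K i(1)])
        have "degree (f i - h) \<le> degree (f i)" by (rule degree_diff_le) (auto simp: h_def degree_monom_le)
        moreover have "coeff (f i - h) (degree (f i)) = 0" by (simp add: h_def)
        ultimately show "(f(i := f i - h)) i = 0 \<or> degree ((f(i := f i - h)) i) < degree (f i)"
          using degree_less_if_top_0[of "f i - h" "f i"] by auto
      qed (use i in auto)
      moreover have "combo K (f(i := f i - h)) x \<in> Lp (int p)"
        unfolding upd[OF i(1)] by (intro sub fK Lp_dvd ph)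
      ultimately have "\<forall>l\<in>K. [:int p:] dvd (f(i := f i - h)) l" using IH less.prems by blast
      then have "[:int p:] dvd f i0" using i0 ph by (metis diff_add_cancel dvd_add fun_upd_other fun_upd_same)
      then show False using i0 by blast
    next
      case F1: False
      show False
      proof (cases "\<exists>i\<in>K. \<exists>j\<in>K. i \<noteq> j \<and> f i \<noteq> 0 \<and> f j \<noteq> 0")
        case True
        then obtain i j where ij: "i \<in> K" "j \<in> K" "i \<noteq> j" "f i \<noteq> 0" "f j \<noteq> 0" "degree (f j) \<le> degree (f i)"
          by (metis nle_le)
        have ijI: "i \<in> I" "j \<in> I" "j \<notin> H" using ij by (auto simp: K_def)
        have "\<not> int p dvd lead_coeff (f j)" using F1 ij by blast
        then have "coprime (lead_coeff (f j)) (int p)" using prime_imp_coprime[OF pp] coprime_commute by blast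
        then obtain c where "[lead_coeff (f j) * c = 1] (mod int p)" using cong_solve_coprime_int by blast
        then have c: "int p dvd 1 - lead_coeff (f j) * c" by (metis cong_iff_dvd_diff cong_sym)
        define q where "q = monom (lead_coeff (f i) * c) (degree (f i) - degree (f j))"
        \<comment> \<open>As \<open>c\<close> inverts the leading coefficient only modulo
          \<open>p\<close>, the cancellation leaves this leading term, which is divisible by
          \<open>p\<close> and is discarded as well.\<close>
        define h where "h = monom (lead_coeff (f i) * (1 - lead_coeff (f j) * c)) (degree (f i))"
        define y where "y = x(j := x j + q *s x i)"
        define g where "g = f(i := f i - q * f j - h)"
        have ph: "[:int p:] dvd h" using c by (auto simp: h_def const_poly_dvd_iff)
        have "psize K g < psize K f"
        proof (rule psize_less[OF K ij(1)])
          have gi: "g i = f i - q * f j - h" by (simp add: g_def)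
          have "degree (q * f j) \<le> degree (f i)"
            using ij by (intro order.trans[OF degree_mult_le]) (auto simp: q_def intro!: order.trans[OF add_right_mono[OF degree_monom_le]])
          then have "degree (g i) \<le> degree (f i)"
            unfolding gi by (intro degree_diff_le) (auto simp: h_def degree_monom_le)
          moreover have "coeff (q * f j) (degree (f i)) = lead_coeff (f i) * c * lead_coeff (f j)"
            using ij by (simp add: q_def coeff_monom_mult)
          then have "coeff (g i) (degree (f i)) = 0"
            by (simp add: gi h_def algebra_simps)
          ultimately show "g i = 0 \<or> degree (g i) < degree (f i)"
            using degree_less_if_top_0 by blast
        qed (use ij in \<open>auto simp: g_def\<close>)
        moreover have "gen I y d" using gen_elem[OF I ijI(1,2) ij(3) less.prems(1), of 1 q]
          by (simp add: y_def flip: one_pCons)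
        moreover have "indep I y" unfolding y_def by (rule indep_elem[OF I ijI(1,2) ij(3) less.prems(2)])
        moreover have "\<forall>i\<in>H. y i \<in> Lp (int p)" using less.prems(3) ijI by (auto simp: y_def)
        moreover have "combo K g y \<in> Lp (int p)"
        proof -
          have "combo K g y = combo K (g(j := g j * 1, i := g i + g j * q)) x"
            using combo_elem[OF K ij(1-3), of g x 1 q] by (simp add: y_def)
          also have "\<dots> = combo K (f(i := f i - h)) x"
            by (rule combo_cong) (use ij(3) in \<open>auto simp: g_def algebra_simps\<close>)
          also have "\<dots> \<in> Lp (int p)" unfolding upd[OF ij(1)] by (intro sub fK Lp_dvd ph)
          finally show ?thesis .
        qed
        ultimately have "\<forall>l\<in>K. [:int p:] dvd g l" using IH by blast
        then have "[:int p:] dvd g j" using ij by blast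
        then have "[:int p:] dvd f j" using ij by (simp add: g_def)
        then have "int p dvd lead_coeff (f j)" by (simp only: const_poly_dvd_iff)
        then show False using F1 ij by blast
      next
        case False
        have i0': "f i0 \<noteq> 0" using i0 by auto
        have "combo K f x = f i0 *s x i0" by (rule combo_single[OF K i0(1)]) (use False i0 i0' in blast)
        then have "x i0 \<in> Lp (int p)" using fK torsion_free_mod_prime[OF p i0(2)] by simp
        then show False using max[OF less.prems(1-3)] i0(1) unfolding K_def by blast
      qed
    qed
  qed
  then show ?case by (simp add: K_def)
qed

text \<open>Dividing the members in \<open>H\<close> by \<open>p\<close> keeps independence and
  gains the factor \<open>p\<close> of the denominator: if \<open>p d v\<close> is a combination of
  the \<open>x i\<close>, its coefficients outside \<open>H\<close> are divisible by
  \<open>p\<close> by purity, and those inside are absorbed by the new members.\<close>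

lemma seshadri_step:
  assumes p: "Factorial_Ring.prime p" and I: "finite I" and x0: "gen I x0 (int p * d)" "indep I x0"
  shows "\<exists>y. gen I y d \<and> indep I y"
proof -
  have pp: "Factorial_Ring.prime (int p)" using p by simp
  define P where "P = (\<lambda>(x, H). H \<subseteq> I \<and> gen I x (int p * d) \<and> indep I x \<and> (\<forall>i\<in>H. x i \<in> Lp (int p)))"
  have "P (x0, {})" using x0 by (simp add: P_def)
  moreover have "\<forall>y. P y \<longrightarrow> card (snd y) < Suc (card I)" using I by (auto simp: P_def less_Suc_eq_le intro: card_mono)
  ultimately have "\<exists>y. P y \<and> (\<forall>z. P z \<longrightarrow> card (snd z) \<le> card (snd y))"
    by (rule ex_has_greatest_nat)
  then obtain x H where xH: "P (x, H)" and mx: "\<And>z. P z \<Longrightarrow> card (snd z) \<le> card H" by force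
  have HI: "H \<subseteq> I" and g: "gen I x (int p * d)" and ind: "indep I x" and xL: "\<forall>i\<in>H. x i \<in> Lp (int p)"
    using xH by (auto simp: P_def)
  have finH: "finite H" using HI I finite_subset by blast
  have max: "y j \<notin> Lp (int p)" if "gen I y (int p * d)" "indep I y" "\<forall>i\<in>H. y i \<in> Lp (int p)" "j \<in> I - H" for y j
  proof
    assume "y j \<in> Lp (int p)"
    then have "P (y, insert j H)" using that HI by (auto simp: P_def)
    then show False using mx[of "(y, insert j H)"] that finH by simp
  qed
  have pure: "\<forall>i\<in>I - H. [:int p:] dvd f i" if "combo (I - H) f x \<in> Lp (int p)" for f
  proof (rule seshadri_pure[OF p I _ g ind xL that])
    show "y j \<notin> Lp (int p)" if "gen I y (int p * d)" "indep I y" "\<forall>i\<in>H. y i \<in> Lp (int p)" "j \<in> I - H" for y j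
      by (rule max[OF that])
  qed
  have "\<exists>k w. monom 1 k *s x i - [:int p:] *s w \<in> L" if "i \<in> H" for i
    using xL that unfolding Lp_def by blast
  then obtain k w where kw: "\<And>i. i \<in> H \<Longrightarrow> monom 1 (k i) *s x i - [:int p:] *s w i \<in> L" by metis
  define y where "y i = (if i \<in> H then w i else x i)" for i
  have split: "combo I f z = combo H f z + combo (I - H) f z" for f z
    unfolding combo_def using I HI by (simp add: sum.subset_diff add.commute)
  have y1: "[:int p:] *s combo H f y - combo H (\<lambda>i. f i * monom 1 (k i)) x \<in> L" for f
  proof -
    have "[:int p:] *s combo H f y - combo H (\<lambda>i. f i * monom 1 (k i)) x
        = - (\<Sum>i\<in>H. f i *s (monom 1 (k i) *s x i - [:int p:] *s w i))"
      by (simp add: combo_def y_def scale_sum_right scale_right_diff_distrib sum_subtractf mult.commute)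
    also have "\<dots> \<in> L" by (intro subspace_neg[OF L] subspace_sum[OF L] L_scale kw)
    finally show ?thesis .
  qed
  have y2: "combo (I - H) f y = combo (I - H) f x" for f by (rule combo_cong) (auto simp: y_def)
  have y3: "[:int p:] *s combo I f y - combo I (\<lambda>i. if i \<in> H then f i * monom 1 (k i) else [:int p:] * f i) x \<in> L" for f
  proof -
    have "combo I (\<lambda>i. if i \<in> H then f i * monom 1 (k i) else [:int p:] * f i) x
      = combo H (\<lambda>i. f i * monom 1 (k i)) x + combo (I - H) (\<lambda>i. [:int p:] * f i) x"
      unfolding split by (intro arg_cong2[of _ _ _ _ plus] combo_cong) auto
    also have "\<dots> = combo H (\<lambda>i. f i * monom 1 (k i)) x + [:int p:] *s combo (I - H) f x" by (simp only: combo_scale)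
    finally show ?thesis using y1[of f] by (simp add: split[of f y] y2 scale_right_distrib add_diff_add)
  qed
  have "indep I y"
    unfolding indep_def
  proof (intro allI impI ballI)
    fix f i assume f: "combo I f y \<in> L" and i: "i \<in> I"
    have "combo I (\<lambda>i. if i \<in> H then f i * monom 1 (k i) else [:int p:] * f i) x \<in> L"
      using L_cong[OF y3[of f]] L_scale[OF f] by blast
    then have "(if i \<in> H then f i * monom 1 (k i) else [:int p:] * f i) = 0" using ind i unfolding indep_def by blast
    then show "f i = 0" using p by (auto split: if_splits)
  qed
  moreover have "gen I y d"
    unfolding gen_def
  proof
    fix v
    obtain m f where mf: "(monom 1 m * [:int p * d:]) *s v - combo I f x \<in> L" using g unfolding gen_def by blast
    define u where "u = (monom 1 m * [:d:]) *s v"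
    have pu: "[:int p:] *s u = (monom 1 m * [:int p * d:]) *s v" by (simp add: u_def mult_ac)
    have 1: "combo I f x \<in> Lp (int p)"
      using Lp_cong[OF L_sub_Lp[OF mf]] Lp_const[of "int p" u] by (simp only: pu)
    have "combo H f x \<in> Lp (int p)"
      unfolding combo_def using xL by (intro subspace_sum[OF subspace_Lp] subspace_scale[OF subspace_Lp]) blast
    with 1 have "combo (I - H) f x \<in> Lp (int p)"
      using subspace_diff[OF subspace_Lp, of "combo I f x" "int p" "combo H f x"] by (simp add: split)
    then have "\<forall>i\<in>I - H. [:int p:] dvd f i" by (rule pure)
    then obtain f' where f': "\<And>i. i \<in> I - H \<Longrightarrow> f i = [:int p:] * f' i" unfolding dvd_def by metis
    \<comment> \<open>Each \<open>w i\<close> is \<open>x i\<close> divided by \<open>p\<close> up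
      to its own power of \<open>X\<close>; \<open>N\<close> bounds all these exponents, so that
      they can be equalized.\<close>
    define N where "N = sum k H"
    have kN: "k i \<le> N" if "i \<in> H" for i using that finH by (auto simp: N_def intro: member_le_sum)
    define h where "h i = (if i \<in> H then f i * monom 1 (N - k i) else monom 1 N * f' i)" for i
    have "combo I (\<lambda>i. if i \<in> H then h i * monom 1 (k i) else [:int p:] * h i) x = combo I (\<lambda>i. monom 1 N * f i) x"
    proof (rule combo_cong)
      fix i assume i: "i \<in> I"
      show "(if i \<in> H then h i * monom 1 (k i) else [:int p:] * h i) = monom 1 N * f i"
      proof (cases "i \<in> H")
        case True
        then show ?thesis using kN[OF True] by (simp add: h_def mult.assoc mult_monom mult.commute)
      next
        case False
        then show ?thesis using i f'[of i] by (simp add: h_def mult.left_commute del: mult_pCons_left mult_pCons_right)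
      qed
    qed simp
    also have "\<dots> = monom 1 N *s combo I f x" by (rule combo_scale)
    finally have 2: "[:int p:] *s combo I h y - monom 1 N *s combo I f x \<in> L" using y3[of h] by simp
    have "monom 1 N *s ([:int p:] *s u - combo I f x) - ([:int p:] *s combo I h y - monom 1 N *s combo I f x) \<in> L"
      by (rule L_diff[OF L_scale[OF mf[folded pu]] 2])
    also have "monom 1 N *s ([:int p:] *s u - combo I f x) - ([:int p:] *s combo I h y - monom 1 N *s combo I f x)
        = [:int p:] *s (monom 1 N *s u - combo I h y)"
      by (simp add: scale_right_diff_distrib mult.commute)
    finally have "monom 1 N *s u - combo I h y \<in> L" by (rule prime_torsion_free[OF pp])
    then have "(monom 1 (N + m) * [:d:]) *s v - combo I h y \<in> L" by (simp add: u_def mult_monom mult.assoc[symmetric] del: mult_pCons_left mult_pCons_right)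
    then show "\<exists>k f. (monom 1 k * [:d:]) *s v - combo I f y \<in> L" by blast
  qed
  ultimately show ?thesis by blast
qed

lemma integral_basis:
  assumes I: "finite I" "d \<noteq> 0" "gen I x d" "indep I x"
  shows "\<exists>y. gen I y 1 \<and> indep I y"
  using I
proof (induction "nat \<bar>d\<bar>" arbitrary: d x rule: less_induct)
  case less
  show ?case
  proof (cases "is_unit d")
    case True
    then have d1: "d = 1 \<or> d = -1" by auto
    have "gen I x 1"
    proof (cases "d = 1")
      case False
      then have "d = -1" using d1 by blast
      show ?thesis
        unfolding gen_def
      proof
        fix v
        obtain k f where "(monom 1 k * [:d:]) *s v - combo I f x \<in> L" using less.prems unfolding gen_def by blast
        then have "[:-1:] *s ((monom 1 k * [:d:]) *s v - combo I f x) \<in> L" by (rule L_scale)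
        then have "(monom 1 k * [:1:]) *s v - combo I (\<lambda>i. [:-1:] * f i) x \<in> L"
          unfolding combo_scale \<open>d = -1\<close> by (simp add: scale_right_diff_distrib smult_monom)
        then show "\<exists>k f. (monom 1 k * [:1:]) *s v - combo I f x \<in> L" by blast
      qed
    qed (use less.prems in simp)
    then show ?thesis using less.prems by blast
  next
    case False
    then obtain p' where p': "Factorial_Ring.prime p'" "p' dvd d"
      using prime_divisor_exists[of d] less.prems by blast
    define p where "p = nat p'"
    have pp: "p' = int p" using prime_gt_0_int[OF p'(1)] by (simp add: p_def)
    have p: "Factorial_Ring.prime p" using p'(1) by (simp add: pp)
    obtain e where d: "d = int p * e" using p'(2) pp by auto
    obtain y where y: "gen I y e" "indep I y" using seshadri_step[OF p less.prems(1)] less.prems d by blast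
    have "p \<ge> 2" using p by (simp add: prime_ge_2_nat)
    then have "\<bar>d\<bar> = int p * \<bar>e\<bar>" by (simp add: d abs_mult)
    moreover have "\<bar>e\<bar> > 0" using less.prems d by auto
    moreover have "2 * \<bar>e\<bar> \<le> int p * \<bar>e\<bar>" using \<open>p \<ge> 2\<close> by (intro mult_right_mono) auto
    ultimately have "nat \<bar>e\<bar> < nat \<bar>d\<bar>" by linarith
    then show ?thesis using less.hyps[of e y] y less.prems d by auto
  qed
qed

theorem free_basis:
  "\<exists>x. (\<forall>v. \<exists>k f. monom 1 k *s v - (\<Sum>i<n. f i *s x i) \<in> L) \<and> (\<forall>f. (\<Sum>i<n. f i *s x i) \<in> L \<longrightarrow> (\<forall>i<n. f i = 0))"
proof -
  obtain I x d where I: "finite I" "d \<noteq> 0" "gen I x d" "indep I x" using rational_basis by blast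
  obtain y where y: "gen I y 1" "indep I y" using integral_basis[OF I] by blast
  have "card I = n" by (rule rank_eq[OF I])
  then obtain h where h: "bij_betw h {..<n} I" using ex_bij_betw_nat_finite[OF I(1)] by (auto simp: atLeast0LessThan)
  define g where "g = the_inv_into {..<n} h"
  have gh: "g (h i) = i" if "i < n" for i using h that by (simp add: g_def the_inv_into_f_f bij_betw_def)
  have 1: "(\<Sum>i<n. f (h i) *s y (h i)) = combo I f y" for f
    unfolding combo_def by (rule sum.reindex_bij_betw[OF h])
  have 2: "(\<Sum>i<n. f i *s y (h i)) = combo I (\<lambda>i. f (g i)) y" for f
    unfolding 1[symmetric] by (rule sum.cong) (auto simp: gh)
  show ?thesis
  proof (intro exI[of _ "\<lambda>i. y (h i)"] conjI allI impI)
    fix v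
    obtain k f where "(monom 1 k * [:1:]) *s v - combo I f y \<in> L" using y unfolding gen_def by blast
    then have "monom 1 k *s v - (\<Sum>i<n. f (h i) *s y (h i)) \<in> L" by (simp add: 1)
    then show "\<exists>k f. monom 1 k *s v - (\<Sum>i<n. f i *s y (h i)) \<in> L" by (intro exI[of _ k] exI[of _ "\<lambda>i. f (h i)"])
  next
    fix f i assume f: "(\<Sum>i<n. f i *s y (h i)) \<in> L" and i: "i < n"
    have "h i \<in> I" using h i by (auto simp: bij_betw_def)
    then have "f (g (h i)) = 0" using f y unfolding 2 indep_def by blast
    then show "f i = 0" by (simp add: gh[OF i])
  qed
qed

end

section \<open>Coherent approximation by finite quotients\<close>

lemma (in normal) rcoset_eq_iff:
  assumes "x \<in> carrier G" "y \<in> carrier G"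
  shows "H #> x = H #> y \<longleftrightarrow> x \<otimes> inv y \<in> H"
proof
  assume "H #> x = H #> y"
  then have "x \<in> H #> y" using rcos_self[OF assms(1)] is_subgroup by metis
  then obtain h where h: "h \<in> H" "x = h \<otimes> y" by (auto simp: r_coset_def)
  then have "x \<otimes> inv y = h" using assms(2) mem_carrier[OF h(1)] by (simp add: m_assoc)
  then show "x \<otimes> inv y \<in> H" using h(1) by simp
next
  assume h: "x \<otimes> inv y \<in> H"
  have "x = (x \<otimes> inv y) \<otimes> y" using assms by (simp add: m_assoc)
  then have "x \<in> H #> y" using h by (auto simp: r_coset_def)
  then show "H #> x = H #> y" using repr_independence[OF _ assms(2) is_subgroup] by simp
qed

text \<open>Finiteness is demanded separately because \<open>card\<close> of an infinite set is 0
  and would satisfy the bound.\<close>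

definition fi_normal :: "('a, 'm) monoid_scheme \<Rightarrow> 'a set \<Rightarrow> nat \<Rightarrow> bool"
  where "fi_normal G N m \<longleftrightarrow> N \<lhd> G \<and> finite (rcosets\<^bsub>G\<^esub> N) \<and> card (rcosets\<^bsub>G\<^esub> N) \<le> m"

text \<open>These intersections depend on the group alone and form a descending chain that is
  cofinal among the normal subgroups of finite index.\<close>

definition Kint :: "('a, 'm) monoid_scheme \<Rightarrow> nat \<Rightarrow> 'a set"
  where "Kint G m = {g \<in> carrier G. \<forall>N. fi_normal G N m \<longrightarrow> g \<in> N}"

lemma Kint_subset: "fi_normal G N m \<Longrightarrow> Kint G m \<subseteq> N"
  by (auto simp: Kint_def)

lemma Kint_antimono: "j \<le> m \<Longrightarrow> Kint G m \<subseteq> Kint G j"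
  by (auto simp: Kint_def fi_normal_def)

lemma (in group) Kint_normal: "Kint G m \<lhd> G"
proof -
  have N: "N \<lhd> G" if "fi_normal G N m" for N using that by (simp add: fi_normal_def)
  have sg: "subgroup N G" if "fi_normal G N m" for N using N[OF that] by (simp add: normal_imp_subgroup)
  show ?thesis
    unfolding normal_inv_iff
  proof (intro conjI ballI subgroupI)
    have "\<one> \<in> Kint G m" using subgroup.one_closed[OF sg] by (simp add: Kint_def)
    then show "Kint G m \<noteq> {}" by blast
  next
    fix a assume "a \<in> Kint G m"
    then show "inv a \<in> Kint G m" using subgroup.m_inv_closed[OF sg] by (simp add: Kint_def)
  next
    fix a b assume "a \<in> Kint G m" "b \<in> Kint G m"
    then show "a \<otimes> b \<in> Kint G m" using subgroup.m_closed[OF sg] by (simp add: Kint_def)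
  next
    fix x h assume "x \<in> carrier G" "h \<in> Kint G m"
    then show "x \<otimes> h \<otimes> inv x \<in> Kint G m" using normal.inv_op_closed2[OF N] by (simp add: Kint_def)
  qed (auto simp: Kint_def)
qed

lemma image_factor:
  assumes "\<And>x y. \<lbrakk>x \<in> A; y \<in> A; F x = F y\<rbrakk> \<Longrightarrow> H x = H y"
  obtains g where "H ` A = g ` (F ` A)" "\<And>x. x \<in> A \<Longrightarrow> H x = g (F x)"
proof -
  define p where "p z = (SOME x. x \<in> A \<and> F x = z)" for z
  have 1: "H x = H (p (F x))" if "x \<in> A" for x
  proof -
    have "p (F x) \<in> A \<and> F (p (F x)) = F x" unfolding p_def by (rule someI[of _ x]) (use that in simp)
    then show ?thesis using assms[OF that, of "p (F x)"] by simp
  qed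
  then have "H ` A = (\<lambda>z. H (p z)) ` (F ` A)" by (simp add: image_image)
  then show ?thesis using 1 by (rule that)
qed

lemma finite_image_factor:
  assumes "finite (F ` A)" "\<And>x y. \<lbrakk>x \<in> A; y \<in> A; F x = F y\<rbrakk> \<Longrightarrow> H x = H y"
  shows "finite (H ` A)" "card (H ` A) \<le> card (F ` A)"
proof -
  obtain g where g: "H ` A = g ` (F ` A)" by (rule image_factor[OF assms(2)])
  show "finite (H ` A)" unfolding g by (rule finite_imageI[OF assms(1)])
  show "card (H ` A) \<le> card (F ` A)" unfolding g by (rule card_image_le[OF assms(1)])
qed

lemma RCOSETS_image: "rcosets\<^bsub>G\<^esub> N = (\<lambda>x. N #>\<^bsub>G\<^esub> x) ` carrier G"
  by (auto simp: RCOSETS_def)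

text \<open>A normal subgroup is recovered from the tables by which the generators permute its cosets.\<close>

lemma (in group) finite_fi_normal:
  assumes S: "finite S" "S \<subseteq> carrier G" "generate G S = carrier G"
  shows "finite {N. fi_normal G N m}"
proof -
  define b where "b N = (SOME b. bij_betw b (rcosets N) {..<card (rcosets N)})" for N
  have b: "bij_betw (b N) (rcosets N) {..<card (rcosets N)}" if "fi_normal G N m" for N
  proof -
    have "\<exists>b. bij_betw b (rcosets N) {..<card (rcosets N)}"
      using that ex_bij_betw_finite_nat[of "rcosets N"] by (auto simp: fi_normal_def atLeast0LessThan)
    then show ?thesis unfolding b_def by (rule someI_ex)
  qed
  define tab where "tab N g = (\<lambda>i\<in>{..<card (rcosets N)}. b N (the_inv_into (rcosets N) (b N) i #> g))" for N g
  \<comment> \<open>\<open>b N N\<close> is the label of the base point: \<open>N\<close> consists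
    of the elements that fix the coset \<open>N\<close>, so the action on labels together with this
    label determines \<open>N\<close>.\<close>
  define F where "F N = (card (rcosets N), b N N, \<lambda>s\<in>S. (tab N s, tab N (inv s)))" for N
  define T where "T = (\<Union>k\<le>m. PiE {..<k} (\<lambda>_. {..<k}))"
  have NG: "subgroup N G" if "fi_normal G N m" for N
    using that by (simp add: fi_normal_def normal_imp_subgroup)
  have shift: "C #> g \<in> rcosets N" if N: "fi_normal G N m" and C: "C \<in> rcosets N" and g: "g \<in> carrier G" for N C g
  proof -
    obtain x where x: "x \<in> carrier G" "C = N #> x" using C by (auto simp: RCOSETS_image)
    then have "C #> g = N #> (x \<otimes> g)" using g subgroup.subset[OF NG[OF N]] by (simp only: coset_mult_assoc)
    moreover have "x \<otimes> g \<in> carrier G" using x g by simp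
    ultimately show ?thesis unfolding RCOSETS_image by blast
  qed
  have tab_eq: "tab N g (b N C) = b N (C #> g)" if "fi_normal G N m" "C \<in> rcosets N" for N C g
  proof -
    have "b N C \<in> {..<card (rcosets N)}" by (rule bij_betwE[OF b[OF that(1)], rule_format, OF that(2)])
    moreover have "the_inv_into (rcosets N) (b N) (b N C) = C"
      by (rule the_inv_into_f_f[OF bij_betw_imp_inj_on[OF b[OF that(1)]] that(2)])
    ultimately show ?thesis by (simp add: tab_def)
  qed
  have tabT: "tab N g \<in> T" if N: "fi_normal G N m" and g: "g \<in> carrier G" for N g
  proof -
    have "tab N g \<in> PiE {..<card (rcosets N)} (\<lambda>_. {..<card (rcosets N)})"
    proof (rule PiE_I)
      fix i assume "i \<in> {..<card (rcosets N)}"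
      then obtain C where C: "C \<in> rcosets N" "i = b N C"
        unfolding bij_betw_imp_surj_on[OF b[OF N], symmetric] by blast
      show "tab N g i \<in> {..<card (rcosets N)}"
        unfolding C(2) tab_eq[OF N C(1)] by (rule bij_betwE[OF b[OF N], rule_format, OF shift[OF N C(1) g]])
    qed (simp add: tab_def)
    moreover have "card (rcosets N) \<le> m" using N by (simp add: fi_normal_def)
    ultimately show ?thesis unfolding T_def by blast
  qed
  have NN: "N \<in> rcosets N" if "fi_normal G N m" for N
    by (rule subgroup.subgroup_in_rcosets[OF NG[OF that] group_axioms])
  have "finite T" unfolding T_def by (auto intro: finite_PiE)
  then have "finite ({..m} \<times> {..m} \<times> PiE S (\<lambda>_. T \<times> T))" using S by (auto intro: finite_PiE)
  moreover have "F ` {N. fi_normal G N m} \<subseteq> {..m} \<times> {..m} \<times> PiE S (\<lambda>_. T \<times> T)"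
  proof
    fix z assume "z \<in> F ` {N. fi_normal G N m}"
    then obtain N where N: "fi_normal G N m" "z = F N" by blast
    have "b N N < card (rcosets N)" using b[OF N(1)] NN[OF N(1)] by (auto simp: bij_betw_def)
    then have "b N N \<le> m" "card (rcosets N) \<le> m" using N by (auto simp: fi_normal_def)
    moreover have "(\<lambda>s\<in>S. (tab N s, tab N (inv s))) \<in> PiE S (\<lambda>_. T \<times> T)"
    proof (rule restrict_PiE_iff[THEN iffD2], rule ballI)
      fix s assume "s \<in> S"
      then have "s \<in> carrier G" using S(2) by blast
      then show "(tab N s, tab N (inv s)) \<in> T \<times> T" using tabT[OF N(1)] by simp
    qed
    ultimately show "z \<in> {..m} \<times> {..m} \<times> PiE S (\<lambda>_. T \<times> T)" by (simp add: N(2) F_def)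
  qed
  ultimately have fin: "finite (F ` {N. fi_normal G N m})" by (rule rev_finite_subset)
  have sub: "N \<subseteq> N'" if N: "fi_normal G N m" and N': "fi_normal G N' m" and eq: "F N = F N'" for N N'
  proof
    have tabs: "tab N s = tab N' s" "tab N (inv s) = tab N' (inv s)" if "s \<in> S" for s
    proof -
      have "(\<lambda>s\<in>S. (tab N s, tab N (inv s))) s = (\<lambda>s\<in>S. (tab N' s, tab N' (inv s))) s"
        using eq unfolding F_def by (simp only: prod.inject)
      then show "tab N s = tab N' s" "tab N (inv s) = tab N' (inv s)" using that by simp_all
    qed
    have step: "b N (C #> g) = b N' (C' #> g)" if "tab N g = tab N' g" "C \<in> rcosets N" "C' \<in> rcosets N'" "b N C = b N' C'" for g C C'
      using tab_eq[OF N that(2), of g] tab_eq[OF N' that(3), of g] that by simp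
    \<comment> \<open>Induction over words in the generators: cosets of \<open>N\<close> and
      \<open>N'\<close> with equal labels are moved to cosets with equal labels.\<close>
    have all: "\<forall>C\<in>rcosets N. \<forall>C'\<in>rcosets N'. b N C = b N' C' \<longrightarrow> b N (C #> g) = b N' (C' #> g)" if "g \<in> generate G S" for g
      using that
    proof (induction g rule: generate.induct)
      case one
      have "C #> \<one> = C" if "fi_normal G M m" "C \<in> rcosets M" for M C
        using subgroup.rcosets_carrier[OF NG[OF that(1)] group_axioms that(2)] by (rule coset_mult_one)
      then show ?case using N N' by simp
    next
      case (eng h1 h2)
      have h: "h1 \<in> carrier G" "h2 \<in> carrier G" using eng.hyps S(3) by auto
      show ?case
      proof (intro ballI impI)
        fix C C' assume C: "C \<in> rcosets N" "C' \<in> rcosets N'" "b N C = b N' C'"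
        have "b N (C #> h1 #> h2) = b N' (C' #> h1 #> h2)"
          using eng.IH C shift[OF N _ h(1)] shift[OF N' _ h(1)] by blast
        moreover have "C \<subseteq> carrier G" by (rule subgroup.rcosets_carrier[OF NG[OF N] group_axioms C(1)])
        moreover have "C' \<subseteq> carrier G" by (rule subgroup.rcosets_carrier[OF NG[OF N'] group_axioms C(2)])
        ultimately show "b N (C #> (h1 \<otimes> h2)) = b N' (C' #> (h1 \<otimes> h2))" using h by (simp add: coset_mult_assoc)
      qed
    next
      case (incl h)
      then show ?case using step[OF tabs(1)] by blast
    next
      case (inv h)
      then show ?case using step[OF tabs(2)] by blast
    qed
    fix g assume g: "g \<in> N"
    then have gG: "g \<in> carrier G" using subgroup.mem_carrier[OF NG[OF N]] by blast
    have bNN: "b N N = b N' N'" using eq by (simp add: F_def)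
    have "g \<in> generate G S" using gG S(3) by simp
    then have "b N (N #> g) = b N' (N' #> g)" using all NN[OF N] NN[OF N'] bNN by blast
    moreover have "N #> g = N" using g NG[OF N] by (simp add: coset_join2 gG)
    ultimately have "b N' (N' #> g) = b N' N'" using bNN by simp
    then have "N' #> g = N'"
      by (rule inj_onD[OF bij_betw_imp_inj_on[OF b[OF N']] _ shift[OF N' NN[OF N'] gG] NN[OF N']])
    then show "g \<in> N'" using rcos_self[OF gG NG[OF N']] by simp
  qed
  then have "inj_on F {N. fi_normal G N m}" by (intro inj_onI) (simp add: subset_antisym)
  then show ?thesis using fin by (rule finite_imageD[rotated])
qed

lemma (in group) finite_index_Kint:
  assumes S: "finite S" "S \<subseteq> carrier G" "generate G S = carrier G"
  shows "finite (rcosets (Kint G m))"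
proof -
  define \<N> where "\<N> = {N. fi_normal G N m}"
  have fin: "finite \<N>" unfolding \<N>_def by (rule finite_fi_normal[OF S])
  define F where "F x = (\<lambda>N\<in>\<N>. N #> x)" for x
  have "F ` carrier G \<subseteq> PiE \<N> (\<lambda>N. rcosets N)" by (auto simp: F_def RCOSETS_image)
  moreover have "finite (PiE \<N> (\<lambda>N. rcosets N))" using fin by (intro finite_PiE) (auto simp: \<N>_def fi_normal_def)
  ultimately have finF: "finite (F ` carrier G)" by (rule finite_subset)
  interpret K: normal "Kint G m" G by (rule Kint_normal)
  show ?thesis unfolding RCOSETS_image
  proof (rule finite_image_factor[OF finF])
    fix x y assume xy: "x \<in> carrier G" "y \<in> carrier G" "F x = F y"
    have "x \<otimes> inv y \<in> N" if "fi_normal G N m" for N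
    proof -
      have "N #> x = N #> y" using fun_cong[OF xy(3), of N] that by (simp add: F_def \<N>_def)
      moreover have "N \<lhd> G" using that by (simp add: fi_normal_def)
      ultimately show ?thesis using normal.rcoset_eq_iff[OF _ xy(1,2)] by simp
    qed
    then have "x \<otimes> inv y \<in> Kint G m" unfolding Kint_def using xy(1,2) by blast
    then show "Kint G m #> x = Kint G m #> y" using K.rcoset_eq_iff[OF xy(1,2)] by blast
  qed
qed

text \<open>An epimorphism of \<open>D\<close> onto \<open>G / N\<close>, given by a map into
  \<open>G\<close> that picks representatives. Maps for different \<open>N\<close> can then be
  compared inside \<open>G\<close>, and a map for \<open>N\<close> serves for every larger normal
  subgroup.\<close>

definition emod :: "('a, 'm) monoid_scheme \<Rightarrow> ('b, 'k) monoid_scheme \<Rightarrow> 'b set \<Rightarrow> ('a \<Rightarrow> 'b) \<Rightarrow> bool"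
  where "emod D G N u \<longleftrightarrow> (\<lambda>x. N #>\<^bsub>G\<^esub> u x) \<in> hom D (G Mod N) \<and> u \<in> carrier D \<rightarrow> carrier G
     \<and> (\<forall>g\<in>carrier G. \<exists>x\<in>carrier D. N #>\<^bsub>G\<^esub> u x = N #>\<^bsub>G\<^esub> g)"

locale two_groups = D: group D + G: group G
  for D :: "('a, 'm) monoid_scheme" and G :: "('b, 'k) monoid_scheme"
begin

lemma emod_iff:
  assumes N: "N \<lhd> G"
  shows "emod D G N u \<longleftrightarrow> u \<in> carrier D \<rightarrow> carrier G
     \<and> (\<forall>x\<in>carrier D. \<forall>y\<in>carrier D. u (x \<otimes>\<^bsub>D\<^esub> y) \<otimes>\<^bsub>G\<^esub> inv\<^bsub>G\<^esub> (u x \<otimes>\<^bsub>G\<^esub> u y) \<in> N)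
     \<and> (\<forall>g\<in>carrier G. \<exists>x\<in>carrier D. u x \<otimes>\<^bsub>G\<^esub> inv\<^bsub>G\<^esub> g \<in> N)" (is "?L \<longleftrightarrow> ?R")
proof -
  interpret N: normal N G by (rule N)
  show ?thesis
  proof (cases "u \<in> carrier D \<rightarrow> carrier G")
    case True
    then have u: "u x \<in> carrier G" if "x \<in> carrier D" for x using that by blast
    show ?thesis using u
      by (auto simp: emod_def hom_def FactGroup_def RCOSETS_image N.rcos_sum N.rcoset_eq_iff Pi_iff)
  qed (simp add: emod_def)
qed

lemma emod_mono:
  assumes "emod D G N u" "N \<lhd> G" "N' \<lhd> G" "N \<subseteq> N'" shows "emod D G N' u"
  using assms unfolding emod_iff[OF assms(2)] emod_iff[OF assms(3)] by blast

lemma emod_preimage: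
  assumes u: "emod D G N u" and N: "N \<lhd> G"
  defines "P \<equiv> {x \<in> carrier D. u x \<in> N}"
  shows "P \<lhd> D" and "finite (rcosets\<^bsub>D\<^esub> P) \<longleftrightarrow> finite (rcosets\<^bsub>G\<^esub> N)" and "card (rcosets\<^bsub>D\<^esub> P) = card (rcosets\<^bsub>G\<^esub> N)"
proof -
  interpret N: normal N G by (rule N)
  interpret Q: group "G Mod N" by (rule N.factorgroup_is_group)
  interpret h: group_hom D "G Mod N" "\<lambda>x. N #>\<^bsub>G\<^esub> u x"
    using u by unfold_locales (simp add: emod_def)
  have uc: "u x \<in> carrier G" if "x \<in> carrier D" for x using u that by (auto simp: emod_def)
  have "kernel D (G Mod N) (\<lambda>x. N #>\<^bsub>G\<^esub> u x) = P"
  proof -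
    have "N #>\<^bsub>G\<^esub> u x = N \<longleftrightarrow> u x \<in> N" if "x \<in> carrier D" for x
      using G.rcos_self[OF uc[OF that] N.subgroup_axioms] G.coset_join2[OF uc[OF that] N.subgroup_axioms] by blast
    then show ?thesis by (auto simp: kernel_def P_def FactGroup_def)
  qed
  moreover have "(\<lambda>x. N #>\<^bsub>G\<^esub> u x) ` carrier D = carrier (G Mod N)"
  proof
    show "(\<lambda>x. N #>\<^bsub>G\<^esub> u x) ` carrier D \<subseteq> carrier (G Mod N)"
      using uc by (auto simp: FactGroup_def RCOSETS_image)
    show "carrier (G Mod N) \<subseteq> (\<lambda>x. N #>\<^bsub>G\<^esub> u x) ` carrier D"
    proof
      fix C assume "C \<in> carrier (G Mod N)"
      then obtain g where "g \<in> carrier G" "C = N #>\<^bsub>G\<^esub> g" by (auto simp: FactGroup_def RCOSETS_image)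
      then show "C \<in> (\<lambda>x. N #>\<^bsub>G\<^esub> u x) ` carrier D" using u unfolding emod_def by (metis imageI)
    qed
  qed
  ultimately have iso: "D Mod P \<cong> G Mod N" "P \<lhd> D"
    using h.FactGroup_iso h.normal_kernel by auto
  obtain f where "f \<in> iso (D Mod P) (G Mod N)" using iso(1) by (auto simp: is_iso_def)
  then have bij: "bij_betw f (rcosets\<^bsub>D\<^esub> P) (rcosets\<^bsub>G\<^esub> N)" by (simp add: iso_def FactGroup_def)
  show "P \<lhd> D" by (rule iso)
  show "finite (rcosets\<^bsub>D\<^esub> P) \<longleftrightarrow> finite (rcosets\<^bsub>G\<^esub> N)" using bij by (rule bij_betw_finite)
  show "card (rcosets\<^bsub>D\<^esub> P) = card (rcosets\<^bsub>G\<^esub> N)" using bij by (rule bij_betw_same_card)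
qed

text \<open>The preimage of a normal subgroup of index at most \<open>m\<close> has the same index,
  so it contains \<open>Kint D m\<close>.\<close>

lemma emod_Kint:
  assumes u: "emod D G (Kint G m) u"
  shows "Kint D m \<subseteq> {x \<in> carrier D. u x \<in> Kint G m}"
proof
  fix x assume x: "x \<in> Kint D m"
  then have xD: "x \<in> carrier D" by (simp add: Kint_def)
  have "u x \<in> N" if N: "fi_normal G N m" for N
  proof -
    have "N \<lhd> G" using N by (simp add: fi_normal_def)
    then have 1: "emod D G N u" using emod_mono[OF u G.Kint_normal] Kint_subset[OF N] by blast
    have "fi_normal D {x \<in> carrier D. u x \<in> N} m"
      using emod_preimage[OF 1 \<open>N \<lhd> G\<close>] N by (simp add: fi_normal_def)
    then show ?thesis using x Kint_subset by blast
  qed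
  moreover have "u x \<in> carrier G" using u xD by (auto simp: emod_def)
  ultimately show "x \<in> {x \<in> carrier D. u x \<in> Kint G m}" using xD by (simp add: Kint_def)
qed

lemma ex_emod_Kint:
  assumes fin: "finite (rcosets\<^bsub>G\<^esub> (Kint G m))"
    and eq: "finite_quotient_classes D = finite_quotient_classes G"
  shows "\<exists>u. emod D G (Kint G m) u"
proof -
  interpret K: normal "Kint G m" G by (rule G.Kint_normal)
  have finQ: "finite (carrier (G Mod Kint G m))" using fin by (simp add: FactGroup_def)
  then have "iso_class (G Mod Kint G m) \<in> finite_quotient_classes G"
    unfolding finite_quotient_classes_def using G.Kint_normal by blast
  then have "iso_class (G Mod Kint G m) \<in> finite_quotient_classes D" using eq by simp
  then obtain N where N: "N \<lhd> D" "finite (carrier (D Mod N))" "iso_class (G Mod Kint G m) = iso_class (D Mod N)"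
    unfolding finite_quotient_classes_def by blast
  interpret N: normal N D by (rule N)
  have "D Mod N \<cong> G Mod Kint G m"
    using N iso_class_eq_iff[OF N.factorgroup_is_group K.factorgroup_is_group] by simp
  then obtain f where f: "f \<in> iso (D Mod N) (G Mod Kint G m)" by (auto simp: is_iso_def)
  define h where "h = f \<circ> (\<lambda>x. N #>\<^bsub>D\<^esub> x)"
  have hh: "h \<in> hom D (G Mod Kint G m)"
    unfolding h_def using N.r_coset_hom_Mod f by (intro hom_compose) (auto simp: iso_def)
  have surj: "h ` carrier D = carrier (G Mod Kint G m)"
  proof -
    have "(\<lambda>x. N #>\<^bsub>D\<^esub> x) ` carrier D = carrier (D Mod N)" by (auto simp: FactGroup_def RCOSETS_image)
    then show ?thesis using f by (auto simp: h_def iso_def bij_betw_def simp flip: image_image)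
  qed
  have "\<exists>g\<in>carrier G. h x = Kint G m #>\<^bsub>G\<^esub> g" if "x \<in> carrier D" for x
  proof -
    have "h x \<in> carrier (G Mod Kint G m)" using surj that by blast
    then show ?thesis by (auto simp: FactGroup_def RCOSETS_image)
  qed
  then obtain u where u: "\<And>x. x \<in> carrier D \<Longrightarrow> u x \<in> carrier G \<and> h x = Kint G m #>\<^bsub>G\<^esub> u x" by metis
  have "(\<lambda>x. Kint G m #>\<^bsub>G\<^esub> u x) \<in> hom D (G Mod Kint G m)"
    using hh u by (auto simp: hom_def Pi_iff)
  moreover have "\<exists>x\<in>carrier D. Kint G m #>\<^bsub>G\<^esub> u x = Kint G m #>\<^bsub>G\<^esub> g" if "g \<in> carrier G" for g
  proof -
    have "Kint G m #>\<^bsub>G\<^esub> g \<in> h ` carrier D" unfolding surj using that by (auto simp: FactGroup_def RCOSETS_image)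
    then show ?thesis using u by (metis imageE)
  qed
  ultimately have "emod D G (Kint G m) u" using u by (auto simp: emod_def)
  then show ?thesis by blast
qed

lemma card_Kint_le:
  assumes fin: "finite (rcosets\<^bsub>G\<^esub> (Kint G m))" "finite (rcosets\<^bsub>D\<^esub> (Kint D m))"
    and eq: "finite_quotient_classes D = finite_quotient_classes G"
  shows "card (rcosets\<^bsub>G\<^esub> (Kint G m)) \<le> card (rcosets\<^bsub>D\<^esub> (Kint D m))"
proof -
  obtain u where u: "emod D G (Kint G m) u" using ex_emod_Kint[OF fin(1) eq] by blast
  define P where "P = {x \<in> carrier D. u x \<in> Kint G m}"
  have P: "P \<lhd> D" "card (rcosets\<^bsub>D\<^esub> P) = card (rcosets\<^bsub>G\<^esub> (Kint G m))"
    using emod_preimage[OF u G.Kint_normal] by (simp_all add: P_def)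
  have KP: "Kint D m \<subseteq> P" unfolding P_def by (rule emod_Kint[OF u])
  interpret P: normal P D by (rule P)
  interpret K: normal "Kint D m" D by (rule D.Kint_normal)
  have "card (rcosets\<^bsub>D\<^esub> P) \<le> card (rcosets\<^bsub>D\<^esub> (Kint D m))"
    using fin(2) unfolding RCOSETS_image
    by (rule finite_image_factor(2)) (use KP in \<open>simp add: P.rcoset_eq_iff K.rcoset_eq_iff subset_iff\<close>)
  then show ?thesis using P(2) by simp
qed

text \<open>Exchanging \<open>D\<close> and \<open>G\<close> in \<open>card_Kint_le\<close> shows
  that both quotients have the same finite order, so the epimorphism induced on
  \<open>D / Kint D m\<close> is injective. This exactness of the kernel later makes the
  approximations cofinal in \<open>D\<close>.\<close>

lemma emod_Kint_eq:
  assumes fin: "finite (rcosets\<^bsub>G\<^esub> (Kint G m))" "finite (rcosets\<^bsub>D\<^esub> (Kint D m))"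
    and eq: "finite_quotient_classes D = finite_quotient_classes G"
    and u: "emod D G (Kint G m) u"
  shows "{x \<in> carrier D. u x \<in> Kint G m} = Kint D m"
proof -
  define P where "P = {x \<in> carrier D. u x \<in> Kint G m}"
  have P: "P \<lhd> D" "card (rcosets\<^bsub>D\<^esub> P) = card (rcosets\<^bsub>G\<^esub> (Kint G m))"
    using emod_preimage[OF u G.Kint_normal] by (simp_all add: P_def)
  have KP: "Kint D m \<subseteq> P" unfolding P_def by (rule emod_Kint[OF u])
  interpret P: normal P D by (rule P)
  interpret K: normal "Kint D m" D by (rule D.Kint_normal)
  have "two_groups G D" by unfold_locales
  then have cle: "card (rcosets\<^bsub>D\<^esub> (Kint D m)) \<le> card (rcosets\<^bsub>D\<^esub> P)"
    unfolding P(2) by (rule two_groups.card_Kint_le[OF _ fin(2,1) eq[symmetric]])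
  obtain g where g: "(\<lambda>x. P #>\<^bsub>D\<^esub> x) ` carrier D = g ` (\<lambda>x. Kint D m #>\<^bsub>D\<^esub> x) ` carrier D"
    and gx: "\<And>x. x \<in> carrier D \<Longrightarrow> P #>\<^bsub>D\<^esub> x = g (Kint D m #>\<^bsub>D\<^esub> x)"
  proof (rule image_factor[of "carrier D" "\<lambda>x. Kint D m #>\<^bsub>D\<^esub> x" "\<lambda>x. P #>\<^bsub>D\<^esub> x"])
    fix x y assume "x \<in> carrier D" "y \<in> carrier D" "Kint D m #>\<^bsub>D\<^esub> x = Kint D m #>\<^bsub>D\<^esub> y"
    then show "P #>\<^bsub>D\<^esub> x = P #>\<^bsub>D\<^esub> y" using KP P.rcoset_eq_iff K.rcoset_eq_iff by blast
  qed (rule that)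
  have "inj_on g (rcosets\<^bsub>D\<^esub> (Kint D m))"
  proof (rule eq_card_imp_inj_on[OF fin(2)])
    have e: "g ` (rcosets\<^bsub>D\<^esub> (Kint D m)) = rcosets\<^bsub>D\<^esub> P" unfolding RCOSETS_image by (rule g[symmetric])
    have "card (rcosets\<^bsub>D\<^esub> P) \<le> card (rcosets\<^bsub>D\<^esub> (Kint D m))"
      using card_image_le[OF fin(2), of g] unfolding e .
    then show "card (g ` (rcosets\<^bsub>D\<^esub> (Kint D m))) = card (rcosets\<^bsub>D\<^esub> (Kint D m))"
      unfolding e using cle by (rule le_antisym)
  qed
  have "P \<subseteq> Kint D m"
  proof
    fix x assume x: "x \<in> P"
    then have xD: "x \<in> carrier D" unfolding P_def by blast
    have x1: "x \<otimes>\<^bsub>D\<^esub> inv\<^bsub>D\<^esub> \<one>\<^bsub>D\<^esub> = x" using xD by simp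
    have "P #>\<^bsub>D\<^esub> x = P #>\<^bsub>D\<^esub> \<one>\<^bsub>D\<^esub>" using P.rcoset_eq_iff[OF xD D.one_closed] x x1 by simp
    then have "g (Kint D m #>\<^bsub>D\<^esub> x) = g (Kint D m #>\<^bsub>D\<^esub> \<one>\<^bsub>D\<^esub>)" using gx xD by simp
    then have "Kint D m #>\<^bsub>D\<^esub> x = Kint D m #>\<^bsub>D\<^esub> \<one>\<^bsub>D\<^esub>"
      by (rule inj_onD[OF \<open>inj_on g _\<close>]) (use xD in \<open>auto simp: RCOSETS_image\<close>)
    then show "x \<in> Kint D m" using K.rcoset_eq_iff[OF xD D.one_closed] x1 by simp
  qed
  then show ?thesis using KP unfolding P_def by blast
qed

lemma hom_agree_generate:
  assumes "f \<in> hom D G" "g \<in> hom D G" "S \<subseteq> carrier D" "\<And>s. s \<in> S \<Longrightarrow> f s = g s" "x \<in> generate D S"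
  shows "f x = g x"
proof -
  interpret f: group_hom D G f by unfold_locales (rule assms)
  interpret g: group_hom D G g by unfold_locales (rule assms)
  have SD: "generate D S \<subseteq> carrier D" by (rule D.generate_incl[OF assms(3)])
  from assms(5) show ?thesis
  proof (induction x rule: generate.induct)
    case (inv h)
    then show ?case using assms(3,4) by (simp add: subset_iff)
  next
    case (eng a b)
    then have "a \<in> carrier D" "b \<in> carrier D" using SD by blast+
    then show ?case using eng.IH by simp
  qed (use assms(4) in auto)
qed

end

text \<open>Modulo \<open>Kint G j\<close> a homomorphism is determined by its values on the finite
  set \<open>S\<close>, so finitely many are possible. A diagonal subsequence makes the given
  epimorphisms eventually agree modulo each \<open>Kint G j\<close>.\<close>

lemma coherent_lifts:
  fixes D :: "('a, 'm) monoid_scheme" and G :: "('b, 'k) monoid_scheme"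
  assumes D: "finitely_generated_group D" and G: "finitely_generated_group G"
    and eq: "finite_quotient_classes D = finite_quotient_classes G"
  obtains U where "\<And>j. emod D G (Kint G j) (U j)"
    "\<And>j x. x \<in> carrier D \<Longrightarrow> U j x \<in> Kint G j \<longleftrightarrow> x \<in> Kint D j"
    "\<And>j k x. \<lbrakk>j \<le> k; x \<in> carrier D\<rbrakk> \<Longrightarrow> U k x \<otimes>\<^bsub>G\<^esub> inv\<^bsub>G\<^esub> U j x \<in> Kint G j"
proof -
  obtain S where S: "finite S" "S \<subseteq> carrier D" "generate D S = carrier D"
    using D by (auto simp: finitely_generated_group_def)
  obtain S' where S': "finite S'" "S' \<subseteq> carrier G" "generate G S' = carrier G"
    using G by (auto simp: finitely_generated_group_def)
  interpret D: group D using D by (simp add: finitely_generated_group_def)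
  interpret G: group G using G by (simp add: finitely_generated_group_def)
  interpret two_groups D G by unfold_locales
  have finD: "finite (rcosets\<^bsub>D\<^esub> (Kint D m))" for m by (rule D.finite_index_Kint[OF S])
  have finG: "finite (rcosets\<^bsub>G\<^esub> (Kint G m))" for m by (rule G.finite_index_Kint[OF S'])
  have "\<exists>u. emod D G (Kint G m) u" for m by (rule ex_emod_Kint[OF finG eq])
  then obtain u where u: "\<And>m. emod D G (Kint G m) (u m)" by metis
  have uj: "emod D G (Kint G j) (u m)" if "j \<le> m" for j m
    by (rule emod_mono[OF u G.Kint_normal G.Kint_normal Kint_antimono[OF that]])
  define P where "P j r \<longleftrightarrow> (\<forall>a b. j \<le> r a \<longrightarrow> j \<le> r b \<longrightarrow> (\<forall>s\<in>S. Kint G j #>\<^bsub>G\<^esub> u (r a) s = Kint G j #>\<^bsub>G\<^esub> u (r b) s))" for j and r :: "nat \<Rightarrow> nat"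
  interpret subseqs P
  proof
    fix j and r :: "nat \<Rightarrow> nat"
    define F where "F a = (\<lambda>s\<in>S. Kint G j #>\<^bsub>G\<^esub> u (r a) s)" for a
    have uc: "u m s \<in> carrier G" if "s \<in> S" for m s using u[of m] that S(2) by (auto simp: emod_def)
    have "F ` UNIV \<subseteq> PiE S (\<lambda>_. rcosets\<^bsub>G\<^esub> (Kint G j))" using uc by (auto simp: F_def RCOSETS_image)
    moreover have "finite (PiE S (\<lambda>_. rcosets\<^bsub>G\<^esub> (Kint G j)))" by (rule finite_PiE[OF S(1) finG])
    ultimately have "finite (F ` UNIV)" by (rule finite_subset)
    then obtain a0 where a0: "infinite {a. F a = F a0}"
      using pigeonhole_infinite[of UNIV F] by auto
    define r' where "r' = enumerate {a. F a = F a0}"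
    have "strict_mono r'" unfolding r'_def by (rule strict_mono_enumerate[OF a0])
    moreover have "P j (r \<circ> r')"
    proof -
      have "F (r' a) = F a0" for a using enumerate_in_set[OF a0, of a] by (simp add: r'_def)
      then have "F (r' a) s = F (r' b) s" for a b s by simp
      then have "Kint G j #>\<^bsub>G\<^esub> u (r (r' a)) s = Kint G j #>\<^bsub>G\<^esub> u (r (r' b)) s" if "s \<in> S" for a b s
        unfolding F_def restrict_def using that by presburger
      then show ?thesis unfolding P_def comp_def by blast
    qed
    ultimately show "\<exists>r'. strict_mono r' \<and> P j (r \<circ> r')" by blast
  qed
  have dP: "P j (diagseq \<circ> (+) (Suc j))" for j
  proof (rule diagseq_holds)
    show "P n (s \<circ> r)" if "P n s" for r s n using that unfolding P_def comp_def by blast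
  qed
  have dge: "a \<le> diagseq a" for a by (rule seq_suble[OF subseq_diagseq])
  have dP': "Kint G j #>\<^bsub>G\<^esub> u (diagseq (Suc j + a)) s = Kint G j #>\<^bsub>G\<^esub> u (diagseq (Suc j + b)) s" if "s \<in> S" for j a b s
  proof -
    have "j \<le> diagseq (Suc j + c)" for c using le_trans[OF _ dge[of "Suc j + c"], of j] by linarith
    then show ?thesis using dP[of j] that unfolding P_def comp_def by blast
  qed
  \<comment> \<open>The diagonal sequence is constant modulo \<open>Kint G j\<close> from index
    \<open>Suc j\<close> on.\<close>
  define U where "U j = u (diagseq (Suc j))" for j
  have Ue: "emod D G (Kint G j) (U j)" for j
    unfolding U_def by (rule uj) (use dge[of "Suc j"] in simp)
  have Uk: "emod D G (Kint G j) (U k)" if "j \<le> k" for j k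
    by (rule emod_mono[OF Ue G.Kint_normal G.Kint_normal Kint_antimono[OF that]])
  have coh: "U k x \<otimes>\<^bsub>G\<^esub> inv\<^bsub>G\<^esub> U j x \<in> Kint G j" if jk: "j \<le> k" and x: "x \<in> carrier D" for j k x
  proof -
    interpret K: normal "Kint G j" G by (rule G.Kint_normal)
    interpret Q: group "G Mod Kint G j" by (rule K.factorgroup_is_group)
    interpret DQ: two_groups D "G Mod Kint G j" by unfold_locales
    have "Kint G j #>\<^bsub>G\<^esub> U k x = Kint G j #>\<^bsub>G\<^esub> U j x"
    proof (rule DQ.hom_agree_generate[of "\<lambda>x. Kint G j #>\<^bsub>G\<^esub> U k x" "\<lambda>x. Kint G j #>\<^bsub>G\<^esub> U j x" S])
      show "(\<lambda>x. Kint G j #>\<^bsub>G\<^esub> U k x) \<in> hom D (G Mod Kint G j)" using Uk[OF jk] by (simp add: emod_def)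
      show "(\<lambda>x. Kint G j #>\<^bsub>G\<^esub> U j x) \<in> hom D (G Mod Kint G j)" using Ue by (simp add: emod_def)
      fix s assume s: "s \<in> S"
      have "Suc j + (k - j) = Suc k" "Suc j + 0 = Suc j" using jk by auto
      then show "Kint G j #>\<^bsub>G\<^esub> U k s = Kint G j #>\<^bsub>G\<^esub> U j s" using dP'[OF s, of j "k - j" 0] unfolding U_def by metis
    qed (use S x in auto)
    then show ?thesis using Ue[of k] Ue[of j] x by (simp add: K.rcoset_eq_iff emod_def Pi_iff)
  qed
  have ker: "U j x \<in> Kint G j \<longleftrightarrow> x \<in> Kint D j" if "x \<in> carrier D" for j x
    using emod_Kint_eq[OF finG finD eq Ue, of j] that by blast
  show ?thesis by (rule that[of U, OF Ue ker coh])
qed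

section \<open>Finite quotients of the lamplighter group\<close>

lemma monom_cong_ideal2: "i mod s = j mod s \<Longrightarrow> monom c i - monom c j \<in> ideal2 q s"
proof -
  have *: "monom c i - monom c (i mod s) \<in> ideal2 q s" for i
  proof -
    have "s dvd s * (i div s)" by simp
    then obtain e where e: "monom 1 (s * (i div s)) - (1::int poly) = (monom 1 s - 1) * e"
      using cyclotomic_dvd by (auto simp: dvd_def)
    have "monom c i - monom c (i mod s) = monom c (i mod s) * (monom 1 (s * (i div s)) - 1)"
      by (simp add: algebra_simps mult_monom)
    also have "\<dots> = (monom 1 s - 1) * (e * monom c (i mod s))" by (simp only: e mult_ac)
    finally show ?thesis by (simp only: ideal2_cyc)
  qed
  assume "i mod s = j mod s"
  then show ?thesis using ideal2_trans[OF *[of i, unfolded \<open>i mod s = j mod s\<close>] ideal2_sym[OF *[of j]]] by simp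
qed

text \<open>For \<open>c < s\<close> this is the coefficient of \<open>X^c\<close> after reduction
  modulo \<open>X^s - 1\<close>. It turns membership in \<open>(q, X^s - 1)\<close> into
  \<open>s\<close> divisibility conditions.\<close>

definition class_sum :: "nat \<Rightarrow> nat \<Rightarrow> int poly \<Rightarrow> int"
  where "class_sum s c p = (\<Sum>i\<le>degree p. if i mod s = c then coeff p i else 0)"

lemma class_sum_bound:
  assumes "degree p \<le> N" shows "class_sum s c p = (\<Sum>i\<le>N. if i mod s = c then coeff p i else 0)"
  unfolding class_sum_def by (rule sum.mono_neutral_left) (use assms in \<open>auto simp: coeff_eq_0\<close>)

lemma class_sum_add: "class_sum s c (p + q) = class_sum s c p + class_sum s c q"
proof -
  define N where "N = max (degree (p + q)) (max (degree p) (degree q))"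
  have "degree (p + q) \<le> N" "degree p \<le> N" "degree q \<le> N" by (auto simp: N_def)
  then show ?thesis unfolding class_sum_bound[OF \<open>degree (p + q) \<le> N\<close>] class_sum_bound[OF \<open>degree p \<le> N\<close>]
      class_sum_bound[OF \<open>degree q \<le> N\<close>] sum.distrib[symmetric]
    by (intro sum.cong) auto
qed

lemma class_sum_monom: "class_sum s c (monom a i) = (if i mod s = c then a else 0)"
proof -
  have "class_sum s c (monom a i) = (\<Sum>j\<le>i. if j = i then (if i mod s = c then a else 0) else 0)"
    unfolding class_sum_bound[OF degree_monom_le] by (rule sum.cong) auto
  then show ?thesis by simp
qed

lemma class_sum_0: "class_sum s c 0 = 0"
  using class_sum_add[of s c 0 0] by simp

lemma class_sum_sum: "class_sum s c (\<Sum>x\<in>A. p x) = (\<Sum>x\<in>A. class_sum s c (p x))"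
  by (induction A rule: infinite_finite_induct) (simp_all add: class_sum_add class_sum_0)

lemma class_sum_ideal2:
  assumes "p \<in> ideal2 q s" shows "q dvd class_sum s c p"
proof -
  obtain a b where p: "p = [:q:] * a + (monom 1 s - 1) * b" using assms by (rule ideal2E)
  have "class_sum s c ([:q:] * a) = q * class_sum s c a"
    by (simp add: class_sum_bound[of _ "degree a"] degree_smult_le sum_distrib_left if_distrib cong: if_cong)
  moreover have "class_sum s c ((monom 1 s - 1) * b) = 0"
  proof -
    have b: "b = (\<Sum>i\<le>degree b. monom (coeff b i) i)" by (simp add: poly_as_sum_of_monoms)
    have "(monom 1 s - 1) * b = (\<Sum>i\<le>degree b. monom (coeff b i) (s + i) + monom (- coeff b i) i)"
      by (subst b) (simp add: sum_distrib_left algebra_simps mult_monom minus_monom[symmetric])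
    then show ?thesis
      by (simp only: class_sum_sum class_sum_add class_sum_monom) (rule sum.neutral, auto)
  qed
  ultimately show ?thesis by (simp only: p class_sum_add) simp
qed

lemma ideal2_class_sum:
  assumes s: "s > 0" and "\<And>c. c < s \<Longrightarrow> q dvd class_sum s c p" shows "p \<in> ideal2 q s"
proof -
  define r where "r = (\<Sum>c<s. monom (class_sum s c p) c)"
  have "(\<Sum>i\<in>A. monom (a i) i) - (\<Sum>i\<in>A. monom (a i) (i mod s)) \<in> ideal2 q s" if "finite A" for A and a :: "nat \<Rightarrow> int"
    using that
  proof (induction A rule: finite_induct)
    case (insert i A)
    then show ?case using ideal2_add[OF monom_cong_ideal2[of i s "i mod s" "a i" q] insert.IH]
      by (simp add: algebra_simps)
  qed simp
  then have "p - (\<Sum>i\<le>degree p. monom (coeff p i) (i mod s)) \<in> ideal2 q s"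
    by (metis finite_atMost poly_as_sum_of_monoms)
  also have "(\<Sum>i\<le>degree p. monom (coeff p i) (i mod s)) = r"
  proof -
    have "(\<Sum>i\<le>degree p. monom (coeff p i) (i mod s)) = (\<Sum>i\<le>degree p. \<Sum>c<s. if i mod s = c then monom (coeff p i) c else 0)"
      by (rule sum.cong) (use s in auto)
    also have "\<dots> = (\<Sum>c<s. \<Sum>i\<le>degree p. if i mod s = c then monom (coeff p i) c else 0)" by (rule sum.swap)
    also have "\<dots> = r"
      unfolding r_def class_sum_def monom_sum by (intro sum.cong refl) auto
    finally show ?thesis .
  qed
  finally have "p - r \<in> ideal2 q s" .
  moreover have "r \<in> ideal2 q s"
  proof -
    have "[:q:] dvd r"
      unfolding r_def by (rule dvd_sum) (use assms in \<open>auto simp: const_poly_dvd_iff\<close>)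
    then show ?thesis by (auto simp: dvd_def intro: ideal2_const simp del: mult_pCons_left)
  qed
  ultimately show ?thesis using ideal2_cong by blast
qed

text \<open>The image in \<open>Z[X] / (X^s - 1)\<close> of the Laurent polynomial with coefficients
  \<open>a\<close>, each exponent being replaced by its residue below \<open>s\<close>.\<close>

definition wrap :: "nat \<Rightarrow> (int \<Rightarrow> int) \<Rightarrow> int poly"
  where "wrap s a = (\<Sum>x | a x \<noteq> 0. monom (a x) (nat (x mod int s)))"

lemma wrap_superset:
  assumes "finite A" "\<And>x. a x \<noteq> 0 \<Longrightarrow> x \<in> A"
  shows "wrap s a = (\<Sum>x\<in>A. monom (a x) (nat (x mod int s)))"
  unfolding wrap_def using assms by (intro sum.mono_neutral_left) auto

text \<open>This is the multiplication of the wreath product in one lamp coordinate, seen at level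
  \<open>s\<close>.\<close>

lemma wrap_add_shift:
  assumes s: "s > 0" and a: "finite {x. a x \<noteq> 0}" and b: "finite {x. b x \<noteq> 0}"
  shows "wrap s (\<lambda>x. a x + b (x - k)) - (wrap s a + monom 1 (nat (k mod int s)) * wrap s b) \<in> ideal2 (int s) s"
proof -
  define A where "A = {x. a x \<noteq> 0}"
  define B where "B = {x. b x \<noteq> 0}"
  define C where "C = A \<union> (\<lambda>x. x + k) ` B"
  have C: "finite C" using a b by (simp add: C_def A_def B_def)
  have 1: "wrap s (\<lambda>x. a x + b (x - k)) = (\<Sum>x\<in>C. monom (a x) (nat (x mod int s))) + (\<Sum>x\<in>C. monom (b (x - k)) (nat (x mod int s)))"
  proof -
    have "x \<in> C" if "a x + b (x - k) \<noteq> 0" for x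
    proof (cases "a x = 0")
      case True
      then have "x - k \<in> B" using that by (simp add: B_def)
      then have "x - k + k \<in> (\<lambda>x. x + k) ` B" by (rule imageI)
      then show ?thesis by (simp add: C_def)
    qed (simp add: C_def A_def)
    then show ?thesis using wrap_superset[OF C, of "\<lambda>x. a x + b (x - k)"] by (simp add: sum.distrib add_monom[symmetric])
  qed
  have 2: "wrap s a = (\<Sum>x\<in>C. monom (a x) (nat (x mod int s)))"
    by (rule wrap_superset[OF C]) (simp add: C_def A_def)
  have 3: "(\<Sum>x\<in>C. monom (b (x - k)) (nat (x mod int s))) = (\<Sum>y\<in>B. monom (b y) (nat ((y + k) mod int s)))"
  proof -
    have "(\<Sum>x\<in>C. monom (b (x - k)) (nat (x mod int s))) = (\<Sum>x\<in>(\<lambda>x. x + k) ` B. monom (b (x - k)) (nat (x mod int s)))"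
    proof (rule sum.mono_neutral_right[OF C])
      show "\<forall>x\<in>C - (\<lambda>x. x + k) ` B. monom (b (x - k)) (nat (x mod int s)) = 0"
      proof
        fix x assume x: "x \<in> C - (\<lambda>x. x + k) ` B"
        have "x - k \<notin> B"
        proof
          assume "x - k \<in> B"
          then have "x - k + k \<in> (\<lambda>x. x + k) ` B" by (rule imageI)
          then show False using x by simp
        qed
        then show "monom (b (x - k)) (nat (x mod int s)) = 0" by (simp add: B_def)
      qed
    qed (auto simp: C_def)
    also have "\<dots> = (\<Sum>y\<in>B. monom (b y) (nat ((y + k) mod int s)))"
      by (subst sum.reindex) (auto simp: inj_on_def)
    finally show ?thesis .
  qed
  have 4: "(\<Sum>y\<in>Y. monom (b y) (nat ((y + k) mod int s))) - monom 1 (nat (k mod int s)) * (\<Sum>y\<in>Y. monom (b y) (nat (y mod int s))) \<in> ideal2 (int s) s"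
    if "finite Y" for Y
    using that
  proof (induction Y rule: finite_induct)
    case (insert y Y)
    have "nat ((y + k) mod int s) mod s = (nat (k mod int s) + nat (y mod int s)) mod s"
    proof -
      have "int (nat ((y + k) mod int s) mod s) = int ((nat (k mod int s) + nat (y mod int s)) mod s)"
        using s by (simp add: zmod_int mod_simps add.commute)
      then show ?thesis by (simp only: of_nat_eq_iff)
    qed
    then have "monom (b y) (nat ((y + k) mod int s)) - monom (b y) (nat (k mod int s) + nat (y mod int s)) \<in> ideal2 (int s) s"
      by (rule monom_cong_ideal2)
    then show ?case using ideal2_add[OF _ insert.IH, of "monom (b y) (nat ((y + k) mod int s)) - monom (b y) (nat (k mod int s) + nat (y mod int s))"] insert.hyps
      by (simp add: algebra_simps mult_monom)
  qed simp
  have 5: "wrap s b = (\<Sum>y\<in>B. monom (b y) (nat (y mod int s)))" by (simp add: wrap_def B_def)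
  show ?thesis using 4[OF b[folded B_def]] by (simp add: 1 2 3 5)
qed

lemma wrap_cong_dvd:
  assumes s: "s > 0" "s dvd s'" "s' > 0" and a: "finite {x. a x \<noteq> 0}"
  shows "wrap s' a - wrap s a \<in> ideal2 (int s) s"
proof -
  have "(\<Sum>x\<in>A. monom (a x) (nat (x mod int s'))) - (\<Sum>x\<in>A. monom (a x) (nat (x mod int s))) \<in> ideal2 (int s) s" if "finite A" for A
    using that
  proof (induction A rule: finite_induct)
    case (insert x A)
    have "int (nat (x mod int s') mod s) = int (nat (x mod int s) mod s)"
      using s by (simp add: zmod_int mod_mod_cancel)
    then have "nat (x mod int s') mod s = nat (x mod int s) mod s" by (simp only: of_nat_eq_iff)
    then have "monom (a x) (nat (x mod int s')) - monom (a x) (nat (x mod int s)) \<in> ideal2 (int s) s"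
      by (rule monom_cong_ideal2)
    from ideal2_add[OF this insert.IH] show ?case using insert.hyps by (simp add: algebra_simps)
  qed simp
  then show ?thesis using a by (simp add: wrap_def)
qed

lemma class_sum_wrap:
  assumes s: "s > 0" and c: "c < s" and A: "finite A" "\<And>x. a x \<noteq> 0 \<Longrightarrow> x \<in> A"
  shows "class_sum s c (wrap s a) = (\<Sum>x\<in>A. if x mod int s = int c then a x else 0)"
proof -
  have "wrap s a = (\<Sum>x\<in>A. monom (a x) (nat (x mod int s)))" by (rule wrap_superset[OF A])
  then have "class_sum s c (wrap s a) = (\<Sum>x\<in>A. if nat (x mod int s) mod s = c then a x else 0)"
    by (simp only: class_sum_sum class_sum_monom)
  also have "\<dots> = (\<Sum>x\<in>A. if x mod int s = int c then a x else 0)"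
  proof (rule sum.cong)
  fix x
  have "nat (x mod int s) mod s = nat (x mod int s)"
    using s by (simp add: nat_less_iff)
  then show "(if nat (x mod int s) mod s = c then a x else 0) = (if x mod int s = int c then a x else 0)"
    using s by auto
  qed simp
  finally show ?thesis .
qed

section \<open>Coordinates on the lamplighter group and its finite quotients\<close>

definition base :: "nat \<Rightarrow> (int \<Rightarrow> nat \<Rightarrow> int) \<Rightarrow> bool"
  where "base n f \<longleftrightarrow> (\<forall>i<n. finite {x. f x i \<noteq> 0})"

text \<open>Base elements take values in extensional functions on \<open>{..<n}\<close>.
  \<open>emb\<close> normalizes an arbitrary function to this form, so that calculations can ignore
  the coordinates outside.\<close>

definition emb :: "nat \<Rightarrow> (int \<Rightarrow> nat \<Rightarrow> int) \<Rightarrow> int \<Rightarrow> nat \<Rightarrow> int"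
  where "emb n f = (\<lambda>x. \<lambda>i\<in>{..<n}. f x i)"

lemma lamplighter_carrier:
  "carrier (lamplighter_group n) = {(f, k). (\<forall>x. f x \<in> extensional {..<n}) \<and> base n f}"
proof -
  have "finite {x. f x \<noteq> (\<lambda>i\<in>{..<n}. 0)} \<longleftrightarrow> base n f" if "\<forall>x. f x \<in> extensional {..<n}" for f :: "int \<Rightarrow> nat \<Rightarrow> int"
  proof -
    have "{x. f x \<noteq> (\<lambda>i\<in>{..<n}. 0)} = (\<Union>i<n. {x. f x i \<noteq> 0})"
      using that by (auto simp: fun_eq_iff extensional_def)
    then show ?thesis by (auto simp: base_def)
  qed
  then show ?thesis
    by (auto simp: lamplighter_group_def restricted_wreath_product_def semidirect_product_def carrier_sum_group PiE_def)
qed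

lemma lamplighter_mult:
  "(f, k) \<otimes>\<^bsub>lamplighter_group n\<^esub> (g, l) = (emb n (\<lambda>x i. f x i + g (x - k) i), k + l)"
  by (simp add: lamplighter_group_def restricted_wreath_product_def semidirect_product_def wreath_shift_def emb_def fun_eq_iff)

lemma lamplighter_one: "\<one>\<^bsub>lamplighter_group n\<^esub> = (emb n (\<lambda>x i. 0), 0)"
  by (simp add: lamplighter_group_def restricted_wreath_product_def semidirect_product_def emb_def fun_eq_iff)

lemma emb_apply: "i < n \<Longrightarrow> emb n f x i = f x i"
  by (simp add: emb_def)

lemma emb_cong: "(\<And>x i. i < n \<Longrightarrow> f x i = g x i) \<Longrightarrow> emb n f = emb n g"
  by (auto simp: emb_def fun_eq_iff)

lemma emb_id: "(\<And>x. f x \<in> extensional {..<n}) \<Longrightarrow> emb n f = f"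
  by (auto simp: emb_def fun_eq_iff extensional_def)

lemma base_emb: "base n (emb n f) \<longleftrightarrow> base n f"
  by (auto simp: base_def emb_apply)

lemma emb_carrier: "base n f \<Longrightarrow> (emb n f, k) \<in> carrier (lamplighter_group n)"
  by (simp add: lamplighter_carrier base_emb) (simp add: emb_def)

lemma lamplighter_emb_mult:
  "(emb n f, k) \<otimes>\<^bsub>lamplighter_group n\<^esub> (emb n g, l) = (emb n (\<lambda>x i. f x i + g (x - k) i), k + l)"
  unfolding lamplighter_mult by (simp add: emb_apply cong: emb_cong)

lemma carrierE:
  assumes "z \<in> carrier (lamplighter_group n)" obtains f k where "z = (emb n f, k)" "base n f"
  using assms emb_id by (auto simp: lamplighter_carrier) metis

lemma base_add: "base n f \<Longrightarrow> base n g \<Longrightarrow> base n (\<lambda>x i. f x i + g x i)"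
  unfolding base_def
proof (intro allI impI)
  fix i assume f: "\<forall>i<n. finite {x. f x i \<noteq> 0}" and g: "\<forall>i<n. finite {x. g x i \<noteq> 0}" and i: "i < n"
  show "finite {x. f x i + g x i \<noteq> 0}"
    by (rule finite_subset[of _ "{x. f x i \<noteq> 0} \<union> {x. g x i \<noteq> 0}"]) (use f g i in auto)
qed

lemma base_shift: "base n f \<Longrightarrow> base n (\<lambda>x i. f (x - k) i)"
proof -
  assume "base n f"
  moreover have "{x. f (x - k) i \<noteq> 0} = (\<lambda>x. x + k) ` {x. f x i \<noteq> 0}" for i
  proof (intro equalityI subsetI)
    fix x assume "x \<in> {x. f (x - k) i \<noteq> 0}"
    then show "x \<in> (\<lambda>x. x + k) ` {x. f x i \<noteq> 0}" by (intro image_eqI[of _ _ "x - k"]) auto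
  qed auto
  ultimately show ?thesis by (simp add: base_def)
qed

definition wrap_mod :: "nat \<Rightarrow> (int \<Rightarrow> nat \<Rightarrow> int) \<times> int \<Rightarrow> nat \<Rightarrow> int poly"
  where "wrap_mod s z i = wrap s (\<lambda>x. fst z x i)"

text \<open>The kernel of the reduction onto the semidirect product of
  \<open>(Z[X] / (s, X^s - 1))^n\<close> with \<open>Z/s\<close>.\<close>

definition Lker :: "nat \<Rightarrow> nat \<Rightarrow> ((int \<Rightarrow> nat \<Rightarrow> int) \<times> int) set"
  where "Lker n s = {z \<in> carrier (lamplighter_group n). int s dvd snd z \<and> (\<forall>i<n. wrap_mod s z i \<in> ideal2 (int s) s)}"

context
  fixes n :: nat
begin

interpretation G: group "lamplighter_group n" by (rule group_lamplighter_group)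

abbreviation "\<Gamma> \<equiv> lamplighter_group n"

lemma snd_mult: "snd (y \<otimes>\<^bsub>\<Gamma>\<^esub> z) = snd y + snd z"
  by (cases y, cases z) (simp add: lamplighter_mult)

lemma wrap_mod_mult:
  assumes "s > 0" "i < n" "y \<in> carrier \<Gamma>" "z \<in> carrier \<Gamma>"
  shows "wrap_mod s (y \<otimes>\<^bsub>\<Gamma>\<^esub> z) i - (wrap_mod s y i + monom 1 (nat (snd y mod int s)) * wrap_mod s z i) \<in> ideal2 (int s) s"
proof -
  obtain f k where y: "y = (f, k)" "base n f" using assms by (cases y) (auto simp: lamplighter_carrier)
  obtain g l where z: "z = (g, l)" "base n g" using assms by (cases z) (auto simp: lamplighter_carrier)
  show ?thesis
    using wrap_add_shift[OF assms(1), of "\<lambda>x. f x i" "\<lambda>x. g x i" k] y z assms(2)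
    by (simp add: wrap_mod_def lamplighter_mult emb_apply base_def)
qed

lemma wrap_mod_mult0:
  assumes "s > 0" "i < n" "y \<in> carrier \<Gamma>" "z \<in> carrier \<Gamma>" "int s dvd snd y"
  shows "wrap_mod s (y \<otimes>\<^bsub>\<Gamma>\<^esub> z) i - (wrap_mod s y i + wrap_mod s z i) \<in> ideal2 (int s) s"
proof -
  have "snd y mod int s = 0" using assms(5) by simp
  then show ?thesis using wrap_mod_mult[OF assms(1-4)] by (simp add: monom_0 flip: one_pCons)
qed

lemma snd_inv: "y \<in> carrier \<Gamma> \<Longrightarrow> snd (inv\<^bsub>\<Gamma>\<^esub> y) = - snd y"
  using snd_mult[of y "inv\<^bsub>\<Gamma>\<^esub> y"] by (simp add: lamplighter_one)

lemma wrap_mod_one: "i < n \<Longrightarrow> wrap_mod s \<one>\<^bsub>\<Gamma>\<^esub> i = 0"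
  by (simp add: wrap_mod_def lamplighter_one emb_apply wrap_def)

lemma Lker_coset:
  assumes s: "s > 0" and yz: "y \<in> carrier \<Gamma>" "z \<in> carrier \<Gamma>"
  shows "y \<otimes>\<^bsub>\<Gamma>\<^esub> inv\<^bsub>\<Gamma>\<^esub> z \<in> Lker n s \<longleftrightarrow>
    int s dvd snd y - snd z \<and> (\<forall>i<n. wrap_mod s y i - wrap_mod s z i \<in> ideal2 (int s) s)"
proof -
  define w where "w = y \<otimes>\<^bsub>\<Gamma>\<^esub> inv\<^bsub>\<Gamma>\<^esub> z"
  have w: "w \<in> carrier \<Gamma>" "y = w \<otimes>\<^bsub>\<Gamma>\<^esub> z" using yz by (simp_all add: w_def G.m_assoc)
  have sw: "snd w = snd y - snd z" using yz by (simp add: w_def snd_mult snd_inv)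
  show ?thesis
  proof (cases "int s dvd snd w")
    case True
    have "wrap_mod s w i \<in> ideal2 (int s) s \<longleftrightarrow> wrap_mod s y i - wrap_mod s z i \<in> ideal2 (int s) s" if "i < n" for i
    proof (rule ideal2_cong)
      have "wrap_mod s y i - (wrap_mod s w i + wrap_mod s z i) \<in> ideal2 (int s) s"
        using wrap_mod_mult0[OF s that w(1) yz(2) True] w(2) by simp
      then show "wrap_mod s w i - (wrap_mod s y i - wrap_mod s z i) \<in> ideal2 (int s) s"
        using ideal2_uminus by (metis (no_types, lifting) add_diff_eq diff_diff_eq2 minus_diff_eq)
    qed
    then show ?thesis using True w(1) sw unfolding w_def[symmetric] Lker_def by simp
  next
    case False
    then show ?thesis using sw unfolding w_def[symmetric] Lker_def by simp
  qed
qed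

lemma Lker_normal:
  assumes s: "s > 0" shows "Lker n s \<lhd> \<Gamma>"
  unfolding G.normal_inv_iff
proof (intro conjI ballI G.subgroupI)
  have "\<one>\<^bsub>\<Gamma>\<^esub> \<in> Lker n s" by (simp add: Lker_def wrap_mod_one) (simp add: lamplighter_one)
  then show "Lker n s \<noteq> {}" by blast
  show "Lker n s \<subseteq> carrier \<Gamma>" by (auto simp: Lker_def)
next
  fix a assume a: "a \<in> Lker n s"
  then have aG: "a \<in> carrier \<Gamma>" by (simp add: Lker_def)
  have "\<one>\<^bsub>\<Gamma>\<^esub> \<otimes>\<^bsub>\<Gamma>\<^esub> inv\<^bsub>\<Gamma>\<^esub> a \<in> Lker n s"
    unfolding Lker_coset[OF s G.one_closed aG] using a ideal2_uminus
    by (auto simp: Lker_def wrap_mod_one) (simp add: lamplighter_one)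
  then show "inv\<^bsub>\<Gamma>\<^esub> a \<in> Lker n s" using aG by simp
next
  fix a b assume ab: "a \<in> Lker n s" "b \<in> Lker n s"
  then have abG: "a \<in> carrier \<Gamma>" "b \<in> carrier \<Gamma>" "int s dvd snd a" by (simp_all add: Lker_def)
  have "wrap_mod s (a \<otimes>\<^bsub>\<Gamma>\<^esub> b) i \<in> ideal2 (int s) s" if "i < n" for i
    using ideal2_cong[OF wrap_mod_mult0[OF s that abG]] ideal2_add ab that by (auto simp: Lker_def)
  then show "a \<otimes>\<^bsub>\<Gamma>\<^esub> b \<in> Lker n s" using ab by (auto simp: Lker_def snd_mult)
next
  fix x h assume x: "x \<in> carrier \<Gamma>" and h: "h \<in> Lker n s"
  then have hG: "h \<in> carrier \<Gamma>" "int s dvd snd h" by (simp_all add: Lker_def)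
  have xh: "x \<otimes>\<^bsub>\<Gamma>\<^esub> h \<in> carrier \<Gamma>" using x hG by simp
  show "x \<otimes>\<^bsub>\<Gamma>\<^esub> h \<otimes>\<^bsub>\<Gamma>\<^esub> inv\<^bsub>\<Gamma>\<^esub> x \<in> Lker n s"
    unfolding Lker_coset[OF s xh x]
  proof (intro conjI allI impI)
    show "int s dvd snd (x \<otimes>\<^bsub>\<Gamma>\<^esub> h) - snd x" using hG by (simp add: snd_mult)
    fix i assume i: "i < n"
    have "wrap_mod s (x \<otimes>\<^bsub>\<Gamma>\<^esub> h) i - (wrap_mod s x i + monom 1 (nat (snd x mod int s)) * wrap_mod s h i) \<in> ideal2 (int s) s"
      by (rule wrap_mod_mult[OF s i x hG(1)])
    moreover have "monom 1 (nat (snd x mod int s)) * wrap_mod s h i \<in> ideal2 (int s) s"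
      using h i by (intro ideal2_mult) (simp add: Lker_def)
    ultimately show "wrap_mod s (x \<otimes>\<^bsub>\<Gamma>\<^esub> h) i - wrap_mod s x i \<in> ideal2 (int s) s"
      using ideal2_add[of "wrap_mod s (x \<otimes>\<^bsub>\<Gamma>\<^esub> h) i - (wrap_mod s x i + monom 1 (nat (snd x mod int s)) * wrap_mod s h i)" "int s" s
        "monom 1 (nat (snd x mod int s)) * wrap_mod s h i"] by (simp add: algebra_simps)
  qed
qed

lemma Lker_finite_index:
  assumes s: "s > 0" shows "finite (rcosets\<^bsub>\<Gamma>\<^esub> (Lker n s))"
proof -
  interpret L: normal "Lker n s" \<Gamma> by (rule Lker_normal[OF s])
  define F where "F z = (snd z mod int s, \<lambda>i\<in>{..<n}. \<lambda>c\<in>{..<s}. class_sum s c (wrap_mod s z i) mod int s)" for z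
  have "F ` carrier \<Gamma> \<subseteq> {0..<int s} \<times> PiE {..<n} (\<lambda>_. PiE {..<s} (\<lambda>_. {0..<int s}))"
    using s by (auto simp: F_def)
  moreover have "finite ({0..<int s} \<times> PiE {..<n} (\<lambda>_. PiE {..<s} (\<lambda>_. {0..<int s})))" by (auto intro!: finite_PiE)
  ultimately have fin: "finite (F ` carrier \<Gamma>)" by (rule finite_subset)
  show ?thesis unfolding RCOSETS_image
  proof (rule finite_image_factor(1)[OF fin])
    fix y z assume yz: "y \<in> carrier \<Gamma>" "z \<in> carrier \<Gamma>" "F y = F z"
    have "wrap_mod s y i - wrap_mod s z i \<in> ideal2 (int s) s" if i: "i < n" for i
    proof (rule ideal2_class_sum[OF s])
      fix c assume c: "c < s"
      have "(\<lambda>i\<in>{..<n}. \<lambda>c\<in>{..<s}. class_sum s c (wrap_mod s y i) mod int s) i c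
          = (\<lambda>i\<in>{..<n}. \<lambda>c\<in>{..<s}. class_sum s c (wrap_mod s z i) mod int s) i c"
        using yz(3) unfolding F_def by (simp only: prod.inject)
      then have "class_sum s c (wrap_mod s y i) mod int s = class_sum s c (wrap_mod s z i) mod int s"
        using i c by simp
      moreover have "class_sum s c (wrap_mod s y i) = class_sum s c (wrap_mod s y i - wrap_mod s z i) + class_sum s c (wrap_mod s z i)"
        by (simp flip: class_sum_add)
      ultimately show "int s dvd class_sum s c (wrap_mod s y i - wrap_mod s z i)"
        by (metis add_diff_cancel_right' mod_eq_dvd_iff)
    qed
    moreover have "int s dvd snd y - snd z" using yz(3) by (simp add: F_def mod_eq_dvd_iff)
    ultimately have "y \<otimes>\<^bsub>\<Gamma>\<^esub> inv\<^bsub>\<Gamma>\<^esub> z \<in> Lker n s" using Lker_coset[OF s yz(1,2)] by blast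
    then show "Lker n s #>\<^bsub>\<Gamma>\<^esub> y = Lker n s #>\<^bsub>\<Gamma>\<^esub> z" using L.rcoset_eq_iff[OF yz(1,2)] by blast
  qed
qed

definition unit_at :: "int \<Rightarrow> nat \<Rightarrow> int \<Rightarrow> int \<Rightarrow> nat \<Rightarrow> int"
  where "unit_at y j m = (\<lambda>x i. if x = y \<and> i = j then m else 0)"

lemma base_unit: "base n (unit_at y j m)"
  unfolding base_def unit_at_def by (auto intro: finite_subset[of _ "{y}"])

lemma subgroup_sum:
  assumes H: "subgroup H \<Gamma>" and h: "\<And>a. a \<in> A \<Longrightarrow> (emb n (h a), 0) \<in> H"
  shows "(emb n (\<lambda>x i. \<Sum>a\<in>A. h a x i), 0) \<in> H"
  using h
proof (induction A rule: infinite_finite_induct)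
  case (insert a A)
  then have "(emb n (h a), 0) \<otimes>\<^bsub>\<Gamma>\<^esub> (emb n (\<lambda>x i. \<Sum>a\<in>A. h a x i), 0) \<in> H"
    using subgroup.m_closed[OF H] by simp
  then show ?case using insert.hyps by (simp add: lamplighter_emb_mult)
qed (use subgroup.one_closed[OF H] in \<open>simp_all add: lamplighter_one\<close>)

lemma unit_pow: "(emb n (unit_at y j m), 0) [^]\<^bsub>\<Gamma>\<^esub> (k::nat) = (emb n (unit_at y j (int k * m)), 0)"
proof (induction k)
  case 0
  then show ?case by (simp add: lamplighter_one) (rule emb_cong, simp add: unit_at_def)
next
  case (Suc k)
  then show ?case by (simp add: lamplighter_emb_mult) (rule emb_cong, simp add: unit_at_def algebra_simps)
qed

lemma unit_inv: "inv\<^bsub>\<Gamma>\<^esub> (emb n (unit_at y j m), 0) = (emb n (unit_at y j (- m)), 0)"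
proof (rule G.inv_equality)
  show "(emb n (unit_at y j (- m)), 0) \<otimes>\<^bsub>\<Gamma>\<^esub> (emb n (unit_at y j m), 0) = \<one>\<^bsub>\<Gamma>\<^esub>"
    by (simp add: lamplighter_emb_mult lamplighter_one) (rule emb_cong, simp add: unit_at_def)
qed (simp_all add: emb_carrier base_unit)

lemma unit_subgroup:
  assumes H: "subgroup H \<Gamma>" and u: "(emb n (unit_at y j q), 0) \<in> H" and q: "q dvd m"
  shows "(emb n (unit_at y j m), 0) \<in> H"
proof -
  obtain k where k: "m = q * k" using q by auto
  have pos: "(emb n (unit_at y j (int l * q)), 0) \<in> H" for l
  proof -
    have "(emb n (unit_at y j q), 0) [^]\<^bsub>\<Gamma>\<^esub> l \<in> H"
      by (induction l) (use subgroup.one_closed[OF H] subgroup.m_closed[OF H _ u] in auto)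
    then show ?thesis by (simp only: unit_pow)
  qed
  show ?thesis
  proof (cases "k \<ge> 0")
    case True
    then show ?thesis using pos[of "nat k"] by (simp add: k mult.commute)
  next
    case False
    then show ?thesis using subgroup.m_inv_closed[OF H pos[of "nat (- k)"]] by (simp add: unit_inv k mult.commute)
  qed
qed

lemma tau_mult: "(emb n (\<lambda>x i. 0), k) \<otimes>\<^bsub>\<Gamma>\<^esub> (emb n (\<lambda>x i. 0), l) = (emb n (\<lambda>x i. 0), k + l)"
  by (simp add: lamplighter_emb_mult)

lemma tau_carrier: "(emb n (\<lambda>x i. 0), k) \<in> carrier \<Gamma>"
  by (rule emb_carrier) (simp add: base_def)

lemma tau_subgroup:
  assumes H: "subgroup H \<Gamma>" and t: "(emb n (\<lambda>x i. 0), q) \<in> H" and q: "q dvd m"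
  shows "(emb n (\<lambda>x i. 0), m) \<in> H"
proof -
  obtain k where k: "m = q * k" using q by auto
  have pos: "(emb n (\<lambda>x i. 0), int l * q) \<in> H" for l
  proof (induction l)
    case 0
    then show ?case using subgroup.one_closed[OF H] by (simp add: lamplighter_one)
  next
    case (Suc l)
    then show ?case using subgroup.m_closed[OF H Suc t] by (simp add: tau_mult algebra_simps)
  qed
  have inv: "inv\<^bsub>\<Gamma>\<^esub> (emb n (\<lambda>x i. 0), l) = (emb n (\<lambda>x i. 0), - l)" for l
    by (rule G.inv_equality) (simp_all add: tau_mult lamplighter_one tau_carrier)
  show ?thesis
  proof (cases "k \<ge> 0")
    case True
    then show ?thesis using pos[of "nat k"] by (simp add: k mult.commute)
  next
    case False
    then show ?thesis using subgroup.m_inv_closed[OF H pos[of "nat (- k)"]] by (simp add: inv k mult.commute)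
  qed
qed

lemma tau_conj:
  "(emb n (\<lambda>x i. 0), k) \<otimes>\<^bsub>\<Gamma>\<^esub> (emb n f, 0) \<otimes>\<^bsub>\<Gamma>\<^esub> (emb n (\<lambda>x i. 0), - k) = (emb n (\<lambda>x i. f (x - k) i), 0)"
  by (simp add: lamplighter_emb_mult)

lemma subgroup_split:
  assumes H: "subgroup H \<Gamma>" and "(emb n f, 0) \<in> H" "(emb n (\<lambda>x i. 0), k) \<in> H"
  shows "(emb n f, k) \<in> H"
  using subgroup.m_closed[OF assms] by (simp add: lamplighter_emb_mult)

lemma lamplighter_fg: "finitely_generated_group \<Gamma>"
proof -
  define S where "S = insert (emb n (\<lambda>x i. 0), 1::int) ((\<lambda>j. (emb n (unit_at 0 j 1), 0)) ` {..<n})"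
  have S: "S \<subseteq> carrier \<Gamma>" using tau_carrier emb_carrier[OF base_unit] by (auto simp: S_def)
  have H: "subgroup (generate \<Gamma> S) \<Gamma>" by (rule G.generate_is_subgroup[OF S])
  have tau: "(emb n (\<lambda>x i. 0), k) \<in> generate \<Gamma> S" for k
    by (rule tau_subgroup[OF H, of 1]) (auto intro: generate.incl simp: S_def)
  have unit: "(emb n (unit_at y j m), 0) \<in> generate \<Gamma> S" if "j < n" for y j m
  proof -
    have "(emb n (unit_at 0 j 1), 0) \<in> generate \<Gamma> S" using that by (auto intro!: generate.incl simp: S_def)
    then have "(emb n (unit_at 0 j m), 0) \<in> generate \<Gamma> S" by (rule unit_subgroup[OF H]) simp
    then have "(emb n (\<lambda>x i. 0), y) \<otimes>\<^bsub>\<Gamma>\<^esub> (emb n (unit_at 0 j m), 0) \<otimes>\<^bsub>\<Gamma>\<^esub> (emb n (\<lambda>x i. 0), - y) \<in> generate \<Gamma> S"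
      using tau by (intro subgroup.m_closed[OF H])
    moreover have "emb n (\<lambda>x i. unit_at 0 j m (x - y) i) = emb n (unit_at y j m)"
      by (rule emb_cong) (simp add: unit_at_def)
    ultimately show ?thesis unfolding tau_conj by simp
  qed
  have "carrier \<Gamma> \<subseteq> generate \<Gamma> S"
  proof
    fix z assume "z \<in> carrier \<Gamma>"
    then obtain f k where z: "z = (emb n f, k)" "base n f" by (rule carrierE)
    define A where "A = (SIGMA j:{..<n}. {x. f x j \<noteq> 0})"
    have "(emb n (\<lambda>x i. \<Sum>(j, y)\<in>A. unit_at y j (f y j) x i), 0) \<in> generate \<Gamma> S"
      using subgroup_sum[OF H, of A "\<lambda>(j, y). unit_at y j (f y j)"] unit by (auto simp: A_def case_prod_unfold)
    moreover have "emb n (\<lambda>x i. \<Sum>(j, y)\<in>A. unit_at y j (f y j) x i) = emb n f"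
    proof (rule emb_cong)
      fix x i assume i: "i < n"
      have finA: "finite A" using z(2) by (auto simp: A_def base_def)
      have "(\<Sum>(j, y)\<in>A. unit_at y j (f y j) x i) = (\<Sum>a\<in>A. if a = (i, x) then f x i else 0)"
        by (rule sum.cong) (auto simp: unit_at_def)
      also have "\<dots> = f x i" using finA i by (auto simp: A_def)
      finally show "(\<Sum>(j, y)\<in>A. unit_at y j (f y j) x i) = f x i" .
    qed
    ultimately show "z \<in> generate \<Gamma> S" using subgroup_split[OF H _ tau] z by simp
  qed
  then have "generate \<Gamma> S = carrier \<Gamma>" using G.generate_incl[OF S] by blast
  then show ?thesis unfolding finitely_generated_group_def
    using S group_lamplighter_group by (intro conjI exI[of _ S]) (auto simp: S_def)
qed

lemma lamplighter_rf: "residually_finite_group \<Gamma>"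
  unfolding residually_finite_group_def
proof (intro conjI ballI impI)
  show "group \<Gamma>" by (rule group_lamplighter_group)
  fix g assume g: "g \<in> carrier \<Gamma>" "g \<noteq> \<one>\<^bsub>\<Gamma>\<^esub>"
  obtain f k where z: "g = (emb n f, k)" "base n f" using carrierE[OF g(1)] .
  have "\<exists>s>0. g \<notin> Lker n s"
  proof (cases "k = 0")
    case False
    have "\<not> int (nat (\<bar>k\<bar> + 1)) dvd k" using False zdvd_imp_le[of "\<bar>k\<bar> + 1" "\<bar>k\<bar>"] by auto
    then have "g \<notin> Lker n (nat (\<bar>k\<bar> + 1))" by (auto simp: Lker_def z)
    then show ?thesis by (intro exI[of _ "nat (\<bar>k\<bar> + 1)"]) auto
  next
    case True
    have "\<exists>x i. i < n \<and> f x i \<noteq> 0"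
    proof (rule ccontr)
      assume "\<not> ?thesis"
      then have "emb n f = emb n (\<lambda>x i. 0)" by (intro emb_cong) auto
      then show False using g z True by (simp add: lamplighter_one)
    qed
    then obtain x i where xi: "i < n" "f x i \<noteq> 0" by blast
    define A where "A = {y. f y i \<noteq> 0}"
    have A: "finite A" using z(2) xi by (simp add: A_def base_def)
    \<comment> \<open>The modulus exceeds the absolute value of \<open>f x i\<close>, so it does not
      divide it, and all distances of \<open>x\<close> to the support, so that \<open>x\<close> is
      alone in its residue class.\<close>
    define s where "s = nat (1 + \<bar>f x i\<bar> + (\<Sum>y\<in>A. \<bar>y - x\<bar>))"
    have nonneg: "(\<Sum>y\<in>A. \<bar>y - x\<bar>) \<ge> 0" by (rule sum_nonneg) simp
    then have s: "int s = 1 + \<bar>f x i\<bar> + (\<Sum>y\<in>A. \<bar>y - x\<bar>)" "s > 0" unfolding s_def by linarith+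
    define c where "c = nat (x mod int s)"
    have c: "c < s" "int c = x mod int s" using s(2) by (simp_all add: c_def nat_less_iff)
    have "class_sum s c (wrap s (\<lambda>x. f x i)) = (\<Sum>y\<in>A. if y mod int s = int c then f y i else 0)"
      by (rule class_sum_wrap[OF s(2) c(1) A]) (simp add: A_def)
    also have "\<dots> = (\<Sum>y\<in>A. if y = x then f x i else 0)"
    proof (rule sum.cong)
      fix y assume y: "y \<in> A"
      have "y = x" if "y mod int s = x mod int s"
      proof (rule ccontr)
        assume "y \<noteq> x"
        then have "int s \<le> \<bar>y - x\<bar>" using zdvd_imp_le[of "int s" "\<bar>y - x\<bar>"] that by (simp add: mod_eq_dvd_iff)
        moreover have "\<bar>y - x\<bar> \<le> (\<Sum>y\<in>A. \<bar>y - x\<bar>)" using A y by (intro member_le_sum) auto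
        ultimately show False using s by linarith
      qed
      then show "(if y mod int s = int c then f y i else 0) = (if y = x then f x i else 0)" by (auto simp: c(2))
    qed simp
    also have "\<dots> = f x i" using A xi by (simp add: A_def)
    finally have cs: "class_sum s c (wrap s (\<lambda>x. f x i)) = f x i" .
    have "g \<notin> Lker n s"
    proof
      assume "g \<in> Lker n s"
      then have "wrap s (\<lambda>x. f x i) \<in> ideal2 (int s) s" using xi by (simp add: Lker_def z wrap_mod_def emb_apply)
      then have "int s dvd f x i" using class_sum_ideal2 cs by metis
      then have "int s \<le> \<bar>f x i\<bar>" using zdvd_imp_le[of "int s" "\<bar>f x i\<bar>"] xi by simp
      then show False using s nonneg by linarith
    qed
    then show ?thesis using s by blast
  qed
  then obtain s where "s > 0" "g \<notin> Lker n s" by blast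
  then show "\<exists>N. N \<lhd> \<Gamma> \<and> finite (carrier (\<Gamma> Mod N)) \<and> g \<notin> N"
    using Lker_normal Lker_finite_index by (intro exI[of _ "Lker n s"]) (auto simp: FactGroup_def)
qed

lemma power_index_mem:
  assumes N: "N \<lhd> \<Gamma>" and fin: "finite (rcosets\<^bsub>\<Gamma>\<^esub> N)" and z: "z \<in> carrier \<Gamma>"
  shows "z [^]\<^bsub>\<Gamma>\<^esub> card (rcosets\<^bsub>\<Gamma>\<^esub> N) \<in> N"
proof -
  interpret N: normal N \<Gamma> by (rule N)
  interpret Q: group "\<Gamma> Mod N" by (rule N.factorgroup_is_group)
  interpret h: group_hom \<Gamma> "\<Gamma> Mod N" "\<lambda>x. N #>\<^bsub>\<Gamma>\<^esub> x"
    by unfold_locales (rule N.r_coset_hom_Mod)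
  have "N #>\<^bsub>\<Gamma>\<^esub> z \<in> carrier (\<Gamma> Mod N)" using z by simp
  then have "(N #>\<^bsub>\<Gamma>\<^esub> z) [^]\<^bsub>\<Gamma> Mod N\<^esub> Coset.order (\<Gamma> Mod N) = \<one>\<^bsub>\<Gamma> Mod N\<^esub>" by (rule Q.pow_order_eq_1)
  then have "N #>\<^bsub>\<Gamma>\<^esub> (z [^]\<^bsub>\<Gamma>\<^esub> Coset.order (\<Gamma> Mod N)) = N" using z by (simp add: h.hom_nat_pow FactGroup_def)
  moreover have "z [^]\<^bsub>\<Gamma>\<^esub> Coset.order (\<Gamma> Mod N) \<in> carrier \<Gamma>" using z by simp
  ultimately have "z [^]\<^bsub>\<Gamma>\<^esub> Coset.order (\<Gamma> Mod N) \<in> N" using G.rcos_self[OF _ N.subgroup_axioms] by metis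
  then show ?thesis by (simp add: Coset.order_def FactGroup_def)
qed

lemma tau_pow: "(emb n (\<lambda>x i. 0), k) [^]\<^bsub>\<Gamma>\<^esub> (m::nat) = (emb n (\<lambda>x i. 0), int m * k)"
  by (induction m) (simp_all add: lamplighter_one tau_mult algebra_simps)

text \<open>Modulo a normal subgroup of index \<open>q\<close>, lamps are only seen modulo \<open>q\<close> and their positions modulo \<open>q\<close>.\<close>

lemma Lker_cofinal:
  assumes N: "N \<lhd> \<Gamma>" and fin: "finite (rcosets\<^bsub>\<Gamma>\<^esub> N)"
  shows "\<exists>s>0. Lker n s \<subseteq> N"
proof -
  have H: "subgroup N \<Gamma>" using N by (rule normal_imp_subgroup)
  define q where "q = card (rcosets\<^bsub>\<Gamma>\<^esub> N)"
  have "N \<in> rcosets\<^bsub>\<Gamma>\<^esub> N" by (rule subgroup.subgroup_in_rcosets[OF H group_lamplighter_group])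
  then have q: "q > 0" unfolding q_def using fin card_gt_0_iff by blast
  have tau: "(emb n (\<lambda>x i. 0), k) \<in> N" if "int q dvd k" for k
    using power_index_mem[OF N fin tau_carrier[of 1]] unfolding tau_pow mult_1_right q_def[symmetric]
    by (rule tau_subgroup[OF H _ that])
  have unit: "(emb n (unit_at y j m), 0) \<in> N" if "int q dvd m" for y j m
    using power_index_mem[OF N fin emb_carrier[OF base_unit], of y j 1 0] unfolding unit_pow mult_1_right q_def[symmetric]
    by (rule unit_subgroup[OF H _ that])
  \<comment> \<open>The commutator of a lamp with a power \<open>t^k\<close> in \<open>N\<close> is
    the difference of the lamp and its translate by \<open>k\<close>.\<close>
  have move: "(emb n (\<lambda>x i. unit_at y j m x i - unit_at (y mod int q) j m x i), 0) \<in> N" for y j m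
  proof -
    define e where "e = (emb n (unit_at (y mod int q) j m), 0::int)"
    define k where "k = y - y mod int q"
    define t where "t = (emb n (\<lambda>x i. 0), k)"
    have e: "e \<in> carrier \<Gamma>" unfolding e_def by (rule emb_carrier[OF base_unit])
    have qk: "int q dvd k" by (simp add: k_def minus_mod_eq_mult_div)
    have t: "t \<in> N" unfolding t_def by (rule tau[OF qk])
    have tG: "t \<in> carrier \<Gamma>" by (rule subgroup.mem_carrier[OF H t])
    have ti: "inv\<^bsub>\<Gamma>\<^esub> t = (emb n (\<lambda>x i. 0), - k)"
      by (rule G.inv_equality) (simp_all add: t_def tau_mult lamplighter_one tau_carrier)
    have "t \<otimes>\<^bsub>\<Gamma>\<^esub> (e \<otimes>\<^bsub>\<Gamma>\<^esub> inv\<^bsub>\<Gamma>\<^esub> t \<otimes>\<^bsub>\<Gamma>\<^esub> inv\<^bsub>\<Gamma>\<^esub> e) \<in> N"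
      by (intro subgroup.m_closed[OF H] t normal.inv_op_closed2[OF N e] subgroup.m_inv_closed[OF H])
    moreover have "t \<otimes>\<^bsub>\<Gamma>\<^esub> (e \<otimes>\<^bsub>\<Gamma>\<^esub> inv\<^bsub>\<Gamma>\<^esub> t \<otimes>\<^bsub>\<Gamma>\<^esub> inv\<^bsub>\<Gamma>\<^esub> e) = t \<otimes>\<^bsub>\<Gamma>\<^esub> e \<otimes>\<^bsub>\<Gamma>\<^esub> inv\<^bsub>\<Gamma>\<^esub> t \<otimes>\<^bsub>\<Gamma>\<^esub> inv\<^bsub>\<Gamma>\<^esub> e"
      using tG e by (simp add: G.m_assoc)
    moreover have "t \<otimes>\<^bsub>\<Gamma>\<^esub> e \<otimes>\<^bsub>\<Gamma>\<^esub> inv\<^bsub>\<Gamma>\<^esub> t = (emb n (\<lambda>x i. unit_at (y mod int q) j m (x - k) i), 0)"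
      unfolding ti unfolding t_def e_def by (rule tau_conj)
    moreover have "(\<lambda>x i. unit_at (y mod int q) j m (x - k) i) = unit_at y j m"
      by (auto simp: unit_at_def k_def fun_eq_iff)
    moreover have "inv\<^bsub>\<Gamma>\<^esub> e = (emb n (unit_at (y mod int q) j (- m)), 0)" by (simp add: e_def unit_inv)
    ultimately have "(emb n (\<lambda>x i. unit_at y j m x i + unit_at (y mod int q) j (- m) x i), 0) \<in> N"
      by (simp add: lamplighter_emb_mult)
    moreover have "(\<lambda>x i. unit_at y j m x i + unit_at (y mod int q) j (- m) x i) = (\<lambda>x i. unit_at y j m x i - unit_at (y mod int q) j m x i)"
      by (auto simp: unit_at_def fun_eq_iff)
    ultimately show ?thesis by simp
  qed
  have "Lker n q \<subseteq> N"
  proof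
    fix z assume z0: "z \<in> Lker n q"
    then have "z \<in> carrier \<Gamma>" by (simp add: Lker_def)
    then obtain f k where z: "z = (emb n f, k)" "base n f" by (rule carrierE)
    have qk: "int q dvd k" using z0 z by (simp add: Lker_def)
    define A where "A = (SIGMA j:{..<n}. {x. f x j \<noteq> 0})"
    have finA: "finite A" using z(2) by (auto simp: A_def base_def)
    define B where "B = {..<n} \<times> {..<q}"
    define cs where "cs j c = (\<Sum>y | f y j \<noteq> 0. if y mod int q = int c then f y j else 0)" for j c
    have csq: "int q dvd cs j c" if "j < n" "c < q" for j c
    proof -
      have fj: "finite {y. f y j \<noteq> 0}" using z(2) that by (simp add: base_def)
      have "class_sum q c (wrap q (\<lambda>x. f x j)) = cs j c"
        unfolding cs_def by (rule class_sum_wrap[OF q that(2) fj]) simp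
      moreover have "wrap q (\<lambda>x. f x j) \<in> ideal2 (int q) q"
        using z0 that by (simp add: Lker_def z wrap_mod_def emb_apply)
      ultimately show ?thesis using class_sum_ideal2 by metis
    qed
    \<comment> \<open>\<open>f\<close> is the sum of differences that move every lamp into the
      window of positions below \<open>q\<close> and of the lamps collected there, whose values
      \<open>cs j c\<close> are multiples of \<open>q\<close>.\<close>
    define h1 where "h1 = (\<lambda>(j, y) x i. unit_at y j (f y j) x i - unit_at (y mod int q) j (f y j) x i)"
    define h2 where "h2 = (\<lambda>(j, c) x i. unit_at (int c) j (cs j c) x i)"
    have 1: "(emb n (\<lambda>x i. \<Sum>a\<in>A. h1 a x i), 0) \<in> N"
      by (rule subgroup_sum[OF H]) (use move in \<open>auto simp: h1_def A_def\<close>)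
    have 2: "(emb n (\<lambda>x i. \<Sum>a\<in>B. h2 a x i), 0) \<in> N"
      by (rule subgroup_sum[OF H]) (use unit csq in \<open>auto simp: h2_def B_def\<close>)
    have "emb n (\<lambda>x i. (\<Sum>a\<in>A. h1 a x i) + (\<Sum>a\<in>B. h2 a x i)) = emb n f"
    proof (rule emb_cong)
      fix x i assume i: "i < n"
      have fi: "finite {y. f y i \<noteq> 0}" using z(2) i by (simp add: base_def)
      have "(\<Sum>a\<in>A. h1 a x i) = (\<Sum>j<n. \<Sum>y | f y j \<noteq> 0. h1 (j, y) x i)"
        unfolding A_def using z(2) by (subst sum.Sigma) (auto simp: base_def)
      also have "\<dots> = (\<Sum>j<n. if j = i then (\<Sum>y | f y i \<noteq> 0. h1 (i, y) x i) else 0)"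
        by (intro sum.cong refl) (auto simp: h1_def unit_at_def)
      also have "\<dots> = (\<Sum>y | f y i \<noteq> 0. h1 (i, y) x i)" using i by simp
      also have "\<dots> = (\<Sum>y | f y i \<noteq> 0. if y = x then f x i else 0) - (\<Sum>y | f y i \<noteq> 0. if y mod int q = x then f y i else 0)"
        unfolding sum_subtractf[symmetric] by (intro sum.cong refl) (auto simp: h1_def unit_at_def)
      also have "(\<Sum>y | f y i \<noteq> 0. if y = x then f x i else 0) = f x i" using fi by simp
      finally have s1: "(\<Sum>a\<in>A. h1 a x i) = f x i - (\<Sum>y | f y i \<noteq> 0. if y mod int q = x then f y i else 0)" .
      have "(\<Sum>a\<in>B. h2 a x i) = (\<Sum>j<n. \<Sum>c<q. h2 (j, c) x i)"
        unfolding B_def by (simp add: sum.cartesian_product)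
      also have "\<dots> = (\<Sum>j<n. if j = i then (\<Sum>c<q. h2 (i, c) x i) else 0)"
        by (intro sum.cong refl) (auto simp: h2_def unit_at_def)
      also have "\<dots> = (\<Sum>c<q. h2 (i, c) x i)" using i by simp
      also have "\<dots> = (\<Sum>c<q. if int c = x then cs i c else 0)"
        by (intro sum.cong refl) (auto simp: h2_def unit_at_def)
      also have "\<dots> = (\<Sum>y | f y i \<noteq> 0. if y mod int q = x then f y i else 0)"
      proof (cases "0 \<le> x \<and> x < int q")
        case True
        then have x: "int (nat x) = x" "nat x < q" by auto
        have "(\<Sum>c<q. if int c = x then cs i c else 0) = (\<Sum>c<q. if c = nat x then cs i (nat x) else 0)"
          by (intro sum.cong refl) (use x in auto)
        then show ?thesis using x by (simp add: cs_def)
      next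
        case False
        have "y mod int q \<noteq> x" for y using False q by auto
        moreover have "int c \<noteq> x" if "c < q" for c using False that by auto
        ultimately show ?thesis by simp
      qed
      finally show "(\<Sum>a\<in>A. h1 a x i) + (\<Sum>a\<in>B. h2 a x i) = f x i" using s1 by simp
    qed
    then have "(emb n f, 0) \<in> N"
      using subgroup.m_closed[OF H 1 2] by (simp add: lamplighter_emb_mult)
    then show "z \<in> N" unfolding z by (rule subgroup_split[OF H _ tau[OF qk]])
  qed
  then show ?thesis using q by blast
qed

end

text \<open>
  Compatible epimorphisms \<open>x \<mapsto> (mu s x, kap s x)\<close> of \<open>D\<close> onto the finite groups
  \<open>(\<int>[X] / (s, X\<^sup>s - 1))\<^sup>n \<rtimes> \<int>/s\<close>, through which every finite quotient of \<open>D\<close> factors.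
\<close>

locale lamp_approx = group D for D (structure) +
  fixes n :: nat and kap :: "nat \<Rightarrow> 'a \<Rightarrow> int" and mu :: "nat \<Rightarrow> 'a \<Rightarrow> nat \<Rightarrow> int poly"
  assumes kap_mult: "\<lbrakk>s > 0; x \<in> carrier D; y \<in> carrier D\<rbrakk> \<Longrightarrow> [kap s (x \<otimes> y) = kap s x + kap s y] (mod int s)"
    and mu_mult: "\<lbrakk>s > 0; x \<in> carrier D; y \<in> carrier D; i < n\<rbrakk>
      \<Longrightarrow> mu s (x \<otimes> y) i - (mu s x i + monom 1 (nat (kap s x mod int s)) * mu s y i) \<in> ideal2 (int s) s"
    and onto: "s > 0 \<Longrightarrow> \<exists>x\<in>carrier D. [kap s x = k] (mod int s) \<and> (\<forall>i<n. mu s x i - p i \<in> ideal2 (int s) s)"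
    and kap_compat: "\<lbrakk>s > 0; s' > 0; s dvd s'; x \<in> carrier D\<rbrakk> \<Longrightarrow> [kap s' x = kap s x] (mod int s)"
    and mu_compat: "\<lbrakk>s > 0; s' > 0; s dvd s'; x \<in> carrier D; i < n\<rbrakk> \<Longrightarrow> mu s' x i - mu s x i \<in> ideal2 (int s) s"
    and cofinal: "\<lbrakk>K \<lhd> D; finite (rcosets K)\<rbrakk> \<Longrightarrow>
      \<exists>s>0. \<forall>x\<in>carrier D. [kap s x = 0] (mod int s) \<longrightarrow> (\<forall>i<n. mu s x i \<in> ideal2 (int s) s) \<longrightarrow> x \<in> K"
    and fg: "finitely_generated_group D"
    and rf: "residually_finite_group D"

lemma lamp_approx_exists:
  fixes D :: "'a monoid"
  assumes fg: "finitely_generated_group D" and rf: "residually_finite_group D"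
    and eq: "finite_quotient_classes D = finite_quotient_classes (lamplighter_group n)"
  shows "\<exists>kap mu. lamp_approx D n kap mu"
proof -
  let ?G = "lamplighter_group n"
  interpret D: group D using fg by (simp add: finitely_generated_group_def)
  interpret G: group ?G by (rule group_lamplighter_group)
  interpret two_groups D ?G by unfold_locales
  obtain U where U: "\<And>j. emod D ?G (Kint ?G j) (U j)"
    and Uker: "\<And>j x. x \<in> carrier D \<Longrightarrow> U j x \<in> Kint ?G j \<longleftrightarrow> x \<in> Kint D j"
    and Ucoh: "\<And>j k x. \<lbrakk>j \<le> k; x \<in> carrier D\<rbrakk> \<Longrightarrow> U k x \<otimes>\<^bsub>?G\<^esub> inv\<^bsub>?G\<^esub> U j x \<in> Kint ?G j"
    by (rule coherent_lifts[OF fg lamplighter_fg eq]) (rule that; assumption)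
  \<comment> \<open>The index of \<open>Lker n s\<close> is a stage of the filtration at which
    \<open>U\<close> is correct modulo \<open>Lker n s\<close>.\<close>
  define J where "J s = card (rcosets\<^bsub>?G\<^esub> (Lker n s))" for s
  have KL: "Kint ?G (J s) \<subseteq> Lker n s" if "s > 0" for s
    by (rule Kint_subset) (simp add: fi_normal_def Lker_normal[OF that] Lker_finite_index[OF that] J_def)
  define V where "V s = U (J s)" for s
  have V: "emod D ?G (Lker n s) (V s)" if "s > 0" for s
    unfolding V_def by (rule emod_mono[OF U G.Kint_normal Lker_normal[OF that] KL[OF that]])
  have Uc: "U j x \<in> carrier ?G" if "x \<in> carrier D" for j x using U[of j] that unfolding emod_def by blast
  then have Vc: "V s x \<in> carrier ?G" if "x \<in> carrier D" for s x using that by (simp add: V_def)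
  \<comment> \<open>Coherence is oriented from the earlier to the later stage; passing to inverses
    covers both orders.\<close>
  have close: "U j x \<otimes>\<^bsub>?G\<^esub> inv\<^bsub>?G\<^esub> U k x \<in> M"
    if M: "M \<lhd> ?G" "Kint ?G j \<subseteq> M" "Kint ?G k \<subseteq> M" and x: "x \<in> carrier D" for j k x M
  proof (cases "k \<le> j")
    case True
    then show ?thesis using Ucoh[OF True x] M by blast
  next
    case False
    then have "U k x \<otimes>\<^bsub>?G\<^esub> inv\<^bsub>?G\<^esub> U j x \<in> M" using Ucoh[of j k x] x M by auto
    then have "inv\<^bsub>?G\<^esub> (U k x \<otimes>\<^bsub>?G\<^esub> inv\<^bsub>?G\<^esub> U j x) \<in> M"
      by (rule subgroup.m_inv_closed[OF normal_imp_subgroup[OF M(1)]])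
    then show ?thesis using Uc[OF x] by (simp add: G.inv_mult_group)
  qed
  define kap where "kap s x = snd (V s x)" for s x
  define mu where "mu s x i = wrap_mod s (V s x) i" for s x i
  have Lrel: "int s dvd snd y - snd z \<and> (\<forall>i<n. wrap_mod s y i - wrap_mod s z i \<in> ideal2 (int s) s)"
    if "s > 0" "y \<in> carrier ?G" "z \<in> carrier ?G" "y \<otimes>\<^bsub>?G\<^esub> inv\<^bsub>?G\<^esub> z \<in> Lker n s" for s y z
    using Lker_coset[OF that(1-3)] that(4) by blast
  have mult: "int s dvd snd (V s (x \<otimes>\<^bsub>D\<^esub> y)) - snd (V s x \<otimes>\<^bsub>?G\<^esub> V s y) \<and>
      (\<forall>i<n. wrap_mod s (V s (x \<otimes>\<^bsub>D\<^esub> y)) i - wrap_mod s (V s x \<otimes>\<^bsub>?G\<^esub> V s y) i \<in> ideal2 (int s) s)"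
    if "s > 0" "x \<in> carrier D" "y \<in> carrier D" for s x y
    using V[OF that(1)] that Vc unfolding emod_iff[OF Lker_normal[OF that(1)]] by (intro Lrel) auto
  have compat: "int s dvd snd (V s' x) - snd (V s x) \<and>
      (\<forall>i<n. wrap_mod s (V s' x) i - wrap_mod s (V s x) i \<in> ideal2 (int s) s)"
    if s: "s > 0" "s' > 0" "s dvd s'" and x: "x \<in> carrier D" for s s' x
  proof (intro Lrel[OF s(1) Vc[OF x] Vc[OF x]])
    have "Lker n s' \<subseteq> Lker n s"
    proof
      fix z assume z: "z \<in> Lker n s'"
      then have zG: "z \<in> carrier ?G" by (simp add: Lker_def)
      obtain f k where zf: "z = (f, k)" "base n f" using zG by (cases z) (auto simp: lamplighter_carrier)
      have "wrap_mod s z i \<in> ideal2 (int s) s" if i: "i < n" for i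
      proof -
        have "wrap_mod s' z i \<in> ideal2 (int s') s'" using z i by (simp add: Lker_def)
        then have "wrap_mod s' z i \<in> ideal2 (int s) s" using s(3) by (intro ideal2_mono[of "int s" "int s'" s s']) auto
        moreover have "wrap_mod s' z i - wrap_mod s z i \<in> ideal2 (int s) s"
          unfolding wrap_mod_def using zf i by (intro wrap_cong_dvd[OF s(1,3,2)]) (simp add: base_def)
        ultimately show ?thesis using ideal2_cong by blast
      qed
      moreover have "int s dvd snd z" using z s(3) by (auto simp: Lker_def intro: dvd_trans[of "int s" "int s'"])
      ultimately show "z \<in> Lker n s" using zG by (simp add: Lker_def)
    qed
    then show "V s' x \<otimes>\<^bsub>?G\<^esub> inv\<^bsub>?G\<^esub> V s x \<in> Lker n s"
      unfolding V_def using KL[OF s(1)] KL[OF s(2)] by (intro close[OF Lker_normal[OF s(1)] _ _ x]) auto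
  qed
  have "lamp_approx D n kap mu"
  proof (unfold_locales, goal_cases)
    case (1 s x y)
    then show ?case using mult[OF 1] by (simp add: kap_def snd_mult cong_iff_dvd_diff)
  next
    case (2 s x y i)
    have "mu s (x \<otimes>\<^bsub>D\<^esub> y) i - wrap_mod s (V s x \<otimes>\<^bsub>?G\<^esub> V s y) i \<in> ideal2 (int s) s"
      using mult[OF 2(1-3)] 2(4) by (simp add: mu_def)
    then show ?case unfolding mu_def kap_def
      by (rule ideal2_trans[OF _ wrap_mod_mult[OF 2(1,4) Vc[OF 2(2)] Vc[OF 2(3)]]])
  next
    case (3 s k p)
    define f where "f = (\<lambda>(x::int) i. if 0 \<le> x then coeff (p i) (nat x) else 0)"
    have supp: "{x. f x i \<noteq> 0} \<subseteq> int ` {..degree (p i)}" for i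
    proof
      fix x assume "x \<in> {x. f x i \<noteq> 0}"
      then have "0 \<le> x" "coeff (p i) (nat x) \<noteq> 0" by (auto simp: f_def split: if_splits)
      then show "x \<in> int ` {..degree (p i)}" by (intro image_eqI[of _ _ "nat x"]) (auto intro: le_degree)
    qed
    have bf: "base n f" unfolding base_def using supp by (meson finite_atMost finite_imageI finite_subset)
    define g where "g = (emb n f, k)"
    have g: "g \<in> carrier ?G" unfolding g_def by (rule emb_carrier[OF bf])
    have wg: "wrap_mod s g i - p i \<in> ideal2 (int s) s" if i: "i < n" for i
    proof -
      have "wrap_mod s g i = wrap s (\<lambda>x. f x i)" using i by (simp add: wrap_mod_def g_def emb_apply)
      also have "\<dots> = (\<Sum>x\<in>int ` {..degree (p i)}. monom (f x i) (nat (x mod int s)))"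
        using supp[of i] by (intro wrap_superset) auto
      also have "\<dots> = (\<Sum>j\<le>degree (p i). monom (coeff (p i) j) (j mod s))"
        by (subst sum.reindex) (auto simp: f_def nat_mod_distrib)
      finally have w: "wrap_mod s g i = (\<Sum>j\<le>degree (p i). monom (coeff (p i) j) (j mod s))" .
      have "(\<Sum>j\<in>A. monom (coeff (p i) j) (j mod s)) - (\<Sum>j\<in>A. monom (coeff (p i) j) j) \<in> ideal2 (int s) s" if "finite A" for A
        using that
      proof (induction A rule: finite_induct)
        case (insert j A)
        have "monom (coeff (p i) j) (j mod s) - monom (coeff (p i) j) j \<in> ideal2 (int s) s"
          by (rule monom_cong_ideal2) simp
        from ideal2_add[OF this insert.IH] show ?case using insert.hyps by (simp add: algebra_simps)
      qed simp
      from this[OF finite_atMost, of "degree (p i)"] show ?thesis by (simp only: w poly_as_sum_of_monoms)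
    qed
    obtain x where x: "x \<in> carrier D" "V s x \<otimes>\<^bsub>?G\<^esub> inv\<^bsub>?G\<^esub> g \<in> Lker n s"
      using V[OF 3] g unfolding emod_iff[OF Lker_normal[OF 3]] by blast
    have "int s dvd snd (V s x) - snd g \<and> (\<forall>i<n. wrap_mod s (V s x) i - wrap_mod s g i \<in> ideal2 (int s) s)"
      by (rule Lrel[OF 3 Vc[OF x(1)] g x(2)])
    then have "[kap s x = k] (mod int s) \<and> (\<forall>i<n. mu s x i - p i \<in> ideal2 (int s) s)"
      using ideal2_trans[OF _ wg] by (auto simp: kap_def mu_def g_def cong_iff_dvd_diff)
    then show ?case using x(1) by blast
  next
    case (4 s s' x)
    then show ?case using compat[OF 4] by (simp add: kap_def cong_iff_dvd_diff)
  next
    case (5 s s' x i)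
    obtain f k where zf: "V s' x = (f, k)" "base n f" using Vc[OF 5(4), of s'] by (cases "V s' x") (auto simp: lamplighter_carrier)
    have "wrap_mod s' (V s' x) i - wrap_mod s (V s' x) i \<in> ideal2 (int s) s"
      unfolding wrap_mod_def using zf 5 by (intro wrap_cong_dvd[OF 5(1,3,2)]) (simp add: base_def)
    then show ?case using ideal2_trans compat[OF 5(1-4)] 5(5) unfolding mu_def by blast
  next
    case (6 K)
    define m where "m = card (rcosets\<^bsub>D\<^esub> K)"
    have mK: "Kint D m \<subseteq> K" by (rule Kint_subset) (simp add: fi_normal_def m_def 6)
    obtain S where S: "finite S" "S \<subseteq> carrier ?G" "generate ?G S = carrier ?G"
      using lamplighter_fg[of n] unfolding finitely_generated_group_def by blast
    have "finite (rcosets\<^bsub>?G\<^esub> (Kint ?G m))" by (rule G.finite_index_Kint[OF S])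
    then obtain s where s: "s > 0" "Lker n s \<subseteq> Kint ?G m" using Lker_cofinal[OF G.Kint_normal] by blast
    show ?case
    proof (intro exI[of _ s] conjI ballI impI)
      show "s > 0" by (rule s)
      fix x assume x: "x \<in> carrier D" "[kap s x = 0] (mod int s)" "\<forall>i<n. mu s x i \<in> ideal2 (int s) s"
      then have 1: "V s x \<in> Kint ?G m" using s(2) Vc[OF x(1)] by (auto simp: Lker_def kap_def mu_def cong_0_iff)
      \<comment> \<open>The kernel of \<open>U m\<close> is known exactly in \<open>D\<close>, that
        of \<open>V s\<close> is not; so the statement about \<open>V s\<close> is moved to stage
        \<open>m\<close> before it is read in \<open>D\<close>.\<close>
      have 2: "U m x \<otimes>\<^bsub>?G\<^esub> inv\<^bsub>?G\<^esub> V s x \<in> Kint ?G m"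
        unfolding V_def using KL[OF s(1)] s(2) by (intro close[OF G.Kint_normal _ _ x(1)]) auto
      have "U m x \<otimes>\<^bsub>?G\<^esub> inv\<^bsub>?G\<^esub> V s x \<otimes>\<^bsub>?G\<^esub> V s x \<in> Kint ?G m"
        by (rule subgroup.m_closed[OF normal_imp_subgroup[OF G.Kint_normal] 2 1])
      moreover have "U m x \<otimes>\<^bsub>?G\<^esub> inv\<^bsub>?G\<^esub> V s x \<otimes>\<^bsub>?G\<^esub> V s x = U m x"
        using Uc[OF x(1)] Vc[OF x(1)] by (simp add: G.m_assoc)
      ultimately have "x \<in> Kint D m" using Uker[OF x(1)] by simp
      then show "x \<in> K" using mK by blast
    qed
  next
    case 7
    show ?case by (rule fg)
  next
    case 8
    show ?case by (rule rf)
  qed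
  then show ?thesis by blast
qed

section \<open>Modules of commuting endomorphisms\<close>

text \<open>A commutative ring of endomorphisms with an augmentation to the integers, presented by
  codes \<open>r\<close>. The augmentation is a function of the code and need not be determined by
  the endomorphism; ring operations are only required to have some code. The instances are the group
  ring acting on \<open>A\<close>, with \<open>p = 3\<close>, and the integers acting on an abelian
  group, with \<open>p = 2\<close>.\<close>

locale endo_module = comm_group Q for Q (structure) +
  fixes act :: "'r \<Rightarrow> 'a \<Rightarrow> 'a" and eps :: "'r \<Rightarrow> int" and p :: int
  assumes act_closed: "x \<in> carrier Q \<Longrightarrow> act r x \<in> carrier Q"
    and act_mult: "\<lbrakk>x \<in> carrier Q; y \<in> carrier Q\<rbrakk> \<Longrightarrow> act r (x \<otimes> y) = act r x \<otimes> act r y"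
    and act_diff: "\<exists>q. eps q = eps r - eps r' \<and> (\<forall>x\<in>carrier Q. act q x = act r x \<otimes> inv (act r' x))"
    and act_comp: "\<exists>q. eps q = eps r * eps r' \<and> (\<forall>x\<in>carrier Q. act q x = act r (act r' x))"
    and act_commute: "x \<in> carrier Q \<Longrightarrow> act r (act r' x) = act r' (act r x)"
    and act_id: "\<exists>q. eps q = 1 \<and> (\<forall>x\<in>carrier Q. act q x = x)"
begin

lemma act_one: "act r \<one> = \<one>"
  using act_mult[of \<one> \<one> r] act_closed[of \<one> r] by simp

lemma act_zero: "\<exists>q. eps q = 0 \<and> (\<forall>x\<in>carrier Q. act q x = \<one>)"
proof -
  obtain i where i: "eps i = 1" "\<forall>x\<in>carrier Q. act i x = x" using act_id by blast
  obtain q where q: "eps q = eps i - eps i" "\<forall>x\<in>carrier Q. act q x = act i x \<otimes> inv (act i x)" using act_diff by blast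
  have "\<forall>x\<in>carrier Q. act q x = \<one>" using q i by simp
  then show ?thesis using q by auto
qed

lemma act_add: "\<exists>q. eps q = eps r + eps r' \<and> (\<forall>x\<in>carrier Q. act q x = act r x \<otimes> act r' x)"
proof -
  obtain z where z: "eps z = 0" "\<forall>x\<in>carrier Q. act z x = \<one>" using act_zero by blast
  obtain m where m: "eps m = eps z - eps r'" "\<forall>x\<in>carrier Q. act m x = act z x \<otimes> inv (act r' x)" using act_diff by blast
  obtain q where q: "eps q = eps r - eps m" "\<forall>x\<in>carrier Q. act q x = act r x \<otimes> inv (act m x)" using act_diff by blast
  have "\<forall>x\<in>carrier Q. act q x = act r x \<otimes> act r' x" using q m z act_closed by simp
  moreover have "eps q = eps r + eps r'" using q m z by simp
  ultimately show ?thesis by blast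
qed

text \<open>Combinations of the list with coefficients whose augmentation satisfies
  \<open>I\<close>. One coefficient per entry of a list lets Nakayama's lemma eliminate the entries
  one by one.\<close>

fun sp :: "(int \<Rightarrow> bool) \<Rightarrow> 'a list \<Rightarrow> 'a set" where
  "sp I [] = {\<one>}"
| "sp I (c # cs) = {act r c \<otimes> y | r y. I (eps r) \<and> y \<in> sp I cs}"

abbreviation "full_span \<equiv> sp (\<lambda>_. True)"
abbreviation "ideal_span \<equiv> sp (\<lambda>e. p dvd e)"

lemma sp_carrier: "set cs \<subseteq> carrier Q \<Longrightarrow> sp I cs \<subseteq> carrier Q"
  by (induction cs) (auto simp: act_closed)

lemma sp_mult:
  assumes "set cs \<subseteq> carrier Q" "\<And>d e. I d \<Longrightarrow> I e \<Longrightarrow> I (d + e)" "x \<in> sp I cs" "y \<in> sp I cs"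
  shows "x \<otimes> y \<in> sp I cs"
  using assms
proof (induction cs arbitrary: x y)
  case (Cons c cs)
  obtain r x' where x: "x = act r c \<otimes> x'" "I (eps r)" "x' \<in> sp I cs" using Cons.prems by auto
  obtain r' y' where y: "y = act r' c \<otimes> y'" "I (eps r')" "y' \<in> sp I cs" using Cons.prems by auto
  obtain q where q: "eps q = eps r + eps r'" "\<forall>x\<in>carrier Q. act q x = act r x \<otimes> act r' x" using act_add by blast
  have c: "c \<in> carrier Q" "x' \<in> carrier Q" "y' \<in> carrier Q" using Cons.prems sp_carrier[of cs I] x y by auto
  have "x \<otimes> y = act q c \<otimes> (x' \<otimes> y')" using c x(1) y(1) q by (simp add: act_closed m_ac)
  moreover have "x' \<otimes> y' \<in> sp I cs" using Cons x y by simp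
  moreover have "I (eps q)" using q(1) Cons.prems(2) x(2) y(2) by simp
  ultimately show ?case by auto
qed simp

lemma ideal_span_mult:
  assumes cs: "set cs \<subseteq> carrier Q" and xy: "x \<in> ideal_span cs" "y \<in> ideal_span cs" shows "x \<otimes> y \<in> ideal_span cs"
  by (rule sp_mult[OF cs _ xy]) simp

lemma full_span_mult:
  assumes cs: "set cs \<subseteq> carrier Q" and xy: "x \<in> full_span cs" "y \<in> full_span cs" shows "x \<otimes> y \<in> full_span cs"
  by (rule sp_mult[OF cs _ xy]) simp

lemma sp_act:
  assumes "set cs \<subseteq> carrier Q" "\<And>e. I e \<Longrightarrow> I' (eps r * e)" "x \<in> sp I cs"
  shows "act r x \<in> sp I' cs"
  using assms
proof (induction cs arbitrary: x)
  case (Cons c cs)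
  obtain r' x' where x: "x = act r' c \<otimes> x'" "I (eps r')" "x' \<in> sp I cs" using Cons.prems by auto
  obtain q where q: "eps q = eps r * eps r'" "\<forall>x\<in>carrier Q. act q x = act r (act r' x)" using act_comp by blast
  have c: "c \<in> carrier Q" "x' \<in> carrier Q" using Cons.prems sp_carrier[of cs I] x by auto
  have "act r x = act q c \<otimes> act r x'" using c x(1) q by (simp add: act_closed act_mult)
  moreover have "act r x' \<in> sp I' cs" using Cons x by simp
  moreover have "I' (eps q)" using q(1) Cons.prems(2) x(2) by simp
  ultimately show ?case by auto
qed (simp add: act_one)

lemma sp_one: "I 0 \<Longrightarrow> set cs \<subseteq> carrier Q \<Longrightarrow> \<one> \<in> sp I cs"
proof (induction cs)
  case (Cons c cs)
  obtain z where z: "eps z = 0" "\<forall>x\<in>carrier Q. act z x = \<one>" using act_zero by blast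
  then have "\<one> = act z c \<otimes> \<one>" using Cons.prems by simp
  moreover have "I (eps z)" using z Cons.prems by simp
  moreover have "\<one> \<in> sp I cs" using Cons by simp
  ultimately show ?case by auto
qed simp

lemma full_span_member: "set cs \<subseteq> carrier Q \<Longrightarrow> c \<in> set cs \<Longrightarrow> c \<in> full_span cs"
proof (induction cs)
  case (Cons b cs)
  obtain i where i: "\<forall>x\<in>carrier Q. act i x = x" using act_id by blast
  obtain z where z: "\<forall>x\<in>carrier Q. act z x = \<one>" using act_zero by blast
  show ?case
  proof (cases "c = b")
    case True
    then have "c = act i b \<otimes> \<one>" using i Cons.prems by simp
    then show ?thesis using sp_one[of "\<lambda>_. True" cs] Cons.prems by auto
  next
    case False
    then have "c \<in> full_span cs" using Cons by simp
    moreover have "c = act z b \<otimes> c" using z Cons.prems by auto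
    ultimately show ?thesis by auto
  qed
qed simp

text \<open>Elimination instead of the determinant trick. The invariant is an operator
  \<open>T\<close> of augmentation 1 modulo \<open>p\<close> that maps all generators into the ideal
  span of the remaining list; each step multiplies \<open>T\<close> by an operator that removes one
  entry.\<close>

lemma nakayama:
  assumes "set all \<subseteq> carrier Q" "\<And>c. c \<in> set all \<Longrightarrow> c \<in> ideal_span all"
  obtains r where "[eps r = 1] (mod p)" "\<And>c. c \<in> set all \<Longrightarrow> act r c = \<one>"
proof -
  have "\<exists>r. [eps r = 1] (mod p) \<and> (\<forall>c\<in>set all. act r c = \<one>)"
    if "[eps T = 1] (mod p)" "\<forall>c\<in>set all. act T c \<in> ideal_span cs" "set cs \<subseteq> set all" for T cs
    using that
  proof (induction cs arbitrary: T)
    case Nil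
    then show ?case by auto
  next
    case (Cons c cs)
    have cs: "set cs \<subseteq> carrier Q" "c \<in> carrier Q" using Cons.prems assms(1) by auto
    have "act T c \<in> ideal_span (c # cs)" using Cons.prems by auto
    then obtain j y where j: "act T c = act j c \<otimes> y" "p dvd eps j" "y \<in> ideal_span cs" by auto
    \<comment> \<open>\<open>q = T - j\<close> sends \<open>c\<close> to \<open>y\<close>, which no
      longer involves \<open>c\<close>. Hence in \<open>q T b\<close> the multiple of
      \<open>c\<close> occurring in \<open>T b\<close> becomes a multiple of \<open>y\<close>. The
      augmentation is unchanged modulo \<open>p\<close> since \<open>p\<close> divides that of
      \<open>j\<close>.\<close>
    obtain q where q: "eps q = eps T - eps j" "\<forall>x\<in>carrier Q. act q x = act T x \<otimes> inv (act j x)" using act_diff by blast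
    obtain u where u: "eps u = eps q * eps T" "\<forall>x\<in>carrier Q. act u x = act q (act T x)" using act_comp by blast
    have yQ: "y \<in> carrier Q" using j sp_carrier[OF cs(1)] by auto
    have qc: "act q c = y" using q cs j yQ by (simp add: act_closed m_ac)
    have "act u b \<in> ideal_span cs" if b: "b \<in> set all" for b
    proof -
      have "act T b \<in> ideal_span (c # cs)" using Cons.prems b by blast
      then obtain j' y' where j': "act T b = act j' c \<otimes> y'" "p dvd eps j'" "y' \<in> ideal_span cs" by auto
      have y'Q: "y' \<in> carrier Q" using j' sp_carrier[OF cs(1)] by auto
      have "act u b = act q (act j' c) \<otimes> act q y'"
        using u b assms(1) j' y'Q cs by (auto simp: act_mult act_closed)
      also have "act q (act j' c) = act j' y" using act_commute[OF cs(2), of q j'] qc by simp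
      finally have e: "act u b = act j' y \<otimes> act q y'" .
      have "act j' y \<in> ideal_span cs" by (rule sp_act[OF cs(1) _ j(3)]) simp
      moreover have "act q y' \<in> ideal_span cs" by (rule sp_act[OF cs(1) _ j'(3)]) simp
      ultimately show ?thesis unfolding e by (rule ideal_span_mult[OF cs(1)])
    qed
    moreover have "[eps u = 1] (mod p)"
    proof -
      have "[eps q = 1 - 0] (mod p)" unfolding q(1) using Cons.prems(1) j(2) by (intro cong_diff) (auto simp: cong_0_iff)
      then have "[eps q * eps T = 1 * 1] (mod p)" using Cons.prems(1) by (intro cong_mult) auto
      then show ?thesis by (simp add: u)
    qed
    ultimately show ?case using Cons.IH[of u] Cons.prems(3) by auto
  qed
  moreover obtain i where "eps i = 1" "\<forall>x\<in>carrier Q. act i x = x" using act_id by blast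
  ultimately obtain r where "[eps r = 1] (mod p)" "\<forall>c\<in>set all. act r c = \<one>"
    using assms by (metis cong_refl subset_iff)
  then show ?thesis using that by blast
qed

end

lemma (in comm_group) finite_if_exponent:
  assumes S: "finite S" "S \<subseteq> carrier G" "generate G S = carrier G" and m: "m > (0::nat)" "\<And>x. x \<in> carrier G \<Longrightarrow> x [^] m = \<one>"
  shows "finite (carrier G)"
proof -
  define h where "h e = finprod G (\<lambda>s. s [^] (e s :: nat)) S" for e
  have fn: "(\<lambda>s. s [^] (e s :: nat)) \<in> S \<rightarrow> carrier G" for e using S(2) by auto
  have hmult: "h e \<otimes> h e' = h (\<lambda>s. e s + e' s)" for e e'
    unfolding h_def finprod_multf[OF fn fn, symmetric] using S(2) by (intro finprod_cong') (auto simp: nat_pow_mult)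
  have hc: "h e \<in> carrier G" for e unfolding h_def using fn by (rule finprod_closed)
  have hpow: "h e [^] (k::nat) = h (\<lambda>s. k * e s)" for e k
  proof (induction k)
    case 0
    show ?case unfolding h_def by (simp add: finprod_one_eqI)
  next
    case (Suc k)
    then show ?case by (simp add: hmult add.commute)
  qed
  have "carrier G \<subseteq> h ` UNIV"
  proof
    fix x assume "x \<in> carrier G"
    then have "x \<in> generate G S" using S(3) by simp
    then show "x \<in> h ` UNIV"
    proof (induction x rule: generate.induct)
      case one
      have "h (\<lambda>_. 0) = \<one>" unfolding h_def by (simp add: finprod_one_eqI)
      then show ?case by (metis rangeI)
    next
      case (incl s)
      have "h (\<lambda>t. if t = s then 1 else 0) = finprod G (\<lambda>t. if s = t then t else \<one>) S"
        unfolding h_def using S(2) by (intro finprod_cong') (auto simp: incl)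
      also have "\<dots> = s" using finprod_singleton[OF incl S(1), of "\<lambda>t. t"] S(2) by auto
      finally show ?case by (metis rangeI)
    next
      case (inv s)
      have s: "s \<in> carrier G" using inv S(2) by blast
      have "s [^] (m - 1) \<otimes> s = \<one>" using m s by (metis Suc_pred' nat_pow_Suc One_nat_def)
      then have "inv s = s [^] (m - 1)" using s by (intro inv_equality) auto
      moreover have "h (\<lambda>t. if t = s then 1 else 0) = finprod G (\<lambda>t. if s = t then t else \<one>) S"
        unfolding h_def using S(2) by (intro finprod_cong') (auto simp: inv)
      then have "h (\<lambda>t. if t = s then 1 else 0) = s" using finprod_singleton[OF inv S(1), of "\<lambda>t. t"] S(2) by auto
      ultimately show ?case using hpow by (metis rangeI)
    next
      case (eng a b)
      then show ?case using hmult by (metis (no_types, lifting) imageE rangeI)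
    qed
  qed
  also have "h ` UNIV \<subseteq> h ` (PiE S (\<lambda>_. {..<m}))"
  proof
    fix x assume "x \<in> h ` UNIV"
    then obtain e where x: "x = h e" by blast
    have red: "s [^] k = s [^] (k mod m)" if "s \<in> S" for s and k :: nat
    proof -
      have s: "s \<in> carrier G" using that S(2) by blast
      have "s [^] k = s [^] (m * (k div m) + k mod m)" by simp
      also have "\<dots> = (s [^] m) [^] (k div m) \<otimes> s [^] (k mod m)"
        using s by (simp only: nat_pow_mult[symmetric] nat_pow_pow)
      finally show ?thesis using s m by simp
    qed
    have "h e = h (\<lambda>s\<in>S. e s mod m)"
      unfolding h_def
    proof (rule finprod_cong')
      fix s assume s: "s \<in> S"
      then show "s [^] e s = s [^] (\<lambda>s\<in>S. e s mod m) s" using red[OF s, of "e s"] by simp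
    qed (use S(2) in auto)
    moreover have "(\<lambda>s\<in>S. e s mod m) \<in> PiE S (\<lambda>_. {..<m})" using m by auto
    ultimately show "x \<in> h ` (PiE S (\<lambda>_. {..<m}))" using x by blast
  qed
  finally show ?thesis using S(1) by (meson finite_PiE finite_imageI finite_lessThan finite_subset)
qed

section \<open>Commutators, abelian quotients and a splitting\<close>

definition (in group) cmt :: "'a \<Rightarrow> 'a \<Rightarrow> 'a" where "cmt x y = x \<otimes> y \<otimes> inv x \<otimes> inv y"

lemma (in group) cmt_closed: "\<lbrakk>x \<in> carrier G; y \<in> carrier G\<rbrakk> \<Longrightarrow> cmt x y \<in> carrier G"
  by (simp add: cmt_def)

lemma (in group) cmt_swap: "\<lbrakk>x \<in> carrier G; y \<in> carrier G\<rbrakk> \<Longrightarrow> x \<otimes> y = cmt x y \<otimes> (y \<otimes> x)"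
proof -
  assume xy: "x \<in> carrier G" "y \<in> carrier G"
  have "cmt x y \<otimes> (y \<otimes> x) = x \<otimes> y \<otimes> (inv x \<otimes> ((inv y \<otimes> y) \<otimes> x))"
    using xy by (simp only: cmt_def m_assoc inv_closed m_closed)
  then show "x \<otimes> y = cmt x y \<otimes> (y \<otimes> x)" using xy by simp
qed

lemma (in group) cmt_one_iff: "\<lbrakk>x \<in> carrier G; y \<in> carrier G\<rbrakk> \<Longrightarrow> cmt x y = \<one> \<longleftrightarrow> x \<otimes> y = y \<otimes> x"
proof -
  assume xy: "x \<in> carrier G" "y \<in> carrier G"
  have e: "cmt x y = (x \<otimes> y) \<otimes> inv (y \<otimes> x)" using xy by (simp add: cmt_def inv_mult_group m_assoc)
  show "cmt x y = \<one> \<longleftrightarrow> x \<otimes> y = y \<otimes> x"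
  proof
    assume "cmt x y = \<one>"
    then show "x \<otimes> y = y \<otimes> x" using cmt_swap[OF xy] xy by simp
  next
    assume "x \<otimes> y = y \<otimes> x"
    then show "cmt x y = \<one>" unfolding e using xy by simp
  qed
qed

lemma (in group) normal_if_cmts:
  assumes H: "subgroup H G" and c: "\<And>x y. \<lbrakk>x \<in> carrier G; y \<in> carrier G\<rbrakk> \<Longrightarrow> cmt x y \<in> H"
  shows "H \<lhd> G"
  unfolding normal_inv_iff
proof (intro conjI ballI H)
  fix x h assume xh: "x \<in> carrier G" "h \<in> H"
  then have hG: "h \<in> carrier G" using subgroup.mem_carrier[OF H] by blast
  have "cmt x h \<otimes> h \<in> H" using subgroup.m_closed[OF H c] xh hG by blast
  also have "cmt x h \<otimes> h = x \<otimes> h \<otimes> inv x" using xh hG by (simp add: cmt_def m_assoc)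
  finally show "x \<otimes> h \<otimes> inv x \<in> H" .
qed

lemma (in group) factor_comm_group:
  assumes N: "N \<lhd> G" and c: "\<And>x y. \<lbrakk>x \<in> carrier G; y \<in> carrier G\<rbrakk> \<Longrightarrow> cmt x y \<in> N"
  shows "comm_group (G Mod N)"
proof -
  interpret N: normal N G by (rule N)
  interpret Q: group "G Mod N" by (rule N.factorgroup_is_group)
  show ?thesis
  proof (rule Q.group_comm_groupI)
    fix a b assume "a \<in> carrier (G Mod N)" "b \<in> carrier (G Mod N)"
    then obtain x y where xy: "x \<in> carrier G" "y \<in> carrier G" "a = N #> x" "b = N #> y"
      by (auto simp: FactGroup_def RCOSETS_image)
    have "x \<otimes> y \<otimes> inv (y \<otimes> x) = cmt x y" using xy by (simp add: cmt_def inv_mult_group m_assoc)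
    then have "N #> (x \<otimes> y) = N #> (y \<otimes> x)"
      using c[OF xy(1,2)] xy N.rcoset_eq_iff[of "x \<otimes> y" "y \<otimes> x"] by simp
    then show "a \<otimes>\<^bsub>G Mod N\<^esub> b = b \<otimes>\<^bsub>G Mod N\<^esub> a" using xy by (simp add: FactGroup_def N.rcos_sum)
  qed
qed

lemma (in group) factor_generated:
  assumes N: "N \<lhd> G" and S: "S \<subseteq> carrier G" "generate G S = carrier G"
  shows "generate (G Mod N) ((\<lambda>x. N #> x) ` S) = carrier (G Mod N)"
proof -
  interpret N: normal N G by (rule N)
  interpret Q: group "G Mod N" by (rule N.factorgroup_is_group)
  interpret h: group_hom G "G Mod N" "\<lambda>x. N #> x" by unfold_locales (rule N.r_coset_hom_Mod)
  have "generate (G Mod N) ((\<lambda>x. N #> x) ` S) = (\<lambda>x. N #> x) ` generate G S" by (rule h.generate_img[OF S(1)])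
  then show ?thesis using S by (auto simp: FactGroup_def RCOSETS_image)
qed

lemma (in group) finite_index_if_powers:
  assumes S: "finite S" "S \<subseteq> carrier G" "generate G S = carrier G" and H: "subgroup H G"
    and c: "\<And>x y. \<lbrakk>x \<in> carrier G; y \<in> carrier G\<rbrakk> \<Longrightarrow> cmt x y \<in> H"
    and m: "m > (0::nat)" "\<And>x. x \<in> carrier G \<Longrightarrow> x [^] m \<in> H"
  shows "finite (rcosets H)"
proof -
  have N: "H \<lhd> G" by (rule normal_if_cmts[OF H c])
  interpret N: normal H G by (rule N)
  interpret Q: comm_group "G Mod H" by (rule factor_comm_group[OF N c])
  interpret h: group_hom G "G Mod H" "\<lambda>x. H #> x" by unfold_locales (rule N.r_coset_hom_Mod)
  have "finite (carrier (G Mod H))"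
  proof (rule Q.finite_if_exponent[of "(\<lambda>x. H #> x) ` S" m])
    show "generate (G Mod H) ((\<lambda>x. H #> x) ` S) = carrier (G Mod H)" by (rule factor_generated[OF N S(2,3)])
    fix C assume "C \<in> carrier (G Mod H)"
    then obtain x where x: "x \<in> carrier G" "C = H #> x" by (auto simp: FactGroup_def RCOSETS_image)
    have "C [^]\<^bsub>G Mod H\<^esub> m = H #> (x [^] m)" using x by (simp add: h.hom_nat_pow)
    also have "\<dots> = H" using m x by (intro coset_join2 H) auto
    finally show "C [^]\<^bsub>G Mod H\<^esub> m = \<one>\<^bsub>G Mod H\<^esub>" by (simp add: FactGroup_def)
  qed (use S m in \<open>auto simp: FactGroup_def RCOSETS_image\<close>)
  then show ?thesis by (simp add: FactGroup_def)
qed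

text \<open>
  An element \<open>g0\<close> inverting \<open>V\<close> makes the extension split, its centralizer being a complement;
  the squares in this complement form the desired subgroup.
\<close>

lemma (in group) sign_split:
  assumes S: "finite S" "S \<subseteq> carrier G" "generate G S = carrier G"
    and V: "subgroup V G" "finite V" "\<And>v. v \<in> V \<Longrightarrow> v \<otimes> v \<otimes> v = \<one>"
    and c: "\<And>x y. \<lbrakk>x \<in> carrier G; y \<in> carrier G\<rbrakk> \<Longrightarrow> cmt x y \<in> V"
    and sgn: "\<And>x v. \<lbrakk>x \<in> carrier G; v \<in> V\<rbrakk> \<Longrightarrow> x \<otimes> x \<otimes> v = v \<otimes> (x \<otimes> x)"
    and g0: "g0 \<in> carrier G" "\<And>v. v \<in> V \<Longrightarrow> g0 \<otimes> v = inv v \<otimes> g0"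
  obtains K where "K \<lhd> G" "finite (rcosets K)" "K \<inter> V = {\<one>}"
proof -
  have VG: "v \<in> carrier G" if "v \<in> V" for v using that V(1) subgroup.mem_carrier by metis
  define C where "C = {x \<in> carrier G. x \<otimes> g0 = g0 \<otimes> x}"
  have CG: "x \<in> carrier G" if "x \<in> C" for x using that by (simp add: C_def)
  have C: "subgroup C G"
  proof (rule subgroupI)
    show "C \<noteq> {}" using g0 by (auto simp: C_def)
    fix a assume a: "a \<in> C"
    then have "inv a \<otimes> (a \<otimes> g0) \<otimes> inv a = inv a \<otimes> (g0 \<otimes> a) \<otimes> inv a" by (simp add: C_def)
    then show "inv a \<in> C" using CG[OF a] g0 by (simp add: C_def m_assoc) (metis inv_closed l_inv l_one m_assoc m_closed)
    fix b assume b: "b \<in> C"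
    then show "a \<otimes> b \<in> C" using a g0 by (simp add: C_def) (metis m_assoc)
  qed (auto simp: C_def)
  have CV: "v = \<one>" if "v \<in> C" "v \<in> V" for v
  proof -
    have "v \<otimes> g0 = inv v \<otimes> g0" using that g0 by (simp add: C_def)
    then have "v = inv v" using VG[OF that(2)] g0 by simp
    then have "v \<otimes> v = \<one>" using VG[OF that(2)] by (metis r_inv)
    then show ?thesis using V(3)[OF that(2)] VG[OF that(2)] by simp
  qed
  have Ccomm: "a \<otimes> b = b \<otimes> a" if "a \<in> C" "b \<in> C" for a b
  proof -
    have "cmt a b \<in> C" unfolding cmt_def using that by (intro subgroup.m_closed[OF C] subgroup.m_inv_closed[OF C])
    moreover have "cmt a b \<in> V" using c that CG by blast
    ultimately have "cmt a b = \<one>" by (rule CV)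
    then show ?thesis using cmt_one_iff CG that by blast
  qed
  have split: "\<exists>v\<in>V. v \<otimes> x \<in> C" if x: "x \<in> carrier G" for x
  proof
    \<comment> \<open>\<open>x\<close> is moved into the centralizer of \<open>g0\<close> by its own
      commutator with \<open>g0\<close>: since \<open>g0\<close> inverts \<open>w\<close>, and
      \<open>w^2\<close> is the inverse of \<open>w\<close> by exponent 3, the product
      \<open>w x\<close> commutes with \<open>g0\<close>.\<close>
    define w where "w = cmt x g0"
    show w: "w \<in> V" unfolding w_def by (rule c[OF x g0(1)])
    have xg: "x \<otimes> g0 = w \<otimes> (g0 \<otimes> x)" unfolding w_def by (rule cmt_swap[OF x g0(1)])
    have gw: "g0 \<otimes> w = inv w \<otimes> g0" by (rule g0(2)[OF w])
    have wG: "w \<in> carrier G" by (rule VG[OF w])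
    have ww: "w \<otimes> w = inv w" using V(3)[OF w] wG by (metis inv_equality m_closed)
    have "w \<otimes> x \<otimes> g0 = (w \<otimes> w) \<otimes> (g0 \<otimes> x)" using xg x g0 wG by (simp add: m_assoc)
    also have "\<dots> = (inv w \<otimes> g0) \<otimes> x" unfolding ww using x g0 wG by (simp add: m_assoc)
    also have "\<dots> = g0 \<otimes> (w \<otimes> x)" unfolding gw[symmetric] using x g0 wG by (simp add: m_assoc)
    finally show "w \<otimes> x \<in> C" using x wG by (simp add: C_def)
  qed
  \<comment> \<open>Squares centralize \<open>V\<close> by \<open>sgn\<close> and commute with the
    abelian group \<open>C\<close>. As \<open>V\<close> and \<open>C\<close> generate the group,
    \<open>K\<close> is central, hence normal.\<close>
  define K where "K = (\<lambda>c. c \<otimes> c) ` C"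
  have K: "subgroup K G"
  proof (rule subgroupI)
    show "K \<subseteq> carrier G" using CG by (auto simp: K_def)
    show "K \<noteq> {}" using subgroup.one_closed[OF C] by (auto simp: K_def)
  next
    fix k assume "k \<in> K"
    then obtain a where a: "a \<in> C" "k = a \<otimes> a" by (auto simp: K_def)
    then have "inv k = inv a \<otimes> inv a" using CG by (simp add: inv_mult_group)
    then show "inv k \<in> K" using a subgroup.m_inv_closed[OF C] by (auto simp: K_def)
  next
    fix k l assume "k \<in> K" "l \<in> K"
    then obtain a b where ab: "a \<in> C" "k = a \<otimes> a" "b \<in> C" "l = b \<otimes> b" by (auto simp: K_def)
    have "k \<otimes> l = a \<otimes> (a \<otimes> b) \<otimes> b" using ab CG by (simp add: m_assoc)
    also have "\<dots> = a \<otimes> (b \<otimes> a) \<otimes> b" by (simp only: Ccomm[OF ab(1,3)])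
    also have "\<dots> = (a \<otimes> b) \<otimes> (a \<otimes> b)" using ab CG by (simp add: m_assoc)
    finally show "k \<otimes> l \<in> K" using subgroup.m_closed[OF C ab(1,3)] by (auto simp: K_def)
  qed
  have KG: "k \<in> carrier G" if "k \<in> K" for k using subgroup.mem_carrier[OF K that] .
  have central: "k \<otimes> x = x \<otimes> k" if k: "k \<in> K" and x: "x \<in> carrier G" for k x
  proof -
    obtain a where a: "a \<in> C" "k = a \<otimes> a" using k by (auto simp: K_def)
    obtain v where v: "v \<in> V" "v \<otimes> x \<in> C" using split[OF x] by blast
    have kC: "k \<in> C" using a subgroup.m_closed[OF C] by simp
    have vG: "v \<in> carrier G" by (rule VG[OF v(1)])
    have kv: "k \<otimes> v = v \<otimes> k" using sgn[OF CG[OF a(1)] v(1)] a(2) by simp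
    have "v \<otimes> (k \<otimes> x) = k \<otimes> (v \<otimes> x)" using kv KG[OF k] vG x by (simp add: m_assoc[symmetric])
    also have "\<dots> = v \<otimes> (x \<otimes> k)" using Ccomm[OF kC v(2)] KG[OF k] vG x by (simp add: m_assoc)
    finally show ?thesis using KG[OF k] vG x by simp
  qed
  have normal: "K \<lhd> G"
    unfolding normal_inv_iff
  proof (intro conjI ballI K)
    fix x h assume "x \<in> carrier G" "h \<in> K"
    then have xh: "x \<in> carrier G" "h \<in> carrier G" using KG by auto
    have "x \<otimes> h \<otimes> inv x = h \<otimes> x \<otimes> inv x" using central[OF \<open>h \<in> K\<close> xh(1)] by simp
    also have "\<dots> = h" using xh by (simp add: m_assoc)
    finally show "x \<otimes> h \<otimes> inv x \<in> K" using \<open>h \<in> K\<close> by simp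
  qed
  \<comment> \<open>\<open>V K\<close> contains all commutators and, as shown below, all squares, so
    its index is finite; since \<open>V\<close> is finite, so is the index of
    \<open>K\<close>.\<close>
  define H where "H = {v \<otimes> k | v k. v \<in> V \<and> k \<in> K}"
  have HI: "v \<otimes> k \<in> H" if "v \<in> V" "k \<in> K" for v k using that by (auto simp: H_def)
  have H: "subgroup H G"
  proof (rule subgroupI)
    show "H \<subseteq> carrier G" using VG KG by (auto simp: H_def)
    show "H \<noteq> {}" using HI[OF subgroup.one_closed[OF V(1)] subgroup.one_closed[OF K]] by blast
  next
    fix a assume "a \<in> H"
    then obtain v k where vk: "a = v \<otimes> k" "v \<in> V" "k \<in> K" by (auto simp: H_def)
    have ik: "inv k \<in> K" using subgroup.m_inv_closed[OF K vk(3)] .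
    have "inv a = inv k \<otimes> inv v" using vk VG KG by (simp add: inv_mult_group)
    also have "\<dots> = inv v \<otimes> inv k" by (rule central[OF ik]) (use vk VG in simp)
    finally show "inv a \<in> H" using HI[OF subgroup.m_inv_closed[OF V(1) vk(2)] ik] by simp
  next
    fix a b assume "a \<in> H" "b \<in> H"
    then obtain v k w l where vk: "a = v \<otimes> k" "v \<in> V" "k \<in> K" "b = w \<otimes> l" "w \<in> V" "l \<in> K" by (auto simp: H_def)
    have "a \<otimes> b = v \<otimes> (k \<otimes> w) \<otimes> l" using vk VG KG by (simp add: m_assoc)
    also have "\<dots> = (v \<otimes> w) \<otimes> (k \<otimes> l)" using central[OF vk(3) VG[OF vk(5)]] vk VG KG by (simp add: m_assoc)
    finally show "a \<otimes> b \<in> H" using HI[OF subgroup.m_closed[OF V(1) vk(2,5)] subgroup.m_closed[OF K vk(3,6)]] by simp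
  qed
  have "finite (rcosets H)"
  proof (rule finite_index_if_powers[OF S H, of 2])
    show "cmt x y \<in> H" if "x \<in> carrier G" "y \<in> carrier G" for x y
      using HI[OF c[OF that] subgroup.one_closed[OF K]] that by (simp add: cmt_closed)
    fix x assume x: "x \<in> carrier G"
    obtain v where v: "v \<in> V" "v \<otimes> x \<in> C" using split[OF x] by blast
    define y where "y = v \<otimes> x"
    have vG: "v \<in> carrier G" "y \<in> carrier G" using VG[OF v(1)] x by (simp_all add: y_def)
    have xy: "x = inv v \<otimes> y" using vG x by (simp add: y_def m_assoc[symmetric])
    have yv: "y \<otimes> inv v = cmt y (inv v) \<otimes> (inv v \<otimes> y)" by (rule cmt_swap) (use vG in auto)
    have "x \<otimes> x = inv v \<otimes> (y \<otimes> inv v) \<otimes> y" unfolding xy using vG by (simp add: m_assoc)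
    also have "\<dots> = (inv v \<otimes> cmt y (inv v) \<otimes> inv v) \<otimes> (y \<otimes> y)" unfolding yv using vG cmt_closed[of y "inv v"] by (simp add: m_assoc)
    finally have xx: "x \<otimes> x = (inv v \<otimes> cmt y (inv v) \<otimes> inv v) \<otimes> (y \<otimes> y)" .
    have "inv v \<otimes> cmt y (inv v) \<otimes> inv v \<in> V"
      using v vG by (intro subgroup.m_closed[OF V(1)] subgroup.m_inv_closed[OF V(1)] c) auto
    moreover have "y \<otimes> y \<in> K" using v(2) by (auto simp: K_def y_def)
    ultimately have "x \<otimes> x \<in> H" unfolding xx by (rule HI)
    then show "x [^] (2::nat) \<in> H" using x by (simp add: numeral_2_eq_2)
  qed simp
  then have "finite ((\<lambda>x. H #> x) ` carrier G)" by (simp only: RCOSETS_image)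
  moreover have "rcosets K \<subseteq> (\<lambda>(v, D). K #> (v \<otimes> (SOME x. x \<in> D \<and> x \<in> carrier G))) ` (V \<times> (\<lambda>x. H #> x) ` carrier G)"
  proof
    fix D assume "D \<in> rcosets K"
    then obtain x where x: "x \<in> carrier G" "D = K #> x" by (auto simp: RCOSETS_image)
    define y where "y = (SOME y. y \<in> H #> x \<and> y \<in> carrier G)"
    have y: "y \<in> H #> x" "y \<in> carrier G"
      using someI[of "\<lambda>y. y \<in> H #> x \<and> y \<in> carrier G" x] rcos_self[OF x(1) H] x(1) by (auto simp: y_def)
    obtain h where h: "h \<in> H" "y = h \<otimes> x" using y(1) by (auto simp: r_coset_def)
    then obtain v k where vk: "h = v \<otimes> k" "v \<in> V" "k \<in> K" by (auto simp: H_def)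
    have "inv v \<otimes> y = k \<otimes> x" using h vk x VG[OF vk(2)] KG[OF vk(3)] by (simp add: m_assoc[symmetric])
    then have "K #> (inv v \<otimes> y) = K #> x"
      using repr_independence[of "k \<otimes> x" K x] x K vk(3) by (auto simp: r_coset_def)
    then have "D = (\<lambda>(v, D). K #> (v \<otimes> (SOME x. x \<in> D \<and> x \<in> carrier G))) (inv v, H #> x)" by (simp add: x(2) y_def)
    then show "D \<in> (\<lambda>(v, D). K #> (v \<otimes> (SOME x. x \<in> D \<and> x \<in> carrier G))) ` (V \<times> (\<lambda>x. H #> x) ` carrier G)"
      using x(1) subgroup.m_inv_closed[OF V(1) vk(2)] by blast
  qed
  ultimately have "finite (rcosets K)" using V(2) by (meson finite_SigmaI finite_imageI finite_subset)
  moreover have "K \<inter> V = {\<one>}"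
  proof -
    have "K \<subseteq> C" using subgroup.m_closed[OF C] by (auto simp: K_def)
    then show ?thesis using CV subgroup.one_closed[OF K] subgroup.one_closed[OF V(1)] by blast
  qed
  ultimately show ?thesis using that normal by blast
qed

section \<open>A group approximated by lamplighter quotients\<close>

lemma (in group) commute_generate:
  assumes x: "x \<in> carrier G" and S: "S \<subseteq> carrier G" "\<And>s. s \<in> S \<Longrightarrow> x \<otimes> s = s \<otimes> x" and y: "y \<in> generate G S"
  shows "x \<otimes> y = y \<otimes> x"
proof -
  have C: "subgroup {y \<in> carrier G. x \<otimes> y = y \<otimes> x} G"
  proof (rule subgroupI)
    show "{y \<in> carrier G. x \<otimes> y = y \<otimes> x} \<noteq> {}" using x by auto
  next
    fix a assume a: "a \<in> {y \<in> carrier G. x \<otimes> y = y \<otimes> x}"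
    then have aG: "a \<in> carrier G" and xa: "x \<otimes> a = a \<otimes> x" by auto
    have "x = a \<otimes> x \<otimes> inv a" using xa[symmetric] aG x by (simp add: m_assoc)
    then have "inv a \<otimes> x = inv a \<otimes> (a \<otimes> x \<otimes> inv a)" by simp
    also have "\<dots> = x \<otimes> inv a" using aG x by (simp add: m_assoc[symmetric])
    finally show "inv a \<in> {y \<in> carrier G. x \<otimes> y = y \<otimes> x}" using aG by simp
  next
    fix a b assume "a \<in> {y \<in> carrier G. x \<otimes> y = y \<otimes> x}" "b \<in> {y \<in> carrier G. x \<otimes> y = y \<otimes> x}"
    then have ab: "a \<in> carrier G" "x \<otimes> a = a \<otimes> x" "b \<in> carrier G" "x \<otimes> b = b \<otimes> x" by auto
    have "x \<otimes> (a \<otimes> b) = (a \<otimes> x) \<otimes> b" using ab x by (simp add: m_assoc[symmetric])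
    also have "\<dots> = (a \<otimes> b) \<otimes> x" using ab x by (simp add: m_assoc)
    finally show "a \<otimes> b \<in> {y \<in> carrier G. x \<otimes> y = y \<otimes> x}" using ab by simp
  qed auto
  have "generate G S \<subseteq> {y \<in> carrier G. x \<otimes> y = y \<otimes> x}"
    by (rule generate_subgroup_incl[OF _ C]) (use S in auto)
  then show ?thesis using y by blast
qed

text \<open>Generators that commute pairwise modulo \<open>E\<close> make the quotient
  abelian.\<close>

lemma (in group) cmts_in_normal:
  assumes E: "E \<lhd> G" and S: "S \<subseteq> carrier G" "generate G S = carrier G"
    and c: "\<And>s t. \<lbrakk>s \<in> S; t \<in> S\<rbrakk> \<Longrightarrow> cmt s t \<in> E" and xy: "x \<in> carrier G" "y \<in> carrier G"
  shows "cmt x y \<in> E"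
proof -
  interpret E: normal E G by (rule E)
  interpret Q: group "G Mod E" by (rule E.factorgroup_is_group)
  have mm: "(E #> x) \<otimes>\<^bsub>G Mod E\<^esub> (E #> y) = E #> (x \<otimes> y)" if "x \<in> carrier G" "y \<in> carrier G" for x y
    using that by (simp add: FactGroup_def E.rcos_sum)
  have iff: "(E #> x) \<otimes>\<^bsub>G Mod E\<^esub> (E #> y) = (E #> y) \<otimes>\<^bsub>G Mod E\<^esub> (E #> x) \<longleftrightarrow> cmt x y \<in> E"
    if "x \<in> carrier G" "y \<in> carrier G" for x y
  proof -
    have "x \<otimes> y \<otimes> inv (y \<otimes> x) = cmt x y" using that by (simp add: cmt_def inv_mult_group m_assoc)
    then show ?thesis unfolding mm[OF that] mm[OF that(2,1)] using that E.rcoset_eq_iff[of "x \<otimes> y" "y \<otimes> x"] by simp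
  qed
  define T where "T = (\<lambda>x. E #> x) ` S"
  have T: "T \<subseteq> carrier (G Mod E)" "generate (G Mod E) T = carrier (G Mod E)"
    using factor_generated[OF E S] S(1) by (auto simp: T_def FactGroup_def RCOSETS_image)
  have 1: "a \<otimes>\<^bsub>G Mod E\<^esub> b = b \<otimes>\<^bsub>G Mod E\<^esub> a" if a: "a \<in> T" and b: "b \<in> carrier (G Mod E)" for a b
  proof (rule Q.commute_generate[OF _ T(1)])
    show "a \<in> carrier (G Mod E)" using a T(1) by blast
    show "b \<in> generate (G Mod E) T" using b T(2) by simp
    fix t assume "t \<in> T"
    then obtain u v where "u \<in> S" "v \<in> S" "a = E #> u" "t = E #> v" using a by (auto simp: T_def)
    then show "a \<otimes>\<^bsub>G Mod E\<^esub> t = t \<otimes>\<^bsub>G Mod E\<^esub> a" using iff[of u v] c[of u v] S(1) by auto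
  qed
  have "(E #> x) \<otimes>\<^bsub>G Mod E\<^esub> (E #> y) = (E #> y) \<otimes>\<^bsub>G Mod E\<^esub> (E #> x)"
  proof (rule Q.commute_generate[OF _ T(1)])
    show "E #> x \<in> carrier (G Mod E)" using xy by (auto simp: FactGroup_def RCOSETS_image)
    then show "(E #> x) \<otimes>\<^bsub>G Mod E\<^esub> t = t \<otimes>\<^bsub>G Mod E\<^esub> (E #> x)" if "t \<in> T" for t
      using 1[OF that, of "E #> x"] by simp
    show "E #> y \<in> generate (G Mod E) T" using xy T(2) by (auto simp: FactGroup_def RCOSETS_image)
  qed
  then show ?thesis using iff[OF xy] by simp
qed

section \<open>The abelian normal subgroup A and the group ring acting on it\<close>

context lamp_approx
begin

text \<open>The kernel of the approximation at level \<open>s\<close>.\<close>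

definition Ks :: "nat \<Rightarrow> 'a set"
  where "Ks s = {x \<in> carrier D. [kap s x = 0] (mod int s) \<and> (\<forall>i<n. mu s x i \<in> ideal2 (int s) s)}"

definition A :: "'a set"
  where "A = {x \<in> carrier D. \<forall>s>0. [kap s x = 0] (mod int s)}"

lemma A_carrier: "x \<in> A \<Longrightarrow> x \<in> carrier D" by (simp add: A_def)
lemma A_kap: "x \<in> A \<Longrightarrow> s > 0 \<Longrightarrow> [kap s x = 0] (mod int s)" by (simp add: A_def)

lemma kap_one: "s > 0 \<Longrightarrow> [kap s \<one> = 0] (mod int s)"
  using kap_mult[of s \<one> \<one>] by (simp add: cong_iff_dvd_diff)

lemma kap_inv:
  assumes "s > 0" "x \<in> carrier D" shows "[kap s (inv x) = - kap s x] (mod int s)"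
proof -
  have "[kap s x + kap s (inv x) = 0] (mod int s)"
    using kap_mult[of s x "inv x"] kap_one[of s] assms by (metis cong_sym cong_trans inv_closed r_inv)
  then show ?thesis by (simp add: cong_iff_dvd_diff add.commute)
qed

lemma kap_nat_pow:
  assumes "s > 0" "x \<in> carrier D" shows "[kap s (x [^] (k::nat)) = int k * kap s x] (mod int s)"
proof (induction k)
  case 0
  then show ?case using kap_one assms by simp
next
  case (Suc k)
  have "[kap s (x [^] Suc k) = kap s (x [^] k) + kap s x] (mod int s)" using kap_mult assms by simp
  also have "[kap s (x [^] k) + kap s x = int k * kap s x + kap s x] (mod int s)" by (intro cong_add Suc cong_refl)
  finally show ?case by (simp add: algebra_simps)
qed

lemma kap_int_pow:
  assumes "s > 0" "x \<in> carrier D" shows "[kap s (x [^] (k::int)) = k * kap s x] (mod int s)"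
proof (cases k rule: int_cases2)
  case (nonneg m)
  show ?thesis unfolding nonneg int_pow_int by (rule kap_nat_pow[OF assms])
next
  case (nonpos m)
  have e: "x [^] k = inv (x [^] m)" unfolding nonpos int_pow_neg[OF assms(2)] int_pow_int ..
  have "[kap s (inv (x [^] m)) = - kap s (x [^] m)] (mod int s)"
    by (rule kap_inv[OF assms(1) nat_pow_closed[OF assms(2)]])
  moreover have "int s dvd kap s (x [^] m) - int m * kap s x"
    using kap_nat_pow[OF assms, of m] unfolding cong_iff_dvd_diff .
  then have "int s dvd - (kap s (x [^] m) - int m * kap s x)" by (simp only: dvd_minus_iff)
  then have "[- kap s (x [^] m) = k * kap s x] (mod int s)"
    unfolding cong_iff_dvd_diff nonpos by (simp add: algebra_simps)
  ultimately show ?thesis unfolding e by (rule cong_trans)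
qed

lemma mu_mult0:
  assumes "s > 0" "x \<in> carrier D" "y \<in> carrier D" "i < n" "[kap s x = 0] (mod int s)"
  shows "mu s (x \<otimes> y) i - (mu s x i + mu s y i) \<in> ideal2 (int s) s"
proof -
  have "kap s x mod int s = 0" using assms(5) by (simp add: cong_def)
  then show ?thesis using mu_mult[OF assms(1-4)] by (simp add: monom_0 flip: one_pCons)
qed

lemma mu_one: "s > 0 \<Longrightarrow> i < n \<Longrightarrow> mu s \<one> i \<in> ideal2 (int s) s"
  using ideal2_uminus[OF mu_mult0[of s \<one> \<one> i]] kap_one[of s] by simp

lemma mu_inv0:
  assumes "s > 0" "x \<in> carrier D" "i < n" "[kap s x = 0] (mod int s)"
  shows "mu s (inv x) i + mu s x i \<in> ideal2 (int s) s"
proof -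
  have "mu s (x \<otimes> inv x) i - (mu s x i + mu s (inv x) i) \<in> ideal2 (int s) s" using assms by (intro mu_mult0) auto
  then have "mu s \<one> i - (mu s x i + mu s (inv x) i) \<in> ideal2 (int s) s" using assms by simp
  then show ?thesis using ideal2_diff[OF mu_one[OF assms(1,3)]] by (metis add.commute diff_diff_eq2 add_diff_cancel_left')
qed

lemma mu_conj:
  assumes "s > 0" "x \<in> carrier D" "a \<in> carrier D" "i < n" "[kap s a = 0] (mod int s)"
  shows "mu s (x \<otimes> a \<otimes> inv x) i - monom 1 (nat (kap s x mod int s)) * mu s a i \<in> ideal2 (int s) s"
proof -
  define z where "z = x \<otimes> a \<otimes> inv x"
  have z: "z \<in> carrier D" "z \<otimes> x = x \<otimes> a" using assms by (simp_all add: z_def m_assoc)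
  have "[kap s z + kap s x = kap s x + kap s a] (mod int s)"
    using kap_mult[of s z x] kap_mult[of s x a] z assms by (metis cong_sym cong_trans)
  then have "[kap s z = kap s a] (mod int s)" by (simp add: cong_iff_dvd_diff)
  then have kz: "[kap s z = 0] (mod int s)" using assms(5) by (rule cong_trans)
  have "mu s (z \<otimes> x) i - (mu s z i + mu s x i) \<in> ideal2 (int s) s" using assms z kz by (intro mu_mult0) auto
  moreover have "mu s (x \<otimes> a) i - (mu s x i + monom 1 (nat (kap s x mod int s)) * mu s a i) \<in> ideal2 (int s) s"
    using assms by (intro mu_mult) auto
  ultimately have "(mu s (x \<otimes> a) i - (mu s x i + monom 1 (nat (kap s x mod int s)) * mu s a i)) - (mu s (x \<otimes> a) i - (mu s z i + mu s x i)) \<in> ideal2 (int s) s"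
    unfolding z(2) by (rule ideal2_diff[rotated])
  then show ?thesis by (simp add: z_def[symmetric] algebra_simps)
qed

lemma Ks_trivial:
  assumes x: "x \<in> carrier D" "\<And>s. s > 0 \<Longrightarrow> x \<in> Ks s" shows "x = \<one>"
proof (rule ccontr)
  assume "x \<noteq> \<one>"
  then obtain N where N: "N \<lhd> D" "finite (carrier (D Mod N))" "x \<notin> N"
    using rf x(1) unfolding residually_finite_group_def by blast
  then obtain s where "s > 0" "\<forall>x\<in>carrier D. [kap s x = 0] (mod int s) \<longrightarrow> (\<forall>i<n. mu s x i \<in> ideal2 (int s) s) \<longrightarrow> x \<in> N"
    using cofinal[OF N(1)] by (auto simp: FactGroup_def)
  then show False using x(2)[of s] x(1) N(3) by (simp add: Ks_def)
qed

lemma A_subgroup: "subgroup A D"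
proof (rule subgroupI)
  show "A \<noteq> {}" using kap_one by (auto simp: A_def)
next
  fix a assume a: "a \<in> A"
  have "[kap s (inv a) = 0] (mod int s)" if "s > 0" for s
    using kap_inv[OF that A_carrier[OF a]] A_kap[OF a that] by (simp add: cong_0_iff cong_iff_dvd_diff) (metis dvd_add_right_iff dvd_minus_iff add.commute)
  then show "inv a \<in> A" using a by (simp add: A_def)
next
  fix a b assume ab: "a \<in> A" "b \<in> A"
  have "[kap s (a \<otimes> b) = 0] (mod int s)" if "s > 0" for s
    using cong_trans[OF kap_mult[OF that A_carrier[OF ab(1)] A_carrier[OF ab(2)]] cong_add[OF A_kap[OF ab(1) that] A_kap[OF ab(2) that]]] by simp
  then show "a \<otimes> b \<in> A" using ab by (simp add: A_def)
qed (simp add: A_def subset_iff)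

lemma kap_cmt:
  assumes "s > 0" "x \<in> carrier D" "y \<in> carrier D" shows "[kap s (cmt x y) = 0] (mod int s)"
proof -
  have "[kap s (cmt x y) + kap s (y \<otimes> x) = kap s (x \<otimes> y)] (mod int s)"
    using kap_mult[of s "cmt x y" "y \<otimes> x"] cmt_swap[OF assms(2,3)] cmt_closed assms by (metis cong_sym m_closed)
  also have "[kap s (x \<otimes> y) = kap s x + kap s y] (mod int s)" by (rule kap_mult[OF assms])
  also have "[kap s x + kap s y = kap s (y \<otimes> x)] (mod int s)"
    using cong_sym[OF kap_mult[OF assms(1,3,2)]] by (simp add: add.commute)
  finally show ?thesis by (simp add: cong_iff_dvd_diff)
qed

lemma cmt_A: "x \<in> carrier D \<Longrightarrow> y \<in> carrier D \<Longrightarrow> cmt x y \<in> A"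
  using kap_cmt cmt_closed by (simp add: A_def)

lemma A_normal: "A \<lhd> D"
  by (rule normal_if_cmts[OF A_subgroup cmt_A])

lemma cmt_Ks:
  assumes s: "s > 0" and x: "x \<in> carrier D" "[kap s x = 0] (mod int s)" and y: "y \<in> carrier D" "[kap s y = 0] (mod int s)"
  shows "cmt x y \<in> Ks s"
proof -
  have c: "cmt x y \<in> carrier D" using x y by (simp add: cmt_closed)
  have "mu s (cmt x y) i \<in> ideal2 (int s) s" if i: "i < n" for i
  proof -
    have 1: "mu s (cmt x y \<otimes> (y \<otimes> x)) i - (mu s (cmt x y) i + mu s (y \<otimes> x) i) \<in> ideal2 (int s) s"
      using s x y i kap_cmt c by (intro mu_mult0) auto
    have 2: "mu s (y \<otimes> x) i - (mu s y i + mu s x i) \<in> ideal2 (int s) s" using s x y i by (intro mu_mult0) auto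
    have 3: "mu s (x \<otimes> y) i - (mu s x i + mu s y i) \<in> ideal2 (int s) s" using s x y i by (intro mu_mult0) auto
    have "(mu s (x \<otimes> y) i - (mu s x i + mu s y i)) - (mu s (x \<otimes> y) i - (mu s (cmt x y) i + mu s (y \<otimes> x) i)) - (mu s (y \<otimes> x) i - (mu s y i + mu s x i)) \<in> ideal2 (int s) s"
      by (rule ideal2_diff[OF ideal2_diff[OF 3 1[folded cmt_swap[OF x(1) y(1)]]] 2])
    then show ?thesis by simp
  qed
  then show ?thesis using kap_cmt[OF s x(1) y(1)] c by (simp add: Ks_def)
qed

text \<open>Elements of \<open>A\<close> have residue 0 at every level, so their images lie in the
  abelian base of each finite group; the commutator then dies at all levels, and these separate
  points.\<close>

lemma A_comm: "a \<in> A \<Longrightarrow> b \<in> A \<Longrightarrow> a \<otimes> b = b \<otimes> a"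
proof -
  assume ab: "a \<in> A" "b \<in> A"
  have "cmt a b = \<one>"
  proof (rule Ks_trivial)
    show "cmt a b \<in> carrier D" using ab by (simp add: cmt_closed A_carrier)
    show "cmt a b \<in> Ks s" if "s > 0" for s
      by (rule cmt_Ks[OF that A_carrier[OF ab(1)] A_kap[OF ab(1) that] A_carrier[OF ab(2)] A_kap[OF ab(2) that]])
  qed
  then show ?thesis using cmt_one_iff A_carrier ab by blast
qed

sublocale AG: comm_group "D\<lparr>carrier := A\<rparr>"
proof -
  interpret AG: group "D\<lparr>carrier := A\<rparr>" by (rule subgroup.subgroup_is_group[OF A_subgroup is_group])
  show "comm_group (D\<lparr>carrier := A\<rparr>)"
    by (rule AG.group_comm_groupI) (simp add: A_comm)
qed

lemma AG_inv: "a \<in> A \<Longrightarrow> inv\<^bsub>D\<lparr>carrier := A\<rparr>\<^esub> a = inv a"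
  by (rule m_inv_consistent[OF A_subgroup])

lemma A_mult: "a \<in> A \<Longrightarrow> b \<in> A \<Longrightarrow> a \<otimes> b \<in> A"
  by (rule subgroup.m_closed[OF A_subgroup])
lemma A_inv: "a \<in> A \<Longrightarrow> inv a \<in> A"
  by (rule subgroup.m_inv_closed[OF A_subgroup])
lemma A_one: "\<one> \<in> A"
  by (rule subgroup.one_closed[OF A_subgroup])
lemma A_pow: "a \<in> A \<Longrightarrow> a [^] (m::int) \<in> A"
  by (rule subgroup_int_pow_closed[OF A_subgroup])
lemma A_conj: "g \<in> carrier D \<Longrightarrow> a \<in> A \<Longrightarrow> g \<otimes> a \<otimes> inv g \<in> A"
  by (rule normal.inv_op_closed2[OF A_normal])

definition term1 :: "int \<Rightarrow> 'a \<Rightarrow> 'a \<Rightarrow> 'a"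
  where "term1 m g d = g \<otimes> (d [^] m) \<otimes> inv g"

lemma term1_A: "g \<in> carrier D \<Longrightarrow> d \<in> A \<Longrightarrow> term1 m g d \<in> A"
  by (simp add: term1_def A_conj A_pow)

lemma conj_mult: "\<lbrakk>g \<in> carrier D; x \<in> carrier D; y \<in> carrier D\<rbrakk> \<Longrightarrow> g \<otimes> (x \<otimes> y) \<otimes> inv g = (g \<otimes> x \<otimes> inv g) \<otimes> (g \<otimes> y \<otimes> inv g)"
proof -
  assume a: "g \<in> carrier D" "x \<in> carrier D" "y \<in> carrier D"
  have "(g \<otimes> x \<otimes> inv g) \<otimes> (g \<otimes> y \<otimes> inv g) = g \<otimes> x \<otimes> (inv g \<otimes> g) \<otimes> y \<otimes> inv g"
    using a by (simp only: m_assoc inv_closed m_closed)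
  then show ?thesis using a by (simp add: m_assoc)
qed

lemma conj_pow: "\<lbrakk>g \<in> carrier D; x \<in> carrier D\<rbrakk> \<Longrightarrow> g \<otimes> (x [^] (m::int)) \<otimes> inv g = (g \<otimes> x \<otimes> inv g) [^] m"
proof -
  assume gx: "g \<in> carrier D" "x \<in> carrier D"
  interpret c: group_hom D D "\<lambda>x. g \<otimes> x \<otimes> inv g"
    by unfold_locales (use gx in \<open>auto simp: hom_def conj_mult\<close>)
  show ?thesis using c.hom_int_pow[OF gx(2)] by simp
qed

lemma term1_mult: "\<lbrakk>g \<in> carrier D; d \<in> A; e \<in> A\<rbrakk> \<Longrightarrow> term1 m g (d \<otimes> e) = term1 m g d \<otimes> term1 m g e"
  unfolding term1_def by (simp add: int_pow_mult_distrib A_comm A_carrier conj_mult)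

lemma term1_term1: "\<lbrakk>g \<in> carrier D; h \<in> carrier D; d \<in> A\<rbrakk> \<Longrightarrow> term1 m g (term1 l h d) = term1 (m * l) (g \<otimes> h) d"
proof -
  assume a: "g \<in> carrier D" "h \<in> carrier D" "d \<in> A"
  have d: "d \<in> carrier D" using a A_carrier by blast
  have "(h \<otimes> (d [^] l) \<otimes> inv h) [^] m = h \<otimes> ((d [^] l) [^] m) \<otimes> inv h"
    using a d by (simp add: conj_pow)
  also have "(d [^] l) [^] m = d [^] (m * l)" using d by (simp add: int_pow_pow mult.commute)
  finally show ?thesis using a d by (simp add: term1_def inv_mult_group m_assoc)
qed

text \<open>\<open>A\<close> is abelian and contains all commutators, so conjugation by
  \<open>g h\<close> and by \<open>h g\<close> agree on it. This is what makes the operators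
  commute.\<close>

lemma term1_swap: "\<lbrakk>g \<in> carrier D; h \<in> carrier D; d \<in> A\<rbrakk> \<Longrightarrow> term1 m (g \<otimes> h) d = term1 m (h \<otimes> g) d"
proof -
  assume a: "g \<in> carrier D" "h \<in> carrier D" "d \<in> A"
  define c where "c = cmt g h"
  define y where "y = (h \<otimes> g) \<otimes> (d [^] m) \<otimes> inv (h \<otimes> g)"
  have c: "c \<in> A" "c \<in> carrier D" using cmt_A a by (simp_all add: c_def cmt_closed)
  have y: "y \<in> A" "y \<in> carrier D" using A_conj[of "h \<otimes> g" "d [^] m"] A_pow[OF a(3)] a A_carrier by (auto simp: y_def)
  have gh: "g \<otimes> h = c \<otimes> (h \<otimes> g)" unfolding c_def by (rule cmt_swap[OF a(1,2)])
  have dm: "d [^] m \<in> carrier D" using A_carrier[OF a(3)] by simp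
  have "term1 m (g \<otimes> h) d = c \<otimes> y \<otimes> inv c"
    unfolding term1_def gh y_def using a c dm by (simp add: inv_mult_group m_assoc)
  also have "\<dots> = y" using A_comm[OF c(1) y(1)] c y by (simp add: m_assoc)
  finally show ?thesis by (simp add: y_def term1_def)
qed

definition cg :: "'a \<Rightarrow> 'a" where "cg g = (if g \<in> carrier D then g else \<one>)"

lemma cg_carrier [simp]: "cg g \<in> carrier D" by (simp add: cg_def)
lemma cg_id: "g \<in> carrier D \<Longrightarrow> cg g = g" by (simp add: cg_def)

text \<open>A list of pairs \<open>(m, g)\<close> codes the group ring element that is the sum of
  the \<open>m g\<close>. One element has many codes, which is harmless since
  \<open>endo_module\<close> speaks of codes; \<open>cg\<close> gives every list a meaning.\<close>

fun act :: "(int \<times> 'a) list \<Rightarrow> 'a \<Rightarrow> 'a" where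
  "act [] d = \<one>"
| "act ((m, g) # P) d = term1 m (cg g) d \<otimes> act P d"

lemma act_A: "d \<in> A \<Longrightarrow> act P d \<in> A"
  by (induction P d rule: act.induct) (simp_all add: A_one A_mult term1_A)

lemma act_append: "d \<in> A \<Longrightarrow> act (P @ R) d = act P d \<otimes> act R d"
  by (induction P d rule: act.induct) (simp_all add: A_carrier act_A term1_A m_assoc)

lemma act_mult: "d \<in> A \<Longrightarrow> e \<in> A \<Longrightarrow> act P (d \<otimes> e) = act P d \<otimes> act P e"
proof (induction P)
  case (Cons mg P)
  obtain m g where mg: "mg = (m, g)" by fastforce
  have A: "term1 m (cg g) d \<in> A" "term1 m (cg g) e \<in> A" "act P d \<in> A" "act P e \<in> A"
    using Cons.prems by (simp_all add: term1_A act_A)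
  have "act (mg # P) (d \<otimes> e) = (term1 m (cg g) d \<otimes> term1 m (cg g) e) \<otimes> (act P d \<otimes> act P e)"
    using Cons mg by (simp add: term1_mult)
  also have "\<dots> = (term1 m (cg g) d \<otimes> act P d) \<otimes> (term1 m (cg g) e \<otimes> act P e)"
    using AG.m_ac(1,2,3) AG.m_closed A by simp
  finally show ?case by (simp add: mg)
qed simp

lemma act_term1: "g \<in> carrier D \<Longrightarrow> d \<in> A \<Longrightarrow> act P (term1 m g d) = term1 m g (act P d)"
proof (induction P)
  case Nil
  have "term1 m g \<one> = \<one>" using Nil by (simp add: term1_def)
  then show ?case by simp
next
  case (Cons lh P)
  obtain l h where lh: "lh = (l, h)" by fastforce
  have "term1 l (cg h) (term1 m g d) = term1 m g (term1 l (cg h) d)"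
    using Cons.prems by (simp add: term1_term1 term1_swap[of "cg h" g] mult.commute)
  then show ?case using Cons lh by (simp add: term1_mult term1_A act_A)
qed

definition neg_list :: "(int \<times> 'a) list \<Rightarrow> (int \<times> 'a) list"
  where "neg_list P = map (\<lambda>(m, g). (- m, g)) P"

definition mult_list :: "(int \<times> 'a) list \<Rightarrow> (int \<times> 'a) list \<Rightarrow> (int \<times> 'a) list"
  where "mult_list P R = concat (map (\<lambda>(m, g). map (\<lambda>(l, h). (m * l, cg g \<otimes> cg h)) R) P)"

lemma act_neg: "d \<in> A \<Longrightarrow> act (neg_list P) d = inv (act P d)"
proof (induction P)
  case (Cons mg P)
  obtain m g where mg: "mg = (m, g)" by fastforce
  have d: "d \<in> carrier D" using Cons.prems A_carrier by blast
  have "term1 (- m) (cg g) d = inv (term1 m (cg g) d)"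
    using d by (simp add: term1_def int_pow_neg inv_mult_group m_assoc)
  then have "act (neg_list (mg # P)) d = inv (term1 m (cg g) d) \<otimes> inv (act P d)" using Cons mg by (simp add: neg_list_def)
  also have "\<dots> = inv (act P d) \<otimes> inv (term1 m (cg g) d)" using Cons.prems by (intro A_comm A_inv term1_A act_A) auto
  also have "\<dots> = inv (act (mg # P) d)" using Cons.prems mg by (simp add: inv_mult_group A_carrier term1_A act_A)
  finally show ?case .
qed (simp add: neg_list_def)

lemma act_map: "d \<in> A \<Longrightarrow> act (map (\<lambda>(l, h). (m * l, cg g \<otimes> cg h)) R) d = term1 m (cg g) (act R d)"
proof (induction R)
  case Nil
  then show ?case by (simp add: term1_def)
next
  case (Cons lh R)
  obtain l h where lh: "lh = (l, h)" by fastforce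
  show ?case using Cons lh by (simp add: term1_mult term1_A act_A term1_term1 cg_id)
qed

lemma act_mult_list: "d \<in> A \<Longrightarrow> act (mult_list P R) d = act P (act R d)"
proof (induction P)
  case (Cons mg P)
  obtain m g where mg: "mg = (m, g)" by fastforce
  show ?case using Cons mg by (simp add: mult_list_def act_append act_map)
qed (simp add: mult_list_def)

lemma act_commute: "d \<in> A \<Longrightarrow> act P (act R d) = act R (act P d)"
proof (induction P)
  case Nil
  have "act R \<one> \<otimes> act R \<one> = act R \<one>" using act_mult[OF A_one A_one, of R] by simp
  then show ?case using act_A[OF A_one] A_carrier by simp
next
  case (Cons mg P)
  obtain m g where mg: "mg = (m, g)" by fastforce
  show ?case using Cons mg by (simp add: act_mult act_term1 term1_A act_A)
qed

text \<open>The augmentation of the group ring twisted by \<open>chi\<close>: it sends a group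
  element \<open>g\<close> to \<open>chi g\<close> instead of 1.\<close>

definition eps :: "('a \<Rightarrow> int) \<Rightarrow> (int \<times> 'a) list \<Rightarrow> int"
  where "eps chi P = (\<Sum>(m, g)\<leftarrow>P. m * chi (cg g))"

definition sign_char :: "('a \<Rightarrow> int) \<Rightarrow> bool"
  where "sign_char chi \<longleftrightarrow> (\<forall>x\<in>carrier D. chi x = 1 \<or> chi x = -1)
     \<and> (\<forall>x\<in>carrier D. \<forall>y\<in>carrier D. chi (x \<otimes> y) = chi x * chi y) \<and> (\<forall>a\<in>A. chi a = 1)"

lemma eps_neg: "eps chi (neg_list P) = - eps chi P"
  by (induction P) (auto simp: eps_def neg_list_def)

lemma eps_append: "eps chi (P @ R) = eps chi P + eps chi R"
  by (simp add: eps_def)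

lemma eps_mult: "sign_char chi \<Longrightarrow> eps chi (mult_list P R) = eps chi P * eps chi R"
proof (induction P)
  case (Cons mg P)
  obtain m g where mg: "mg = (m, g)" by fastforce
  have "eps chi (map (\<lambda>(l, h). (m * l, cg g \<otimes> cg h)) R) = m * chi (cg g) * eps chi R"
  proof (induction R)
    case (Cons lh R)
    have "chi (cg g \<otimes> cg h) = chi (cg g) * chi (cg h)" for h using \<open>sign_char chi\<close> by (simp add: sign_char_def)
    then show ?case using Cons by (cases lh) (simp add: eps_def cg_id algebra_simps)
  qed (simp add: eps_def)
  moreover have "mult_list (mg # P) R = map (\<lambda>(l, h). (m * l, cg g \<otimes> cg h)) R @ mult_list P R" by (simp add: mult_list_def mg)
  ultimately have "eps chi (mult_list (mg # P) R) = m * chi (cg g) * eps chi R + eps chi P * eps chi R"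
    using Cons by (simp add: eps_append)
  then show ?case by (simp add: mg eps_def algebra_simps)
qed (simp add: eps_def mult_list_def)

lemma endo_module_A:
  assumes chi: "sign_char chi" shows "endo_module (D\<lparr>carrier := A\<rparr>) act (eps chi)"
proof (unfold_locales, goal_cases)
  case (1 x r)
  then show ?case by (simp add: act_A)
next
  case (2 x y r)
  then show ?case by (simp add: act_mult)
next
  case (3 r r')
  show ?case by (rule exI[of _ "r @ neg_list r'"]) (simp add: eps_append eps_neg act_append act_neg act_A AG_inv)
next
  case (4 r r')
  show ?case by (rule exI[of _ "mult_list r r'"]) (simp add: eps_mult[OF chi] act_mult_list)
next
  case (5 x r r')
  then show ?case by (simp add: act_commute)
next
  case 6
  have "chi \<one> = 1" using chi A_one by (simp add: sign_char_def)
  then show ?case by (intro exI[of _ "[(1, \<one>)]"]) (simp add: eps_def cg_id term1_def A_carrier)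
qed

end

lemma (in endo_module) act_kills_sp:
  assumes "set cs \<subseteq> carrier Q" "\<And>c. c \<in> set cs \<Longrightarrow> act r c = \<one>" "x \<in> sp I cs" shows "act r x = \<one>"
  using assms
proof (induction cs arbitrary: x)
  case (Cons c cs)
  obtain q y where x: "x = act q c \<otimes> y" "y \<in> sp I cs" using Cons.prems by auto
  have c: "c \<in> carrier Q" "y \<in> carrier Q" using Cons.prems x sp_carrier[of cs I] by auto
  have "act r x = act q (act r c) \<otimes> act r y" using c x by (simp add: act_mult act_closed act_commute[of c r q])
  also have "act r c = \<one>" using Cons.prems by simp
  also have "act r y = \<one>" using Cons x by simp
  finally show ?case by (simp add: act_one)
qed (simp add: act_one)

lemma sum_list_absent:
  "c \<notin> r ` snd ` set P \<Longrightarrow> (\<Sum>(m, g)\<leftarrow>P. if r g = c then F m g else (0::int)) = 0"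
  by (induction P) auto

section \<open>Annihilators of the commutators\<close>

context lamp_approx
begin

lemma mu_nat_pow:
  assumes s: "s > 0" and d: "d \<in> carrier D" "[kap s d = 0] (mod int s)" and i: "i < n"
  shows "mu s (d [^] (k::nat)) i - [:int k:] * mu s d i \<in> ideal2 (int s) s"
proof (induction k)
  case 0
  then show ?case using mu_one[OF s i] by simp
next
  case (Suc k)
  have "[kap s (d [^] k) = int k * kap s d] (mod int s)" by (rule kap_nat_pow[OF s d(1)])
  also have "[int k * kap s d = int k * 0] (mod int s)" by (rule cong_mult[OF cong_refl d(2)])
  finally have "[kap s (d [^] k) = 0] (mod int s)" by simp
  then have "mu s (d [^] k \<otimes> d) i - (mu s (d [^] k) i + mu s d i) \<in> ideal2 (int s) s"
    using s d i by (intro mu_mult0) auto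
  from ideal2_add[OF this Suc] have "mu s (d [^] k \<otimes> d) i - ([:int k:] + 1) * mu s d i \<in> ideal2 (int s) s"
    by (simp add: algebra_simps)
  moreover have "[:int k:] + 1 = ([:int (Suc k):] :: int poly)" by (simp add: one_pCons)
  ultimately show ?case by simp
qed

lemma mu_int_pow:
  assumes s: "s > 0" and d: "d \<in> carrier D" "[kap s d = 0] (mod int s)" and i: "i < n"
  shows "mu s (d [^] (k::int)) i - [:k:] * mu s d i \<in> ideal2 (int s) s"
proof (cases k rule: int_cases2)
  case (nonneg m)
  show ?thesis unfolding nonneg int_pow_int by (rule mu_nat_pow[OF assms])
next
  case (nonpos m)
  have e: "d [^] k = inv (d [^] m)" unfolding nonpos int_pow_neg[OF d(1)] int_pow_int ..
  have "[kap s (d [^] m) = int m * kap s d] (mod int s)" by (rule kap_nat_pow[OF s d(1)])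
  also have "[int m * kap s d = int m * 0] (mod int s)" by (rule cong_mult[OF cong_refl d(2)])
  finally have "[kap s (d [^] m) = 0] (mod int s)" by simp
  then have "mu s (inv (d [^] m)) i + mu s (d [^] m) i \<in> ideal2 (int s) s"
    using s d i by (intro mu_inv0) auto
  from ideal2_diff[OF this mu_nat_pow[OF assms, of m]]
  have "mu s (inv (d [^] m)) i + [:int m:] * mu s d i \<in> ideal2 (int s) s" by simp
  moreover have "[:k:] = - ([:int m:] :: int poly)" by (simp add: nonpos)
  ultimately show ?thesis unfolding e by simp
qed

lemma mu_term1:
  assumes s: "s > 0" and g: "g \<in> carrier D" and d: "d \<in> A" and i: "i < n"
  shows "mu s (term1 m g d) i - monom m (nat (kap s g mod int s)) * mu s d i \<in> ideal2 (int s) s"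
proof -
  define r where "r = nat (kap s g mod int s)"
  have "mu s (term1 m g d) i - monom 1 r * mu s (d [^] m) i \<in> ideal2 (int s) s"
    unfolding term1_def r_def using s g i A_carrier[OF d] A_kap[OF A_pow[OF d] s] by (intro mu_conj) auto
  moreover have "monom 1 r * (mu s (d [^] m) i - [:m:] * mu s d i) \<in> ideal2 (int s) s"
    by (rule ideal2_mult[OF mu_int_pow[OF s A_carrier[OF d] A_kap[OF d s] i]])
  ultimately have a: "mu s (term1 m g d) i - monom 1 r * mu s (d [^] m) i + monom 1 r * (mu s (d [^] m) i - [:m:] * mu s d i) \<in> ideal2 (int s) s"
    by (rule ideal2_add)
  have "monom 1 r * [:m:] = monom m r" by (simp add: smult_monom)
  then have e: "mu s (term1 m g d) i - monom 1 r * mu s (d [^] m) i + monom 1 r * (mu s (d [^] m) i - [:m:] * mu s d i)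
     = mu s (term1 m g d) i - monom m r * mu s d i"
    by (simp add: right_diff_distrib mult.assoc[symmetric] del: mult_pCons_left mult_pCons_right)
  show ?thesis using a unfolding e by (simp only: r_def)
qed

definition res :: "nat \<Rightarrow> 'a \<Rightarrow> nat" where "res s g = nat (kap s (cg g) mod int s)"

text \<open>The image of a group ring element at level \<open>s\<close>, where \<open>g\<close> acts
  on the coordinates as \<open>X\<close> to the power of its residue.\<close>

definition pol :: "nat \<Rightarrow> (int \<times> 'a) list \<Rightarrow> int poly"
  where "pol s P = (\<Sum>(m, g)\<leftarrow>P. monom m (res s g))"

lemma mu_act:
  assumes s: "s > 0" and d: "d \<in> A" and i: "i < n"
  shows "mu s (act P d) i - pol s P * mu s d i \<in> ideal2 (int s) s"
proof (induction P)
  case Nil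
  then show ?case using mu_one[OF s i] by (simp add: pol_def)
next
  case (Cons mg P)
  obtain m g where mg: "mg = (m, g)" by fastforce
  have t: "term1 m (cg g) d \<in> A" using d by (simp add: term1_A)
  have "mu s (term1 m (cg g) d \<otimes> act P d) i - (mu s (term1 m (cg g) d) i + mu s (act P d) i) \<in> ideal2 (int s) s"
    by (rule mu_mult0[OF s A_carrier[OF t] A_carrier[OF act_A[OF d]] i A_kap[OF t s]])
  moreover have "mu s (term1 m (cg g) d) i - monom m (res s g) * mu s d i \<in> ideal2 (int s) s"
    unfolding res_def by (rule mu_term1[OF s _ d i]) simp
  ultimately have "(mu s (term1 m (cg g) d \<otimes> act P d) i - (mu s (term1 m (cg g) d) i + mu s (act P d) i))
     + (mu s (term1 m (cg g) d) i - monom m (res s g) * mu s d i) + (mu s (act P d) i - pol s P * mu s d i) \<in> ideal2 (int s) s"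
    by (intro ideal2_add Cons)
  then show ?case by (simp add: mg pol_def algebra_simps)
qed

lemma class_sum_pol: "c < s \<Longrightarrow> class_sum s c (pol s P) = (\<Sum>(m, g)\<leftarrow>P. if res s g = c then m else 0)"
proof (induction P)
  case (Cons mg P)
  have "res s g mod s = res s g" for g using Cons.prems by (simp add: res_def nat_less_iff)
  then show ?case using Cons by (cases mg) (simp add: pol_def class_sum_add class_sum_monom)
qed (simp add: pol_def class_sum_0)

text \<open>Multiplication by \<open>X\<close> moves each residue class to the next one;
  \<open>Suc c < s\<close> keeps it from wrapping around.\<close>

lemma class_sum_shift_pol: "Suc c < s \<Longrightarrow> class_sum s (Suc c) (monom 1 1 * pol s P) = (\<Sum>(m, g)\<leftarrow>P. if res s g = c then m else 0)"
proof (induction P)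
  case (Cons mg P)
  have *: "(Suc (res s g) mod s = Suc c) = (res s g = c)" for g
  proof -
    have "res s g < s" using Cons.prems by (simp add: res_def nat_less_iff)
    then show ?thesis using Cons.prems by (cases "Suc (res s g) = s") (auto simp: mod_less)
  qed
  have "pol s (mg # P) = monom (fst mg) (res s (snd mg)) + pol s P" by (simp add: pol_def case_prod_unfold)
  then have "monom 1 1 * pol s (mg # P) = monom (fst mg) (Suc (res s (snd mg))) + monom 1 1 * pol s P"
    by (simp only: distrib_left mult_monom mult_1 plus_1_eq_Suc)
  then show ?case using Cons by (simp only: class_sum_add class_sum_monom *) (simp add: case_prod_unfold)
qed (simp add: pol_def class_sum_0)

text \<open>At a suitable level some commutator has the coordinate \<open>X - 1\<close>, so
  \<open>pol s P\<close> is unchanged by multiplication with \<open>X\<close> and all its class sums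
  agree modulo \<open>s\<close>. There are more classes than terms, so one class is empty and all
  class sums vanish modulo \<open>s\<close>, hence modulo 3. On each class \<open>chi\<close> is
  constant, so the twisted augmentation is a signed sum of class sums.\<close>

lemma annihilator:
  assumes n: "n > 0" and chi: "sign_char chi"
    and P: "\<And>x y. \<lbrakk>x \<in> carrier D; y \<in> carrier D\<rbrakk> \<Longrightarrow> act P (cmt x y) = \<one>"
  shows "3 dvd eps chi P"
proof -
  define T where "T = (\<lambda>mg. cg (snd mg)) ` set P"
  have T: "finite T" "g \<in> carrier D" if "g \<in> T" for g using that by (auto simp: T_def)
  have finT: "finite T" by (simp add: T_def)
  have "\<exists>s>0. g \<otimes> inv h \<in> A \<or> \<not> [kap s (g \<otimes> inv h) = 0] (mod int s)" if "g \<in> T" "h \<in> T" for g h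
    using T(2)[OF that(1)] T(2)[OF that(2)] by (auto simp: A_def)
  then obtain f where f: "\<And>g h. \<lbrakk>g \<in> T; h \<in> T\<rbrakk> \<Longrightarrow> f g h > 0 \<and> (g \<otimes> inv h \<in> A \<or> \<not> [kap (f g h) (g \<otimes> inv h) = 0] (mod int (f g h)))"
    by metis
  \<comment> \<open>The factor 3 passes from modulus \<open>s\<close> to modulus 3,
    \<open>length P + 2\<close> leaves a class empty and gives \<open>s\<close> at least 2, and the
    product separates elements of \<open>T\<close> that differ modulo \<open>A\<close>.\<close>
  define s where "s = 3 * (length P + 2) * (\<Prod>g\<in>T. \<Prod>h\<in>T. f g h)"
  have fs: "f g h dvd s" if "g \<in> T" "h \<in> T" for g h
    unfolding s_def using that finT by (intro dvd_mult dvd_trans[OF dvd_prodI[OF finT that(2)] dvd_prodI[OF finT that(1)]])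
  have pp: "(\<Prod>g\<in>T. \<Prod>h\<in>T. f g h) > 0" using f by (intro prod_pos ballI) auto
  then have "3 * (length P + 2) * 1 \<le> s" unfolding s_def by (intro mult_le_mono2) simp
  then have s: "s > 0" "s > length P" "s \<ge> 2" by auto
  have s3: "3 dvd s" by (simp add: s_def)
  have sep: "g \<otimes> inv h \<in> A" if gh: "g \<in> T" "h \<in> T" and k: "[kap s g = kap s h] (mod int s)" for g h
  proof (rule ccontr)
    assume no: "g \<otimes> inv h \<notin> A"
    have c: "g \<in> carrier D" "h \<in> carrier D" using T gh by auto
    have "[kap s (g \<otimes> inv h) = kap s g + kap s (inv h)] (mod int s)" using s c by (intro kap_mult) auto
    also have "[kap s g + kap s (inv h) = kap s h + - kap s h] (mod int s)" using s c by (intro cong_add k kap_inv) auto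
    finally have "[kap s (g \<otimes> inv h) = 0] (mod int s)" by simp
    moreover have "int (f g h) dvd int s" using fs[OF gh] by (simp only: of_nat_dvd_iff)
    ultimately have "[kap s (g \<otimes> inv h) = 0] (mod int (f g h))" by (rule cong_dvd_modulus)
    moreover have "[kap s (g \<otimes> inv h) = kap (f g h) (g \<otimes> inv h)] (mod int (f g h))"
      using s c f[OF gh] fs[OF gh] by (intro kap_compat) auto
    ultimately have "[kap (f g h) (g \<otimes> inv h) = 0] (mod int (f g h))" using cong_sym cong_trans by blast
    then show False using f[OF gh] no by blast
  qed
  \<comment> \<open>\<open>x\<close> has residue 1 and coordinates 0, \<open>y\<close> has residue 0
    and coordinates 1; their commutator therefore has the coordinate
    \<open>X * 1 - 1\<close>.\<close>
  obtain x where x: "x \<in> carrier D" "[kap s x = 1] (mod int s)" "\<And>i. i < n \<Longrightarrow> mu s x i - 0 \<in> ideal2 (int s) s"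
    using onto[OF s(1), of 1 "\<lambda>_. 0"] by blast
  obtain y where y: "y \<in> carrier D" "[kap s y = 0] (mod int s)" "\<And>i. i < n \<Longrightarrow> mu s y i - 1 \<in> ideal2 (int s) s"
    using onto[OF s(1), of 0 "\<lambda>_. 1"] by blast
  define z where "z = cmt x y"
  have z: "z \<in> A" unfolding z_def by (rule cmt_A[OF x(1) y(1)])
  have xy: "x \<otimes> y = z \<otimes> (y \<otimes> x)" unfolding z_def by (rule cmt_swap[OF x(1) y(1)])
  have "kap s x mod int s = 1" using x(2) s by (simp add: cong_def)
  then have 1: "mu s (x \<otimes> y) 0 - (mu s x 0 + monom 1 1 * mu s y 0) \<in> ideal2 (int s) s"
    using mu_mult[OF s(1) x(1) y(1) n] by simp
  have 2: "mu s (y \<otimes> x) 0 - (mu s y 0 + mu s x 0) \<in> ideal2 (int s) s" by (rule mu_mult0[OF s(1) y(1) x(1) n y(2)])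
  have 3: "mu s (x \<otimes> y) 0 - (mu s z 0 + mu s (y \<otimes> x) 0) \<in> ideal2 (int s) s"
    unfolding xy by (rule mu_mult0[OF s(1) A_carrier[OF z] _ n A_kap[OF z s(1)]]) (use x y in simp)
  have 4: "(monom 1 1 - 1) * (mu s y 0 - 1) \<in> ideal2 (int s) s" by (rule ideal2_mult[OF y(3)[OF n]])
  have "(mu s (x \<otimes> y) 0 - (mu s x 0 + monom 1 1 * mu s y 0)) - (mu s (x \<otimes> y) 0 - (mu s z 0 + mu s (y \<otimes> x) 0))
      - (mu s (y \<otimes> x) 0 - (mu s y 0 + mu s x 0)) + (monom 1 1 - 1) * (mu s y 0 - 1) \<in> ideal2 (int s) s"
    by (rule ideal2_add[OF ideal2_diff[OF ideal2_diff[OF 1 3] 2] 4])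
  then have mz: "mu s z 0 - (monom 1 1 - 1) \<in> ideal2 (int s) s" by (simp add: algebra_simps)
  have "mu s (act P z) 0 \<in> ideal2 (int s) s" using P[OF x(1) y(1)] mu_one[OF s(1) n] by (simp add: z_def)
  then have "pol s P * mu s z 0 \<in> ideal2 (int s) s" using ideal2_cong[OF mu_act[OF s(1) z n]] by blast
  from ideal2_diff[OF this ideal2_mult[OF mz, of "pol s P"]]
  have ps: "monom 1 1 * pol s P - pol s P \<in> ideal2 (int s) s" by (simp add: algebra_simps)
  define w where "w c = (\<Sum>(m, g)\<leftarrow>P. if res s g = c then m else 0)" for c
  have step: "[w (Suc c) = w c] (mod int s)" if "Suc c < s" for c
  proof -
    have "class_sum s (Suc c) (monom 1 1 * pol s P) = class_sum s (Suc c) (monom 1 1 * pol s P - pol s P) + class_sum s (Suc c) (pol s P)"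
      by (simp flip: class_sum_add)
    then have "w c = class_sum s (Suc c) (monom 1 1 * pol s P - pol s P) + w (Suc c)"
      using class_sum_shift_pol[OF that] class_sum_pol[OF that] by (simp only: w_def)
    moreover have "int s dvd class_sum s (Suc c) (monom 1 1 * pol s P - pol s P)" by (rule class_sum_ideal2[OF ps])
    ultimately show ?thesis by (simp add: cong_iff_dvd_diff dvd_diff_commute)
  qed
  have w0: "[w c = w 0] (mod int s)" if "c < s" for c
    using that
  proof (induction c)
    case (Suc c)
    then show ?case using cong_trans[OF step] by simp
  qed simp
  have "card (res s ` snd ` set P) \<le> length P"
    using card_image_le[of "set P" "res s \<circ> snd"] card_length[of P] by (simp add: image_comp)
  then have "\<not> {..<s} \<subseteq> res s ` snd ` set P" using s(2) card_mono[of "res s ` snd ` set P" "{..<s}"] by auto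
  then obtain c0 where c0: "c0 < s" "c0 \<notin> res s ` snd ` set P" by blast
  have "w c0 = 0" unfolding w_def by (rule sum_list_absent[OF c0(2)])
  then have w3: "3 dvd w c" if "c < s" for c
  proof -
    have "[w c = 0] (mod int s)" using cong_trans[OF w0[OF that] cong_sym[OF w0[OF c0(1)]]] \<open>w c0 = 0\<close> by simp
    then have "int s dvd w c" by (simp add: cong_0_iff)
    moreover have "3 dvd int s" using s3 by presburger
    ultimately show ?thesis using dvd_trans by blast
  qed
  define v where "v c = (\<Sum>(m, g)\<leftarrow>P. if res s g = c then m * chi (cg g) else 0)" for c
  have v3: "3 dvd v c" if c: "c < s" for c
  proof (cases "c \<in> res s ` snd ` set P")
    case True
    then obtain m0 g0 where g0: "(m0, g0) \<in> set P" "res s g0 = c" by auto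
    have "m * chi (cg g) = chi (cg g0) * m" if "(m, g) \<in> set P" "res s g = c" for m g
    proof -
      have T': "cg g \<in> T" "cg g0 \<in> T" using that g0 by (force simp: T_def)+
      have "kap s (cg g) mod int s = kap s (cg g0) mod int s"
        using that(2) g0(2) s(1) by (simp add: res_def nat_eq_iff) 
      then have "cg g \<otimes> inv (cg g0) \<in> A" using sep[OF T'] by (simp add: cong_def)
      then have "chi (cg g \<otimes> inv (cg g0)) = 1" using chi by (simp add: sign_char_def)
      moreover have "cg g = (cg g \<otimes> inv (cg g0)) \<otimes> cg g0" by (simp add: m_assoc)
      ultimately have "chi (cg g) = chi (cg g0)" using chi unfolding sign_char_def by (metis cg_carrier inv_closed m_closed mult_1)
      then show ?thesis by simp
    qed
    then have "v c = (\<Sum>(m, g)\<leftarrow>P. chi (cg g0) * (if res s g = c then m else 0))"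
      unfolding v_def by (intro arg_cong[of _ _ sum_list] map_cong) auto
    also have "\<dots> = chi (cg g0) * w c" unfolding w_def by (simp add: case_prod_unfold sum_list_const_mult)
    finally show ?thesis using w3[OF c] by simp
  next
    case False
    then have "v c = 0" unfolding v_def by (rule sum_list_absent)
    then show ?thesis by simp
  qed
  have "eps chi P' = (\<Sum>c<s. \<Sum>(m, g)\<leftarrow>P'. if res s g = c then m * chi (cg g) else 0)" for P'
  proof (induction P')
    case (Cons mg P')
    have "res s (snd mg) < s" using s(1) by (simp add: res_def nat_less_iff)
    then show ?case using Cons by (simp add: eps_def case_prod_unfold sum.distrib)
  qed (simp add: eps_def)
  then have "eps chi P = (\<Sum>c<s. v c)" by (simp only: v_def)
  moreover have "3 dvd (\<Sum>c<s. v c)" by (rule dvd_sum) (use v3 in simp)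
  ultimately show ?thesis by simp
qed

end

section \<open>Sign characters and generation modulo squares\<close>

context lamp_approx
begin

text \<open>For nontrivial \<open>chi\<close>, the commutator subgroup \<open>E\<close> has a
  nonzero finite quotient \<open>V\<close> of exponent 3 on which \<open>D\<close> acts through
  \<open>chi\<close>. The splitting embeds \<open>V\<close> into a finite quotient of
  \<open>D\<close>, which some level \<open>s\<close> dominates. There an element of residue 0
  commutes with the base, so it acts trivially on \<open>V\<close> and its sign is 1.\<close>

lemma chi_factors:
  assumes n: "n > 0" and chi: "sign_char chi"
  shows "\<exists>s>0. \<forall>g\<in>carrier D. [kap s g = 0] (mod int s) \<longrightarrow> chi g = 1"
proof (cases "\<forall>g\<in>carrier D. chi g = 1")
  case True
  then show ?thesis by (intro exI[of _ 1]) auto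
next
  case False
  have chi_pm: "chi x = 1 \<or> chi x = -1" if "x \<in> carrier D" for x using chi that by (simp add: sign_char_def)
  have chi_mult: "chi (x \<otimes> y) = chi x * chi y" if "x \<in> carrier D" "y \<in> carrier D" for x y using chi that by (simp add: sign_char_def)
  have chi1: "chi \<one> = 1" using chi A_one by (simp add: sign_char_def)
  obtain g0 where g0: "g0 \<in> carrier D" "chi g0 = -1" using False chi_pm by blast
  interpret M: endo_module "D\<lparr>carrier := A\<rparr>" act "eps chi" 3 by (rule endo_module_A[OF chi])
  obtain S where S: "finite S" "S \<subseteq> carrier D" "generate D S = carrier D"
    using fg unfolding finitely_generated_group_def by blast
  obtain Sl where Sl: "set Sl = S" using finite_list[OF S(1)] by blast
  define full where "full = concat (map (\<lambda>x. map (\<lambda>y. cmt x y) Sl) Sl)"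
  have full: "set full = {cmt x y | x y. x \<in> S \<and> y \<in> S}" using Sl by (auto simp: full_def)
  have fullA: "set full \<subseteq> A" using full cmt_A S(2) by auto
  define E where "E = M.full_span full"
  \<comment> \<open>\<open>E\<close> times the ideal of group ring elements whose twisted
    augmentation is divisible by 3: modulo \<open>D0\<close>, every \<open>g\<close> acts on
    \<open>E\<close> as the sign \<open>chi g\<close>.\<close>
  define D0 where "D0 = M.ideal_span full"
  have sub: "subgroup (M.sp I full) D" "\<And>g x. g \<in> carrier D \<Longrightarrow> x \<in> M.sp I full \<Longrightarrow> g \<otimes> x \<otimes> inv g \<in> M.sp I full"
    if I: "I 0" "\<And>d e. I d \<Longrightarrow> I e \<Longrightarrow> I (d + e)" "\<And>k e. I e \<Longrightarrow> I (k * e)" for I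
  proof -
    have spA: "M.sp I full \<subseteq> A" using M.sp_carrier[of full I] fullA by simp
    have acts: "act r x \<in> M.sp I full" if "x \<in> M.sp I full" for r x
      by (rule M.sp_act[OF _ _ that]) (use fullA I(3) in auto)
    show "subgroup (M.sp I full) D"
    proof (rule subgroupI)
      show "M.sp I full \<subseteq> carrier D" using spA A_carrier by blast
      show "M.sp I full \<noteq> {}" using M.sp_one[of I full] I(1) fullA by auto
    next
      fix a assume a: "a \<in> M.sp I full"
      have "act [(-1, \<one>)] a = inv a" using a spA A_carrier by (auto simp: term1_def cg_id int_pow_neg)
      then show "inv a \<in> M.sp I full" using acts[OF a, of "[(-1, \<one>)]"] by simp
    next
      fix a b assume ab: "a \<in> M.sp I full" "b \<in> M.sp I full"
      show "a \<otimes> b \<in> M.sp I full" using M.sp_mult[OF _ I(2) ab] fullA by simp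
    qed
    fix g x assume g: "g \<in> carrier D" and x: "x \<in> M.sp I full"
    have "act [(1, g)] x = g \<otimes> x \<otimes> inv g" using g x spA A_carrier by (auto simp: term1_def cg_id)
    then show "g \<otimes> x \<otimes> inv g \<in> M.sp I full" using acts[OF x, of "[(1, g)]"] by simp
  qed
  have E_sub: "subgroup E D" unfolding E_def by (rule sub(1)) auto
  have E_normal: "E \<lhd> D" unfolding normal_inv_iff using E_sub sub(2)[of "\<lambda>_. True"] by (auto simp: E_def)
  have D0_sub: "subgroup D0 D" unfolding D0_def by (rule sub(1)) auto
  have D0_normal: "D0 \<lhd> D" unfolding normal_inv_iff using D0_sub sub(2)[of "\<lambda>e. 3 dvd e"] by (auto simp: D0_def)
  have EA: "E \<subseteq> A" using M.sp_carrier[of full "\<lambda>_. True"] fullA by (simp add: E_def)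
  have fullE: "c \<in> E" if "c \<in> set full" for c using M.full_span_member[of full c] fullA that by (simp add: E_def)
  have cmtE: "cmt x y \<in> E" if "x \<in> carrier D" "y \<in> carrier D" for x y
    by (rule cmts_in_normal[OF E_normal S(2,3) _ that]) (use fullE full in blast)
  have EtoD0: "act r d \<in> D0" if "d \<in> E" "3 dvd eps chi r" for r d
    unfolding D0_def by (rule M.sp_act[OF _ _ that(1)[unfolded E_def]]) (use fullA that(2) in auto)
  \<comment> \<open>Otherwise Nakayama's lemma yields an element of augmentation 1 modulo 3 that
    kills all commutators, against \<open>annihilator\<close>.\<close>
  have "\<exists>c\<in>set full. c \<notin> D0"
  proof (rule ccontr)
    assume "\<not> ?thesis"
    then have all: "\<And>c. c \<in> set full \<Longrightarrow> c \<in> M.ideal_span full" by (simp add: D0_def)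
    obtain r where r: "[eps chi r = 1] (mod 3)" "\<And>c. c \<in> set full \<Longrightarrow> act r c = \<one>\<^bsub>D\<lparr>carrier := A\<rparr>\<^esub>"
      by (rule M.nakayama[OF _ all]) (use fullA in auto)
    have "act r d = \<one>\<^bsub>D\<lparr>carrier := A\<rparr>\<^esub>" if "d \<in> E" for d
      by (rule M.act_kills_sp[OF _ r(2) that[unfolded E_def]]) (use fullA in auto)
    then have "act r (cmt x y) = \<one>" if "x \<in> carrier D" "y \<in> carrier D" for x y using cmtE[OF that] by simp
    then have "3 dvd eps chi r" by (rule annihilator[OF n chi])
    then show False using r(1) by (simp add: cong_def)
  qed
  then obtain c0 where c0: "c0 \<in> E" "c0 \<notin> D0" using fullE by blast
  have cube: "d \<otimes> d \<otimes> d \<in> D0" if "d \<in> E" for d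
  proof -
    have d: "d \<in> carrier D" using that EA A_carrier by blast
    have "act [(3, \<one>)] d = d [^] (3::int)" using d by (simp add: term1_def cg_id)
    also have "\<dots> = d [^] int 3" by simp
    also have "\<dots> = d \<otimes> d \<otimes> d" unfolding int_pow_int using d by (simp add: numeral_3_eq_3)
    finally show ?thesis using EtoD0[OF that, of "[(3, \<one>)]"] by (simp add: eps_def cg_id chi1)
  qed
  have twist: "g \<otimes> d \<otimes> inv g \<otimes> d [^] (- chi g) \<in> D0" if "g \<in> carrier D" "d \<in> E" for g d
  proof -
    have d: "d \<in> carrier D" using that EA A_carrier by blast
    have "act [(1, g), (- chi g, \<one>)] d = g \<otimes> d \<otimes> inv g \<otimes> d [^] (- chi g)" using d that(1) by (simp add: term1_def cg_id)
    then show ?thesis using EtoD0[OF that(2), of "[(1, g), (- chi g, \<one>)]"] that(1) by (simp add: eps_def cg_id chi1)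
  qed
  interpret N: normal D0 D by (rule D0_normal)
  interpret W: group "D Mod D0" by (rule N.factorgroup_is_group)
  interpret h: group_hom D "D Mod D0" "\<lambda>x. D0 #> x" by unfold_locales (rule N.r_coset_hom_Mod)
  have Wc: "carrier (D Mod D0) = (\<lambda>x. D0 #> x) ` carrier D" by (auto simp: FactGroup_def RCOSETS_image)
  have Weq: "D0 #> x = D0 #> y \<longleftrightarrow> x \<otimes> inv y \<in> D0" if "x \<in> carrier D" "y \<in> carrier D" for x y by (rule N.rcoset_eq_iff[OF that])
  have W1: "\<one>\<^bsub>D Mod D0\<^esub> = D0 #> \<one>" by simp
  define V where "V = (\<lambda>x. D0 #> x) ` E"
  have EG: "d \<in> carrier D" if "d \<in> E" for d using that EA A_carrier by blast
  \<comment> \<open>Modulo \<open>D0\<close> a coefficient matters only through its twisted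
    augmentation modulo 3, so three powers of each generator suffice.\<close>
  have fin: "finite ((\<lambda>x. D0 #> x) ` M.full_span cs)" if "set cs \<subseteq> set full" for cs
    using that
  proof (induction cs)
    case (Cons c cs)
    have cE: "c \<in> E" using Cons.prems fullE by auto
    have csA: "set cs \<subseteq> A" using Cons.prems fullA by auto
    have "(\<lambda>x. D0 #> x) ` M.full_span (c # cs) \<subseteq> (\<lambda>(k, y). (D0 #> (c [^] (k::int))) \<otimes>\<^bsub>D Mod D0\<^esub> y) ` ({0..<3} \<times> (\<lambda>x. D0 #> x) ` M.full_span cs)"
    proof
      fix w assume "w \<in> (\<lambda>x. D0 #> x) ` M.full_span (c # cs)"
      then obtain r y where r: "w = D0 #> (act r c \<otimes> y)" "y \<in> M.full_span cs" by auto
      have yA: "y \<in> A" using M.sp_carrier[of cs "\<lambda>_. True"] csA r(2) by auto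
      define k where "k = eps chi r mod 3"
      have "3 dvd eps chi (r @ [(- k, \<one>)])" by (simp add: eps_append eps_def cg_id chi1 k_def flip: mod_eq_dvd_iff)
      then have "act (r @ [(- k, \<one>)]) c \<in> D0" by (rule EtoD0[OF cE])
      moreover have "act (r @ [(- k, \<one>)]) c = act r c \<otimes> inv (c [^] k)"
        using cE EA EG by (simp add: act_append subset_iff term1_def cg_id int_pow_neg)
      ultimately have "D0 #> act r c = D0 #> (c [^] k)"
        using Weq[of "act r c" "c [^] k"] cE EG EA act_A A_carrier by (simp add: subset_iff)
      moreover have "w = (D0 #> act r c) \<otimes>\<^bsub>D Mod D0\<^esub> (D0 #> y)"
        unfolding r(1) by (rule h.hom_mult) (use cE EA act_A A_carrier yA in blast)+
      ultimately have "w = (\<lambda>(k, y). (D0 #> (c [^] (k::int))) \<otimes>\<^bsub>D Mod D0\<^esub> y) (k, D0 #> y)" by simp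
      moreover have "k \<in> {0..<3}" by (simp add: k_def)
      ultimately show "w \<in> (\<lambda>(k, y). (D0 #> (c [^] (k::int))) \<otimes>\<^bsub>D Mod D0\<^esub> y) ` ({0..<3} \<times> (\<lambda>x. D0 #> x) ` M.full_span cs)"
        using r(2) by blast
    qed
    moreover have "finite ({0..<3::int} \<times> (\<lambda>x. D0 #> x) ` M.full_span cs)" using Cons by simp
    ultimately show ?case by (meson finite_imageI finite_subset)
  qed simp
  obtain KW where KW: "KW \<lhd> D Mod D0" "finite (rcosets\<^bsub>D Mod D0\<^esub> KW)" "KW \<inter> V = {\<one>\<^bsub>D Mod D0\<^esub>}"
  proof (rule W.sign_split[of "(\<lambda>x. D0 #> x) ` S" V "D0 #> g0"])
    show "generate (D Mod D0) ((\<lambda>x. D0 #> x) ` S) = carrier (D Mod D0)" by (rule factor_generated[OF D0_normal S(2,3)])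
    show "subgroup V (D Mod D0)" unfolding V_def by (rule h.subgroup_img_is_subgroup[OF E_sub])
    show "finite V" unfolding V_def E_def by (rule fin) simp
  next
    fix v assume "v \<in> V"
    then obtain d where d: "d \<in> E" "v = D0 #> d" by (auto simp: V_def)
    have "v \<otimes>\<^bsub>D Mod D0\<^esub> v \<otimes>\<^bsub>D Mod D0\<^esub> v = D0 #> (d \<otimes> d \<otimes> d)" using d EG by simp
    also have "\<dots> = D0" using cube[OF d(1)] by (intro coset_join2 D0_sub) (use d EG in auto)
    finally show "v \<otimes>\<^bsub>D Mod D0\<^esub> v \<otimes>\<^bsub>D Mod D0\<^esub> v = \<one>\<^bsub>D Mod D0\<^esub>" by (simp add: FactGroup_def)
  next
    fix a b assume "a \<in> carrier (D Mod D0)" "b \<in> carrier (D Mod D0)"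
    then obtain x y where xy: "x \<in> carrier D" "y \<in> carrier D" "a = D0 #> x" "b = D0 #> y" unfolding Wc by blast
    have "W.cmt a b = D0 #> cmt x y" using xy by (simp add: W.cmt_def cmt_def)
    then show "W.cmt a b \<in> V" using cmtE[OF xy(1,2)] by (simp add: V_def)
  next
    fix a v assume "a \<in> carrier (D Mod D0)" "v \<in> V"
    then obtain x d where xd: "x \<in> carrier D" "d \<in> E" "a = D0 #> x" "v = D0 #> d" unfolding Wc V_def by blast
    have d: "d \<in> carrier D" by (rule EG[OF xd(2)])
    have "chi (x \<otimes> x) = 1" using chi_mult[OF xd(1,1)] chi_pm[OF xd(1)] by auto
    then have "(x \<otimes> x) \<otimes> d \<otimes> inv (x \<otimes> x) \<otimes> inv d \<in> D0" using twist[of "x \<otimes> x" d] xd d by (simp add: int_pow_neg)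
    also have "(x \<otimes> x) \<otimes> d \<otimes> inv (x \<otimes> x) \<otimes> inv d = (x \<otimes> x \<otimes> d) \<otimes> inv (d \<otimes> (x \<otimes> x))"
      using xd d by (simp add: inv_mult_group m_assoc)
    finally have "D0 #> (x \<otimes> x \<otimes> d) = D0 #> (d \<otimes> (x \<otimes> x))" by (rule iffD2[OF Weq, rotated 2]) (use xd d in simp_all)
    then show "a \<otimes>\<^bsub>D Mod D0\<^esub> a \<otimes>\<^bsub>D Mod D0\<^esub> v = v \<otimes>\<^bsub>D Mod D0\<^esub> (a \<otimes>\<^bsub>D Mod D0\<^esub> a)" using xd d by simp
  next
    show "D0 #> g0 \<in> carrier (D Mod D0)" using g0 unfolding Wc by blast
    fix v assume "v \<in> V"
    then obtain d where d: "d \<in> E" "v = D0 #> d" by (auto simp: V_def)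
    have dG: "d \<in> carrier D" by (rule EG[OF d(1)])
    have "g0 \<otimes> d \<otimes> inv g0 \<otimes> d \<in> D0" using twist[OF g0(1) d(1)] g0 dG by simp
    also have "g0 \<otimes> d \<otimes> inv g0 \<otimes> d = (g0 \<otimes> d) \<otimes> inv (inv d \<otimes> g0)" using g0 dG by (simp add: inv_mult_group m_assoc)
    finally have "D0 #> (g0 \<otimes> d) = D0 #> (inv d \<otimes> g0)" by (rule iffD2[OF Weq, rotated 2]) (use g0 dG in simp_all)
    then show "(D0 #> g0) \<otimes>\<^bsub>D Mod D0\<^esub> v = inv\<^bsub>D Mod D0\<^esub> v \<otimes>\<^bsub>D Mod D0\<^esub> (D0 #> g0)"
      unfolding d(2) h.hom_inv[OF dG, symmetric] using g0 dG by simp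
  qed (use S Wc in auto)
  interpret two_groups D "D Mod D0" by unfold_locales
  interpret KN: normal KW "D Mod D0" by (rule KW(1))
  have em: "emod D (D Mod D0) KW (\<lambda>x. D0 #> x)"
    unfolding emod_iff[OF KW(1)]
  proof (intro conjI ballI)
    show "(\<lambda>x. D0 #> x) \<in> carrier D \<rightarrow> carrier (D Mod D0)" using Wc by blast
    fix x y assume xy: "x \<in> carrier D" "y \<in> carrier D"
    show "(D0 #> (x \<otimes> y)) \<otimes>\<^bsub>D Mod D0\<^esub> inv\<^bsub>D Mod D0\<^esub> ((D0 #> x) \<otimes>\<^bsub>D Mod D0\<^esub> (D0 #> y)) \<in> KW"
      unfolding h.hom_mult[OF xy] W.r_inv[OF W.m_closed[OF h.hom_closed[OF xy(1)] h.hom_closed[OF xy(2)]]] by (rule KN.one_closed)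
  next
    fix w assume "w \<in> carrier (D Mod D0)"
    then obtain x where x: "x \<in> carrier D" "w = D0 #> x" unfolding Wc by blast
    have "(D0 #> x) \<otimes>\<^bsub>D Mod D0\<^esub> inv\<^bsub>D Mod D0\<^esub> w \<in> KW"
      unfolding x(2) W.r_inv[OF h.hom_closed[OF x(1)]] by (rule KN.one_closed)
    then show "\<exists>x\<in>carrier D. (D0 #> x) \<otimes>\<^bsub>D Mod D0\<^esub> inv\<^bsub>D Mod D0\<^esub> w \<in> KW" using x(1) by blast
  qed
  define K where "K = {x \<in> carrier D. D0 #> x \<in> KW}"
  have K: "K \<lhd> D" "finite (rcosets K)" using emod_preimage[OF em KW(1)] KW(2) by (simp_all add: K_def)
  obtain s where s: "s > 0" "\<forall>x\<in>carrier D. [kap s x = 0] (mod int s) \<longrightarrow> (\<forall>i<n. mu s x i \<in> ideal2 (int s) s) \<longrightarrow> x \<in> K"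
    using cofinal[OF K] by blast
  have "chi g = 1" if g: "g \<in> carrier D" "[kap s g = 0] (mod int s)" for g
  proof (rule ccontr)
    assume "chi g \<noteq> 1"
    then have cg1: "chi g = -1" using chi_pm[OF g(1)] by blast
    have c0G: "c0 \<in> carrier D" by (rule EG[OF c0(1)])
    define z where "z = cmt g c0"
    have zG: "z \<in> carrier D" using g c0G by (simp add: z_def cmt_closed)
    \<comment> \<open>\<open>g\<close> and \<open>c0\<close> both have residue 0, so their
      commutator vanishes at level \<open>s\<close>. But \<open>g\<close> inverts \<open>c0\<close>
      modulo \<open>D0\<close>, where \<open>z\<close> is thus the inverse square of
      \<open>c0\<close>; with exponent 3 this would put \<open>c0\<close> into
      \<open>D0\<close>.\<close>
    have "z \<in> Ks s" unfolding z_def by (rule cmt_Ks[OF s(1) g c0G]) (use c0(1) EA A_kap s(1) in blast)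
    then have "z \<in> K" using s(2) by (simp add: Ks_def)
    then have "D0 #> z \<in> KW" by (simp add: K_def)
    moreover have "D0 #> z \<in> V" using cmtE[OF g(1) c0G] by (simp add: V_def z_def)
    ultimately have "D0 #> z = \<one>\<^bsub>D Mod D0\<^esub>" using KW(3) by blast
    then have "D0 #> z = D0" by (simp add: FactGroup_def)
    then have zD: "z \<in> D0" using rcos_self[OF zG D0_sub] by simp
    have "g \<otimes> c0 \<otimes> inv g \<otimes> c0 \<in> D0" using twist[OF g(1) c0(1)] cg1 c0G by simp
    also have "g \<otimes> c0 \<otimes> inv g \<otimes> c0 = z \<otimes> (c0 \<otimes> c0)" using g c0G by (simp add: z_def cmt_def m_assoc)
      (metis c0G inv_closed l_one m_assoc l_inv)
    finally have "inv z \<otimes> (z \<otimes> (c0 \<otimes> c0)) \<in> D0" by (rule subgroup.m_closed[OF D0_sub subgroup.m_inv_closed[OF D0_sub zD]])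
    then have cc: "c0 \<otimes> c0 \<in> D0" using zG c0G by (simp add: m_assoc[symmetric])
    have "inv (c0 \<otimes> c0) \<otimes> (c0 \<otimes> c0 \<otimes> c0) \<in> D0"
      by (rule subgroup.m_closed[OF D0_sub subgroup.m_inv_closed[OF D0_sub cc] cube[OF c0(1)]])
    then have "c0 \<in> D0" using c0G m_assoc[symmetric, of "inv (c0 \<otimes> c0)" "c0 \<otimes> c0" c0] by simp
    then show False using c0(2) by blast
  qed
  then show ?thesis using s(1) by blast
qed

text \<open>By \<open>chi_factors\<close> the sign of \<open>x\<close> is that of an element
  \<open>h\<close> of residue 1, raised to the residue of \<open>x\<close>. The residue of
  \<open>t\<close> is odd, so \<open>chi t = 1\<close> forces \<open>chi h = 1\<close>.\<close>

lemma chi_trivial: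
  assumes n: "n > 0" and chi: "sign_char chi" and t: "t \<in> carrier D" "[kap 2 t = 1] (mod 2)" "chi t = 1" and g: "g \<in> carrier D"
  shows "chi g = 1"
proof -
  have chi_pm: "chi x = 1 \<or> chi x = -1" if "x \<in> carrier D" for x using chi that by (simp add: sign_char_def)
  have chi_mult: "chi (x \<otimes> y) = chi x * chi y" if "x \<in> carrier D" "y \<in> carrier D" for x y using chi that by (simp add: sign_char_def)
  have chi1: "chi \<one> = 1" using chi A_one by (simp add: sign_char_def)
  obtain s0 where s0: "s0 > 0" "\<forall>g\<in>carrier D. [kap s0 g = 0] (mod int s0) \<longrightarrow> chi g = 1" using chi_factors[OF n chi] by blast
  \<comment> \<open>An even level makes the parity of residues meaningful.\<close>
  define s where "s = 2 * s0"
  have s: "s > 0" "s0 dvd s" "2 dvd s" using s0 by (simp_all add: s_def)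
  have triv: "chi x = 1" if x: "x \<in> carrier D" "[kap s x = 0] (mod int s)" for x
  proof -
    have "[kap s x = 0] (mod int s0)" using x(2) s(2) by (auto intro: cong_dvd_modulus)
    then have "[kap s0 x = 0] (mod int s0)" using cong_trans[OF cong_sym[OF kap_compat[OF s0(1) s(1,2) x(1)]]] by blast
    then show ?thesis using s0(2) x(1) by blast
  qed
  obtain h where h: "h \<in> carrier D" "[kap s h = 1] (mod int s)" using onto[OF s(1), of 1 "\<lambda>_. 0"] by blast
  have pow: "chi (h [^] (k::nat)) = chi h ^ k" for k
    by (induction k) (simp_all add: chi1 chi_mult h mult.commute)
  have val: "chi x = chi h ^ nat (kap s x mod int s)" if x: "x \<in> carrier D" for x
  proof -
    define k where "k = nat (kap s x mod int s)"
    have k: "int k = kap s x mod int s" using s(1) by (simp add: k_def)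
    have hk: "h [^] k \<in> carrier D" using h by simp
    have "[kap s (h [^] k) = int k * kap s h] (mod int s)" by (rule kap_nat_pow[OF s(1) h(1)])
    also have "[int k * kap s h = int k * 1] (mod int s)" by (rule cong_mult[OF cong_refl h(2)])
    finally have khk: "[kap s (h [^] k) = kap s x] (mod int s)" by (simp add: k cong_def)
    have "[kap s (x \<otimes> inv (h [^] k)) = kap s x + kap s (inv (h [^] k))] (mod int s)" using x hk s by (intro kap_mult) auto
    also have "[kap s x + kap s (inv (h [^] k)) = kap s x + - kap s (h [^] k)] (mod int s)" using hk s by (intro cong_add cong_refl kap_inv)
    also have "[kap s x + - kap s (h [^] k) = 0] (mod int s)" using khk by (simp add: cong_iff_dvd_diff dvd_diff_commute)
    finally have "chi (x \<otimes> inv (h [^] k)) = 1" using x hk by (intro triv) auto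
    moreover have "x = x \<otimes> inv (h [^] k) \<otimes> h [^] k" using x hk by (simp add: m_assoc)
    ultimately have "chi x = chi (h [^] k)" using chi_mult[of "x \<otimes> inv (h [^] k)" "h [^] k"] x hk by simp
    then show ?thesis by (simp only: pow k_def)
  qed
  have "[kap s t = kap 2 t] (mod int 2)" using kap_compat[of 2 s t] s t by simp
  then have "[kap s t = 1] (mod 2)" using t(2) cong_trans by simp
  then have "odd (kap s t mod int s)" using s(3) by (simp add: cong_def dvd_mod_iff odd_iff_mod_2_eq_one)
  moreover have "even (nat m) = even m" if "m \<ge> 0" for m :: int using that by (simp add: even_nat_iff)
  ultimately have "odd (nat (kap s t mod int s))" using s(1) by simp
  then have "chi h = 1" using val[OF t(1)] t(3) chi_pm[OF h(1)] by (auto simp: uminus_power_if)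
  then show ?thesis using val[OF g] by simp
qed

text \<open>A proper such \<open>H\<close> lies in a subgroup \<open>K\<close> maximal among those
  avoiding some \<open>x\<close>. For \<open>y\<close> outside \<open>K\<close> the squares make
  \<open>K\<close> and the coset \<open>K y\<close> together a subgroup, which must contain
  \<open>x\<close>; so \<open>K\<close> has index 2. It defines a nontrivial sign character that is
  1 at \<open>t\<close>, against \<open>chi_trivial\<close>.\<close>

lemma index_two_generation:
  assumes n: "n > 0" and t: "t \<in> carrier D" "[kap 2 t = 1] (mod 2)"
    and H: "subgroup H D" "A \<subseteq> H" "t \<in> H" "\<And>y. y \<in> carrier D \<Longrightarrow> y \<otimes> y \<in> H"
  shows "H = carrier D"
proof (rule ccontr)
  assume "H \<noteq> carrier D"
  then obtain x where x: "x \<in> carrier D" "x \<notin> H" using subgroup.subset[OF H(1)] by blast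
  define \<H> where "\<H> = {K. subgroup K D \<and> H \<subseteq> K \<and> x \<notin> K}"
  have "\<exists>K\<in>\<H>. \<forall>Y\<in>\<H>. K \<subseteq> Y \<longrightarrow> Y = K"
  proof (rule subset_Zorn_nonempty)
    show "\<H> \<noteq> {}" using H x by (auto simp: \<H>_def)
  next
    fix C assume C: "C \<noteq> {}" "subset.chain \<H> C"
    then have CW: "subgroup Y D" "H \<subseteq> Y" "x \<notin> Y" if "Y \<in> C" for Y using that by (auto simp: subset_chain_def \<H>_def)
    have "subgroup (\<Union>C) D"
    proof (rule subgroupI)
      show "\<Union>C \<subseteq> carrier D" using CW(1) subgroup.subset by blast
      show "\<Union>C \<noteq> {}" using C(1) CW(1) subgroup.one_closed by blast
    next
      fix a assume "a \<in> \<Union>C"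
      then obtain Y where "a \<in> Y" "Y \<in> C" by blast
      then show "inv a \<in> \<Union>C" using subgroup.m_inv_closed[OF CW(1)] by blast
    next
      fix a b assume "a \<in> \<Union>C" "b \<in> \<Union>C"
      then obtain Y Z where YZ: "a \<in> Y" "Y \<in> C" "b \<in> Z" "Z \<in> C" by blast
      then have "Y \<subseteq> Z \<or> Z \<subseteq> Y" using C(2) by (auto simp: subset_chain_def)
      then show "a \<otimes> b \<in> \<Union>C"
      proof
        assume "Y \<subseteq> Z"
        then have "a \<otimes> b \<in> Z" using subgroup.m_closed[OF CW(1)[OF YZ(4)]] YZ by blast
        then show ?thesis using YZ by blast
      next
        assume "Z \<subseteq> Y"
        then have "a \<otimes> b \<in> Y" using subgroup.m_closed[OF CW(1)[OF YZ(2)]] YZ by blast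
        then show ?thesis using YZ by blast
      qed
    qed
    moreover have "H \<subseteq> \<Union>C" using C(1) CW(2) by blast
    moreover have "x \<notin> \<Union>C" using CW(3) by blast
    ultimately show "\<Union>C \<in> \<H>" by (simp add: \<H>_def)
  qed
  then obtain K where K0: "K \<in> \<H>" and max: "\<And>Y. Y \<in> \<H> \<Longrightarrow> K \<subseteq> Y \<Longrightarrow> Y = K" by blast
  have K: "subgroup K D" "H \<subseteq> K" "x \<notin> K" using K0 by (auto simp: \<H>_def)
  have KG: "k \<in> carrier D" if "k \<in> K" for k by (rule subgroup.mem_carrier[OF K(1) that])
  have sq: "y \<otimes> y \<in> K" if "y \<in> carrier D" for y using H(4)[OF that] K(2) by blast
  have cK: "cmt a b \<in> K" if "a \<in> carrier D" "b \<in> carrier D" for a b using cmt_A[OF that] H(2) K(2) by blast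
  have KN: "K \<lhd> D" by (rule normal_if_cmts[OF K(1) cK])
  have coset: "y \<otimes> inv x \<in> K" if y: "y \<in> carrier D" "y \<notin> K" for y
  proof -
    define Y where "Y = K \<union> {k \<otimes> y | k. k \<in> K}"
    have Yc: "y \<otimes> k \<otimes> inv y \<in> K" if "k \<in> K" for k by (rule normal.inv_op_closed2[OF KN y(1) that])
    have mul: "(k \<otimes> y) \<otimes> l = (k \<otimes> (y \<otimes> l \<otimes> inv y)) \<otimes> y" if "k \<in> K" "l \<in> K" for k l
      using y KG[OF that(1)] KG[OF that(2)] by (simp add: m_assoc)
    have "subgroup Y D"
    proof (rule subgroupI)
      show "Y \<subseteq> carrier D" using y KG by (auto simp: Y_def)
      show "Y \<noteq> {}" using subgroup.one_closed[OF K(1)] by (auto simp: Y_def)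
    next
      fix a assume "a \<in> Y"
      then consider "a \<in> K" | k where "k \<in> K" "a = k \<otimes> y" by (auto simp: Y_def)
      then show "inv a \<in> Y"
      proof cases
        case 1
        then show ?thesis using subgroup.m_inv_closed[OF K(1)] by (simp add: Y_def)
      next
        case 2
        have "inv a = (inv (y \<otimes> y) \<otimes> (y \<otimes> inv k \<otimes> inv y)) \<otimes> y"
          using 2 y KG by (simp add: inv_mult_group m_assoc) (simp add: m_assoc[symmetric])
        moreover have "inv (y \<otimes> y) \<otimes> (y \<otimes> inv k \<otimes> inv y) \<in> K"
          by (intro subgroup.m_closed[OF K(1)] subgroup.m_inv_closed[OF K(1)] Yc 2 sq y)
        ultimately show ?thesis unfolding Y_def by blast
      qed
    next
      fix a b assume "a \<in> Y" "b \<in> Y"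
      then consider "a \<in> K" "b \<in> K" | l where "a \<in> K" "l \<in> K" "b = l \<otimes> y" | k where "k \<in> K" "a = k \<otimes> y" "b \<in> K"
        | k l where "k \<in> K" "a = k \<otimes> y" "l \<in> K" "b = l \<otimes> y" by (auto simp: Y_def)
      then show "a \<otimes> b \<in> Y"
      proof cases
        case 1
        then show ?thesis using subgroup.m_closed[OF K(1)] by (simp add: Y_def)
      next
        case 2
        then have "a \<otimes> b = (a \<otimes> l) \<otimes> y" using y KG by (simp add: m_assoc)
        then show ?thesis using subgroup.m_closed[OF K(1) 2(1,2)] unfolding Y_def by blast
      next
        case 3
        then have "a \<otimes> b = (k \<otimes> (y \<otimes> b \<otimes> inv y)) \<otimes> y" using mul by simp
        then show ?thesis using subgroup.m_closed[OF K(1) 3(1) Yc[OF 3(3)]] unfolding Y_def by blast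
      next
        case 4
        have "a \<otimes> b = (k \<otimes> y) \<otimes> l \<otimes> y" using 4 y KG by (simp add: m_assoc)
        also have "\<dots> = (k \<otimes> (y \<otimes> l \<otimes> inv y)) \<otimes> (y \<otimes> y)" unfolding mul[OF 4(1,3)] using 4 y KG by (simp add: m_assoc) (simp add: m_assoc[symmetric])
        finally show ?thesis using subgroup.m_closed[OF K(1) subgroup.m_closed[OF K(1) 4(1) Yc[OF 4(3)]] sq[OF y(1)]] unfolding Y_def by simp
      qed
    qed
    moreover have "K \<subseteq> Y" by (auto simp: Y_def)
    moreover have "y \<in> Y" using subgroup.one_closed[OF K(1)] y by (auto simp: Y_def intro!: exI[of _ \<one>])
    ultimately have "x \<in> Y" using max[of Y] K(2) y(2) by (auto simp: \<H>_def)
    then obtain k where k: "k \<in> K" "x = k \<otimes> y" using K(3) by (auto simp: Y_def)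
    have "y \<otimes> inv x = inv (y \<otimes> y) \<otimes> ((y \<otimes> y) \<otimes> inv k \<otimes> inv (y \<otimes> y)) \<otimes> (y \<otimes> y) \<otimes> (k \<otimes> (y \<otimes> inv y) \<otimes> inv k)"
      using k y KG by (simp add: inv_mult_group m_assoc) (simp add: m_assoc[symmetric])
    then have e: "y \<otimes> inv x = inv k" using k y KG by (simp add: inv_mult_group m_assoc[symmetric])
    show ?thesis unfolding e by (rule subgroup.m_inv_closed[OF K(1) k(1)])
  qed
  define chi where "chi g = (if g \<in> K then 1 else -1 :: int)" for g
  have mK: "a \<otimes> b \<in> K \<longleftrightarrow> b \<in> K" if "a \<in> K" "b \<in> carrier D" for a b
  proof
    assume "a \<otimes> b \<in> K"
    then have "inv a \<otimes> (a \<otimes> b) \<in> K" by (rule subgroup.m_closed[OF K(1) subgroup.m_inv_closed[OF K(1) that(1)]])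
    moreover have "inv a \<otimes> (a \<otimes> b) = b" using KG[OF that(1)] that(2) by (simp add: m_assoc[symmetric])
    ultimately show "b \<in> K" by simp
  qed (rule subgroup.m_closed[OF K(1) that(1)])
  have Km: "a \<otimes> b \<in> K \<longleftrightarrow> a \<in> K" if "a \<in> carrier D" "b \<in> K" for a b
  proof
    assume "a \<otimes> b \<in> K"
    then have "(a \<otimes> b) \<otimes> inv b \<in> K" by (rule subgroup.m_closed[OF K(1) _ subgroup.m_inv_closed[OF K(1) that(2)]])
    moreover have "(a \<otimes> b) \<otimes> inv b = a" using KG[OF that(2)] that(1) by (simp add: m_assoc)
    ultimately show "a \<in> K" by simp
  qed (rule subgroup.m_closed[OF K(1) _ that(2)])
  have "sign_char chi"
    unfolding sign_char_def
  proof (intro conjI ballI)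
    fix a b assume ab: "a \<in> carrier D" "b \<in> carrier D"
    show "chi (a \<otimes> b) = chi a * chi b"
    proof (cases "a \<in> K \<or> b \<in> K")
      case True
      then show ?thesis using mK[OF _ ab(2)] Km[OF ab(1)] by (auto simp: chi_def)
    next
      case False
      define k where "k = a \<otimes> inv x"
      define l where "l = b \<otimes> inv x"
      have kl: "k \<in> K" "l \<in> K" using coset ab False by (auto simp: k_def l_def)
      have "a \<otimes> b = k \<otimes> (x \<otimes> l \<otimes> inv x) \<otimes> (x \<otimes> x)" using ab x by (simp add: k_def l_def m_assoc) (simp add: m_assoc[symmetric])
      also have "\<dots> \<in> K" by (intro subgroup.m_closed[OF K(1)] kl normal.inv_op_closed2[OF KN x(1)] sq x)
      finally show ?thesis using False by (simp add: chi_def)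
    qed
  qed (use H(2) K(2) in \<open>auto simp: chi_def\<close>)
  moreover have "chi t = 1" using H(3) K(2) by (auto simp: chi_def)
  ultimately have "chi x = 1" using chi_trivial[OF n _ t] x by blast
  then show False using K(3) by (simp add: chi_def)
qed

end

section \<open>The quotient by the base is infinite cyclic\<close>

lemma (in endo_module) full_span_subgroup:
  assumes cs: "set cs \<subseteq> carrier Q" shows "subgroup (full_span cs) Q"
proof (rule subgroupI)
  show "full_span cs \<subseteq> carrier Q" by (rule sp_carrier[OF cs])
  show "full_span cs \<noteq> {}" using sp_one[of "\<lambda>_. True" cs] cs by auto
next
  fix a assume a: "a \<in> full_span cs"
  have aQ: "a \<in> carrier Q" using a sp_carrier[OF cs] by blast
  obtain z where z: "\<forall>x\<in>carrier Q. act z x = \<one>" using act_zero by blast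
  obtain i where i: "\<forall>x\<in>carrier Q. act i x = x" using act_id by blast
  obtain q where q: "\<forall>x\<in>carrier Q. act q x = act z x \<otimes> inv (act i x)" using act_diff by blast
  have "act q a = inv a" using q z i aQ by simp
  moreover have "act q a \<in> full_span cs" by (rule sp_act[OF cs _ a]) simp
  ultimately show "inv a \<in> full_span cs" by simp
next
  fix a b assume "a \<in> full_span cs" "b \<in> full_span cs"
  then show "a \<otimes> b \<in> full_span cs" by (rule full_span_mult[OF cs])
qed

text \<open>The augmentation is the identity, so Nakayama's lemma with \<open>p = 2\<close> produces
  an odd integer that annihilates a finitely generated abelian group all of whose elements are
  squares.\<close>

lemma (in comm_group) endo_module_int: "endo_module G (\<lambda>(r::int) x. x [^] r) (\<lambda>r. r)"
proof (unfold_locales, goal_cases)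
  case (2 x y r)
  then show ?case by (simp add: int_pow_mult_distrib m_comm)
next
  case (3 r r')
  show ?case by (intro exI[of _ "r - r'"]) (simp add: int_pow_diff)
next
  case (4 r r')
  show ?case by (intro exI[of _ "r * r'"]) (simp add: int_pow_pow mult.commute)
next
  case (5 x r r')
  then show ?case by (simp add: int_pow_pow mult.commute)
next
  case 6
  show ?case by (intro exI[of _ 1]) simp
qed simp

text \<open>The exponent in \<open>x^r = t^(e x)\<close> is an injective homomorphism
  \<open>e\<close> to the integers; a preimage of its least positive value generates.\<close>

lemma (in comm_group) cyclic_if_commensurable:
  assumes t: "t \<in> carrier G" "\<And>k::int. t [^] k = \<one> \<Longrightarrow> k = 0"
    and r: "r \<noteq> (0::int)" "\<And>x. x \<in> carrier G \<Longrightarrow> \<exists>k::int. x [^] r = t [^] k" "\<And>x. x \<in> carrier G \<Longrightarrow> x [^] r = \<one> \<Longrightarrow> x = \<one>"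
  obtains g where "g \<in> carrier G" "\<And>k::int. g [^] k = \<one> \<Longrightarrow> k = 0" "\<And>x. x \<in> carrier G \<Longrightarrow> \<exists>k::int. x = g [^] k"
proof -
  obtain e where e: "\<And>x. x \<in> carrier G \<Longrightarrow> x [^] r = t [^] (e x :: int)" using r(2) by metis
  have uniq: "k = l" if "t [^] k = t [^] l" for k l :: int
  proof -
    have "t [^] (k - l) = \<one>" using that t(1) by (simp add: int_pow_diff)
    then show ?thesis using t(2)[of "k - l"] by simp
  qed
  have e_comb: "e (x \<otimes> y [^] k) = e x + k * e y" if "x \<in> carrier G" "y \<in> carrier G" for x y and k :: int
  proof (rule uniq)
    have yk: "y [^] k \<in> carrier G" using that by simp
    have "t [^] e (x \<otimes> y [^] k) = (x \<otimes> y [^] k) [^] r" using e that by simp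
    also have "\<dots> = x [^] r \<otimes> (y [^] k) [^] r" using that(1) yk by (simp add: int_pow_mult_distrib m_comm)
    also have "(y [^] k) [^] r = (y [^] r) [^] k" using that(2) by (simp add: int_pow_pow mult.commute)
    also have "x [^] r \<otimes> (y [^] r) [^] k = t [^] (e x + k * e y)"
      unfolding e[OF that(1)] e[OF that(2)] using t(1) by (simp add: int_pow_pow int_pow_mult mult.commute)
    finally show "t [^] e (x \<otimes> y [^] k) = t [^] (e x + k * e y)" .
  qed
  have e1: "e \<one> = 0" by (rule uniq) (use e[of \<one>] in simp)
  have e_t: "e t = r" by (rule uniq) (use e[OF t(1)] in simp)
  have e0: "x = \<one>" if "x \<in> carrier G" "e x = 0" for x using r(3)[OF that(1)] e[OF that(1)] that(2) by simp
  have "\<exists>m>0. \<exists>x\<in>carrier G. e x = int m"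
  proof -
    \<comment> \<open>\<open>e t = r\<close> may be negative; the power with exponent
      \<open>sgn r\<close> supplies a positive value. The factor \<open>\<one>\<close> only fits it
      to \<open>e_comb\<close>.\<close>
    have "e (\<one> \<otimes> t [^] (sgn r)) = \<bar>r\<bar>" using e_comb[OF one_closed t(1), of "sgn r"] e1 e_t by (simp add: abs_sgn mult.commute)
    then show ?thesis using r(1) t(1) by (intro exI[of _ "nat \<bar>r\<bar>"] conjI bexI[of _ "\<one> \<otimes> t [^] (sgn r)"]) auto
  qed
  then obtain m where m: "m > 0" "\<exists>x\<in>carrier G. e x = int m" "\<And>l. l < m \<Longrightarrow> \<not> (l > 0 \<and> (\<exists>x\<in>carrier G. e x = int l))"
    using exists_least_iff[of "\<lambda>m. m > 0 \<and> (\<exists>x\<in>carrier G. e x = int m)"] by blast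
  obtain g where g: "g \<in> carrier G" "e g = int m" using m(2) by blast
  show ?thesis
  proof (rule that[of g])
    show "g \<in> carrier G" by (rule g)
    show "k = 0" if "g [^] k = \<one>" for k :: int
    proof -
      have "e (\<one> \<otimes> g [^] k) = k * int m" using e_comb[OF one_closed g(1), of k] e1 g(2) by simp
      then show ?thesis using that e1 m(1) by simp
    qed
    fix x assume x: "x \<in> carrier G"
    define k where "k = e x div int m"
    define y where "y = x \<otimes> g [^] (- k)"
    have y: "y \<in> carrier G" "e y = e x mod int m"
      using x g e_comb[OF x g(1), of "- k"] by (simp_all add: y_def k_def minus_mult_div_eq_mod mult.commute)
    have "e y = 0"
    proof (rule ccontr)
      assume "e y \<noteq> 0"
      then have "nat (e y) > 0" "nat (e y) < m" "int (nat (e y)) = e y" using y(2) m(1) by (simp_all add: nat_less_iff) (metis order_less_le pos_mod_sign of_nat_0_less_iff)+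
      then show False using m(3)[of "nat (e y)"] y(1) by metis
    qed
    then have "y = \<one>" using e0 y(1) by blast
    then have "x = g [^] k" using x g by (simp add: y_def int_pow_neg) (metis inv_closed inv_equality inv_inv int_pow_closed)
    then show "\<exists>k::int. x = g [^] k" by blast
  qed
qed

context lamp_approx
begin

text \<open>Dividing a residue by \<open>r\<close> costs a factor of the modulus; so the residue
  modulo \<open>s\<close> is computed at level \<open>s\<close> times the absolute value of
  \<open>r\<close>.\<close>

lemma A_torsion:
  assumes x: "x \<in> carrier D" "x [^] (r::int) \<in> A" and r: "r \<noteq> 0" shows "x \<in> A"
proof -
  have "[kap s x = 0] (mod int s)" if s: "s > 0" for s
  proof -
    define s' where "s' = s * nat \<bar>r\<bar>"
    have s': "s' > 0" "s dvd s'" "int s' = int s * \<bar>r\<bar>" using s r by (simp_all add: s'_def)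
    have "[r * kap s' x = 0] (mod int s')"
      using cong_trans[OF cong_sym[OF kap_int_pow[OF s'(1) x(1)]] A_kap[OF x(2) s'(1)]] .
    then have "int s * \<bar>r\<bar> dvd r * kap s' x" by (simp add: cong_0_iff s'(3))
    then have "int s * r dvd kap s' x * r" by (simp add: mult.commute abs_if split: if_splits)
    then have "int s dvd kap s' x" using r by simp
    moreover have "[kap s' x = kap s x] (mod int s)" by (rule kap_compat[OF s s'(1,2) x(1)])
    ultimately show ?thesis by (metis cong_0_iff cong_sym cong_trans)
  qed
  then show ?thesis using x(1) by (simp add: A_def)
qed

text \<open>At a level \<open>2 ^ j\<close> above the absolute value of \<open>k\<close> the residue
  of \<open>t\<close> is a unit, so \<open>t^k\<close> in \<open>A\<close> would make
  \<open>2 ^ j\<close> divide \<open>k\<close>.\<close>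

lemma odd_generator_infinite:
  assumes t: "t \<in> carrier D" "[kap 2 t = 1] (mod 2)" and k: "t [^] (k::int) \<in> A" shows "k = 0"
proof (rule ccontr)
  assume "k \<noteq> 0"
  define j where "j = Suc (nat \<bar>k\<bar>)"
  have j: "(2::nat) ^ j > 0" "(2::nat) dvd 2 ^ j" by (simp_all add: j_def)
  have "[k * kap (2 ^ j) t = 0] (mod int (2 ^ j))"
    using cong_trans[OF cong_sym[OF kap_int_pow[OF j(1) t(1)]] A_kap[OF k j(1)]] .
  then have d: "2 ^ j dvd k * kap (2 ^ j) t" by (simp add: cong_0_iff)
  have "[kap (2 ^ j) t = kap 2 t] (mod int 2)" by (rule kap_compat[OF _ j(1,2) t(1)]) simp
  then have "[kap (2 ^ j) t = 1] (mod 2)" using t(2) cong_trans by simp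
  then have "odd (kap (2 ^ j) t)" by (simp add: cong_def odd_iff_mod_2_eq_one)
  then have "coprime (2 ^ j) (kap (2 ^ j) t)" by simp
  then have "2 ^ j dvd k" using d by (simp add: coprime_dvd_mult_left_iff)
  then have "2 ^ j \<le> \<bar>k\<bar>" using \<open>k \<noteq> 0\<close> zdvd_imp_le[of "2 ^ j" "\<bar>k\<bar>"] by simp
  moreover have "nat \<bar>k\<bar> < 2 ^ j" using less_exp[of j] by (simp add: j_def)
  then have "\<bar>k\<bar> < 2 ^ j" by (metis abs_ge_zero nat_less_iff of_nat_numeral of_nat_power zless_nat_eq_int_zless nat_eq_iff)
  ultimately show False by linarith
qed

text \<open>\<open>D/A\<close> is compared with the subgroup \<open>R\<close> generated by an
  element of odd residue. All elements of the quotient by \<open>R\<close> are squares, so an odd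
  \<open>r\<close> annihilates it, and the torsion-free group \<open>D/A\<close> is commensurable
  with the infinite cyclic group \<open>R\<close>.\<close>

lemma exists_generator:
  notes mult_FactGroup [simp del]
  assumes n: "n > 0"
  obtains t where "t \<in> carrier D" "\<And>x. x \<in> carrier D \<Longrightarrow> \<exists>k::int. x \<otimes> inv (t [^] k) \<in> A" "\<And>k::int. t [^] k \<in> A \<Longrightarrow> k = 0"
proof -
  obtain t1 where t1: "t1 \<in> carrier D" "[kap 2 t1 = 1] (mod 2)" using onto[of 2 1 "\<lambda>_. 0"] by auto
  interpret N: normal A D by (rule A_normal)
  interpret Q: comm_group "D Mod A" by (rule factor_comm_group[OF A_normal cmt_A])
  interpret h: group_hom D "D Mod A" "\<lambda>x. A #> x" by unfold_locales (rule N.r_coset_hom_Mod)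
  have Qc: "carrier (D Mod A) = (\<lambda>x. A #> x) ` carrier D" by (auto simp: FactGroup_def RCOSETS_image)
  have Q1: "A #> x = \<one>\<^bsub>D Mod A\<^esub> \<longleftrightarrow> x \<in> A" if "x \<in> carrier D" for x
    using rcos_self[OF that A_subgroup] coset_join2[OF that A_subgroup] by (auto simp: FactGroup_def)
  have pw: "A #> (x [^] k) = (A #> x) [^]\<^bsub>D Mod A\<^esub> k" if "x \<in> carrier D" for x and k :: int by (rule h.hom_int_pow[OF that])
  define \<tau> where "\<tau> = A #> t1"
  have \<tau>: "\<tau> \<in> carrier (D Mod A)" unfolding \<tau>_def Qc using t1(1) by (rule imageI)
  define R where "R = range (\<lambda>k::int. \<tau> [^]\<^bsub>D Mod A\<^esub> k)"
  have R: "subgroup R (D Mod A)"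
  proof (rule Q.subgroupI)
    show "R \<subseteq> carrier (D Mod A)" using \<tau> by (auto simp: R_def)
    show "R \<noteq> {}" by (auto simp: R_def)
  next
    fix a assume "a \<in> R"
    then obtain k :: int where "a = \<tau> [^]\<^bsub>D Mod A\<^esub> k" by (auto simp: R_def)
    then have "inv\<^bsub>D Mod A\<^esub> a = \<tau> [^]\<^bsub>D Mod A\<^esub> (- k)" using Q.int_pow_neg[OF \<tau>] by simp
    then show "inv\<^bsub>D Mod A\<^esub> a \<in> R" by (auto simp: R_def)
  next
    fix a b assume "a \<in> R" "b \<in> R"
    then obtain k l :: int where "a = \<tau> [^]\<^bsub>D Mod A\<^esub> k" "b = \<tau> [^]\<^bsub>D Mod A\<^esub> l" by (auto simp: R_def)
    then have "a \<otimes>\<^bsub>D Mod A\<^esub> b = \<tau> [^]\<^bsub>D Mod A\<^esub> (k + l)" using Q.int_pow_mult[OF \<tau>] by simp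
    then show "a \<otimes>\<^bsub>D Mod A\<^esub> b \<in> R" by (auto simp: R_def)
  qed
  have RN: "R \<lhd> D Mod A" by (rule Q.normal_iff_subgroup[THEN iffD2, OF R])
  interpret RN: normal R "D Mod A" by (rule RN)
  have Qcmt: "Q.cmt x y \<in> R" if "x \<in> carrier (D Mod A)" "y \<in> carrier (D Mod A)" for x y
    unfolding iffD2[OF Q.cmt_one_iff[OF that] Q.m_comm[OF that]] by (rule subgroup.one_closed[OF R])
  interpret Z: comm_group "(D Mod A) Mod R"
    by (rule Q.factor_comm_group[OF RN Qcmt])
  interpret z: group_hom "D Mod A" "(D Mod A) Mod R" "\<lambda>x. R #>\<^bsub>D Mod A\<^esub> x" by unfold_locales (rule RN.r_coset_hom_Mod)
  define u where "u = (\<lambda>x. R #>\<^bsub>D Mod A\<^esub> (A #> x))"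
  have uh: "u \<in> hom D ((D Mod A) Mod R)"
    using Group.hom_compose[OF h.homh z.homh] by (simp add: u_def comp_def)
  interpret u: group_hom D "(D Mod A) Mod R" u by unfold_locales (rule uh)
  have Zc: "carrier ((D Mod A) Mod R) = u ` carrier D"
    by (simp add: FactGroup_def[of "D Mod A"] RCOSETS_image Qc image_image u_def)
  have uA: "u x = \<one>\<^bsub>(D Mod A) Mod R\<^esub> \<longleftrightarrow> A #> x \<in> R" if "x \<in> carrier D" for x
  proof -
    have xQ: "A #> x \<in> carrier (D Mod A)" unfolding Qc using that by (rule imageI)
    show ?thesis using Q.rcos_self[OF xQ R] Q.coset_join2[OF xQ R] by (auto simp: u_def FactGroup_def[of "D Mod A"])
  qed
  interpret M: endo_module "(D Mod A) Mod R" "\<lambda>(r::int) x. x [^]\<^bsub>(D Mod A) Mod R\<^esub> r" "\<lambda>r. r" 2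
    by (rule Z.endo_module_int)
  obtain S where S: "finite S" "S \<subseteq> carrier D" "generate D S = carrier D"
    using fg unfolding finitely_generated_group_def by blast
  obtain cs where cs: "set cs = u ` S" using finite_list[of "u ` S"] S(1) by blast
  have csZ: "set cs \<subseteq> carrier ((D Mod A) Mod R)" using cs S(2) Zc by auto
  have fullZ: "M.full_span cs = carrier ((D Mod A) Mod R)"
  proof
    show "M.full_span cs \<subseteq> carrier ((D Mod A) Mod R)" by (rule M.sp_carrier[OF csZ])
    have "generate ((D Mod A) Mod R) (u ` S) = u ` generate D S" by (rule u.generate_img[OF S(2)])
    then have "carrier ((D Mod A) Mod R) = generate ((D Mod A) Mod R) (set cs)" using S(3) Zc cs by simp
    also have "\<dots> \<subseteq> M.full_span cs"
      by (rule Z.generate_subgroup_incl[OF _ M.full_span_subgroup[OF csZ]]) (use M.full_span_member[OF csZ] in blast)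
    finally show "carrier ((D Mod A) Mod R) \<subseteq> M.full_span cs" .
  qed
  \<comment> \<open>The preimage in \<open>D\<close> of the squares of \<open>(D/A)/R\<close>; it
    satisfies the hypotheses of \<open>index_two_generation\<close>.\<close>
  define H where "H = {x \<in> carrier D. \<exists>y\<in>carrier D. u x = u y \<otimes>\<^bsub>(D Mod A) Mod R\<^esub> u y}"
  have u11: "\<one>\<^bsub>(D Mod A) Mod R\<^esub> = u \<one> \<otimes>\<^bsub>(D Mod A) Mod R\<^esub> u \<one>" unfolding u.hom_one by (rule Z.r_one[OF Z.one_closed, symmetric])
  have in_H: "a \<in> H" if "a \<in> carrier D" "u a = \<one>\<^bsub>(D Mod A) Mod R\<^esub>" for a
    unfolding H_def using that(1) trans[OF that(2) u11] one_closed by blast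
  have "H = carrier D"
  proof (rule index_two_generation[OF n t1])
    show "subgroup H D"
    proof (rule subgroupI)
      show "H \<subseteq> carrier D" by (auto simp: H_def)
      show "H \<noteq> {}" using in_H[OF one_closed u.hom_one] by blast
    next
      fix a assume "a \<in> H"
      then obtain y where y: "a \<in> carrier D" "y \<in> carrier D" "u a = u y \<otimes>\<^bsub>(D Mod A) Mod R\<^esub> u y" by (auto simp: H_def)
      have "u (inv a) = u (inv y) \<otimes>\<^bsub>(D Mod A) Mod R\<^esub> u (inv y)" using y by (simp add: u.hom_inv Z.inv_mult_group)
      then show "inv a \<in> H" unfolding H_def using y(1) inv_closed[OF y(2)] by blast
    next
      fix a b assume "a \<in> H" "b \<in> H"
      then obtain y y' where y: "a \<in> carrier D" "y \<in> carrier D" "u a = u y \<otimes>\<^bsub>(D Mod A) Mod R\<^esub> u y"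
        "b \<in> carrier D" "y' \<in> carrier D" "u b = u y' \<otimes>\<^bsub>(D Mod A) Mod R\<^esub> u y'" by (auto simp: H_def)
      have "u (a \<otimes> b) = u (y \<otimes> y') \<otimes>\<^bsub>(D Mod A) Mod R\<^esub> u (y \<otimes> y')" using y by (simp add: Z.m_ac)
      then show "a \<otimes> b \<in> H" unfolding H_def using m_closed[OF y(1) y(4)] m_closed[OF y(2) y(5)] by blast
    qed
    have "A #> a \<in> R" if "a \<in> A" for a using Q1[OF A_carrier[OF that]] that subgroup.one_closed[OF R] by simp
    then have uA1: "u a = \<one>\<^bsub>(D Mod A) Mod R\<^esub>" if "a \<in> A" for a using iffD2[OF uA[OF A_carrier[OF that]]] that by blast
    show "A \<subseteq> H" using in_H[OF A_carrier uA1] by blast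
    have "\<tau> [^]\<^bsub>D Mod A\<^esub> (1::int) \<in> R" unfolding R_def by blast
    then have "A #> t1 \<in> R" using \<tau> by (simp add: \<tau>_def)
    then show "t1 \<in> H" by (rule in_H[OF t1(1) iffD2[OF uA[OF t1(1)]]])
    show "y \<otimes> y \<in> H" if "y \<in> carrier D" for y unfolding H_def using m_closed[OF that that] u.hom_mult[OF that that] that by blast
  qed
  then have sq: "\<exists>y\<in>carrier D. u x = u y \<otimes>\<^bsub>(D Mod A) Mod R\<^esub> u y" if "x \<in> carrier D" for x using that by (auto simp: H_def)
  have "c \<in> M.ideal_span cs" if c: "c \<in> set cs" for c
  proof -
    obtain x where x: "x \<in> carrier D" "c = u x" using c cs S(2) by auto
    obtain y where y: "y \<in> carrier D" "u x = u y \<otimes>\<^bsub>(D Mod A) Mod R\<^esub> u y" using sq[OF x(1)] by blast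
    have uy: "u y \<in> carrier ((D Mod A) Mod R)" using y(1) Zc by blast
    have "u y [^]\<^bsub>(D Mod A) Mod R\<^esub> (2::int) \<in> M.ideal_span cs"
      by (rule M.sp_act[OF csZ, of "\<lambda>_. True"]) (use uy fullZ in auto)
    moreover have "u y [^]\<^bsub>(D Mod A) Mod R\<^esub> (2::int) = u y \<otimes>\<^bsub>(D Mod A) Mod R\<^esub> u y"
      using Z.int_pow_mult[OF uy, of 1 1] uy by simp
    ultimately show ?thesis using x y by simp
  qed
  then obtain r :: int where r: "[r = 1] (mod 2)" "\<And>c. c \<in> set cs \<Longrightarrow> c [^]\<^bsub>(D Mod A) Mod R\<^esub> r = \<one>\<^bsub>(D Mod A) Mod R\<^esub>"
    by (rule M.nakayama[OF csZ]) (assumption, (rule that; assumption))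
  have r0: "r \<noteq> 0" using r(1) by (auto simp: cong_def)
  have rR: "\<xi> [^]\<^bsub>D Mod A\<^esub> r \<in> R" if \<xi>: "\<xi> \<in> carrier (D Mod A)" for \<xi>
  proof -
    obtain x where x: "x \<in> carrier D" "\<xi> = A #> x" using \<xi> unfolding Qc by blast
    have ux: "u x \<in> M.full_span cs" using x(1) fullZ Zc by blast
    have "u x [^]\<^bsub>(D Mod A) Mod R\<^esub> r = \<one>\<^bsub>(D Mod A) Mod R\<^esub>" by (rule M.act_kills_sp[OF csZ _ ux]) (rule r(2))
    then have "u (x [^] r) = \<one>\<^bsub>(D Mod A) Mod R\<^esub>" using x(1) by (simp add: u.hom_int_pow)
    then show ?thesis using uA[of "x [^] r"] x by (simp add: pw)
  qed
  obtain g where g: "g \<in> carrier (D Mod A)" "\<And>k::int. g [^]\<^bsub>D Mod A\<^esub> k = \<one>\<^bsub>D Mod A\<^esub> \<Longrightarrow> k = 0"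
    "\<And>x. x \<in> carrier (D Mod A) \<Longrightarrow> \<exists>k::int. x = g [^]\<^bsub>D Mod A\<^esub> k"
  proof (rule Q.cyclic_if_commensurable[OF \<tau> _ r0])
    show "k = 0" if "\<tau> [^]\<^bsub>D Mod A\<^esub> k = \<one>\<^bsub>D Mod A\<^esub>" for k :: int
    proof -
      have "A #> (t1 [^] k) = \<one>\<^bsub>D Mod A\<^esub>" using that pw[OF t1(1)] by (simp add: \<tau>_def)
      then have "t1 [^] k \<in> A" using Q1[of "t1 [^] k"] t1(1) by simp
      then show ?thesis by (rule odd_generator_infinite[OF t1])
    qed
    show "\<exists>k::int. x [^]\<^bsub>D Mod A\<^esub> r = \<tau> [^]\<^bsub>D Mod A\<^esub> k" if "x \<in> carrier (D Mod A)" for x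
      using rR[OF that] by (auto simp: R_def)
    fix \<xi> assume \<xi>: "\<xi> \<in> carrier (D Mod A)" "\<xi> [^]\<^bsub>D Mod A\<^esub> r = \<one>\<^bsub>D Mod A\<^esub>"
    obtain x where x: "x \<in> carrier D" "\<xi> = A #> x" using \<xi> unfolding Qc by blast
    have "A #> (x [^] r) = \<one>\<^bsub>D Mod A\<^esub>" using \<xi>(2) x pw by simp
    then have "x [^] r \<in> A" using Q1[of "x [^] r"] x(1) by simp
    then show "\<xi> = \<one>\<^bsub>D Mod A\<^esub>" using A_torsion[OF x(1) _ r0] Q1[OF x(1)] x(2) by blast
  qed (rule that)
  obtain t where t: "t \<in> carrier D" "g = A #> t" using g(1) unfolding Qc by blast
  show ?thesis
  proof (rule that[OF t(1)])
    fix x assume x: "x \<in> carrier D"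
    then have "A #> x \<in> carrier (D Mod A)" unfolding Qc by (rule imageI)
    then obtain k :: int where "A #> x = g [^]\<^bsub>D Mod A\<^esub> k" using g(3) by blast
    then have "A #> x = A #> (t [^] k)" using t pw by simp
    then have "x \<otimes> inv (t [^] k) \<in> A" using N.rcoset_eq_iff[OF x] t(1) by simp
    then show "\<exists>k::int. x \<otimes> inv (t [^] k) \<in> A" by blast
  next
    fix k :: int assume "t [^] k \<in> A"
    then have "A #> (t [^] k) = \<one>\<^bsub>D Mod A\<^esub>" using Q1[of "t [^] k"] t(1) by simp
    then show "k = 0" using g(2)[of k] t pw by simp
  qed
qed

end

section \<open>The base is free\<close>

lemma monom_1_pCons: "monom 1 (Suc 0) * p = pCons 0 (p :: int poly)"
  by (simp add: monom_Suc)

lemma pcompose_monom_monom: "pcompose (monom 1 r) (monom 1 j) = monom (1::int) (j * r)"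
  by (induct r) (simp_all add: monom_Suc pcompose_pCons mult_monom monom_0)

text \<open>Substituting \<open>X^j\<close> for \<open>X\<close> sends \<open>X^s - 1\<close> to a
  multiple of itself.\<close>

lemma pcompose_ideal2:
  assumes "f \<in> ideal2 q s" shows "pcompose f (monom 1 j) \<in> ideal2 q s"
proof -
  obtain a b where f: "f = [:q:] * a + (monom 1 s - 1) * b" using assms by (rule ideal2E)
  have "pcompose f (monom 1 j) = [:q:] * pcompose a (monom 1 j) + (monom 1 (j * s) - 1) * pcompose b (monom 1 j)"
    unfolding f pcompose_add pcompose_mult pcompose_diff pcompose_monom_monom pcompose_const pcompose_1 ..
  moreover have "monom 1 (j * s) - monom 1 0 \<in> ideal2 q s" by (rule monom_cong_ideal2) simp
  then have "pcompose b (monom 1 j) * (monom 1 (j * s) - 1) \<in> ideal2 q s" using ideal2_mult by (metis monom_eq_1)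
  then have "(monom 1 (j * s) - 1) * pcompose b (monom 1 j) \<in> ideal2 q s" by (simp only: mult.commute)
  ultimately show ?thesis using ideal2_add[OF ideal2_const] by metis
qed

lemma pcompose_cong1:
  assumes m: "m mod s = 1 mod s" shows "pcompose f (monom 1 m) - f \<in> ideal2 q s"
proof (induct f rule: pCons_induct)
  case 0
  then show ?case by simp
next
  case (pCons c p)
  have "monom 1 m - monom 1 1 \<in> ideal2 q s" by (rule monom_cong_ideal2[OF m])
  then have 1: "p * (monom 1 m - monom 1 1) \<in> ideal2 q s" by (rule ideal2_mult)
  have 2: "monom 1 m * (pcompose p (monom 1 m) - p) \<in> ideal2 q s" by (rule ideal2_mult[OF pCons.hyps(2)])
  have e: "pCons c p = [:c:] + monom 1 1 * p" by (simp add: monom_1_pCons)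
  have "pcompose (pCons c p) (monom 1 m) - pCons c p = monom 1 m * (pcompose p (monom 1 m) - p) + p * (monom 1 m - monom 1 1)"
    by (metis (no_types, lifting) add_diff_cancel_left e mult.commute mult_diff_mult pcompose_pCons)
  then show ?case using ideal2_add[OF 2 1] by simp
qed

lemma sum_fun_app: "(sum f B) x = (\<Sum>i\<in>B. f i x)" for f :: "'i \<Rightarrow> 'b \<Rightarrow> 'c::comm_monoid_add"
  by (induct B rule: infinite_finite_induct) simp_all

text \<open>Vectors are functions on all natural numbers, of which a presentation sees only an
  initial segment; one type thus serves for every rank.\<close>

definition sc :: "int poly \<Rightarrow> (nat \<Rightarrow> int poly) \<Rightarrow> nat \<Rightarrow> int poly"
  where "sc f v = (\<lambda>i. f * v i)"

lemma module_sc: "Modules.module sc"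
  by unfold_locales (simp_all add: sc_def fun_eq_iff distrib_left distrib_right mult.assoc)

section \<open>Normal forms a t^k and coordinates in which t acts as X\<close>

locale lamp_gen = lamp_approx D n kap mu for D :: "'a monoid" (structure) and n kap mu +
  fixes t :: 'a
  assumes t: "t \<in> carrier D"
    and t_span: "x \<in> carrier D \<Longrightarrow> \<exists>k::int. x \<otimes> inv (t [^] k) \<in> A"
    and t_inj: "t [^] (k::int) \<in> A \<Longrightarrow> k = 0"
begin

definition cj :: "int \<Rightarrow> 'a \<Rightarrow> 'a" where "cj k a = t [^] k \<otimes> a \<otimes> inv (t [^] k)"

lemma tpow: "t [^] (k::int) \<in> carrier D" by (rule int_pow_closed[OF t])

lemma cj_A: "a \<in> A \<Longrightarrow> cj k a \<in> A"
  unfolding cj_def by (rule A_conj[OF tpow])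

lemma cj_mult: "\<lbrakk>a \<in> A; b \<in> A\<rbrakk> \<Longrightarrow> cj k (a \<otimes> b) = cj k a \<otimes> cj k b"
  unfolding cj_def by (rule conj_mult[OF tpow A_carrier A_carrier])

lemma cj_cj: assumes "a \<in> A" shows "cj k (cj l a) = cj (k + l) a"
proof -
  have a: "a \<in> carrier D" by (rule A_carrier[OF assms])
  show ?thesis unfolding cj_def int_pow_mult[OF t, of k l] inv_mult_group[OF tpow tpow]
    using a tpow by (simp add: m_assoc)
qed

lemma cj_0: "a \<in> A \<Longrightarrow> cj 0 a = a"
  unfolding cj_def using A_carrier by simp

lemma cj_one: "cj k \<one> = \<one>"
  unfolding cj_def using tpow by simp

lemma cj_inv: assumes "a \<in> A" shows "cj k (inv a) = inv (cj k a)"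
proof -
  have "cj k (inv a) \<otimes> cj k a = cj k (inv a \<otimes> a)" using cj_mult[OF A_inv[OF assms] assms] by simp
  also have "\<dots> = \<one>" using A_carrier[OF assms] cj_one by simp
  finally show ?thesis using inv_equality[OF _ A_carrier[OF cj_A[OF assms]] A_carrier[OF cj_A[OF A_inv[OF assms]]]] by simp
qed

lemma cj_pow: "a \<in> A \<Longrightarrow> cj k (a [^] (m::int)) = cj k a [^] m"
  unfolding cj_def by (rule conj_pow[OF tpow A_carrier])

lemma A_ac4: assumes "a \<in> A" "b \<in> A" "c \<in> A" "d \<in> A" shows "(a \<otimes> b) \<otimes> (c \<otimes> d) = (a \<otimes> c) \<otimes> (b \<otimes> d)"
proof -
  note c = assms[THEN A_carrier]
  have "b \<otimes> (c \<otimes> d) = c \<otimes> (b \<otimes> d)" unfolding m_assoc[OF c(2,3,4), symmetric] A_comm[OF assms(2,3)] m_assoc[OF c(3,2,4)] ..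
  then show ?thesis using c by (simp add: m_assoc)
qed

lemma mul_form: assumes "a \<in> A" "b \<in> A" shows "(a \<otimes> t [^] (k::int)) \<otimes> (b \<otimes> t [^] (l::int)) = (a \<otimes> cj k b) \<otimes> t [^] (k + l)"
proof -
  note c = assms[THEN A_carrier]
  have "cj k b \<otimes> t [^] (k + l) = t [^] k \<otimes> b \<otimes> (inv (t [^] k) \<otimes> t [^] k) \<otimes> t [^] l"
    unfolding cj_def int_pow_mult[OF t, of k l] using c tpow by (simp only: m_assoc m_closed inv_closed)
  also have "\<dots> = t [^] k \<otimes> (b \<otimes> t [^] l)" using c tpow by (simp add: m_assoc)
  finally show ?thesis using c tpow A_carrier[OF cj_A[OF assms(2)]] by (simp add: m_assoc)
qed

lemma inv_form: assumes "a \<in> A" shows "inv (a \<otimes> t [^] (k::int)) = cj (- k) (inv a) \<otimes> t [^] (- k)"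
proof (rule inv_equality)
  have "(cj (- k) (inv a) \<otimes> t [^] (- k)) \<otimes> (a \<otimes> t [^] k) = (cj (- k) (inv a) \<otimes> cj (- k) a) \<otimes> t [^] (- k + k)"
    by (rule mul_form[OF cj_A[OF A_inv[OF assms]] assms])
  also have "cj (- k) (inv a) \<otimes> cj (- k) a = \<one>"
    unfolding cj_inv[OF assms] by (rule l_inv[OF A_carrier[OF cj_A[OF assms]]])
  finally show "(cj (- k) (inv a) \<otimes> t [^] (- k)) \<otimes> (a \<otimes> t [^] k) = \<one>" by simp
  show "a \<otimes> t [^] k \<in> carrier D" by (rule m_closed[OF A_carrier[OF assms] tpow])
  show "cj (- k) (inv a) \<otimes> t [^] (- k) \<in> carrier D" by (rule m_closed[OF A_carrier[OF cj_A[OF A_inv[OF assms]]] tpow])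
qed

lemma formE:
  assumes "x \<in> carrier D" obtains a k where "a \<in> A" "x = a \<otimes> t [^] (k::int)"
proof -
  obtain k :: int where k: "x \<otimes> inv (t [^] k) \<in> A" using t_span[OF assms] by blast
  have "x = (x \<otimes> inv (t [^] k)) \<otimes> t [^] k" using assms tpow by (simp add: m_assoc)
  then show ?thesis using that k by blast
qed

lemma form_A: assumes "a \<in> A" "a \<otimes> t [^] (k::int) \<in> A" shows "k = 0"
proof (rule t_inj)
  have "inv a \<otimes> (a \<otimes> t [^] k) = t [^] k" using A_carrier[OF assms(1)] tpow by (simp add: m_assoc[symmetric])
  then show "t [^] k \<in> A" using A_mult[OF A_inv[OF assms(1)] assms(2)] by simp
qed

text \<open>Horner's rule for a polynomial in \<open>t\<close> acting on \<open>A\<close> by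
  conjugation.\<close>

definition actp :: "int poly \<Rightarrow> 'a \<Rightarrow> 'a"
  where "actp p a = fold_coeffs (\<lambda>c y. a [^] c \<otimes> cj 1 y) p \<one>"

lemma actp_0: "actp 0 a = \<one>" by (simp add: actp_def)

lemma actp_pCons: "actp (pCons c p) a = a [^] c \<otimes> cj 1 (actp p a)"
  by (cases "p = 0"; cases "c = 0") (simp_all add: actp_def cj_one)

lemma actp_A: "a \<in> A \<Longrightarrow> actp p a \<in> A"
  by (induct p rule: pCons_induct) (simp_all add: actp_0 actp_pCons A_one A_mult A_pow cj_A)

lemma actp_add: assumes a: "a \<in> A" shows "actp (p + q) a = actp p a \<otimes> actp q a"
proof (induct p q rule: poly_induct2)
  case 0
  show ?case by (simp add: actp_0)
next
  case (pCons c p d q)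
  have "a [^] (c + d) \<otimes> cj 1 (actp (p + q) a) = (a [^] c \<otimes> a [^] d) \<otimes> (cj 1 (actp p a) \<otimes> cj 1 (actp q a))"
    unfolding pCons int_pow_mult[OF A_carrier[OF a]] cj_mult[OF actp_A[OF a] actp_A[OF a]] ..
  also have "\<dots> = (a [^] c \<otimes> cj 1 (actp p a)) \<otimes> (a [^] d \<otimes> cj 1 (actp q a))"
    by (rule A_ac4[OF A_pow[OF a] A_pow[OF a] cj_A[OF actp_A[OF a]] cj_A[OF actp_A[OF a]]])
  finally show ?case by (simp add: actp_pCons)
qed

lemma actp_X: "a \<in> A \<Longrightarrow> actp (monom 1 (Suc 0) * p) a = cj 1 (actp p a)"
  unfolding monom_1_pCons actp_pCons using A_carrier[OF cj_A[OF actp_A]] by simp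

lemma actp_1: "a \<in> A \<Longrightarrow> actp 1 a = a"
  using A_carrier by (simp add: one_pCons actp_pCons actp_0 cj_one)

text \<open>The linear combination of the first \<open>g\<close> elements \<open>a i\<close> with
  polynomial coefficients, written multiplicatively.\<close>

fun pim :: "(nat \<Rightarrow> 'a) \<Rightarrow> nat \<Rightarrow> (nat \<Rightarrow> int poly) \<Rightarrow> 'a" where
  "pim a 0 v = \<one>"
| "pim a (Suc g) v = pim a g v \<otimes> actp (v g) (a g)"

lemma pim_A: "(\<And>i. i < g \<Longrightarrow> a i \<in> A) \<Longrightarrow> pim a g v \<in> A"
  by (induct g) (simp_all add: A_one A_mult actp_A)

lemma pim_add: "(\<And>i. i < g \<Longrightarrow> a i \<in> A) \<Longrightarrow> pim a g (u + v) = pim a g u \<otimes> pim a g v"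
proof (induct g)
  case (Suc g)
  have a: "a g \<in> A" "\<And>i. i < g \<Longrightarrow> a i \<in> A" using Suc.prems by simp_all
  have h: "pim a g (\<lambda>i. u i + v i) = pim a g u \<otimes> pim a g v" using Suc.hyps a(2) unfolding plus_fun_def by blast
  have "pim a (Suc g) (\<lambda>i. u i + v i) = (pim a g u \<otimes> pim a g v) \<otimes> (actp (u g) (a g) \<otimes> actp (v g) (a g))"
    using h actp_add[OF a(1)] by simp
  also have "\<dots> = pim a (Suc g) u \<otimes> pim a (Suc g) v"
    unfolding pim.simps by (rule A_ac4[OF pim_A[OF a(2)] pim_A[OF a(2)] actp_A[OF a(1)] actp_A[OF a(1)]])
  finally show ?case unfolding plus_fun_def .
qed simp

lemma pim_X: "(\<And>i. i < g \<Longrightarrow> a i \<in> A) \<Longrightarrow> pim a g (sc (monom 1 (Suc 0)) v) = cj 1 (pim a g v)"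
proof (induct g)
  case (Suc g)
  have a: "a g \<in> A" "\<And>i. i < g \<Longrightarrow> a i \<in> A" using Suc.prems by simp_all
  have h: "pim a g (sc (monom 1 (Suc 0)) v) = cj 1 (pim a g v)" using Suc.hyps a(2) by blast
  have "pim a g v \<in> A" using pim_A a(2) by blast
  then have "cj 1 (pim a g v \<otimes> actp (v g) (a g)) = cj 1 (pim a g v) \<otimes> cj 1 (actp (v g) (a g))" by (rule cj_mult[OF _ actp_A[OF a(1)]])
  then show ?case unfolding pim.simps h by (simp only: sc_def actp_X[OF a(1)])
qed (simp add: cj_one)

lemma pim_cong: "(\<And>i. i < g \<Longrightarrow> u i = v i) \<Longrightarrow> pim a g u = pim a g v"
  by (induct g) simp_all

lemma pim_zero: "(\<And>i. i < g \<Longrightarrow> v i = 0) \<Longrightarrow> pim a g v = \<one>"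
  by (induct g) (simp_all add: actp_0)

lemma pim_unit: "\<lbrakk>\<And>i. i < g \<Longrightarrow> a i \<in> A; i < g\<rbrakk> \<Longrightarrow> pim a g (\<lambda>j. if j = i then 1 else 0) = a i"
proof (induct g)
  case (Suc g)
  have a: "a g \<in> A" "\<And>i. i < g \<Longrightarrow> a i \<in> A" using Suc.prems by simp_all
  show ?case
  proof (cases "i = g")
    case True
    have "pim a g (\<lambda>j. if j = i then 1 else 0) = \<one>" by (rule pim_zero) (simp add: True)
    then show ?thesis using True actp_1[OF a(1)] A_carrier[OF a(1)] by simp
  next
    case False
    then have i: "i < g" using Suc.prems(2) by simp
    show ?thesis unfolding pim.simps using Suc.hyps[OF a(2) i] False A_carrier[OF a(2)[OF i]] by (simp add: actp_0)
  qed
qed simp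

lemma kap_form: "\<lbrakk>s > 0; a \<in> A\<rbrakk> \<Longrightarrow> [kap s (a \<otimes> t [^] (k::int)) = k * kap s t] (mod int s)"
  using cong_trans[OF kap_mult[OF _ A_carrier tpow, of s a k] cong_add[OF A_kap[of a s] kap_int_pow[OF _ t, of s k]]] by simp

text \<open>An element of residue 1 has the form \<open>a t^k\<close> with \<open>a\<close> of
  residue 0, so \<open>k\<close> inverts the residue of \<open>t\<close>.\<close>

lemma kap_unit: assumes s: "s > 0" shows "\<exists>j::nat. [int j * kap s t = 1] (mod int s)"
proof -
  obtain x where x: "x \<in> carrier D" "[kap s x = 1] (mod int s)" using onto[OF s, of 1 "\<lambda>_. 0"] by blast
  obtain a and k :: int where a: "a \<in> A" "x = a \<otimes> t [^] k" using x(1) by (rule formE)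
  have k: "[k * kap s t = 1] (mod int s)" using cong_trans[OF cong_sym[OF kap_form[OF s a(1), of k]]] x(2) a(2) by simp
  have "int (nat (k mod int s)) = k mod int s" using s by simp
  then have "[int (nat (k mod int s)) * kap s t = k * kap s t] (mod int s)" by (simp add: cong_def mod_mult_left_eq)
  then show ?thesis using k cong_trans by blast
qed

definition jj :: "nat \<Rightarrow> nat" where "jj s = (SOME j. [int j * kap s t = 1] (mod int s))"
definition rr :: "nat \<Rightarrow> nat" where "rr s = nat (kap s t mod int s)"

lemma jj_kap: "s > 0 \<Longrightarrow> [int (jj s) * kap s t = 1] (mod int s)"
  unfolding jj_def by (rule someI_ex[OF kap_unit])

lemma jj_rr: assumes s: "s > 0" shows "(jj s * rr s) mod s = 1 mod s"
proof -
  have "int (rr s) = kap s t mod int s" using s by (simp add: rr_def)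
  then have "int (jj s * rr s) mod int s = int (jj s) * kap s t mod int s" by (simp add: mod_mult_right_eq)
  also have "\<dots> = 1 mod int s" using jj_kap[OF s] by (simp add: cong_def)
  finally have "int ((jj s * rr s) mod s) = int (1 mod s)" unfolding zmod_int by simp
  then show ?thesis by (simp only: of_nat_eq_iff)
qed

text \<open>At level \<open>s\<close>, conjugation by \<open>t\<close> multiplies \<open>mu\<close>
  by \<open>X\<close> to the residue of \<open>t\<close>. As \<open>jj s\<close> inverts this
  residue modulo \<open>s\<close>, substituting \<open>X^(jj s)\<close> makes \<open>t\<close> act
  as \<open>X\<close> at every level.\<close>

definition psi :: "nat \<Rightarrow> 'a \<Rightarrow> nat \<Rightarrow> int poly" where "psi s a i = pcompose (mu s a i) (monom 1 (jj s))"

lemma psi_mult: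
  assumes s: "s > 0" and ab: "a \<in> A" "b \<in> A" and i: "i < n"
  shows "psi s (a \<otimes> b) i - (psi s a i + psi s b i) \<in> ideal2 (int s) s"
  using pcompose_ideal2[OF mu_mult0[OF s ab[THEN A_carrier] i A_kap[OF ab(1) s]], of "jj s"]
  by (simp add: psi_def pcompose_diff pcompose_add)

lemma psi_inv:
  assumes s: "s > 0" and a: "a \<in> A" and i: "i < n"
  shows "psi s (inv a) i + psi s a i \<in> ideal2 (int s) s"
  using pcompose_ideal2[OF mu_inv0[OF s A_carrier[OF a] i A_kap[OF a s]], of "jj s"]
  by (simp add: psi_def pcompose_add)

lemma psi_pow:
  assumes s: "s > 0" and a: "a \<in> A" and i: "i < n"
  shows "psi s (a [^] (k::int)) i - [:k:] * psi s a i \<in> ideal2 (int s) s"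
  using pcompose_ideal2[OF mu_int_pow[OF s A_carrier[OF a] A_kap[OF a s] i, of k], of "jj s"]
  by (simp only: psi_def pcompose_diff pcompose_mult pcompose_const)

lemma psi_one: "\<lbrakk>s > 0; i < n\<rbrakk> \<Longrightarrow> psi s \<one> i \<in> ideal2 (int s) s"
  unfolding psi_def by (rule pcompose_ideal2[OF mu_one])

lemma psi_cj1:
  assumes s: "s > 0" and a: "a \<in> A" and i: "i < n"
  shows "psi s (cj 1 a) i - monom 1 1 * psi s a i \<in> ideal2 (int s) s"
proof -
  have c: "cj 1 a = t \<otimes> a \<otimes> inv t" unfolding cj_def using t by simp
  have 1: "psi s (cj 1 a) i - monom 1 (jj s * rr s) * psi s a i \<in> ideal2 (int s) s"
    using pcompose_ideal2[OF mu_conj[OF s t A_carrier[OF a] i A_kap[OF a s]], of "jj s"]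
    unfolding psi_def c rr_def[symmetric] pcompose_diff pcompose_mult pcompose_monom_monom .
  have "psi s a i * (monom 1 (jj s * rr s) - monom 1 1) \<in> ideal2 (int s) s"
    by (rule ideal2_mult[OF monom_cong_ideal2[OF jj_rr[OF s]]])
  then have "monom 1 (jj s * rr s) * psi s a i - monom 1 1 * psi s a i \<in> ideal2 (int s) s" by (simp only: algebra_simps)
  then show ?thesis by (rule ideal2_trans[OF 1])
qed

lemma psi_cj:
  assumes s: "s > 0" and a: "a \<in> A" and i: "i < n"
  shows "psi s (cj (int k) a) i - monom 1 k * psi s a i \<in> ideal2 (int s) s"
proof (induct k)
  case 0
  show ?case using cj_0[OF a] by simp
next
  case (Suc k)
  have e: "cj (int (Suc k)) a = cj 1 (cj (int k) a)" unfolding cj_cj[OF a] by simp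
  have "monom 1 1 * (psi s (cj (int k) a) i - monom 1 k * psi s a i) \<in> ideal2 (int s) s" by (rule ideal2_mult[OF Suc])
  moreover have "monom 1 1 * (psi s (cj (int k) a) i - monom 1 k * psi s a i) = monom 1 1 * psi s (cj (int k) a) i - monom 1 (Suc k) * psi s a i"
    unfolding right_diff_distrib mult.assoc[symmetric] mult_monom by simp
  ultimately show ?case unfolding e using ideal2_trans[OF psi_cj1[OF s cj_A[OF a] i]] by simp
qed

text \<open>Substituting \<open>X^(rr s)\<close> undoes the change of variable modulo the
  ideal.\<close>

lemma psi_Ks:
  assumes s: "s > 0" and a: "a \<in> A"
  shows "a \<in> Ks s \<longleftrightarrow> (\<forall>i<n. psi s a i \<in> ideal2 (int s) s)"
proof -
  have "mu s a i \<in> ideal2 (int s) s \<longleftrightarrow> psi s a i \<in> ideal2 (int s) s" for i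
  proof
    assume "psi s a i \<in> ideal2 (int s) s"
    then have "pcompose (psi s a i) (monom 1 (rr s)) \<in> ideal2 (int s) s" by (rule pcompose_ideal2)
    moreover have "pcompose (psi s a i) (monom 1 (rr s)) = pcompose (mu s a i) (monom 1 (rr s * jj s))"
      unfolding psi_def pcompose_assoc[symmetric] pcompose_monom_monom ..
    moreover have "pcompose (mu s a i) (monom 1 (rr s * jj s)) - mu s a i \<in> ideal2 (int s) s"
      by (rule pcompose_cong1) (use jj_rr[OF s] in \<open>simp add: mult.commute\<close>)
    ultimately show "mu s a i \<in> ideal2 (int s) s" using ideal2_cong by metis
  qed (simp add: psi_def pcompose_ideal2)
  then show ?thesis using A_carrier[OF a] A_kap[OF a s] by (simp add: Ks_def)
qed

text \<open>\<open>onto\<close> yields an element \<open>a t^k\<close> of \<open>D\<close>, and the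
  factor \<open>t^k\<close> must not disturb the coordinates. Divisibility of \<open>k\<close> by
  \<open>s\<close> alone does not ensure this; level \<open>s * s\<close> makes \<open>t^k\<close> a
  power of \<open>t^s\<close> with exponent divisible by \<open>s\<close>, whose coordinates vanish
  modulo \<open>s\<close>.\<close>

lemma mu_surj:
  assumes s: "s > 0" shows "\<exists>a\<in>A. \<forall>i<n. mu s a i - p i \<in> ideal2 (int s) s"
proof -
  have ss: "s * s > 0" "s dvd s * s" using s by simp_all
  obtain x where x: "x \<in> carrier D" "[kap (s * s) x = 0] (mod int (s * s))" "\<And>i. i < n \<Longrightarrow> mu (s * s) x i - p i \<in> ideal2 (int (s * s)) (s * s)"
    using onto[OF ss(1), of 0 p] by blast
  obtain a and k :: int where a: "a \<in> A" "x = a \<otimes> t [^] k" using x(1) by (rule formE)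
  have "[k * kap (s * s) t = 0] (mod int (s * s))" using cong_trans[OF cong_sym[OF kap_form[OF ss(1) a(1), of k]]] x(2) a(2) by simp
  then have "int (s * s) dvd int (jj (s * s)) * (k * kap (s * s) t)" by (simp add: cong_0_iff)
  moreover have "[k * (int (jj (s * s)) * kap (s * s) t) = k * 1] (mod int (s * s))" by (rule cong_scalar_left[OF jj_kap[OF ss(1)]])
  ultimately have "int (s * s) dvd k" by (metis cong_dvd_iff mult.left_commute mult.right_neutral)
  then obtain m where m: "k = int s * (int s * m)" unfolding of_nat_mult dvd_def mult.assoc by blast
  define d where "d = t [^] (int s)"
  have d: "d \<in> carrier D" "[kap s d = 0] (mod int s)"
    using cong_trans[OF kap_int_pow[OF s t, of "int s"], of 0] by (simp_all add: d_def tpow cong_0_iff)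
  have tk: "t [^] k = d [^] (int s * m)" unfolding d_def m using int_pow_pow[OF t, of "int s" "int s * m"] by (simp add: mult.commute)
  have "mu s a i - p i \<in> ideal2 (int s) s" if i: "i < n" for i
  proof -
    have 1: "mu s (t [^] k) i - [:int s * m:] * mu s d i \<in> ideal2 (int s) s" unfolding tk by (rule mu_int_pow[OF s d i])
    have "[:int s * m:] * mu s d i = [:int s:] * ([:m:] * mu s d i)" by (metis mult.assoc mult_to_poly)
    then have "[:int s * m:] * mu s d i \<in> ideal2 (int s) s" using ideal2_const by metis
    then have 2: "mu s (t [^] k) i \<in> ideal2 (int s) s" using ideal2_cong[OF 1] by blast
    have 3: "mu s x i - (mu s a i + mu s (t [^] k) i) \<in> ideal2 (int s) s"
      unfolding a(2) by (rule mu_mult0[OF s A_carrier[OF a(1)] tpow i A_kap[OF a(1) s]])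
    have 4: "mu s x i - mu s a i \<in> ideal2 (int s) s" using ideal2_add[OF 3 2] by simp
    have 5: "mu (s * s) x i - p i \<in> ideal2 (int s) s" by (rule ideal2_mono[OF _ _ x(3)[OF i]]) simp_all
    show ?thesis using ideal2_trans[OF ideal2_sym[OF 4] ideal2_trans[OF ideal2_sym[OF mu_compat[OF s ss(1) ss(2) x(1) i]] 5]] .
  qed
  then show ?thesis using a(1) by blast
qed

lemma psi_surj:
  assumes s: "s > 0" shows "\<exists>a\<in>A. \<forall>i<n. psi s a i - p i \<in> ideal2 (int s) s"
proof -
  obtain a where a: "a \<in> A" "\<And>i. i < n \<Longrightarrow> mu s a i - pcompose (p i) (monom 1 (rr s)) \<in> ideal2 (int s) s"
    using mu_surj[OF s, of "\<lambda>i. pcompose (p i) (monom 1 (rr s))"] by blast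
  have "psi s a i - p i \<in> ideal2 (int s) s" if i: "i < n" for i
  proof (rule ideal2_trans)
    show "psi s a i - pcompose (p i) (monom 1 (jj s * rr s)) \<in> ideal2 (int s) s"
      using pcompose_ideal2[OF a(2)[OF i], of "jj s"]
      unfolding psi_def pcompose_diff pcompose_assoc[symmetric] pcompose_monom_monom .
    show "pcompose (p i) (monom 1 (jj s * rr s)) - p i \<in> ideal2 (int s) s" by (rule pcompose_cong1[OF jj_rr[OF s]])
  qed
  then show ?thesis using a(1) by blast
qed

lemma psi_compat:
  assumes s: "s > 0" "s' > 0" "s dvd s'" and a: "a \<in> A" "a \<in> Ks s" and i: "i < n"
  shows "psi s' a i \<in> ideal2 (int s) s"
proof -
  have "mu s' a i \<in> ideal2 (int s) s"
    using ideal2_cong[OF mu_compat[OF s A_carrier[OF a(1)] i]] a(2) i by (simp add: Ks_def)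
  then show ?thesis unfolding psi_def by (rule pcompose_ideal2)
qed

end

text \<open>A presentation of \<open>A\<close> as a module: \<open>\<pi>\<close> starts from
  \<open>g\<close> copies of \<open>Z[X]\<close> and reaches every element after conjugation by a
  power of \<open>t\<close>. It is used first with elements obtained from generators of
  \<open>D\<close>, and then with \<open>g = n\<close> and a basis.\<close>

locale lamp_rep = lamp_gen D n kap mu t for D :: "'a monoid" (structure) and n kap mu t +
  fixes g :: nat and \<pi> :: "(nat \<Rightarrow> int poly) \<Rightarrow> 'a"
  assumes pi_A: "\<pi> v \<in> A"
    and pi_add: "\<pi> (u + v) = \<pi> u \<otimes> \<pi> v"
    and pi_X: "\<pi> (sc (monom 1 (Suc 0)) v) = cj 1 (\<pi> v)"
    and pi_cong: "(\<And>i. i < g \<Longrightarrow> u i = v i) \<Longrightarrow> \<pi> u = \<pi> v"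
    and pi_onto: "a \<in> A \<Longrightarrow> \<exists>(k::nat) v. cj (int k) a = \<pi> v"
begin

lemma pi_carrier: "\<pi> v \<in> carrier D" by (rule A_carrier[OF pi_A])

lemma pi_0: "\<pi> 0 = \<one>"
  using pi_add[of 0 0] pi_carrier[of 0] by simp

lemma pi_uminus: "\<pi> (- v) = inv (\<pi> v)"
proof -
  have "\<pi> (- v) \<otimes> \<pi> v = \<one>" unfolding pi_add[symmetric] left_minus by (rule pi_0)
  then show ?thesis using inv_equality[OF _ pi_carrier pi_carrier] by metis
qed

lemma pi_diff: "\<pi> (u - v) = \<pi> u \<otimes> inv (\<pi> v)"
  using pi_add[of u "- v"] pi_uminus by simp

lemma pi_int: "\<pi> (sc [:c:] v) = \<pi> v [^] c"
proof (induct c rule: int_induct[of _ 0])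
  case base
  have e: "sc [:0:] v = 0" by (simp add: sc_def fun_eq_iff)
  show ?case by (simp only: e pi_0 int_pow_0)
next
  case (step1 c)
  have e: "sc [:c + 1:] v = sc [:c:] v + v" by (simp add: sc_def fun_eq_iff smult_add_left)
  show ?case by (simp only: e pi_add step1(2) int_pow_mult[OF pi_carrier] int_pow_1[OF pi_carrier])
next
  case (step2 c)
  have e: "sc [:c - 1:] v = sc [:c:] v - v" by (simp add: sc_def fun_eq_iff smult_diff_left)
  show ?case by (simp only: e pi_diff step2(2) int_pow_diff[OF pi_carrier] int_pow_1[OF pi_carrier])
qed

lemma pi_shift: "\<pi> (sc (monom 1 k) v) = cj (int k) (\<pi> v)"
proof (induct k)
  case 0
  have "sc (monom 1 0) v = v" by (simp add: sc_def monom_0 flip: one_pCons)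
  then show ?case using cj_0[OF pi_A] by simp
next
  case (Suc k)
  have "sc (monom 1 (Suc k)) v = sc (monom 1 (Suc 0)) (sc (monom 1 k) v)"
    by (simp add: sc_def mult.assoc[symmetric] mult_monom)
  then show ?case using Suc pi_X cj_cj[OF pi_A, of 1 "int k" v] by simp
qed

lemma sc_pCons: "sc (pCons c p) v = sc [:c:] v + sc (monom 1 (Suc 0)) (sc p v)"
  by (simp add: sc_def fun_eq_iff monom_1_pCons)

lemma pi_pCons: "\<pi> (sc (pCons c p) v) = \<pi> v [^] c \<otimes> cj 1 (\<pi> (sc p v))"
  unfolding sc_pCons[of c p] pi_add pi_int pi_X ..

lemma pi_kill: "\<pi> v = \<one> \<Longrightarrow> \<pi> (sc f v) = \<one>"
proof (induct f rule: pCons_induct)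
  case 0
  have e: "sc 0 v = 0" by (simp add: sc_def fun_eq_iff)
  show ?case by (simp only: e pi_0)
next
  case (pCons c p)
  then show ?case unfolding pi_pCons by (simp add: cj_one)
qed

lemma psi_scale:
  assumes s: "s > 0" and i: "i < n"
  shows "psi s (\<pi> (sc f v)) i - f * psi s (\<pi> v) i \<in> ideal2 (int s) s"
proof (induct f rule: pCons_induct)
  case 0
  have e: "sc 0 v = 0" by (simp add: sc_def fun_eq_iff)
  show ?case unfolding e pi_0 mult_zero_left diff_zero by (rule psi_one[OF s i])
next
  case (pCons c p)
  define P where "P = psi s (\<pi> v) i"
  define R where "R = psi s (\<pi> (sc p v)) i"
  have 1: "psi s (\<pi> (sc (pCons c p) v)) i - (psi s (\<pi> v [^] c) i + psi s (cj 1 (\<pi> (sc p v))) i) \<in> ideal2 (int s) s"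
    unfolding pi_pCons by (rule psi_mult[OF s A_pow[OF pi_A] cj_A[OF pi_A] i])
  have 2: "psi s (\<pi> v [^] c) i - [:c:] * P \<in> ideal2 (int s) s" unfolding P_def by (rule psi_pow[OF s pi_A i])
  have 3: "psi s (cj 1 (\<pi> (sc p v))) i - monom 1 1 * R \<in> ideal2 (int s) s" unfolding R_def by (rule psi_cj1[OF s pi_A i])
  have 4: "monom 1 1 * (R - p * P) \<in> ideal2 (int s) s" using ideal2_mult[OF pCons.hyps(2)] unfolding R_def P_def .
  have e: "pCons c p * P = [:c:] * P + monom 1 1 * (p * P)" by (simp add: monom_1_pCons)
  have "psi s (\<pi> (sc (pCons c p) v)) i - pCons c p * P =
      (psi s (\<pi> (sc (pCons c p) v)) i - (psi s (\<pi> v [^] c) i + psi s (cj 1 (\<pi> (sc p v))) i))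
      + ((psi s (\<pi> v [^] c) i - [:c:] * P) + ((psi s (cj 1 (\<pi> (sc p v))) i - monom 1 1 * R) + monom 1 1 * (R - p * P)))"
    unfolding e by (simp only: algebra_simps)
  then show ?case unfolding P_def[symmetric] using ideal2_add[OF 1 ideal2_add[OF 2 ideal2_add[OF 3 4]]] by (simp only:)
qed

definition dl :: "nat \<Rightarrow> 'a \<Rightarrow> 'a" where "dl s y = cj (int s) y \<otimes> inv y"

text \<open>The submodule \<open>(s, t^s - 1) A\<close>, with \<open>dl s\<close> as multiplication
  by \<open>t^s - 1\<close>. It turns out to be the intersection of \<open>A\<close> with
  \<open>Ks s\<close>.\<close>

definition JA :: "nat \<Rightarrow> 'a set"
  where "JA s = {x [^] (int s) \<otimes> dl s y | x y. x \<in> A \<and> y \<in> A}"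

lemma dl_A: "y \<in> A \<Longrightarrow> dl s y \<in> A" unfolding dl_def by (rule A_mult[OF cj_A A_inv])

lemma JA_A: "c \<in> JA s \<Longrightarrow> c \<in> A" unfolding JA_def using A_mult[OF A_pow dl_A] by blast

lemma inv_mult_A: "\<lbrakk>a \<in> A; b \<in> A\<rbrakk> \<Longrightarrow> inv (a \<otimes> b) = inv a \<otimes> inv b"
  using inv_mult_group[OF A_carrier A_carrier, of a b] A_comm[OF A_inv A_inv, of a b] by simp

lemma dl_mult: "\<lbrakk>x \<in> A; y \<in> A\<rbrakk> \<Longrightarrow> dl s (x \<otimes> y) = dl s x \<otimes> dl s y"
  unfolding dl_def cj_mult inv_mult_A by (rule A_ac4[OF cj_A cj_A A_inv A_inv])

lemma JA_form_mult:
  assumes "x \<in> A" "y \<in> A" "x' \<in> A" "y' \<in> A"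
  shows "(x [^] (int s) \<otimes> dl s y) \<otimes> (x' [^] (int s) \<otimes> dl s y') = (x \<otimes> x') [^] (int s) \<otimes> dl s (y \<otimes> y')"
  unfolding A_ac4[OF A_pow[OF assms(1)] dl_A[OF assms(2)] A_pow[OF assms(3)] dl_A[OF assms(4)]] dl_mult[OF assms(2,4)]
    int_pow_mult_distrib[OF A_comm[OF assms(1,3)] A_carrier[OF assms(1)] A_carrier[OF assms(3)]] ..

lemma JA_mult: assumes "c \<in> JA s" "d \<in> JA s" shows "c \<otimes> d \<in> JA s"
proof -
  obtain x y x' y' where xy: "x \<in> A" "y \<in> A" "x' \<in> A" "y' \<in> A"
    and c: "c = x [^] (int s) \<otimes> dl s y" and d: "d = x' [^] (int s) \<otimes> dl s y'" using assms unfolding JA_def by blast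
  show ?thesis unfolding c d JA_form_mult[OF xy] unfolding JA_def using A_mult[OF xy(1,3)] A_mult[OF xy(2,4)] by blast
qed

lemma dl_one: "dl s \<one> = \<one>" by (simp add: dl_def cj_one)

lemma JA_one: "\<one> \<in> JA s"
proof -
  have "\<one> = \<one> [^] (int s) \<otimes> dl s \<one>" by (simp add: dl_one)
  then show ?thesis unfolding JA_def using A_one by blast
qed

lemma dl_JA: assumes "y \<in> A" shows "dl s y \<in> JA s"
proof -
  have "dl s y = \<one> [^] (int s) \<otimes> dl s y" using A_carrier[OF dl_A[OF assms]] by simp
  then show ?thesis unfolding JA_def using A_one assms by blast
qed

lemma JA_inv: assumes "c \<in> JA s" shows "inv c \<in> JA s"
proof -
  obtain x y where xy: "x \<in> A" "y \<in> A" and c: "c = x [^] (int s) \<otimes> dl s y" using assms unfolding JA_def by blast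
  define d where "d = (inv x) [^] (int s) \<otimes> dl s (inv y)"
  have dJ: "d \<in> JA s" unfolding JA_def d_def using A_inv[OF xy(1)] A_inv[OF xy(2)] by blast
  have "d \<otimes> c = \<one>" unfolding c d_def JA_form_mult[OF A_inv[OF xy(1)] A_inv[OF xy(2)] xy]
      l_inv[OF A_carrier[OF xy(1)]] l_inv[OF A_carrier[OF xy(2)]] dl_one by simp
  then have "inv c = d" by (rule inv_equality[OF _ A_carrier[OF JA_A[OF assms]] A_carrier[OF JA_A[OF dJ]]])
  then show ?thesis using dJ by simp
qed

lemma JA_cj: assumes "c \<in> JA s" shows "cj k c \<in> JA s"
proof -
  obtain x y where xy: "x \<in> A" "y \<in> A" and c: "c = x [^] (int s) \<otimes> dl s y" using assms unfolding JA_def by blast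
  have "cj k (dl s y) = dl s (cj k y)"
    unfolding dl_def cj_mult[OF cj_A[OF xy(2)] A_inv[OF xy(2)]] cj_cj[OF xy(2)] cj_inv[OF xy(2)] by (simp add: add.commute)
  then have "cj k c = (cj k x) [^] (int s) \<otimes> dl s (cj k y)" unfolding c cj_mult[OF A_pow[OF xy(1)] dl_A[OF xy(2)]] cj_pow[OF xy(1)] by simp
  then show ?thesis unfolding JA_def using cj_A[OF xy(1)] cj_A[OF xy(2)] by blast
qed

lemma tel: assumes "u \<in> carrier D" "y \<in> carrier D" "w \<in> carrier D" shows "(u \<otimes> inv y) \<otimes> (y \<otimes> w) = u \<otimes> w"
proof -
  have "(u \<otimes> inv y) \<otimes> (y \<otimes> w) = u \<otimes> (inv y \<otimes> (y \<otimes> w))" using assms by (simp add: m_assoc)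
  also have "inv y \<otimes> (y \<otimes> w) = w" using assms m_assoc[OF inv_closed[OF assms(2)] assms(2,3)] by simp
  finally show ?thesis .
qed

definition eqv :: "nat \<Rightarrow> 'a \<Rightarrow> 'a \<Rightarrow> bool" where "eqv s x y \<longleftrightarrow> x \<otimes> inv y \<in> JA s"

lemma eqv_sym: assumes "x \<in> A" "y \<in> A" "eqv s x y" shows "eqv s y x"
proof -
  have "inv (x \<otimes> inv y) = y \<otimes> inv x" using A_carrier[OF assms(1)] A_carrier[OF assms(2)] by (simp add: inv_mult_group)
  then show ?thesis using JA_inv assms(3) unfolding eqv_def by metis
qed

lemma eqv_trans: assumes "x \<in> A" "y \<in> A" "z \<in> A" "eqv s x y" "eqv s y z" shows "eqv s x z"
  using JA_mult[OF assms(4)[unfolded eqv_def] assms(5)[unfolded eqv_def]]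
  unfolding eqv_def tel[OF A_carrier[OF assms(1)] A_carrier[OF assms(2)] inv_closed[OF A_carrier[OF assms(3)]]] .

lemma eqv_cj: assumes a: "a \<in> A" shows "eqv s (cj (int s * m) a) a"
proof (induct m rule: int_induct[of _ 0])
  case base
  then show ?case unfolding eqv_def using cj_0[OF a] A_carrier[OF a] JA_one by simp
next
  case (step1 m)
  have "cj (int s * (m + 1)) a = cj (int s) (cj (int s * m) a)" unfolding cj_cj[OF a] by (simp add: algebra_simps)
  then have "eqv s (cj (int s * (m + 1)) a) (cj (int s * m) a)" using dl_JA[OF cj_A[OF a], of s "int s * m"] by (simp add: eqv_def dl_def)
  then show ?case by (rule eqv_trans[OF cj_A[OF a] cj_A[OF a] a _ step1(2)])
next
  case (step2 m)
  have "cj (int s * m) a = cj (int s) (cj (int s * (m - 1)) a)" unfolding cj_cj[OF a] by (simp add: algebra_simps)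
  then have "eqv s (cj (int s * m) a) (cj (int s * (m - 1)) a)" using dl_JA[OF cj_A[OF a], of s "int s * (m - 1)"] by (simp add: eqv_def dl_def)
  then show ?case by (rule eqv_trans[OF cj_A[OF a] cj_A[OF a] a eqv_sym[OF cj_A[OF a] cj_A[OF a]] step2(2)])
qed

text \<open>The power of \<open>t\<close> can be chosen with an exponent divisible by
  \<open>s\<close>, so that it acts trivially modulo \<open>JA s\<close>.\<close>

lemma rng: assumes s: "s > 0" and a: "a \<in> A" shows "\<exists>(m::nat) v. cj (int s * int m) a = \<pi> v"
proof -
  obtain k :: nat and v where v: "cj (int k) a = \<pi> v" using pi_onto[OF a] by blast
  have "k \<le> s * k" using s by simp
  then have "cj (int s * int k) a = cj (int (s * k - k)) (cj (int k) a)" unfolding cj_cj[OF a] by simp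
  then show ?thesis unfolding v pi_shift[symmetric] by blast
qed

lemma pi_LJ: "\<pi> (sc [:int s:] \<alpha> + sc (monom 1 s - 1) \<beta>) = \<pi> \<alpha> [^] (int s) \<otimes> dl s (\<pi> \<beta>)"
proof -
  have "sc (monom 1 s - 1) \<beta> = sc (monom 1 s) \<beta> - \<beta>" by (simp add: sc_def fun_eq_iff left_diff_distrib)
  then show ?thesis by (simp only: pi_add pi_int pi_diff pi_shift dl_def)
qed

lemma pi_ideal2:
  assumes "\<And>i. i < g \<Longrightarrow> u i - v i \<in> ideal2 (int s) s" shows "eqv s (\<pi> u) (\<pi> v)"
proof -
  have "\<forall>i. \<exists>a b. i < g \<longrightarrow> u i - v i = [:int s:] * a + (monom 1 s - 1) * b" using assms unfolding ideal2_def by blast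
  then obtain \<alpha> \<beta> where ab: "\<And>i. i < g \<Longrightarrow> u i - v i = [:int s:] * \<alpha> i + (monom 1 s - 1) * \<beta> i" by metis
  have "\<pi> (u - v) = \<pi> (sc [:int s:] \<alpha> + sc (monom 1 s - 1) \<beta>)" by (rule pi_cong) (simp add: sc_def ab del: mult_pCons_left mult_pCons_right)
  then show ?thesis unfolding eqv_def pi_diff[symmetric] pi_LJ unfolding JA_def using pi_A by auto
qed

text \<open>A normal subgroup of finite index that meets \<open>A\<close> in \<open>JA s\<close>.
  Cofinality applies to it, and in this way the levels recognize \<open>JA s\<close>.\<close>

definition KK :: "nat \<Rightarrow> 'a set"
  where "KK s = {b \<otimes> t [^] (int s * m) | b m. b \<in> JA s}"

lemma KK_carrier: "x \<in> KK s \<Longrightarrow> x \<in> carrier D"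
  unfolding KK_def using m_closed[OF A_carrier[OF JA_A] tpow] by blast

lemma KK_normal: "KK s \<lhd> D"
proof (rule normal_inv_iff[THEN iffD2], intro conjI ballI)
  show "subgroup (KK s) D"
  proof (rule subgroupI)
    show "KK s \<subseteq> carrier D" using KK_carrier by blast
    show "KK s \<noteq> {}" unfolding KK_def using JA_one by blast
  next
    fix x assume "x \<in> KK s"
    then obtain b m where x: "b \<in> JA s" "x = b \<otimes> t [^] (int s * m)" unfolding KK_def by blast
    have "inv x = cj (- (int s * m)) (inv b) \<otimes> t [^] (int s * - m)" unfolding x(2) inv_form[OF JA_A[OF x(1)]] by simp
    then show "inv x \<in> KK s" unfolding KK_def using JA_cj[OF JA_inv[OF x(1)]] by blast
  next
    fix x y assume "x \<in> KK s" "y \<in> KK s"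
    then obtain b m b' m' where x: "b \<in> JA s" "x = b \<otimes> t [^] (int s * m)" "b' \<in> JA s" "y = b' \<otimes> t [^] (int s * m')"
      unfolding KK_def by blast
    have "x \<otimes> y = (b \<otimes> cj (int s * m) b') \<otimes> t [^] (int s * (m + m'))"
      unfolding x(2,4) mul_form[OF JA_A[OF x(1)] JA_A[OF x(3)]] distrib_left ..
    then show "x \<otimes> y \<in> KK s" unfolding KK_def using JA_mult[OF x(1) JA_cj[OF x(3)]] by blast
  qed
next
  fix x h assume "x \<in> carrier D" "h \<in> KK s"
  then obtain a and k :: int where a: "a \<in> A" "x = a \<otimes> t [^] k" by (rule_tac formE)
  obtain b m where h: "b \<in> JA s" "h = b \<otimes> t [^] (int s * m)" using \<open>h \<in> KK s\<close> unfolding KK_def by blast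
  define l where "l = int s * m"
  have bA: "b \<in> A" by (rule JA_A[OF h(1)])
  have ia: "inv a \<in> A" by (rule A_inv[OF a(1)])
  have "x \<otimes> h \<otimes> inv x = ((a \<otimes> cj k b) \<otimes> cj (k + l) (cj (- k) (inv a))) \<otimes> t [^] (k + l + - k)"
    unfolding a(2) h(2) l_def[symmetric] inv_form[OF a(1)] mul_form[OF a(1) bA]
    by (rule mul_form[OF A_mult[OF a(1) cj_A[OF bA]] cj_A[OF ia]])
  also have "\<dots> = ((a \<otimes> cj k b) \<otimes> cj l (inv a)) \<otimes> t [^] l" unfolding cj_cj[OF ia] by simp
  also have "(a \<otimes> cj k b) \<otimes> cj l (inv a) = cj k b \<otimes> (cj l (inv a) \<otimes> a)"
    unfolding A_comm[OF a(1) cj_A[OF bA]] A_comm[OF cj_A[OF ia] a(1)]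
    by (rule m_assoc[OF A_carrier[OF cj_A[OF bA]] A_carrier[OF a(1)] A_carrier[OF cj_A[OF ia]]])
  finally have e: "x \<otimes> h \<otimes> inv x = cj k b \<otimes> (cj l (inv a) \<otimes> a) \<otimes> t [^] (int s * m)" unfolding l_def .
  \<comment> \<open>\<open>t^l\<close> acts trivially on \<open>A\<close> modulo \<open>JA s\<close>
    because \<open>s\<close> divides \<open>l\<close>.\<close>
  have "cj l (inv a) \<otimes> a \<in> JA s" using eqv_cj[OF ia, of s m] A_carrier[OF a(1)] unfolding eqv_def l_def by simp
  then show "x \<otimes> h \<otimes> inv x \<in> KK s" unfolding e unfolding KK_def using JA_mult[OF JA_cj[OF h(1)]] by blast
qed

text \<open>The coset of \<open>a t^k\<close> is determined by \<open>k\<close> modulo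
  \<open>s\<close> and by the class sums modulo \<open>s\<close> of a vector that represents
  \<open>a\<close> up to a power of \<open>t^s\<close>.\<close>

lemma KK_finite: assumes s: "s > 0" shows "finite (rcosets (KK s))"
proof -
  interpret K: normal "KK s" D by (rule KK_normal)
  have "\<forall>x\<in>carrier D. \<exists>a (k::int) (m::nat) v. a \<in> A \<and> x = a \<otimes> t [^] k \<and> cj (int s * int m) a = \<pi> v"
  proof
    fix x assume "x \<in> carrier D"
    then obtain a and k :: int where a: "a \<in> A" "x = a \<otimes> t [^] k" by (rule formE)
    then show "\<exists>a (k::int) (m::nat) v. a \<in> A \<and> x = a \<otimes> t [^] k \<and> cj (int s * int m) a = \<pi> v" using rng[OF s a(1)] by blast
  qed
  then obtain fa fk fm fv where f: "\<forall>x\<in>carrier D. fa x \<in> A \<and> x = fa x \<otimes> t [^] (fk x :: int) \<and> cj (int s * int (fm x :: nat)) (fa x) = \<pi> (fv x)"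
    unfolding bchoice_iff by blast
  define F where "F x = (fk x mod int s, map (\<lambda>i. map (\<lambda>c. class_sum s c (fv x i) mod int s) [0..<s]) [0..<g])" for x
  define B where "B = {l :: int list. set l \<subseteq> {0..<int s} \<and> length l = s}"
  have "finite B" unfolding B_def by (rule finite_lists_length_eq) simp
  then have "finite ({0..<int s} \<times> {l. set l \<subseteq> B \<and> length l = g})" by (intro finite_cartesian_product finite_lists_length_eq) simp_all
  moreover have "F ` carrier D \<subseteq> {0..<int s} \<times> {l. set l \<subseteq> B \<and> length l = g}" using s by (auto simp: F_def B_def)
  ultimately have fin: "finite (F ` carrier D)" by (rule finite_subset[rotated])
  have eq: "KK s #> x = KK s #> y" if x: "x \<in> carrier D" and y: "y \<in> carrier D" and xy: "F x = F y" for x y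
  proof -
    have fx: "fa x \<in> A" "x = fa x \<otimes> t [^] fk x" "cj (int s * int (fm x)) (fa x) = \<pi> (fv x)" using f x by blast+
    have fy: "fa y \<in> A" "y = fa y \<otimes> t [^] fk y" "cj (int s * int (fm y)) (fa y) = \<pi> (fv y)" using f y by blast+
    have "fv x i - fv y i \<in> ideal2 (int s) s" if i: "i < g" for i
    proof (rule ideal2_class_sum[OF s])
      fix c assume c: "c < s"
      have "snd (F x) ! i ! c = snd (F y) ! i ! c" using xy by (simp only:)
      then have "class_sum s c (fv x i) mod int s = class_sum s c (fv y i) mod int s" using i c unfolding F_def snd_conv by simp
      then have "int s dvd class_sum s c (fv x i) - class_sum s c (fv y i)" by (simp add: mod_eq_dvd_iff)
      moreover have "class_sum s c (fv x i) = class_sum s c (fv x i - fv y i) + class_sum s c (fv y i)"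
        using class_sum_add[of s c "fv x i - fv y i" "fv y i"] by simp
      ultimately show "int s dvd class_sum s c (fv x i - fv y i)" by simp
    qed
    then have "eqv s (\<pi> (fv x)) (\<pi> (fv y))" by (rule pi_ideal2)
    then have 1: "eqv s (cj (int s * int (fm x)) (fa x)) (cj (int s * int (fm y)) (fa y))" using fx(3) fy(3) by simp
    note cA = cj_A[OF fx(1), of "int s * int (fm x)"] cj_A[OF fy(1), of "int s * int (fm y)"]
    have 2: "eqv s (fa x) (fa y)"
      by (rule eqv_trans[OF fx(1) cA(1) fy(1) eqv_sym[OF cA(1) fx(1) eqv_cj[OF fx(1)]] eqv_trans[OF cA(1) cA(2) fy(1) 1 eqv_cj[OF fy(1)]]])
    have "int s dvd fk x - fk y" using xy by (simp add: F_def mod_eq_dvd_iff)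
    then obtain m where m: "fk x - fk y = int s * m" by (rule dvdE)
    define iy where "iy = inv (fa y)"
    have iy: "iy \<in> A" unfolding iy_def by (rule A_inv[OF fy(1)])
    have "x \<otimes> inv y = (fa x \<otimes> t [^] fk x) \<otimes> (cj (- fk y) iy \<otimes> t [^] (- fk y))"
      unfolding iy_def inv_form[OF fy(1), symmetric] fx(2)[symmetric] fy(2)[symmetric] ..
    also have "\<dots> = (fa x \<otimes> cj (fk x) (cj (- fk y) iy)) \<otimes> t [^] (fk x + - fk y)" by (rule mul_form[OF fx(1) cj_A[OF iy]])
    also have "\<dots> = (fa x \<otimes> cj (int s * m) iy) \<otimes> t [^] (int s * m)" unfolding cj_cj[OF iy] m[symmetric] by simp
    finally have e: "x \<otimes> inv y = (fa x \<otimes> cj (int s * m) iy) \<otimes> t [^] (int s * m)" .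
    have "cj (int s * m) iy \<otimes> inv iy \<in> JA s" using eqv_cj[OF iy, of s m] unfolding eqv_def .
    then have "fa y \<otimes> cj (int s * m) iy \<in> JA s"
      using A_comm[OF cj_A[OF iy] fy(1), of "int s * m"] A_carrier[OF fy(1)] unfolding iy_def by simp
    then have "(fa x \<otimes> inv (fa y)) \<otimes> (fa y \<otimes> cj (int s * m) iy) \<in> JA s" by (rule JA_mult[OF 2[unfolded eqv_def]])
    then have "fa x \<otimes> cj (int s * m) iy \<in> JA s"
      unfolding tel[OF A_carrier[OF fx(1)] A_carrier[OF fy(1)] A_carrier[OF cj_A[OF iy]]] .
    then have "x \<otimes> inv y \<in> KK s" unfolding e unfolding KK_def by blast
    then show ?thesis using K.rcoset_eq_iff[OF x y] by blast
  qed
  show ?thesis unfolding RCOSETS_image by (rule finite_image_factor(1)[OF fin eq])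
qed

lemma KK_A: assumes "x \<in> KK s" "x \<in> A" shows "x \<in> JA s"
proof -
  obtain b m where x: "b \<in> JA s" "x = b \<otimes> t [^] (int s * m)" using assms(1) unfolding KK_def by blast
  have m: "int s * m = 0" by (rule form_A[OF JA_A[OF x(1)]]) (use assms(2) x(2) in simp)
  have "x = b" unfolding x(2) m using A_carrier[OF JA_A[OF x(1)]] by simp
  then show ?thesis using x(1) by simp
qed

lemma psi_form:
  assumes s': "s' > 0" and xy: "x \<in> A" "y \<in> A" and i: "i < n"
  shows "psi s' (x [^] (int s) \<otimes> dl s y) i - ([:int s:] * psi s' x i + (monom 1 s - 1) * psi s' y i) \<in> ideal2 (int s') s'"
proof -
  have 1: "psi s' (x [^] (int s) \<otimes> dl s y) i - (psi s' (x [^] (int s)) i + psi s' (dl s y) i) \<in> ideal2 (int s') s'"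
    by (rule psi_mult[OF s' A_pow[OF xy(1)] dl_A[OF xy(2)] i])
  have 2: "psi s' (x [^] (int s)) i - [:int s:] * psi s' x i \<in> ideal2 (int s') s'" by (rule psi_pow[OF s' xy(1) i])
  have 3: "psi s' (dl s y) i - (psi s' (cj (int s) y) i + psi s' (inv y) i) \<in> ideal2 (int s') s'"
    unfolding dl_def by (rule psi_mult[OF s' cj_A[OF xy(2)] A_inv[OF xy(2)] i])
  have 4: "psi s' (cj (int s) y) i - monom 1 s * psi s' y i \<in> ideal2 (int s') s'" by (rule psi_cj[OF s' xy(2) i])
  have 5: "psi s' (inv y) i + psi s' y i \<in> ideal2 (int s') s'" by (rule psi_inv[OF s' xy(2) i])
  have "psi s' (x [^] (int s) \<otimes> dl s y) i - ([:int s:] * psi s' x i + (monom 1 s - 1) * psi s' y i)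
    = (psi s' (x [^] (int s) \<otimes> dl s y) i - (psi s' (x [^] (int s)) i + psi s' (dl s y) i))
    + ((psi s' (x [^] (int s)) i - [:int s:] * psi s' x i) + ((psi s' (dl s y) i - (psi s' (cj (int s) y) i + psi s' (inv y) i))
    + ((psi s' (cj (int s) y) i - monom 1 s * psi s' y i) + (psi s' (inv y) i + psi s' y i))))"
    by (simp only: algebra_simps mult_1_left)
  then show ?thesis using ideal2_add[OF 1 ideal2_add[OF 2 ideal2_add[OF 3 ideal2_add[OF 4 5]]]] by (simp only:)
qed

lemma JA_Ks: assumes s: "s > 0" and c: "c \<in> JA s" shows "c \<in> Ks s"
proof -
  obtain x y where xy: "x \<in> A" "y \<in> A" and e: "c = x [^] (int s) \<otimes> dl s y" using c unfolding JA_def by blast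
  have "psi s c i \<in> ideal2 (int s) s" if i: "i < n" for i
    using ideal2_cong[OF psi_form[OF s xy i, of s]] ideal2I[OF refl] unfolding e by blast
  then show ?thesis using psi_Ks[OF s JA_A[OF c]] by blast
qed

text \<open>Some level \<open>s1\<close> has its kernel inside \<open>KK s\<close>. At the common
  level \<open>s * s1\<close> the coordinates of \<open>c\<close> lie in
  \<open>(s, X^s - 1)\<close>, so an element \<open>b\<close> of \<open>JA s\<close> with the same
  coordinates exists. The quotient of \<open>c\<close> by \<open>b\<close> lies in \<open>A\<close>
  and in \<open>KK s\<close>, hence in \<open>JA s\<close>.\<close>

lemma Ks_JA: assumes s: "s > 0" and c: "c \<in> A" "c \<in> Ks s" shows "c \<in> JA s"
proof -
  obtain s1 where s1: "s1 > 0" "\<forall>x\<in>carrier D. [kap s1 x = 0] (mod int s1) \<longrightarrow> (\<forall>i<n. mu s1 x i \<in> ideal2 (int s1) s1) \<longrightarrow> x \<in> KK s"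
    using cofinal[OF KK_normal KK_finite[OF s]] by blast
  define s' where "s' = s * s1"
  have s': "s' > 0" "s dvd s'" "s1 dvd s'" using s s1(1) by (simp_all add: s'_def)
  have "\<forall>i. \<exists>a b. i < n \<longrightarrow> psi s' c i = [:int s:] * a + (monom 1 s - 1) * b"
    using psi_compat[OF s s'(1,2) c] unfolding ideal2_def by blast
  then obtain \<alpha> \<beta> where ab: "\<And>i. i < n \<Longrightarrow> psi s' c i = [:int s:] * \<alpha> i + (monom 1 s - 1) * \<beta> i" by metis
  obtain x where x: "x \<in> A" "\<And>i. i < n \<Longrightarrow> psi s' x i - \<alpha> i \<in> ideal2 (int s') s'" using psi_surj[OF s'(1), of \<alpha>] by blast
  obtain y where y: "y \<in> A" "\<And>i. i < n \<Longrightarrow> psi s' y i - \<beta> i \<in> ideal2 (int s') s'" using psi_surj[OF s'(1), of \<beta>] by blast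
  define b where "b = x [^] (int s) \<otimes> dl s y"
  have bJ: "b \<in> JA s" unfolding b_def JA_def using x(1) y(1) by blast
  have bA: "b \<in> A" by (rule JA_A[OF bJ])
  define d where "d = c \<otimes> inv b"
  have dA: "d \<in> A" unfolding d_def by (rule A_mult[OF c(1) A_inv[OF bA]])
  have "psi s' d i \<in> ideal2 (int s') s'" if i: "i < n" for i
  proof -
    have 1: "psi s' d i - (psi s' c i + psi s' (inv b) i) \<in> ideal2 (int s') s'" unfolding d_def by (rule psi_mult[OF s'(1) c(1) A_inv[OF bA] i])
    have 2: "psi s' (inv b) i + psi s' b i \<in> ideal2 (int s') s'" by (rule psi_inv[OF s'(1) bA i])
    have 3: "psi s' b i - ([:int s:] * psi s' x i + (monom 1 s - 1) * psi s' y i) \<in> ideal2 (int s') s'"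
      unfolding b_def by (rule psi_form[OF s'(1) x(1) y(1) i])
    have 4: "[:int s:] * (psi s' x i - \<alpha> i) \<in> ideal2 (int s') s'" by (rule ideal2_mult[OF x(2)[OF i]])
    have 5: "(monom 1 s - 1) * (psi s' y i - \<beta> i) \<in> ideal2 (int s') s'" by (rule ideal2_mult[OF y(2)[OF i]])
    have "psi s' d i = (psi s' d i - (psi s' c i + psi s' (inv b) i)) + ((psi s' (inv b) i + psi s' b i)
       - ((psi s' b i - ([:int s:] * psi s' x i + (monom 1 s - 1) * psi s' y i)) + ([:int s:] * (psi s' x i - \<alpha> i) + (monom 1 s - 1) * (psi s' y i - \<beta> i))))"
      unfolding ab[OF i] by (simp only: algebra_simps mult_1_left)
    then show ?thesis using ideal2_add[OF 1 ideal2_diff[OF 2 ideal2_add[OF 3 ideal2_add[OF 4 5]]]] by (simp only:)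
  qed
  then have dK: "d \<in> Ks s'" using psi_Ks[OF s'(1) dA] by blast
  have "mu s1 d i \<in> ideal2 (int s1) s1" if i: "i < n" for i
  proof -
    have "mu s' d i \<in> ideal2 (int s1) s1" by (rule ideal2_mono[of _ "int s'" _ s']) (use dK i s'(3) in \<open>simp_all add: Ks_def\<close>)
    then show ?thesis using ideal2_cong[OF mu_compat[OF s1(1) s'(1,3) A_carrier[OF dA] i]] by blast
  qed
  then have "d \<in> KK s" using s1(2) A_carrier[OF dA] A_kap[OF dA s1(1)] by blast
  then have "d \<in> JA s" using dA by (rule KK_A)
  then have "d \<otimes> b \<in> JA s" using bJ by (rule JA_mult)
  moreover have "d \<otimes> b = c" unfolding d_def using A_carrier[OF c(1)] A_carrier[OF bA] by (simp add: m_assoc)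
  ultimately show ?thesis by simp
qed

definition LL :: "(nat \<Rightarrow> int poly) set" where "LL = {v. \<pi> v = \<one>}"

lemma lattice: "lattice_data sc LL"
proof -
  interpret V: Modules.module sc by (rule module_sc)
  show ?thesis
  proof unfold_locales
    show "V.subspace LL"
      unfolding V.subspace_def LL_def using pi_0 pi_add pi_kill by auto
    fix k v assume "sc (monom 1 k) v \<in> LL"
    then have "cj (int k) (\<pi> v) = \<one>" by (simp add: LL_def pi_shift)
    then have "cj (- int k) (cj (int k) (\<pi> v)) = \<one>" using cj_one by simp
    then show "v \<in> LL" unfolding cj_cj[OF pi_A] using cj_0[OF pi_A] by (simp add: LL_def)
  qed
qed

lemma LL_diff: "u - v \<in> LL \<longleftrightarrow> \<pi> u = \<pi> v"
proof
  assume "u - v \<in> LL"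
  then have "\<pi> u \<otimes> inv (\<pi> v) = \<one>" by (simp add: LL_def pi_diff)
  then show "\<pi> u = \<pi> v" using tel[OF pi_carrier pi_carrier one_closed, of u v] pi_carrier by simp
qed (simp add: LL_def pi_diff pi_carrier)

lemma LJ_iff: assumes s: "s > 0" shows "v \<in> lattice_data.LJ sc LL (int s) s \<longleftrightarrow> \<pi> v \<in> Ks s"
proof -
  interpret lattice_data sc LL by (rule lattice)
  have e: "v - sc [:int s:] a - sc (monom 1 s - 1) b \<in> LL \<longleftrightarrow> \<pi> v = \<pi> a [^] (int s) \<otimes> dl s (\<pi> b)" for v a b
    unfolding diff_diff_eq LL_diff pi_LJ ..
  show ?thesis
  proof
    assume "v \<in> LJ (int s) s"
    then have "\<pi> v \<in> JA s" unfolding LJ_def e JA_def using pi_A by auto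
    then show "\<pi> v \<in> Ks s" by (rule JA_Ks[OF s])
  next
    assume "\<pi> v \<in> Ks s"
    then have "\<pi> v \<in> JA s" by (rule Ks_JA[OF s pi_A])
    then obtain x y where xy: "x \<in> A" "y \<in> A" "\<pi> v = x [^] (int s) \<otimes> dl s y" unfolding JA_def by blast
    obtain k a where a: "cj (int s * int k) x = \<pi> a" using rng[OF s xy(1)] by blast
    obtain l b where b: "cj (int s * int l) y = \<pi> b" using rng[OF s xy(2)] by blast
    \<comment> \<open>\<open>x\<close> and \<open>y\<close> lift to vectors only after different
      powers of \<open>t\<close>. Both are brought to the common shift \<open>M\<close>, a multiple
      of \<open>s\<close>, which is trivial modulo \<open>LJ\<close>.\<close>
    define a' where "a' = sc (monom 1 (s * l)) a"
    define b' where "b' = sc (monom 1 (s * k)) b"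
    define M where "M = int s * int (k + l)"
    have a': "\<pi> a' = cj M x" unfolding a'_def pi_shift a[symmetric] cj_cj[OF xy(1)] M_def by (simp add: algebra_simps)
    have b': "\<pi> b' = cj M y" unfolding b'_def pi_shift b[symmetric] cj_cj[OF xy(2)] M_def by (simp add: algebra_simps)
    have "cj M (dl s y) = dl s (cj M y)"
      unfolding dl_def cj_mult[OF cj_A[OF xy(2)] A_inv[OF xy(2)]] cj_cj[OF xy(2)] cj_inv[OF xy(2)] by (simp add: add.commute)
    then have "cj M (\<pi> v) = \<pi> a' [^] (int s) \<otimes> dl s (\<pi> b')"
      unfolding xy(3) cj_mult[OF A_pow[OF xy(1)] dl_A[OF xy(2)]] cj_pow[OF xy(1)] a' b' by simp
    then have "\<pi> (sc (monom 1 (s * (k + l))) v) = \<pi> a' [^] (int s) \<otimes> dl s (\<pi> b')" unfolding pi_shift M_def by simp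
    then have 1: "sc (monom 1 (s * (k + l))) v \<in> LJ (int s) s" unfolding LJ_def using e by blast
    have "monom 1 (s * (k + l)) - monom 1 0 \<in> ideal2 (int s) s" by (rule monom_cong_ideal2) simp
    then have "sc (monom 1 (s * (k + l)) - monom 1 0) v \<in> LJ (int s) s" by (rule ideal2_scale_LJ)
    then have "sc (monom 1 (s * (k + l))) v - sc (monom 1 (s * (k + l)) - monom 1 0) v \<in> LJ (int s) s" using 1 subspace_diff[OF subspace_LJ] by blast
    moreover have "sc (monom 1 (s * (k + l))) v - sc (monom 1 (s * (k + l)) - monom 1 0) v = v"
      by (simp add: sc_def fun_eq_iff left_diff_distrib monom_0 flip: one_pCons)
    ultimately show "v \<in> LJ (int s) s" by simp
  qed
qed

definition uu :: "nat \<Rightarrow> nat \<Rightarrow> int poly" where "uu i = (\<lambda>j. if j = i then 1 else 0)"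

text \<open>The bridge to \<open>free_basis\<close>: separation by the levels comes from
  \<open>Ks_trivial\<close>, and the isomorphisms at finite level are the maps \<open>psi s\<close>
  composed with \<open>\<pi>\<close>.\<close>

lemma profree: "profree_data sc LL n (uu ` {..<g})"
proof -
  interpret lattice_data sc LL by (rule lattice)
  have inj: "inj_on uu {..<g}" by (rule inj_onI) (auto simp: uu_def fun_eq_iff split: if_splits)
  show ?thesis
  proof unfold_locales
    show "finite (uu ` {..<g})" by simp
  next
    fix v
    have "(\<Sum>x\<in>uu ` {..<g}. sc (v (the_inv_into {..<g} uu x)) x) = (\<Sum>i\<in>{..<g}. sc (v i) (uu i))"
      unfolding sum.reindex[OF inj] by (rule sum.cong) (simp_all add: the_inv_into_f_f[OF inj])
    moreover have "\<pi> (\<Sum>i\<in>{..<g}. sc (v i) (uu i)) = \<pi> v"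
    proof (rule pi_cong)
      fix j assume j: "j < g"
      have "(\<Sum>i\<in>{..<g}. sc (v i) (uu i)) j = (\<Sum>i\<in>{..<g}. if i = j then v i else 0)"
        unfolding sum_fun_app by (rule sum.cong) (auto simp: sc_def uu_def)
      then show "(\<Sum>i\<in>{..<g}. sc (v i) (uu i)) j = v j" using j by simp
    qed
    moreover have "sc (monom 1 0) v = v" by (simp add: sc_def monom_0 flip: one_pCons)
    ultimately have "sc (monom 1 0) v - (\<Sum>x\<in>uu ` {..<g}. sc (v (the_inv_into {..<g} uu x)) x) \<in> LL" unfolding LL_diff by simp
    then show "\<exists>k f. sc (monom 1 k) v - (\<Sum>x\<in>uu ` {..<g}. sc (f x) x) \<in> LL"
      by (intro exI[of _ 0] exI[of _ "\<lambda>x. v (the_inv_into {..<g} uu x)"])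
  next
    fix v assume "\<And>s. s > 0 \<Longrightarrow> v \<in> LJ (int s) s"
    then have "\<pi> v \<in> Ks s" if "s > 0" for s using LJ_iff[OF that] that by blast
    then show "v \<in> LL" unfolding LL_def using Ks_trivial[OF pi_carrier] by blast
  next
    fix s :: nat assume s: "s > 0"
    define \<psi> where "\<psi> v i = psi s (\<pi> v) i" for v i
    have 1: "\<forall>u v. \<forall>i<n. \<psi> (u + v) i - (\<psi> u i + \<psi> v i) \<in> ideal2 (int s) s"
      unfolding \<psi>_def pi_add using psi_mult[OF s pi_A pi_A] by blast
    have 2: "\<forall>f v. \<forall>i<n. \<psi> (sc f v) i - f * \<psi> v i \<in> ideal2 (int s) s"
      unfolding \<psi>_def using psi_scale[OF s] by blast
    have 3: "\<exists>v. \<forall>i<n. \<psi> v i - y i \<in> ideal2 (int s) s" for y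
    proof -
      obtain a where a: "a \<in> A" "\<And>i. i < n \<Longrightarrow> psi s a i - y i \<in> ideal2 (int s) s" using psi_surj[OF s, of y] by blast
      obtain m v where v: "cj (int s * int m) a = \<pi> v" using rng[OF s a(1)] by blast
      have "\<psi> v i - y i \<in> ideal2 (int s) s" if i: "i < n" for i
      proof -
        have p: "psi s (cj (int (s * m)) a) i - monom 1 (s * m) * psi s a i \<in> ideal2 (int s) s" by (rule psi_cj[OF s a(1) i])
        have "monom 1 (s * m) - monom 1 0 \<in> ideal2 (int s) s" by (rule monom_cong_ideal2) simp
        then have "psi s a i * (monom 1 (s * m) - monom 1 0) \<in> ideal2 (int s) s" by (rule ideal2_mult)
        moreover have "psi s a i * (monom 1 (s * m) - monom 1 0) = monom 1 (s * m) * psi s a i - psi s a i"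
          by (simp add: algebra_simps monom_0 flip: one_pCons)
        ultimately have "monom 1 (s * m) * psi s a i - psi s a i \<in> ideal2 (int s) s" by simp
        then have "psi s (cj (int (s * m)) a) i - psi s a i \<in> ideal2 (int s) s" by (rule ideal2_trans[OF p])
        then have "\<psi> v i - psi s a i \<in> ideal2 (int s) s" unfolding \<psi>_def v[symmetric] by simp
        then show ?thesis using a(2)[OF i] by (rule ideal2_trans)
      qed
      then show ?thesis by blast
    qed
    have 4: "\<forall>v. v \<in> LJ (int s) s \<longleftrightarrow> (\<forall>i<n. \<psi> v i \<in> ideal2 (int s) s)"
      unfolding \<psi>_def using LJ_iff[OF s] psi_Ks[OF s pi_A] by blast
    show "\<exists>\<psi>. (\<forall>u v. \<forall>i<n. \<psi> (u + v) i - (\<psi> u i + \<psi> v i) \<in> ideal2 (int s) s)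
      \<and> (\<forall>f v. \<forall>i<n. \<psi> (sc f v) i - f * \<psi> v i \<in> ideal2 (int s) s)
      \<and> (\<forall>y. \<exists>v. \<forall>i<n. \<psi> v i - y i \<in> ideal2 (int s) s)
      \<and> (\<forall>v. v \<in> LJ (int s) s \<longleftrightarrow> (\<forall>i<n. \<psi> v i \<in> ideal2 (int s) s))"
      using 1 2 3 4 by blast
  qed
qed

text \<open>\<open>free_basis\<close> for the kernel of \<open>\<pi>\<close> gives \<open>n\<close>
  vectors that form a basis up to powers of \<open>X\<close>; their images give a presentation with
  \<open>n\<close> generators and no relations.\<close>

lemma free_rep: "\<exists>\<rho>. lamp_rep D n kap mu t n \<rho> \<and> (\<forall>f. \<rho> f = \<one> \<longrightarrow> (\<forall>i<n. f i = 0))"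
proof -
  interpret profree_data sc LL n "uu ` {..<g}" by (rule profree)
  obtain x where x: "\<And>v. \<exists>k f. sc (monom 1 k) v - (\<Sum>i<n. sc (f i) (x i)) \<in> LL"
    and ind: "\<And>f. (\<Sum>i<n. sc (f i) (x i)) \<in> LL \<Longrightarrow> (\<forall>i<n. f i = 0)" using free_basis by blast
  define \<rho> where "\<rho> f = \<pi> (\<Sum>i<n. sc (f i) (x i))" for f
  have "lamp_rep D n kap mu t n \<rho>"
  proof unfold_locales
    show "\<rho> v \<in> A" for v unfolding \<rho>_def by (rule pi_A)
    show "\<rho> (u + v) = \<rho> u \<otimes> \<rho> v" for u v
    proof -
      have "(\<Sum>i<n. sc ((u + v) i) (x i)) = (\<Sum>i<n. sc (u i) (x i)) + (\<Sum>i<n. sc (v i) (x i))"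
        by (simp add: fun_eq_iff sum_fun_app sc_def distrib_right sum.distrib)
      then show ?thesis unfolding \<rho>_def by (simp only: pi_add)
    qed
    show "\<rho> (sc (monom 1 (Suc 0)) v) = cj 1 (\<rho> v)" for v
    proof -
      have "(\<Sum>i<n. sc (sc (monom 1 (Suc 0)) v i) (x i)) = sc (monom 1 (Suc 0)) (\<Sum>i<n. sc (v i) (x i))"
        unfolding scale_sum_right by (rule sum.cong) (simp_all add: sc_def mult.assoc)
      then show ?thesis unfolding \<rho>_def by (simp only: pi_X)
    qed
    show "\<rho> u = \<rho> v" if "\<And>i. i < n \<Longrightarrow> u i = v i" for u v
      unfolding \<rho>_def using that by (metis (mono_tags, lifting) lessThan_iff sum.cong)
    show "\<exists>(k::nat) v. cj (int k) a = \<rho> v" if a: "a \<in> A" for a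
    proof -
      obtain k :: nat and v where v: "cj (int k) a = \<pi> v" using pi_onto[OF a] by blast
      obtain l f where "sc (monom 1 l) v - (\<Sum>i<n. sc (f i) (x i)) \<in> LL" using x by blast
      then have "cj (int l) (\<pi> v) = \<rho> f" unfolding LL_diff pi_shift \<rho>_def .
      then have "cj (int (l + k)) a = \<rho> f" unfolding v[symmetric] cj_cj[OF a] by simp
      then show ?thesis by blast
    qed
  qed
  moreover have "\<forall>f. \<rho> f = \<one> \<longrightarrow> (\<forall>i<n. f i = 0)" unfolding \<rho>_def using ind by (simp add: LL_def)
  ultimately show ?thesis by blast
qed

end

context lamp_gen
begin

text \<open>Every generator is written as \<open>a i\<close> times a power of \<open>t\<close>. The
  elements of \<open>A\<close> reached from the \<open>a i\<close> form a subgroup \<open>E\<close>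
  stable under \<open>t\<close>, so \<open>E\<close> and the powers of \<open>t\<close> make up a
  subgroup containing all generators; comparing the exponents of \<open>t\<close> gives
  \<open>E = A\<close>.\<close>

lemma exists_rep: "\<exists>g \<pi>. lamp_rep D n kap mu t g \<pi>"
proof -
  obtain S where S: "finite S" "S \<subseteq> carrier D" "generate D S = carrier D"
    using fg unfolding finitely_generated_group_def by blast
  obtain xs where xs: "set xs = S" using finite_list[OF S(1)] by blast
  define \<kappa> where "\<kappa> x = (SOME k::int. x \<otimes> inv (t [^] k) \<in> A)" for x
  define a where "a i = xs ! i \<otimes> inv (t [^] \<kappa> (xs ! i))" for i
  define g where "g = length xs"
  have xsD: "xs ! i \<in> carrier D" if "i < g" for i using that xs S(2) nth_mem unfolding g_def by blast
  have aA: "a i \<in> A" if "i < g" for i unfolding a_def \<kappa>_def by (rule someI_ex[OF t_span[OF xsD[OF that]]])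
  define P where "P = pim a g"
  have PA: "P v \<in> A" for v unfolding P_def by (rule pim_A[OF aA])
  have P_add: "P (u + v) = P u \<otimes> P v" for u v unfolding P_def by (rule pim_add[OF aA])
  have P_X: "P (sc (monom 1 (Suc 0)) v) = cj 1 (P v)" for v unfolding P_def by (rule pim_X[OF aA])
  have P_0: "P 0 = \<one>" unfolding P_def by (rule pim_zero) simp
  have P_uminus: "P (- v) = inv (P v)" for v
  proof -
    have "P (- v) \<otimes> P v = \<one>" unfolding P_add[symmetric] left_minus by (rule P_0)
    then show ?thesis using inv_equality[OF _ A_carrier[OF PA] A_carrier[OF PA]] by metis
  qed
  have P_shift: "P (sc (monom 1 k) v) = cj (int k) (P v)" for k v
  proof (induct k)
    case 0
    have "sc (monom 1 0) v = v" by (simp add: sc_def monom_0 flip: one_pCons)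
    then show ?case using cj_0[OF PA] by simp
  next
    case (Suc k)
    have "sc (monom 1 (Suc k)) v = sc (monom 1 (Suc 0)) (sc (monom 1 k) v)"
      by (simp add: sc_def mult.assoc[symmetric] mult_monom)
    then show ?case using Suc P_X cj_cj[OF PA, of 1 "int k" v] by simp
  qed
  define E where "E = {x \<in> A. \<exists>(k::nat) v. cj (int k) x = P v}"
  have E_A: "x \<in> A" if "x \<in> E" for x using that by (simp add: E_def)
  have E_mult: "x \<otimes> y \<in> E" if x: "x \<in> E" and y: "y \<in> E" for x y
  proof -
    obtain k :: nat and u where k: "cj (int k) x = P u" using x unfolding E_def by blast
    obtain l :: nat and v where l: "cj (int l) y = P v" using y unfolding E_def by blast
    have "cj (int (k + l)) (x \<otimes> y) = cj (int l) (cj (int k) x) \<otimes> cj (int k) (cj (int l) y)"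
      unfolding cj_mult[OF E_A[OF x] E_A[OF y]] cj_cj[OF E_A[OF x]] cj_cj[OF E_A[OF y]] by (simp add: add.commute)
    then have "cj (int (k + l)) (x \<otimes> y) = P (sc (monom 1 l) u + sc (monom 1 k) v)" unfolding k l P_shift[symmetric] P_add .
    then show ?thesis unfolding E_def using A_mult[OF E_A[OF x] E_A[OF y]] by blast
  qed
  have E_inv: "inv x \<in> E" if x: "x \<in> E" for x
  proof -
    obtain k :: nat and u where k: "cj (int k) x = P u" using x unfolding E_def by blast
    have "cj (int k) (inv x) = P (- u)" unfolding cj_inv[OF E_A[OF x]] k P_uminus ..
    then show ?thesis unfolding E_def using A_inv[OF E_A[OF x]] by blast
  qed
  have E_cj: "cj m x \<in> E" if x: "x \<in> E" for m x
  proof -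
    obtain k :: nat and u where k: "cj (int k) x = P u" using x unfolding E_def by blast
    have "int (k + nat (- m)) + m = int (nat m) + int k" by simp
    then have "cj (int (k + nat (- m))) (cj m x) = cj (int (nat m)) (cj (int k) x)" unfolding cj_cj[OF E_A[OF x]] by (simp only:)
    then have "cj (int (k + nat (- m))) (cj m x) = P (sc (monom 1 (nat m)) u)" unfolding k P_shift .
    then show ?thesis unfolding E_def using cj_A[OF E_A[OF x]] by blast
  qed
  have E_a: "a i \<in> E" if i: "i < g" for i
  proof -
    have "P (\<lambda>j. if j = i then 1 else 0) = a i" unfolding P_def by (rule pim_unit[OF aA i])
    then have "cj (int 0) (a i) = P (\<lambda>j. if j = i then 1 else 0)" using cj_0[OF aA[OF i]] by simp
    then show ?thesis unfolding E_def using aA[OF i] by blast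
  qed
  have E_one: "\<one> \<in> E" unfolding E_def using A_one cj_one P_0 by (metis (mono_tags, lifting) mem_Collect_eq)
  define W where "W = {e \<otimes> t [^] (k::int) | e k. e \<in> E}"
  have W: "subgroup W D"
  proof (rule subgroupI)
    show "W \<subseteq> carrier D" unfolding W_def using m_closed[OF A_carrier[OF E_A] tpow] by blast
    show "W \<noteq> {}" unfolding W_def using E_one by blast
  next
    fix x assume "x \<in> W"
    then obtain e and k :: int where e: "e \<in> E" "x = e \<otimes> t [^] k" unfolding W_def by blast
    show "inv x \<in> W" unfolding e(2) inv_form[OF E_A[OF e(1)]] unfolding W_def using E_cj[OF E_inv[OF e(1)]] by blast
  next
    fix x y assume "x \<in> W" "y \<in> W"
    then obtain e and k :: int and f and l :: int where e: "e \<in> E" "x = e \<otimes> t [^] k" "f \<in> E" "y = f \<otimes> t [^] l" unfolding W_def by blast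
    show "x \<otimes> y \<in> W" unfolding e(2,4) mul_form[OF E_A[OF e(1)] E_A[OF e(3)]] unfolding W_def using E_mult[OF e(1) E_cj[OF e(3)]] by blast
  qed
  have "S \<subseteq> W"
  proof
    fix x assume "x \<in> S"
    then obtain i where i: "i < g" "x = xs ! i" using xs unfolding g_def in_set_conv_nth[symmetric] by (metis in_set_conv_nth)
    have "x = a i \<otimes> t [^] \<kappa> x" unfolding a_def i(2) using xsD[OF i(1)] tpow by (simp add: m_assoc)
    then show "x \<in> W" unfolding W_def using E_a[OF i(1)] by blast
  qed
  then have DW: "carrier D \<subseteq> W" using generate_subgroup_incl[OF _ W] S(3) by blast
  have A_E: "x \<in> E" if x: "x \<in> A" for x
  proof -
    obtain e and k :: int where e: "e \<in> E" "x = e \<otimes> t [^] k" using DW A_carrier[OF x] unfolding W_def by blast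
    have "k = 0" by (rule form_A[OF E_A[OF e(1)]]) (use x e(2) in simp)
    then have "x = e" using e A_carrier[OF E_A[OF e(1)]] by simp
    then show ?thesis using e(1) by simp
  qed
  have "lamp_rep D n kap mu t g P"
  proof unfold_locales
    show "P u = P v" if "\<And>i. i < g \<Longrightarrow> u i = v i" for u v unfolding P_def using that by (rule pim_cong)
    show "\<exists>(k::nat) v. cj (int k) x = P v" if "x \<in> A" for x using A_E[OF that] unfolding E_def by blast
  qed (fact PA P_add P_X)+
  then show ?thesis by blast
qed

end

section \<open>The isomorphism with the lamplighter group\<close>

definition pl :: "nat \<Rightarrow> (int \<Rightarrow> nat \<Rightarrow> int) \<Rightarrow> nat \<Rightarrow> int poly"
  where "pl N h i = Abs_poly (\<lambda>m. h (int m - int N) i)"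

text \<open>Under this bound \<open>pl N h\<close> is \<open>X^N\<close> times the Laurent vector
  \<open>h\<close> with nothing cut off.\<close>

definition lowb :: "nat \<Rightarrow> nat \<Rightarrow> (int \<Rightarrow> nat \<Rightarrow> int) \<Rightarrow> bool"
  where "lowb n N h \<longleftrightarrow> (\<forall>x i. i < n \<and> x < - int N \<longrightarrow> h x i = 0)"

lemma coeff_pl:
  assumes "base n h" "i < n" shows "coeff (pl N h i) m = h (int m - int N) i"
proof -
  have "finite {x. h x i \<noteq> 0}" using assms unfolding base_def by blast
  then have "bdd_above {x. h x i \<noteq> 0}" by (rule bdd_above_finite)
  then obtain M where M: "\<And>x. h x i \<noteq> 0 \<Longrightarrow> x \<le> M" unfolding bdd_above_def by blast
  have z: "h (int k - int N) i = 0" if "k > nat (M + int N)" for k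
  proof (rule ccontr)
    assume "h (int k - int N) i \<noteq> 0"
    then have "int k - int N \<le> M" by (rule M)
    then show False using that by linarith
  qed
  have "coeff (Abs_poly (\<lambda>m. h (int m - int N) i)) = (\<lambda>m. h (int m - int N) i)" by (rule coeff_Abs_poly) (rule z)
  then show ?thesis unfolding pl_def by (rule fun_cong)
qed

lemma exists_lowb: assumes "base n h" shows "\<exists>N. lowb n N h"
proof -
  have "finite (\<Union>i\<in>{..<n}. {x. h x i \<noteq> 0})" using assms unfolding base_def by blast
  then have "bdd_below (\<Union>i\<in>{..<n}. {x. h x i \<noteq> 0})" by (rule bdd_below_finite)
  then obtain b where b: "\<And>x. x \<in> (\<Union>i\<in>{..<n}. {x. h x i \<noteq> 0}) \<Longrightarrow> b \<le> x" unfolding bdd_below_def by blast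
  have "h x i = 0" if "i < n" "x < - int (nat (- b))" for x i
  proof (rule ccontr)
    assume "h x i \<noteq> 0"
    then have "x \<in> (\<Union>i\<in>{..<n}. {x. h x i \<noteq> 0})" using that(1) by blast
    then have "b \<le> x" by (rule b)
    then show False using that(2) by linarith
  qed
  then show ?thesis unfolding lowb_def by blast
qed

lemma lowb_mono: "lowb n N h \<Longrightarrow> N \<le> M \<Longrightarrow> lowb n M h"
  unfolding lowb_def by auto

lemma pl_add_shift:
  assumes b: "base n h" and N: "lowb n N h" and i: "i < n" shows "pl (N + d) h i = monom 1 d * pl N h i"
proof (rule poly_eqI)
  fix m
  have "h (int m - int (N + d)) i = (if m < d then 0 else h (int (m - d) - int N) i)"
    using N i unfolding lowb_def by (auto simp: algebra_simps of_nat_diff)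
  then show "coeff (pl (N + d) h i) m = coeff (monom 1 d * pl N h i) m"
    unfolding coeff_pl[OF b i] coeff_monom_mult by simp
qed

context lamp_rep
begin

text \<open>The extension of \<open>\<pi>\<close> to Laurent vectors: a factor \<open>X^N\<close>
  clears the negative exponents and conjugation by \<open>t^(-N)\<close> compensates for it, with a
  result that does not depend on \<open>N\<close>.\<close>

definition Pf :: "(int \<Rightarrow> nat \<Rightarrow> int) \<Rightarrow> 'a"
  where "Pf h = cj (- int (SOME N. lowb g N h)) (\<pi> (pl (SOME N. lowb g N h) h))"

lemma Pf_A: "Pf h \<in> A" unfolding Pf_def by (rule cj_A[OF pi_A])

lemma Pf_step:
  assumes b: "base g h" and N: "lowb g N h" shows "cj (- int (N + d)) (\<pi> (pl (N + d) h)) = cj (- int N) (\<pi> (pl N h))"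
proof -
  have "\<pi> (pl (N + d) h) = \<pi> (sc (monom 1 d) (pl N h))" by (rule pi_cong) (simp add: sc_def pl_add_shift[OF b N])
  then show ?thesis unfolding pi_shift by (simp add: cj_cj[OF pi_A])
qed

lemma Pf_eq: assumes b: "base g h" and N: "lowb g N h" shows "Pf h = cj (- int N) (\<pi> (pl N h))"
proof -
  have "lowb g (SOME N. lowb g N h) h" by (rule someI_ex[OF exists_lowb[OF b]])
  then show ?thesis unfolding Pf_def using Pf_step[OF b N, of "SOME N. lowb g N h"] Pf_step[OF b _, of "SOME N. lowb g N h" N]
    by (simp only: add.commute)
qed

lemma Pf_add:
  assumes b: "base g h" "base g h'" shows "Pf (\<lambda>x i. h x i + h' x i) = Pf h \<otimes> Pf h'"
proof -
  obtain N1 N2 where "lowb g N1 h" "lowb g N2 h'" using b exists_lowb by blast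
  then have N: "lowb g (max N1 N2) h" "lowb g (max N1 N2) h'" by (auto elim: lowb_mono)
  then have N': "lowb g (max N1 N2) (\<lambda>x i. h x i + h' x i)" unfolding lowb_def by simp
  have "\<pi> (pl (max N1 N2) (\<lambda>x i. h x i + h' x i)) = \<pi> (pl (max N1 N2) h + pl (max N1 N2) h')"
    by (rule pi_cong) (simp add: poly_eq_iff coeff_pl[OF b(1)] coeff_pl[OF b(2)] coeff_pl[OF base_add[OF b]])
  then show ?thesis unfolding Pf_eq[OF b(1) N(1)] Pf_eq[OF b(2) N(2)] Pf_eq[OF base_add[OF b] N'] by (simp only: pi_add cj_mult[OF pi_A pi_A])
qed

lemma Pf_shift:
  assumes b: "base g h" shows "Pf (\<lambda>x i. h (x - k) i) = cj k (Pf h)"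
proof -
  obtain N0 where N0: "lowb g N0 h" using exists_lowb[OF b] by blast
  \<comment> \<open>The slack keeps \<open>N' = N + k\<close> at least \<open>N0\<close> also for
    negative \<open>k\<close>.\<close>
  define N where "N = N0 + nat \<bar>k\<bar>"
  define N' where "N' = nat (int N + k)"
  have i: "int N' = int N + k" unfolding N'_def N_def by simp
  have le: "N0 \<le> N'" unfolding N'_def N_def by simp
  have N: "lowb g N (\<lambda>x i. h (x - k) i)" using N0 unfolding lowb_def N_def by auto
  have "\<pi> (pl N (\<lambda>x i. h (x - k) i)) = \<pi> (pl N' h)"
    by (rule pi_cong) (simp add: poly_eq_iff coeff_pl[OF b] coeff_pl[OF base_shift[OF b]] i algebra_simps)
  then show ?thesis unfolding Pf_eq[OF b lowb_mono[OF N0 le]] Pf_eq[OF base_shift[OF b] N] cj_cj[OF pi_A] by (simp add: i)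
qed

lemma Pf_emb:
  assumes b: "base g h" shows "Pf (emb g h) = Pf h"
proof -
  obtain N where N: "lowb g N h" using exists_lowb[OF b] by blast
  have N': "lowb g N (emb g h)" using N unfolding lowb_def by (simp add: emb_apply)
  have b': "base g (emb g h)" using b by (simp only: base_emb)
  have "\<pi> (pl N (emb g h)) = \<pi> (pl N h)"
    by (rule pi_cong) (simp add: poly_eq_iff coeff_pl[OF b] coeff_pl[OF b'] emb_apply)
  then show ?thesis unfolding Pf_eq[OF b N] Pf_eq[OF b' N'] by simp
qed

lemma Pf_trivial:
  assumes ind: "\<And>f i. \<pi> f = \<one> \<Longrightarrow> i < g \<Longrightarrow> f i = 0" and b: "base g h" and 1: "Pf h = \<one>" and i: "i < g"
  shows "h x i = 0"
proof -
  obtain N where N: "lowb g N h" using exists_lowb[OF b] by blast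
  have "cj (int N) (cj (- int N) (\<pi> (pl N h))) = \<one>" using 1 unfolding Pf_eq[OF b N] by (simp only: cj_one)
  then have "\<pi> (pl N h) = \<one>" unfolding cj_cj[OF pi_A] using cj_0[OF pi_A] by simp
  then have p: "pl N h i = 0" using i by (rule ind)
  show ?thesis
  proof (cases "x < - int N")
    case True
    then show ?thesis using N i unfolding lowb_def by blast
  next
    case False
    then have "int (nat (x + int N)) - int N = x" by simp
    then show ?thesis using coeff_pl[OF b i, of N "nat (x + int N)"] p by simp
  qed
qed

lemma Pf_surj:
  assumes a: "a \<in> A" shows "\<exists>h. base g h \<and> Pf h = a"
proof -
  obtain m :: nat and v where v: "cj (int m) a = \<pi> v" using pi_onto[OF a] by blast
  define h where "h = (\<lambda>x i. if - int m \<le> x then coeff (v i) (nat (x + int m)) else 0)"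
  have "finite {x. h x i \<noteq> 0}" for i
  proof (rule finite_subset)
    show "{x. h x i \<noteq> 0} \<subseteq> {- int m..int (degree (v i))}"
    proof
      fix x assume "x \<in> {x. h x i \<noteq> 0}"
      then have x: "- int m \<le> x" "coeff (v i) (nat (x + int m)) \<noteq> 0" by (auto simp: h_def split: if_splits)
      have "nat (x + int m) \<le> degree (v i)" by (rule le_degree[OF x(2)])
      then show "x \<in> {- int m..int (degree (v i))}" using x(1) by simp
    qed
  qed simp
  then have b: "base g h" unfolding base_def by blast
  have low: "lowb g m h" unfolding lowb_def h_def by simp
  have "\<pi> (pl m h) = \<pi> v" by (rule pi_cong) (simp add: poly_eq_iff coeff_pl[OF b], simp add: h_def)
  then have "Pf h = cj (- int m) (cj (int m) a)" unfolding Pf_eq[OF b low] v by simp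
  also have "\<dots> = a" unfolding cj_cj[OF a] using cj_0[OF a] by simp
  finally show ?thesis using b by blast
qed

text \<open>A pair \<open>(h, k)\<close> goes to the normal form with base part \<open>Pf h\<close>
  and exponent \<open>k\<close>. By \<open>mul_form\<close> such products multiply as in the wreath
  product; independence gives injectivity, and \<open>Pf_surj\<close> with the existence of normal
  forms gives surjectivity.\<close>

lemma iso_lamplighter:
  assumes ind: "\<And>f i. \<pi> f = \<one> \<Longrightarrow> i < g \<Longrightarrow> f i = 0"
  shows "lamplighter_group g \<cong> D"
proof -
  define \<theta> where "\<theta> z = Pf (fst z) \<otimes> t [^] (snd z :: int)" for z
  have th: "\<theta> (emb g f, k) = Pf f \<otimes> t [^] k" if "base g f" for f k
    unfolding \<theta>_def using Pf_emb[OF that] by simp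
  have cl: "\<theta> z \<in> carrier D" for z unfolding \<theta>_def by (rule m_closed[OF A_carrier[OF Pf_A] tpow])
  have hom: "\<theta> \<in> hom (lamplighter_group g) D"
  proof (rule homI)
    fix x y assume "x \<in> carrier (lamplighter_group g)" "y \<in> carrier (lamplighter_group g)"
    then obtain f k f' l where f: "x = (emb g f, k)" "base g f" "y = (emb g f', l)" "base g f'" by (metis carrierE)
    have b: "base g (\<lambda>x i. f x i + f' (x - k) i)" by (rule base_add[OF f(2) base_shift[OF f(4)]])
    have "\<theta> (x \<otimes>\<^bsub>lamplighter_group g\<^esub> y) = Pf (\<lambda>x i. f x i + f' (x - k) i) \<otimes> t [^] (k + l)"
      unfolding f(1,3) lamplighter_emb_mult th[OF b] ..
    also have "Pf (\<lambda>x i. f x i + f' (x - k) i) = Pf f \<otimes> cj k (Pf f')"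
      unfolding Pf_add[OF f(2) base_shift[OF f(4)]] Pf_shift[OF f(4)] ..
    also have "(Pf f \<otimes> cj k (Pf f')) \<otimes> t [^] (k + l) = \<theta> x \<otimes> \<theta> y"
      unfolding f(1,3) th[OF f(2)] th[OF f(4)] by (rule mul_form[OF Pf_A Pf_A, symmetric])
    finally show "\<theta> (x \<otimes>\<^bsub>lamplighter_group g\<^esub> y) = \<theta> x \<otimes> \<theta> y" .
  qed (rule cl)
  interpret G: group "lamplighter_group g" by (rule group_lamplighter_group)
  interpret h: group_hom "lamplighter_group g" D \<theta> by unfold_locales (rule hom)
  have "inj_on \<theta> (carrier (lamplighter_group g))"
  proof (rule h.inj_on_one_iff[THEN iffD2], intro allI impI)
    fix z assume z: "z \<in> carrier (lamplighter_group g)" "\<theta> z = \<one>"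
    obtain f k where f: "z = (emb g f, k)" "base g f" using z(1) by (rule carrierE)
    have 1: "Pf f \<otimes> t [^] k = \<one>" using z(2) unfolding f(1) th[OF f(2)] .
    then have k: "k = 0" using form_A[OF Pf_A[of f], of k] A_one by simp
    have fz: "Pf f = \<one>" using 1 k A_carrier[OF Pf_A[of f]] by simp
    have "f x i = 0" if i: "i < g" for x i
    proof (rule Pf_trivial[where h = f and i = i and x = x])
      show "h j = 0" if "\<pi> h = \<one>" "j < g" for h j using that by (rule ind)
    qed (fact f(2) fz i)+
    then have "emb g f = emb g (\<lambda>x i. 0)" by (rule emb_cong)
    then show "z = \<one>\<^bsub>lamplighter_group g\<^esub>" unfolding lamplighter_one f(1) k by simp
  qed
  moreover have "carrier D \<subseteq> \<theta> ` carrier (lamplighter_group g)"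
  proof
    fix x assume "x \<in> carrier D"
    then obtain a and k :: int where a: "a \<in> A" "x = a \<otimes> t [^] k" by (rule formE)
    obtain f where f: "base g f" "Pf f = a" using Pf_surj[OF a(1)] by blast
    have "x = \<theta> (emb g f, k)" unfolding th[OF f(1)] a(2) f(2) ..
    then show "x \<in> \<theta> ` carrier (lamplighter_group g)" using emb_carrier[OF f(1), of k] by (rule image_eqI)
  qed
  ultimately have "bij_betw \<theta> (carrier (lamplighter_group g)) (carrier D)" unfolding bij_betw_def using cl by blast
  then have "\<theta> \<in> iso (lamplighter_group g) D" using hom by (simp add: iso_def)
  then show ?thesis by (rule is_isoI)
qed

end

theorem theorem1:
  fixes n :: nat
  assumes "n > 0"
  shows "profinitely_rigid TYPE('b) (lamplighter_group n)"
  unfolding profinitely_rigid_def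
proof (intro conjI allI impI)
  show "finitely_generated_group (lamplighter_group n)" by (rule lamplighter_fg)
  show "residually_finite_group (lamplighter_group n)" by (rule lamplighter_rf)
  fix D :: "'b monoid"
  assume D: "finitely_generated_group D \<and> residually_finite_group D \<and> finite_quotient_classes D = finite_quotient_classes (lamplighter_group n)"
  then obtain kap mu where "lamp_approx D n kap mu" using lamp_approx_exists by blast
  then interpret lamp_approx D n kap mu .
  obtain t where t: "t \<in> carrier D" "\<And>x. x \<in> carrier D \<Longrightarrow> \<exists>k::int. x \<otimes>\<^bsub>D\<^esub> inv\<^bsub>D\<^esub> (t [^]\<^bsub>D\<^esub> k) \<in> A" "\<And>k::int. t [^]\<^bsub>D\<^esub> k \<in> A \<Longrightarrow> k = 0"
    by (rule exists_generator[OF assms]) (rule that; assumption)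
  interpret lamp_gen D n kap mu t by unfold_locales (use t in auto)
  obtain g \<pi> where "lamp_rep D n kap mu t g \<pi>" using exists_rep by blast
  then interpret R: lamp_rep D n kap mu t g \<pi> .
  obtain \<rho> where r: "lamp_rep D n kap mu t n \<rho>" "\<And>f. \<rho> f = \<one>\<^bsub>D\<^esub> \<Longrightarrow> \<forall>i<n. f i = 0" using R.free_rep by blast
  have "lamplighter_group n \<cong> D" by (rule lamp_rep.iso_lamplighter[OF r(1)]) (use r(2) in blast)
  then show "D \<cong> lamplighter_group n" by (rule group.iso_sym[OF group_lamplighter_group])
qed

end
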